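(* Let $d=2$. The following characterizations hold, with constants depending only on $\Xi$. (1) $\Gamma u^\sharp\in\mathscr D(H)\iff u^\sharp\in\mathscr H^2$. More precisely, on $\mathscr D(H)$ one has the norm equivalence $$\|u^\sharp\|_{\mathscr H^2}\lesssim\|H\Gamma u^\sharp\|_{L^2}\lesssim\|u^\sharp\|_{\mathscr H^2}.$$ (2) $\Gamma u^\sharp\in\mathscr D(\sqrt{-H})\iff u^\sharp\in\mathscr H^1$, where the form domain $\mathscr D(\sqrt{-H})$ of $-H$ is the closure of $\mathscr D(H)$ under the norm $\|\Gamma u^\sharp\|_{\mathscr D(\sqrt{-H})}:=\sqrt{\langle\Gamma u^\sharp,-H\Gamma u^\sharp\rangle}$. More precisely, on $\mathscr D(H)$ one has $$\|u^\sharp\|_{\mathscr H^1}\lesssim\|\Gamma u^\sharp\|_{\mathscr D(\sqrt{-H})}\lesssim\|u^\sharp\|_{\mathscr H^1},$$ and hence the closures with respect to the two norms coincide.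
   Context: Function spaces. $\mathbb T^2=\mathbb R^2/\mathbb Z^2$; $L^2=L^2(\mathbb T^2)$; $\mathscr H^s$ is the $L^2$-based Sobolev space. $\Delta$ without index is the Laplacian. $\Delta_j$, $j\ge -1$, are Littlewood–Paley blocks: Fourier multipliers with symbols $\chi$ ($j=-1$) and $\rho(2^{-j}\cdot)$ ($j\ge0$), where $\chi,\rho\ge 0$ are smooth radial, $\chi$ supported in a ball, $\rho$ in an annulus, $\chi+\sum_{j\ge0}\rho(2^{-j}\cdot)=1$, $\chi\rho(2^{-j}\cdot)=0$ for $j\ge1$, $\rho(2^{-i}\cdot)\rho(2^{-j}\cdot)=0$ for $|i-j|>1$. $\Delta_{>N}$ is the Fourier multiplier with symbol $\mathbf 1_{|\cdot|>2^N}$. $\mathscr C^a=B^a_{\infty,\infty}$ with norm $\sup_j2^{ja}\|\Delta_jf\|_{L^\infty}$. Paraproducts: $f\prec g=\sum_{j}\sum_{i\le j-2}\Delta_if\,\Delta_jg$, $f\succ g=g\prec f$; resonant product: $f\circ g=\sum_{|i-j|\le1}\Delta_if\,\Delta_jg$ (products of gradients are contracted). For $a\in(0,1)$, $b+c<0$, $a+b+c>0$, $C:\mathscr H^a\times\mathscr C^b\times\mathscr C^c\to\mathscr H^{a+b+c}$ is the bounded trilinear operator which on smooth functions is $C(f,g,h)=(f\prec g)\circ h-f(g\circ h)$. Noise. $\xi=\sum_{k\in\mathbb Z^2}\hat\xi(k)e^{2\pi ik\cdot x}$ is (real) Gaussian white noise on $\mathbb T^2$, i.e. $\hat\xi(k)$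 are centred complex Gaussians, independent up to $\hat\xi(-k)=\overline{\hat\xi(k)}$, with $\mathbb E[\hat\xi(k)\overline{\hat\xi(l)}]=\delta_{kl}$. $\xi_\varepsilon=\sum_{k\in\mathbb Z^2}m(\varepsilon k)\hat\xi(k)e^{2\pi ik\cdot x}$, with $m$ radial, smooth away from $0$, compactly supported, $\lim_{x\to0}m(x)=1$, and $c_\varepsilon=\sum_{k\in\mathbb Z^2}|m(\varepsilon k)|^2/(1+4\pi^2|k|^2)$. Almost surely $\Xi^\varepsilon=(\xi_\varepsilon,\ \xi_\varepsilon\circ(1-\Delta)^{-1}\xi_\varepsilon-c_\varepsilon)$ converges as $\varepsilon\to0$ in $\mathscr C^{\alpha}\times\mathscr C^{2\alpha+2}$, for every $\alpha<-1$, to a limit $\Xi=(\xi,\Xi_2)$ (the enhanced noise). Everything is pathwise: a realization for which this holds is fixed. The operator. Fix $-4/3<\alpha<-1$, $2/3<\gamma\le\alpha+2$. Put $X=(1-\Delta)^{-1}\xi$, $B_\Xi(u)=(1-\Delta)^{-1}(\Delta u\prec X+2\nabla u\prec\nabla X+\xi\prec u+u\prec\Xi_2)$, and $\mathscr D(A)=\{u\in\mathscr H^\gamma:\ R(u):=u-u\prec X-B_\Xi(u)\in\mathscr H^2\}$ (independent of $\gamma$). For $u\in\mathscr D(A)$, $Au:=\Delta u+u\prec\xi+\xi\prec u+u\circ\xi\in L^2$, with $u\circ\xi:=C(u,X,\xi)+u\,\Xi_2+B_\Xi(u)\circ\xi+R(u)\circ\xi$. $H=A-K_\Xi$, $\mathscr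 D(H)=\mathscr D(A)$, where $K_\Xi>0$ is a sufficiently large constant depending only on $\Xi$; in particular $\langle -Hu,u\rangle\ge\|u\|_{L^2}^2$ on $\mathscr D(H)$ (claims are meant for all $K_\Xi$ above some threshold depending only on $\Xi$). The map $\Gamma$. For $N$ sufficiently large (depending only on $\Xi$), which is fixed, and $f\in L^2$, $\Gamma f$ denotes the unique solution of $\Gamma f=\Delta_{>N}(\Gamma f\prec X+B_\Xi(\Gamma f))+f$. *)

theory Defs
  imports "HOL-Probability.Probability" "HOL-Library.Function_Algebras"
begin

section \<open>Distributions on the two-dimensional torus\<close>

text \<open>
  A distribution \<open>f\<close> on the torus \<open>\<real>\<^sup>2 / \<int>\<^sup>2\<close> is represented by its family of Fourier
  coefficients, \<open>f = (\<Sum>k. f k * e\<^sub>k)\<close> with \<open>e\<^sub>k(x) = exp (2 \<pi> i k \<bullet> x)\<close>.  No growth condition is built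
  into the type: every space below only contains families of at most polynomial growth.
  Distributions are complex valued; sums and differences are the pointwise ones.
\<close>

type_synonym plane = "real \<times> real"
type_synonym freq = "int \<times> int"
type_synonym torus_dist = "freq \<Rightarrow> complex"

definition vec_of :: "freq \<Rightarrow> plane" where
  "vec_of k = (real_of_int (fst k), real_of_int (snd k))"

definition scale :: "complex \<Rightarrow> torus_dist \<Rightarrow> torus_dist" where
  "scale c f = (\<lambda>k. c * f k)"

definition const_dist :: "complex \<Rightarrow> torus_dist" where
  "const_dist c = (\<lambda>k. if k = 0 then c else 0)"

text \<open>Point values; only used for trigonometric polynomials.\<close>

definition eval_at :: "torus_dist \<Rightarrow> plane \<Rightarrow> complex" where
  "eval_at f x = (\<Sum>\<^sub>\<infinity>k. f k * cis (2 * pi * (vec_of k \<bullet> x)))"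

definition linf_norm :: "torus_dist \<Rightarrow> ennreal" where
  "linf_norm f = (SUP x. ennreal (cmod (eval_at f x)))"

text \<open>Fourier coefficients of a product of functions (the convolution theorem).\<close>

definition mult :: "torus_dist \<Rightarrow> torus_dist \<Rightarrow> torus_dist" where
  "mult f g = (\<lambda>n. \<Sum>\<^sub>\<infinity>k. f k * g (n - k))"

lemma vec_of_diff: "vec_of (n - k) = vec_of n - vec_of k"
  by (simp add: vec_of_def)

lemma eval_at_finite:
  assumes "finite F" and "\<And>k. k \<notin> F \<Longrightarrow> f k = 0"
  shows "eval_at f x = (\<Sum>k\<in>F. f k * cis (2 * pi * (vec_of k \<bullet> x)))"
proof -
  have "eval_at f x = (\<Sum>\<^sub>\<infinity>k\<in>F. f k * cis (2 * pi * (vec_of k \<bullet> x)))"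
    unfolding eval_at_def by (rule infsum_cong_neutral) (auto simp: assms(2))
  then show ?thesis using assms(1) by simp
qed

lemma eval_at_mult:
  assumes F: "finite F" "\<And>k. k \<notin> F \<Longrightarrow> f k = 0" and G: "finite G" "\<And>k. k \<notin> G \<Longrightarrow> g k = 0"
  shows "eval_at (mult f g) x = eval_at f x * eval_at g x"
proof -
  let ?e = "\<lambda>k. cis (2 * pi * (vec_of k \<bullet> x))"
  have e: "?e n = ?e k * ?e (n - k)" for n k
    by (simp add: cis_mult vec_of_diff inner_diff_left algebra_simps)
  define S where "S = (\<lambda>(k, l). k + l) ` (F \<times> G)"
  have S: "finite S" unfolding S_def using F(1) G(1) by simp
  have m: "mult f g n = (\<Sum>k\<in>F. f k * g (n - k))" for n
  proof -
    have "mult f g n = (\<Sum>\<^sub>\<infinity>k\<in>F. f k * g (n - k))"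
      unfolding mult_def by (rule infsum_cong_neutral) (auto simp: F(2))
    then show ?thesis using F(1) by simp
  qed
  have mem: "n \<in> S" if "k \<in> F" "n - k \<in> G" for n k
    unfolding S_def using that by (intro image_eqI[of _ _ "(k, n - k)"]) auto
  have z: "mult f g n = 0" if "n \<notin> S" for n
    unfolding m using that mem G(2) by (metis (no_types, lifting) mult_zero_right sum.neutral)
  have "eval_at (mult f g) x = (\<Sum>n\<in>S. mult f g n * ?e n)"
    by (rule eval_at_finite[OF S z])
  also have "\<dots> = (\<Sum>n\<in>S. \<Sum>k\<in>F. (f k * ?e k) * (g (n - k) * ?e (n - k)))"
    unfolding m sum_distrib_right
  proof (intro sum.cong refl)
    fix n k
    show "f k * g (n - k) * ?e n = (f k * ?e k) * (g (n - k) * ?e (n - k))"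
      unfolding e[of n k] by (simp only: mult_ac)
  qed
  also have "\<dots> = (\<Sum>k\<in>F. \<Sum>n\<in>S. (f k * ?e k) * (g (n - k) * ?e (n - k)))"
    by (rule sum.swap)
  also have "\<dots> = (\<Sum>k\<in>F. (f k * ?e k) * eval_at g x)"
  proof (rule sum.cong[OF refl])
    fix k assume k: "k \<in> F"
    have sub: "(\<lambda>l. k + l) ` G \<subseteq> S" unfolding S_def using k by force
    have "(\<Sum>n\<in>S. g (n - k) * ?e (n - k)) = (\<Sum>n\<in>(\<lambda>l. k + l) ` G. g (n - k) * ?e (n - k))"
    proof (rule sum.mono_neutral_right[OF S sub], safe)
      fix a b assume "(a, b) \<notin> (\<lambda>l. k + l) ` G"
      then have "(a, b) - k \<notin> G" by (metis add_diff_cancel_left' diff_add_cancel image_eqI add.commute)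
      then show "g ((a, b) - k) * ?e ((a, b) - k) = 0" using G(2) by simp
    qed
    also have "\<dots> = (\<Sum>l\<in>G. g l * ?e l)"
      by (subst sum.reindex) (auto simp: inj_on_def)
    finally show "(\<Sum>n\<in>S. (f k * ?e k) * (g (n - k) * ?e (n - k))) = (f k * ?e k) * eval_at g x"
      by (simp add: sum_distrib_left[symmetric] eval_at_finite[OF G])
  qed
  finally show ?thesis
    by (simp add: sum_distrib_right[symmetric] eval_at_finite[OF F])
qed

section \<open>Fourier multipliers and Sobolev spaces\<close>

definition bracket :: "freq \<Rightarrow> real" where  \<comment> \<open>symbol of \<open>1 - \<Delta>\<close>\<close>
  "bracket k = 1 + 4 * pi\<^sup>2 * (norm (vec_of k))\<^sup>2"

definition laplacian :: "torus_dist \<Rightarrow> torus_dist" where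
  "laplacian f = (\<lambda>k. - of_real (4 * pi\<^sup>2 * (norm (vec_of k))\<^sup>2) * f k)"

definition resolvent :: "torus_dist \<Rightarrow> torus_dist" where  \<comment> \<open>\<open>(1 - \<Delta>)\<close> inverse\<close>
  "resolvent f = (\<lambda>k. f k / of_real (bracket k))"

definition partial1 :: "torus_dist \<Rightarrow> torus_dist" where
  "partial1 f = (\<lambda>k. 2 * of_real pi * \<i> * of_int (fst k) * f k)"

definition partial2 :: "torus_dist \<Rightarrow> torus_dist" where
  "partial2 f = (\<lambda>k. 2 * of_real pi * \<i> * of_int (snd k) * f k)"

definition high_freq :: "nat \<Rightarrow> torus_dist \<Rightarrow> torus_dist" where  \<comment> \<open>\<open>\<Delta>\<close> with index \<open>> N\<close>\<close>
  "high_freq N f = (\<lambda>k. if norm (vec_of k) > 2 ^ N then f k else 0)"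

definition sobolev_norm :: "real \<Rightarrow> torus_dist \<Rightarrow> ennreal" where
  "sobolev_norm s f =
     (if (\<lambda>k. bracket k powr s * (cmod (f k))\<^sup>2) summable_on UNIV
      then ennreal (sqrt (\<Sum>\<^sub>\<infinity>k. bracket k powr s * (cmod (f k))\<^sup>2)) else \<infinity>)"

definition sobolev :: "real \<Rightarrow> torus_dist set" where
  "sobolev s = {f. sobolev_norm s f < \<infinity>}"

abbreviation L2_norm_T :: "torus_dist \<Rightarrow> ennreal" where "L2_norm_T \<equiv> sobolev_norm 0"
abbreviation L2_T :: "torus_dist set" where "L2_T \<equiv> sobolev 0"

definition L2_inner :: "torus_dist \<Rightarrow> torus_dist \<Rightarrow> complex" where
  "L2_inner f g = (\<Sum>\<^sub>\<infinity>k. f k * cnj (g k))"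

definition torus_smooth :: "torus_dist set" where
  "torus_smooth = {f. \<forall>n::nat. \<exists>c. \<forall>k. norm (vec_of k) ^ n * cmod (f k) \<le> c}"

section \<open>Littlewood--Paley blocks\<close>

text \<open>Only meaningful for open \<open>S\<close>.\<close>

primrec Ck_on :: "nat \<Rightarrow> 'a::real_normed_vector set \<Rightarrow> ('a \<Rightarrow> real) \<Rightarrow> bool" where
  "Ck_on 0 S f \<longleftrightarrow> continuous_on S f"
| "Ck_on (Suc n) S f \<longleftrightarrow> (\<forall>x\<in>S. f differentiable (at x)) \<and>
      (\<forall>v. Ck_on n S (\<lambda>x. frechet_derivative f (at x) v))"

definition smooth_on :: "'a::real_normed_vector set \<Rightarrow> ('a \<Rightarrow> real) \<Rightarrow> bool" where
  "smooth_on S f \<longleftrightarrow> (\<forall>n. Ck_on n S f)"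

definition radial :: "(plane \<Rightarrow> real) \<Rightarrow> bool" where
  "radial f \<longleftrightarrow> (\<forall>x y. norm x = norm y \<longrightarrow> f x = f y)"

text \<open>The pair \<open>(chi, rho)\<close> of a dyadic partition of unity.\<close>

type_synonym dyadic = "(plane \<Rightarrow> real) \<times> (plane \<Rightarrow> real)"

definition dyadic_partition :: "dyadic \<Rightarrow> bool" where
  "dyadic_partition P \<longleftrightarrow> (case P of (chi, rho) \<Rightarrow>
     (\<forall>x. chi x \<ge> 0) \<and> (\<forall>x. rho x \<ge> 0) \<and>
     smooth_on UNIV chi \<and> smooth_on UNIV rho \<and> radial chi \<and> radial rho \<and>
     (\<exists>R. \<forall>x. chi x \<noteq> 0 \<longrightarrow> norm x \<le> R) \<and>
     (\<exists>r>0. \<exists>R. \<forall>x. rho x \<noteq> 0 \<longrightarrow> r \<le> norm x \<and> norm x \<le> R) \<and>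
     (\<forall>x. (\<lambda>j. rho (x /\<^sub>R 2 ^ j)) sums (1 - chi x)) \<and>
     (\<forall>j\<ge>1. \<forall>x. chi x * rho (x /\<^sub>R 2 ^ j) = 0) \<and>
     (\<forall>i j::nat. \<bar>int i - int j\<bar> > 1 \<longrightarrow> (\<forall>x. rho (x /\<^sub>R 2 ^ i) * rho (x /\<^sub>R 2 ^ j) = 0)))"

definition lp_block :: "dyadic \<Rightarrow> int \<Rightarrow> torus_dist \<Rightarrow> torus_dist" where
  "lp_block P j f = (\<lambda>k.
     (if j = -1 then of_real (fst P (vec_of k))
      else if j \<ge> 0 then of_real (snd P (vec_of k /\<^sub>R 2 ^ nat j)) else 0) * f k)"

definition holder_norm :: "dyadic \<Rightarrow> real \<Rightarrow> torus_dist \<Rightarrow> ennreal" where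
  "holder_norm P a f = (SUP j\<in>{-1..}. ennreal (2 powr (of_int j * a)) * linf_norm (lp_block P j f))"

definition holder :: "dyadic \<Rightarrow> real \<Rightarrow> torus_dist set" where
  "holder P a = {f. holder_norm P a f < \<infinity>}"

definition paraproduct :: "dyadic \<Rightarrow> torus_dist \<Rightarrow> torus_dist \<Rightarrow> torus_dist" where
  "paraproduct P f g = (\<lambda>n. \<Sum>\<^sub>\<infinity>j\<in>{-1..}. \<Sum>i\<in>{-1..j - 2}.
     mult (lp_block P i f) (lp_block P j g) n)"

definition resonant :: "dyadic \<Rightarrow> torus_dist \<Rightarrow> torus_dist \<Rightarrow> torus_dist" where
  "resonant P f g = (\<lambda>n. \<Sum>\<^sub>\<infinity>j\<in>{-1..}. \<Sum>i\<in>{max (-1) (j - 1)..j + 1}.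
     mult (lp_block P i f) (lp_block P j g) n)"

definition grad_paraproduct :: "dyadic \<Rightarrow> torus_dist \<Rightarrow> torus_dist \<Rightarrow> torus_dist" where
  "grad_paraproduct P f g =
     paraproduct P (partial1 f) (partial1 g) + paraproduct P (partial2 f) (partial2 g)"

text \<open>
  The commutator operator, as one map acting consistently on all admissible triples of spaces.
  Smooth functions are not dense in \<open>holder P b\<close>, but they are for the norms of slightly smaller
  exponents, so these conditions determine \<open>C f g h\<close> for all admissible \<open>f\<close>, \<open>g\<close>, \<open>h\<close>.
\<close>

definition commutator_operator ::
    "dyadic \<Rightarrow> (torus_dist \<Rightarrow> torus_dist \<Rightarrow> torus_dist \<Rightarrow> torus_dist) \<Rightarrow> bool" where
  "commutator_operator P C \<longleftrightarrow>
     (\<forall>a b c. 0 < a \<and> a < 1 \<and> b + c < 0 \<and> a + b + c > 0 \<longrightarrow>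
       (\<exists>M::real. \<forall>f\<in>sobolev a. \<forall>g\<in>holder P b. \<forall>h\<in>holder P c.
          sobolev_norm (a + b + c) (C f g h)
            \<le> ennreal M * sobolev_norm a f * holder_norm P b g * holder_norm P c h) \<and>
       (\<forall>f\<in>sobolev a. \<forall>f'\<in>sobolev a. \<forall>g\<in>holder P b. \<forall>g'\<in>holder P b.
        \<forall>h\<in>holder P c. \<forall>h'\<in>holder P c. \<forall>z.
          C (f + f') g h = C f g h + C f' g h \<and> C (scale z f) g h = scale z (C f g h) \<and>
          C f (g + g') h = C f g h + C f g' h \<and> C f (scale z g) h = scale z (C f g h) \<and>
          C f g (h + h') = C f g h + C f g h' \<and> C f g (scale z h) = scale z (C f g h))) \<and>
     (\<forall>f\<in>torus_smooth. \<forall>g\<in>torus_smooth. \<forall>h\<in>torus_smooth.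
        C f g h = resonant P (paraproduct P f g) h - mult f (resonant P g h))"

section \<open>White noise and its enhancement\<close>

text \<open>The degenerate case is the Dirac measure at 0.\<close>

definition centred_gaussian :: "'w measure \<Rightarrow> ('w \<Rightarrow> real) \<Rightarrow> bool" where
  "centred_gaussian M X \<longleftrightarrow> X \<in> borel_measurable M \<and>
     (distr M borel X = return borel 0 \<or>
      (\<exists>\<sigma>>0. distributed M lborel X (\<lambda>x. ennreal (normal_density 0 \<sigma> x))))"

definition centred_complex_gaussian :: "'w measure \<Rightarrow> ('w \<Rightarrow> complex) \<Rightarrow> bool" where
  "centred_complex_gaussian M Z \<longleftrightarrow>
     (\<forall>a b::real. centred_gaussian M (\<lambda>w. a * Re (Z w) + b * Im (Z w)))"

text \<open>
  Independence up to the reality constraint is independence over a set of frequencies which contains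
  exactly one of \<open>k\<close>, \<open>- k\<close>.  The covariance at \<open>(k, - k)\<close> forces the variables with \<open>k \<noteq> 0\<close> to be
  circularly symmetric.
\<close>

definition white_noise :: "'w measure \<Rightarrow> (freq \<Rightarrow> 'w \<Rightarrow> complex) \<Rightarrow> bool" where
  "white_noise M W \<longleftrightarrow> prob_space M \<and>
     (\<forall>k. \<forall>w\<in>space M. W (- k) w = cnj (W k w)) \<and>
     (\<forall>k. centred_complex_gaussian M (W k)) \<and>
     prob_space.indep_vars M (\<lambda>_. borel) W {k. fst k > 0 \<or> fst k = 0 \<and> snd k \<ge> 0} \<and>
     (\<forall>k l. (\<integral>w. W k w * cnj (W l w) \<partial>M) = (if k = l then 1 else 0))"

definition mollifier :: "(plane \<Rightarrow> real) \<Rightarrow> bool" where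
  "mollifier m \<longleftrightarrow> radial m \<and> smooth_on (- {0}) m \<and>
     (\<exists>R. \<forall>x. m x \<noteq> 0 \<longrightarrow> norm x \<le> R) \<and> (m \<longlongrightarrow> 1) (at 0)"

definition regularized :: "(plane \<Rightarrow> real) \<Rightarrow> torus_dist \<Rightarrow> real \<Rightarrow> torus_dist" where
  "regularized m \<xi> \<epsilon> = (\<lambda>k. of_real (m (\<epsilon> *\<^sub>R vec_of k)) * \<xi> k)"

definition renorm_const :: "(plane \<Rightarrow> real) \<Rightarrow> real \<Rightarrow> real" where
  "renorm_const m \<epsilon> = (\<Sum>\<^sub>\<infinity>k. \<bar>m (\<epsilon> *\<^sub>R vec_of k)\<bar>\<^sup>2 / bracket k)"

type_synonym enhanced = "torus_dist \<times> torus_dist"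

definition enhanced_noise :: "dyadic \<Rightarrow> (plane \<Rightarrow> real) \<Rightarrow> enhanced \<Rightarrow> bool" where
  "enhanced_noise P m \<Xi> \<longleftrightarrow> (case \<Xi> of (\<xi>, \<Xi>2) \<Rightarrow> \<forall>\<beta> < -1.
     ((\<lambda>\<epsilon>. holder_norm P \<beta> (regularized m \<xi> \<epsilon> - \<xi>)) \<longlongrightarrow> 0) (at_right 0) \<and>
     ((\<lambda>\<epsilon>. holder_norm P (2 * \<beta> + 2)
        (resonant P (regularized m \<xi> \<epsilon>) (resolvent (regularized m \<xi> \<epsilon>))
          - const_dist (of_real (renorm_const m \<epsilon>)) - \<Xi>2)) \<longlongrightarrow> 0) (at_right 0))"

section \<open>The Anderson Hamiltonian\<close>

definition X_of :: "enhanced \<Rightarrow> torus_dist" where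
  "X_of \<Xi> = resolvent (fst \<Xi>)"

definition B_op :: "dyadic \<Rightarrow> enhanced \<Rightarrow> torus_dist \<Rightarrow> torus_dist" where
  "B_op P \<Xi> u = resolvent (paraproduct P (laplacian u) (X_of \<Xi>)
     + scale 2 (grad_paraproduct P u (X_of \<Xi>))
     + paraproduct P (fst \<Xi>) u + paraproduct P u (snd \<Xi>))"

definition remainder :: "dyadic \<Rightarrow> enhanced \<Rightarrow> torus_dist \<Rightarrow> torus_dist" where
  "remainder P \<Xi> u = u - paraproduct P u (X_of \<Xi>) - B_op P \<Xi> u"

definition domain_H :: "dyadic \<Rightarrow> enhanced \<Rightarrow> real \<Rightarrow> torus_dist set" where
  "domain_H P \<Xi> \<gamma> = {u \<in> sobolev \<gamma>. remainder P \<Xi> u \<in> sobolev 2}"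

definition resonant_noise :: "dyadic \<Rightarrow> (torus_dist \<Rightarrow> torus_dist \<Rightarrow> torus_dist \<Rightarrow> torus_dist)
    \<Rightarrow> enhanced \<Rightarrow> torus_dist \<Rightarrow> torus_dist" where
  "resonant_noise P C \<Xi> u = C u (X_of \<Xi>) (fst \<Xi>) + mult u (snd \<Xi>)
     + resonant P (B_op P \<Xi> u) (fst \<Xi>) + resonant P (remainder P \<Xi> u) (fst \<Xi>)"

definition A_op :: "dyadic \<Rightarrow> (torus_dist \<Rightarrow> torus_dist \<Rightarrow> torus_dist \<Rightarrow> torus_dist)
    \<Rightarrow> enhanced \<Rightarrow> torus_dist \<Rightarrow> torus_dist" where
  "A_op P C \<Xi> u = laplacian u + paraproduct P u (fst \<Xi>) + paraproduct P (fst \<Xi>) u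
     + resonant_noise P C \<Xi> u"

definition H_op :: "dyadic \<Rightarrow> (torus_dist \<Rightarrow> torus_dist \<Rightarrow> torus_dist \<Rightarrow> torus_dist)
    \<Rightarrow> enhanced \<Rightarrow> real \<Rightarrow> torus_dist \<Rightarrow> torus_dist" where
  "H_op P C \<Xi> K u = A_op P C \<Xi> u - scale (of_real K) u"

text \<open>
  The inner product below is real for \<open>u\<close> in the domain, as \<open>H\<close> is symmetric.
\<close>

definition form_norm :: "dyadic \<Rightarrow> (torus_dist \<Rightarrow> torus_dist \<Rightarrow> torus_dist \<Rightarrow> torus_dist)
    \<Rightarrow> enhanced \<Rightarrow> real \<Rightarrow> torus_dist \<Rightarrow> ennreal" where
  "form_norm P C \<Xi> K u = ennreal (sqrt (Re (L2_inner u (- H_op P C \<Xi> K u))))"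

text \<open>
  Closure, inside \<open>L\<^sup>2\<close>, of a subspace \<open>D\<close> under a norm \<open>p\<close> which dominates the \<open>L\<^sup>2\<close> norm:
  the \<open>L\<^sup>2\<close> limits of the \<open>p\<close>-Cauchy sequences of \<open>D\<close>.
\<close>

definition norm_closure :: "(torus_dist \<Rightarrow> ennreal) \<Rightarrow> torus_dist set \<Rightarrow> torus_dist set" where
  "norm_closure p D = {u \<in> L2_T. \<exists>s::nat \<Rightarrow> torus_dist. (\<forall>n. s n \<in> D) \<and>
     (\<forall>e>0. \<exists>n0. \<forall>n\<ge>n0. \<forall>n'\<ge>n0. p (s n - s n') < e) \<and>
     (\<lambda>n. L2_norm_T (s n - u)) \<longlonglongrightarrow> 0}"

definition form_domain :: "dyadic \<Rightarrow> (torus_dist \<Rightarrow> torus_dist \<Rightarrow> torus_dist \<Rightarrow> torus_dist)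
    \<Rightarrow> enhanced \<Rightarrow> real \<Rightarrow> real \<Rightarrow> torus_dist set" where
  "form_domain P C \<Xi> \<gamma> K = norm_closure (form_norm P C \<Xi> K) (domain_H P \<Xi> \<gamma>)"

definition Gamma_map :: "dyadic \<Rightarrow> enhanced \<Rightarrow> nat \<Rightarrow> torus_dist \<Rightarrow> torus_dist" where
  "Gamma_map P \<Xi> N f = (THE g. g \<in> L2_T \<and>
     g = high_freq N (paraproduct P g (X_of \<Xi>) + B_op P \<Xi> g) + f)"

end

theory Submission
  imports Defs
begin

text \<open>
  By the product rule for \<open>1 - \<Delta>\<close> the explicit terms cancel and
  \<open>u \<prec> X + B\<^sub>\<Xi>(u) = (1 - \<Delta>)\<inverse>(u \<prec> \<xi> + \<xi> \<prec> u + u \<prec> \<Xi>\<^sub>2)\<close>; call this \<open>T u\<close>.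
  It maps \<open>L\<^sup>2\<close> boundedly to \<open>H\<^sup>\<gamma>\<close>, so for large \<open>N\<close> its part above frequency \<open>2\<^sup>N\<close> is a contraction
  of \<open>L\<^sup>2\<close>: \<open>\<Gamma>\<close> is a bounded bijection of \<open>L\<^sup>2\<close>, and the remainder \<open>R(\<Gamma> f)\<close> differs from \<open>f\<close> by a
  band-limited function controlled by the \<open>L\<^sup>2\<close> norm of \<open>\<Gamma> f\<close>.  Everything is thereby reduced to
  statements on \<open>R u\<close>.

  Similarly \<open>A u = \<Delta> R(u) + R(u) \<circ> \<xi>\<close> up to terms bounded from \<open>H\<^sup>\<gamma>\<close> to \<open>L\<^sup>2\<close>, and interpolation
  gives the two-sided bound by the \<open>H\<^sup>2\<close> norm of \<open>R u\<close> together with the \<open>L\<^sup>2\<close> norm of \<open>u\<close>.  In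
  \<open>\<langle>u, - A u\<rangle>\<close> the only terms that are not of lower order than the squared \<open>H\<^sup>1\<close> norm of \<open>R u\<close> are
  \<open>\<langle>u \<prec> \<xi>, R u\<rangle>\<close> and \<open>\<langle>u, R u \<circ> \<xi>\<rangle>\<close>.  Their difference is small because, block by block, the
  paraproduct and the resonant product with the real distribution \<open>\<xi>\<close> are adjoint to each other up
  to cut-offs that only see high frequencies of \<open>u\<close> or of \<open>R u\<close>.  A large shift \<open>K\<close> then makes the form
  coercive.
\<close>

text \<open>The supports of the dyadic functions may touch: the partition only makes products of
  distant symbols vanish pointwise, so the spectrum of a paraproduct block need not stay away from
  the origin, and bounds in spaces of negative order are not automatic. The substitute is that a
  nonnegative function with bounded second differences vanishes quadratically at its zeros. Output
  frequencies n of the block at scale 2^j then carry a factor (|n| / 2^j)^2, which pays for every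
  order t > -2; this is the origin of the hypothesis -2 < t. No almost orthogonality is used: block
  series converge absolutely at the price of an arbitrarily small power, paid by \<kappa>. No
  integral over the torus occurs. Bounds by sup norms come from exact averages over fine grids. In
  the quadratic form, order \<gamma> for u and order 1/2 for R u suffice, since \<gamma> + 1/2 > 1 +
  \<kappa>; both norms are interpolated, with a small constant, between the H^1 norm of R u and the
  L^2 norm of u. The resulting error constant is free of K, so a threshold for K exists.\<close>

no_notation Infinite_Set_Sum.abs_summable_on (infix "abs'_summable'_on" 50)

section \<open>Sobolev bounds\<close>

lemma bracket_ge1: "1 \<le> bracket k"
  by (simp add: bracket_def)

lemma bracket_pos: "0 < bracket k"
  using bracket_ge1[of k] by linarith

text \<open>Membership in H^s with norm at most c, stated through finite partial sums: it passes to
  sums and to coefficientwise limits without summability side conditions, and F = {} forces 0 \<le>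
  c.\<close>

definition sob_le :: "real \<Rightarrow> real \<Rightarrow> torus_dist \<Rightarrow> bool" where
  "sob_le s c f \<longleftrightarrow> (\<forall>F. finite F \<longrightarrow> L2_set (\<lambda>k. bracket k powr (s / 2) * cmod (f k)) F \<le> c)"

lemma sob_leD: "sob_le s c f \<Longrightarrow> finite F \<Longrightarrow> L2_set (\<lambda>k. bracket k powr (s / 2) * cmod (f k)) F \<le> c"
  by (simp add: sob_le_def)

lemma sob_le_nonneg: "sob_le s c f \<Longrightarrow> 0 \<le> c"
  using sob_leD[of s c f "{}"] by simp

lemma weighted_square: "(bracket k powr (s / 2) * cmod z)\<^sup>2 = bracket k powr s * (cmod z)\<^sup>2"
proof -
  have "(bracket k powr (s / 2))\<^sup>2 = bracket k powr s"
    by (simp add: power2_eq_square flip: powr_add)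
  then show ?thesis by (simp add: power_mult_distrib)
qed

lemma sob_le_iff_sum:
  assumes "0 \<le> c"
  shows "sob_le s c f \<longleftrightarrow> (\<forall>F. finite F \<longrightarrow> (\<Sum>k\<in>F. bracket k powr s * (cmod (f k))\<^sup>2) \<le> c\<^sup>2)"
proof -
  have "L2_set (\<lambda>k. bracket k powr (s / 2) * cmod (f k)) F \<le> c \<longleftrightarrow>
      (\<Sum>k\<in>F. bracket k powr s * (cmod (f k))\<^sup>2) \<le> c\<^sup>2" for F
  proof -
    have "0 \<le> (\<Sum>k\<in>F. bracket k powr s * (cmod (f k))\<^sup>2)" by (simp add: sum_nonneg)
    then show ?thesis
      unfolding L2_set_def weighted_square using assms by (auto intro: real_le_lsqrt dest: sqrt_le_D)
  qed
  then show ?thesis by (simp add: sob_le_def)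
qed

text \<open>Translates between the \<open>ennreal\<close> norms of the theorem and
  \<open>sob_le\<close>, in which all estimates are carried out.\<close>

lemma sobolev_norm_le_iff:
  assumes c: "0 \<le> c"
  shows "sobolev_norm s f \<le> ennreal c \<longleftrightarrow> sob_le s c f"
proof -
  let ?g = "\<lambda>k. bracket k powr s * (cmod (f k))\<^sup>2"
  show ?thesis
  proof
    assume "sobolev_norm s f \<le> ennreal c"
    then have sm: "?g summable_on UNIV" and le: "sqrt (infsum ?g UNIV) \<le> c"
      by (auto simp: sobolev_norm_def c infsum_nonneg top_unique split: if_splits)
    have "sum ?g F \<le> c\<^sup>2" if "finite F" for F
    proof -
      have "sum ?g F \<le> infsum ?g UNIV"
        using that sm by (intro finite_sum_le_infsum) auto
      also have "\<dots> = (sqrt (infsum ?g UNIV))\<^sup>2" by (simp add: infsum_nonneg)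
      also have "\<dots> \<le> c\<^sup>2" using le by (intro power_mono) (auto simp: infsum_nonneg)
      finally show ?thesis .
    qed
    then show "sob_le s c f" using c by (simp add: sob_le_iff_sum)
  next
    assume "sob_le s c f"
    then have b: "sum ?g F \<le> c\<^sup>2" if "finite F" for F using that c by (simp add: sob_le_iff_sum)
    have sm: "?g summable_on UNIV"
      by (rule nonneg_bdd_above_summable_on) (auto intro!: bdd_aboveI2[where M="c\<^sup>2"] b)
    have "infsum ?g UNIV \<le> c\<^sup>2"
      by (rule infsum_le_finite_sums[OF sm]) (use b in auto)
    then have "sqrt (infsum ?g UNIV) \<le> c" using c by (simp add: real_le_lsqrt infsum_nonneg)
    then show "sobolev_norm s f \<le> ennreal c" using sm by (simp add: sobolev_norm_def ennreal_leI)
  qed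
qed

lemma sobolev_iff: "f \<in> sobolev s \<longleftrightarrow> (\<exists>c. sob_le s c f)"
proof
  assume "f \<in> sobolev s"
  then obtain c where "0 \<le> c" "sobolev_norm s f = ennreal c"
    unfolding sobolev_def by (cases "sobolev_norm s f") auto
  then show "\<exists>c. sob_le s c f" using sobolev_norm_le_iff[of c s f] by auto
next
  assume "\<exists>c. sob_le s c f"
  then obtain c where "sob_le s c f" by blast
  then have "sobolev_norm s f \<le> ennreal c" using sobolev_norm_le_iff sob_le_nonneg by blast
  then show "f \<in> sobolev s" by (auto simp: sobolev_def intro: le_less_trans)
qed

lemma sob_le_dominated:
  assumes "sob_le s c g" "0 \<le> D"
    and "\<And>k. bracket k powr (t / 2) * cmod (f k) \<le> D * (bracket k powr (s / 2) * cmod (g k))"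
  shows "sob_le t (D * c) f"
  unfolding sob_le_def
proof safe
  fix F :: "freq set" assume F: "finite F"
  have "L2_set (\<lambda>k. bracket k powr (t / 2) * cmod (f k)) F
      \<le> L2_set (\<lambda>k. D * (bracket k powr (s / 2) * cmod (g k))) F"
    by (rule L2_set_mono) (use assms in auto)
  also have "\<dots> = D * L2_set (\<lambda>k. bracket k powr (s / 2) * cmod (g k)) F"
    by (simp add: L2_set_right_distrib assms(2))
  also have "\<dots> \<le> D * c" using sob_leD[OF assms(1) F] assms(2) by (rule mult_left_mono)
  finally show "L2_set (\<lambda>k. bracket k powr (t / 2) * cmod (f k)) F \<le> D * c" .
qed

lemma sob_le_mono: "sob_le s c f \<Longrightarrow> c \<le> d \<Longrightarrow> sob_le s d f"
  unfolding sob_le_def by (meson order_trans)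

lemma sob_le_smaller:
  assumes "sob_le s c g" "\<And>k. cmod (f k) \<le> cmod (g k)"
  shows "sob_le s c f"
  using sob_le_dominated[OF assms(1), of 1 s f] assms(2) by (simp add: mult_left_mono)

lemma sob_le_weaken:
  assumes "sob_le s c f" "t \<le> s"
  shows "sob_le t c f"
proof -
  have "bracket k powr (t / 2) \<le> bracket k powr (s / 2)" for k
    using assms(2) bracket_ge1 by (intro powr_mono) auto
  then show ?thesis using sob_le_dominated[OF assms(1), of 1 t f] by (simp add: mult_right_mono)
qed

text \<open>Bernstein's inequality: on the Fourier support the two weights differ by at most the
  factor D, so the change of regularity costs D.\<close>

lemma sob_le_localized:
  assumes f: "sob_le s c f" and D: "0 \<le> D"
    and b: "\<And>k. f k \<noteq> 0 \<Longrightarrow> bracket k powr ((t - s) / 2) \<le> D"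
  shows "sob_le t (D * c) f"
proof (rule sob_le_dominated[OF f D])
  fix k
  have "bracket k powr (t / 2) = bracket k powr ((t - s) / 2) * bracket k powr (s / 2)"
    by (simp add: powr_add[symmetric] diff_divide_distrib)
  then show "bracket k powr (t / 2) * cmod (f k) \<le> D * (bracket k powr (s / 2) * cmod (f k))"
    using b[of k] by (cases "f k = 0") (auto simp: mult.assoc intro!: mult_right_mono)
qed

lemma sob_le_add:
  assumes "sob_le s c f" "sob_le s d g"
  shows "sob_le s (c + d) (f + g)"
  unfolding sob_le_def
proof safe
  fix F :: "freq set" assume F: "finite F"
  have "L2_set (\<lambda>k. bracket k powr (s / 2) * cmod ((f + g) k)) F
      \<le> L2_set (\<lambda>k. bracket k powr (s / 2) * cmod (f k) + bracket k powr (s / 2) * cmod (g k)) F"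
    by (intro L2_set_mono) (auto simp: distrib_left[symmetric] intro!: mult_left_mono norm_triangle_ineq)
  also have "\<dots> \<le> L2_set (\<lambda>k. bracket k powr (s / 2) * cmod (f k)) F
      + L2_set (\<lambda>k. bracket k powr (s / 2) * cmod (g k)) F" by (rule L2_set_triangle_ineq)
  also have "\<dots> \<le> c + d" using assms F by (intro add_mono) (auto dest: sob_leD)
  finally show "L2_set (\<lambda>k. bracket k powr (s / 2) * cmod ((f + g) k)) F \<le> c + d" .
qed

lemma sob_le_uminus: "sob_le s c f \<Longrightarrow> sob_le s c (- f)"
  by (erule sob_le_smaller) simp

lemma sob_le_diff:
  assumes "sob_le s c f" "sob_le s d g"
  shows "sob_le s (c + d) (f - g)"
  using sob_le_add[OF assms(1) sob_le_uminus[OF assms(2)]] by simp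

lemma sob_le_scale:
  assumes "sob_le s c f"
  shows "sob_le s (cmod z * c) (scale z f)"
  using sob_le_dominated[OF assms, of "cmod z" s "scale z f"] by (simp add: scale_def norm_mult mult_ac)

lemma sob_le_zero: "0 \<le> c \<Longrightarrow> sob_le s c (\<lambda>k. 0)"
  by (simp add: sob_le_def L2_set_def)

lemma sob_le_point:
  assumes "sob_le s c f"
  shows "bracket k powr (s / 2) * cmod (f k) \<le> c"
  using sob_leD[OF assms, of "{k}"] by (simp add: L2_set_def)

lemma sob_le_0_point: "sob_le 0 c f \<Longrightarrow> cmod (f k) \<le> c"
  using sob_le_point[of 0 c f k] bracket_pos[of k] by simp

lemma sob_le_sum:
  assumes "\<And>i. i \<in> I \<Longrightarrow> sob_le s (c i) (f i)"
  shows "sob_le s (\<Sum>i\<in>I. c i) (\<lambda>k. \<Sum>i\<in>I. f i k)"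
  using assms
proof (induction I rule: infinite_finite_induct)
  case (insert i I)
  then have "sob_le s (c i + (\<Sum>i\<in>I. c i)) (f i + (\<lambda>k. \<Sum>i\<in>I. f i k))"
    by (intro sob_le_add) auto
  then show ?case using insert by (simp add: plus_fun_def)
qed (auto intro: sob_le_zero)

text \<open>Lower semicontinuity of the Sobolev norm: each partial sum involves finitely many
  coefficients, so coefficientwise convergence is enough.\<close>

lemma sob_le_limit:
  assumes "G \<noteq> bot" "\<And>k. ((\<lambda>i. f i k) \<longlongrightarrow> g k) G" "\<forall>\<^sub>F i in G. sob_le s c (f i)"
  shows "sob_le s c g"
  unfolding sob_le_def
proof safe
  fix F :: "freq set" assume F: "finite F"
  have "((\<lambda>i. L2_set (\<lambda>k. bracket k powr (s / 2) * cmod (f i k)) F)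
      \<longlongrightarrow> L2_set (\<lambda>k. bracket k powr (s / 2) * cmod (g k)) F) G"
    unfolding L2_set_def by (intro tendsto_intros assms)
  then show "L2_set (\<lambda>k. bracket k powr (s / 2) * cmod (g k)) F \<le> c"
    by (rule tendsto_upperbound) (use assms(1,3) F in \<open>auto elim!: eventually_mono dest: sob_leD\<close>)
qed

lemma sob_le_infsum_pointwise:
  assumes "\<And>j. j \<in> J \<Longrightarrow> sob_le t (c j) (F j)" "c summable_on J"
  shows "(\<lambda>j. F j n) abs_summable_on J" "(\<lambda>j. F j n) summable_on J"
proof -
  have "(\<lambda>j. bracket n powr (- (t / 2)) * c j) summable_on J"
    by (intro summable_on_cmult_right assms)
  then show "(\<lambda>j. F j n) abs_summable_on J"
  proof (rule Infinite_Sum.abs_summable_on_comparison_test')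
    fix j assume "j \<in> J"
    then have "bracket n powr (t / 2) * cmod (F j n) \<le> c j" by (rule sob_le_point[OF assms(1)])
    then show "norm (F j n) \<le> bracket n powr (- (t / 2)) * c j"
      using bracket_pos[of n] by (simp add: powr_minus field_simps)
  qed
  then show "(\<lambda>j. F j n) summable_on J" by (rule abs_summable_summable)
qed

text \<open>Block series are controlled by the triangle inequality alone; the sum is taken
  coefficientwise, as in the definition of the paraproduct.\<close>

lemma sob_le_infsum:
  assumes F: "\<And>j. j \<in> J \<Longrightarrow> sob_le t (c j) (F j)" and c: "c summable_on J"
  shows "sob_le t (infsum c J) (\<lambda>n. \<Sum>\<^sub>\<infinity>j\<in>J. F j n)"
proof (rule sob_le_limit)
  show "finite_subsets_at_top J \<noteq> bot" by simp
  show "((\<lambda>I. \<Sum>j\<in>I. F j k) \<longlongrightarrow> (\<Sum>\<^sub>\<infinity>j\<in>J. F j k)) (finite_subsets_at_top J)" for k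
    using infsum_tendsto[OF sob_le_infsum_pointwise(2)[OF F c]] by simp
  have "sob_le t (infsum c J) (\<lambda>k. \<Sum>j\<in>I. F j k)" if "finite I" "I \<subseteq> J" for I
  proof (rule sob_le_mono)
    show "sob_le t (sum c I) (\<lambda>k. \<Sum>j\<in>I. F j k)" using that F by (intro sob_le_sum) auto
    show "sum c I \<le> infsum c J"
      using that sob_le_nonneg[OF F] by (intro finite_sum_le_infsum c) auto
  qed
  then show "\<forall>\<^sub>F I in finite_subsets_at_top J. sob_le t (infsum c J) (\<lambda>k. \<Sum>j\<in>I. F j k)"
    by (intro eventually_finite_subsets_at_top_weakI)
qed

text \<open>The weight of order s is at most \<delta> times the weight of order s' where their
  quotient exceeds 1 / \<delta>, and it is bounded at the remaining frequencies.\<close>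

lemma sob_le_interpolation:
  assumes "s < s'" "0 < \<delta>"
  obtains D where "0 \<le> D"
    "\<And>f c d. sob_le s' c f \<Longrightarrow> sob_le 0 d f \<Longrightarrow> sob_le s (\<delta> * c + D * d) f"
proof -
  \<comment> \<open>The power is the value of the weight at the threshold when s > 0; the summand 1
    covers s \<le> 0, where the weight never exceeds 1.\<close>
  define D where "D = (1 / \<delta>) powr \<bar>s / (s' - s)\<bar> + 1"
  have D: "0 \<le> D" unfolding D_def by (simp add: add_nonneg_nonneg)
  have key: "b powr (s / 2) \<le> \<delta> * b powr (s' / 2) + D" if b: "b \<ge> 1" for b
  proof (cases "b powr ((s' - s) / 2) \<ge> 1 / \<delta>")
    case True
    have "b powr (s' / 2) = b powr ((s' - s) / 2) * b powr (s / 2)"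
      by (simp add: powr_add[symmetric] diff_divide_distrib)
    then have "1 / \<delta> * b powr (s / 2) \<le> b powr (s' / 2)" using mult_right_mono[OF True, of "b powr (s / 2)"] by simp
    then have "b powr (s / 2) \<le> \<delta> * b powr (s' / 2)" using assms(2) by (simp add: field_simps)
    then show ?thesis using D by linarith
  next
    case False
    then have lt: "b powr ((s' - s) / 2) < 1 / \<delta>" by simp
    have "b powr (s / 2) \<le> D"
    proof (cases "s \<le> 0")
      case True
      have "b powr (s / 2) \<le> b powr 0" using True b by (intro powr_mono) auto
      also have "b powr 0 = 1" using b by simp
      also have "1 \<le> D" by (simp add: D_def)
      finally show ?thesis .
    next
      case s: False
      have "b powr (s / 2) = (b powr ((s' - s) / 2)) powr (s / (s' - s))"
      proof -
        have "d \<noteq> 0 \<Longrightarrow> d / 2 * (s / d) = s / 2" for d :: real by simp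
        from this[of "s' - s"] have "(s' - s) / 2 * (s / (s' - s)) = s / 2" using assms(1) by simp
        then show ?thesis by (simp only: powr_powr)
      qed
      also have "\<dots> \<le> (1 / \<delta>) powr (s / (s' - s))" using lt s assms(1) by (intro powr_mono2) auto
      finally show ?thesis using s assms(1) by (simp add: D_def)
    qed
    moreover have "0 \<le> \<delta> * b powr (s' / 2)" using assms(2) by simp
    ultimately show ?thesis by linarith
  qed
  show thesis
  proof (rule that[OF D])
    fix f c d assume f: "sob_le s' c f" "sob_le 0 d f"
    show "sob_le s (\<delta> * c + D * d) f"
      unfolding sob_le_def
    proof safe
      fix F :: "freq set" assume F: "finite F"
      have "L2_set (\<lambda>k. bracket k powr (s / 2) * cmod (f k)) F
          \<le> L2_set (\<lambda>k. \<delta> * (bracket k powr (s' / 2) * cmod (f k))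
                + D * (bracket k powr (0 / 2) * cmod (f k))) F"
      proof (rule L2_set_mono)
        fix k
        have "bracket k powr (s / 2) * cmod (f k) \<le> (\<delta> * bracket k powr (s' / 2) + D) * cmod (f k)"
          by (intro mult_right_mono key bracket_ge1) auto
        then show "bracket k powr (s / 2) * cmod (f k)
          \<le> \<delta> * (bracket k powr (s' / 2) * cmod (f k)) + D * (bracket k powr (0 / 2) * cmod (f k))"
          using bracket_pos[of k] by (simp add: algebra_simps)
      qed simp
      also have "\<dots> \<le> L2_set (\<lambda>k. \<delta> * (bracket k powr (s' / 2) * cmod (f k))) F
          + L2_set (\<lambda>k. D * (bracket k powr (0 / 2) * cmod (f k))) F"
        by (rule L2_set_triangle_ineq)
      also have "\<dots> = \<delta> * L2_set (\<lambda>k. bracket k powr (s' / 2) * cmod (f k)) F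
          + D * L2_set (\<lambda>k. bracket k powr (0 / 2) * cmod (f k)) F"
        using assms(2) D by (simp add: L2_set_right_distrib del: zero_power2)
      also have "\<dots> \<le> \<delta> * c + D * d"
        using assms(2) D sob_leD[OF f(1) F] sob_leD[OF f(2) F] by (intro add_mono mult_left_mono) auto
      finally show "L2_set (\<lambda>k. bracket k powr (s / 2) * cmod (f k)) F \<le> \<delta> * c + D * d" .
    qed
  qed
qed

section \<open>Duality between H^s and H^(-s)\<close>

lemma sob_le_pairing:
  assumes f: "sob_le s c f" and g: "sob_le (- s) d g"
  shows "(\<lambda>k. f k * g k) abs_summable_on UNIV" "(\<Sum>\<^sub>\<infinity>k. cmod (f k * g k)) \<le> c * d"
    "cmod (\<Sum>\<^sub>\<infinity>k. f k * g k) \<le> c * d"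
proof -
  have b: "(\<Sum>k\<in>F. cmod (f k * g k)) \<le> c * d" if F: "finite F" for F
  proof -
    have "cmod (f k * g k) = \<bar>bracket k powr (s / 2) * cmod (f k)\<bar> * \<bar>bracket k powr (- s / 2) * cmod (g k)\<bar>" for k
      using bracket_pos[of k] by (simp add: norm_mult powr_minus field_simps abs_mult)
    then have "(\<Sum>k\<in>F. cmod (f k * g k)) \<le> L2_set (\<lambda>k. bracket k powr (s / 2) * cmod (f k)) F
        * L2_set (\<lambda>k. bracket k powr (- s / 2) * cmod (g k)) F"
      using L2_set_mult_ineq[of "\<lambda>k. bracket k powr (s / 2) * cmod (f k)"
            "\<lambda>k. bracket k powr (- s / 2) * cmod (g k)" F] by simp
    also have "\<dots> \<le> c * d"
      using sob_leD[OF f F] sob_leD[OF g F] sob_le_nonneg[OF f] by (intro mult_mono) auto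
    finally show ?thesis .
  qed
  show s: "(\<lambda>k. f k * g k) abs_summable_on UNIV"
    by (rule nonneg_bdd_above_summable_on) (auto intro!: bdd_aboveI2[where M="c * d"] b)
  show i: "(\<Sum>\<^sub>\<infinity>k. cmod (f k * g k)) \<le> c * d"
    by (rule infsum_le_finite_sums[OF s]) (use b in auto)
  have "cmod (\<Sum>\<^sub>\<infinity>k. f k * g k) \<le> (\<Sum>\<^sub>\<infinity>k. cmod (f k * g k))"
    by (rule norm_infsum_bound[OF s])
  then show "cmod (\<Sum>\<^sub>\<infinity>k. f k * g k) \<le> c * d" using i by linarith
qed

lemma sob_le_cnj: "sob_le s c f \<Longrightarrow> sob_le s c (\<lambda>k. cnj (f k))"
  by (simp add: sob_le_def)

lemma L2_inner_summable:
  assumes "sob_le s c f" "sob_le (- s) d g"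
  shows "(\<lambda>k. f k * cnj (g k)) summable_on UNIV"
  using sob_le_pairing(1)[OF assms(1) sob_le_cnj[OF assms(2)]] by (rule abs_summable_summable)

lemma L2_inner_bound:
  assumes "sob_le s c f" "sob_le (- s) d g"
  shows "cmod (L2_inner f g) \<le> c * d"
  using sob_le_pairing(3)[OF assms(1) sob_le_cnj[OF assms(2)]] by (simp add: L2_inner_def)

lemma L2_inner_cnj: "L2_inner g f = cnj (L2_inner f g)"
  unfolding L2_inner_def by (subst infsum_cnj[symmetric]) (simp add: mult.commute)

lemma L2_inner_uminus_right: "L2_inner f (- g) = - L2_inner f g"
  unfolding L2_inner_def by (subst infsum_uminus[symmetric]) simp

lemma L2_inner_add_right:
  assumes "sob_le s c f" "sob_le (- s) d g" "sob_le (- s) d' g'"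
  shows "L2_inner f (g + g') = L2_inner f g + L2_inner f g'"
  unfolding L2_inner_def
  by (subst infsum_add[symmetric]) (use assms in \<open>auto simp: algebra_simps intro: L2_inner_summable\<close>)

lemma L2_inner_diff_right:
  assumes "sob_le s c f" "sob_le (- s) d g" "sob_le (- s) d' g'"
  shows "L2_inner f (g - g') = L2_inner f g - L2_inner f g'"
  using L2_inner_add_right[OF assms(1,2) sob_le_uminus[OF assms(3)]] by (simp add: L2_inner_uminus_right)

lemma L2_inner_add_left:
  assumes "sob_le s c f" "sob_le s c' f'" "sob_le (- s) d g"
  shows "L2_inner (f + f') g = L2_inner f g + L2_inner f' g"
  unfolding L2_inner_def
  by (subst infsum_add[symmetric]) (use assms in \<open>auto simp: algebra_simps intro: L2_inner_summable\<close>)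

text \<open>Paraproducts are coefficientwise infinite sums, so pairing with one requires exchanging
  the sums over blocks and over frequencies; the duality bound c * d j makes the double series
  absolutely summable.\<close>

lemma L2_inner_infsum_right:
  assumes f: "sob_le s c f" and F: "\<And>j. j \<in> J \<Longrightarrow> sob_le (- s) (d j) (F j)" and d: "d summable_on J"
  shows "(\<lambda>j. L2_inner f (F j)) summable_on J"
    "L2_inner f (\<lambda>n. \<Sum>\<^sub>\<infinity>j\<in>J. F j n) = (\<Sum>\<^sub>\<infinity>j\<in>J. L2_inner f (F j))"
proof -
  let ?h = "\<lambda>j k. f k * cnj (F j k)"
  have sj: "?h j abs_summable_on UNIV" and bj: "(\<Sum>\<^sub>\<infinity>k. cmod (?h j k)) \<le> c * d j" if "j \<in> J" for j
    using sob_le_pairing(1,2)[OF f sob_le_cnj[OF F[OF that]]] by auto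
  have sb: "(\<lambda>j. \<Sum>\<^sub>\<infinity>k. cmod (?h j k)) summable_on J"
    by (rule summable_on_comparison_test[OF summable_on_cmult_right[OF d, of c]])
       (use bj in \<open>auto intro: infsum_nonneg\<close>)
  have "(\<lambda>(j, k). ?h j k) abs_summable_on (SIGMA j:J. UNIV)"
    unfolding Infinite_Sum.abs_summable_on_Sigma_iff
    using sj sb by (auto simp: infsum_nonneg)
  then have tot: "(\<lambda>(j, k). ?h j k) summable_on (J \<times> UNIV)" by (rule abs_summable_summable)
  have "(\<lambda>j. \<Sum>\<^sub>\<infinity>k. ?h j k) summable_on J"
    using summable_on_Sigma_banach[OF tot] by simp
  then show "(\<lambda>j. L2_inner f (F j)) summable_on J" by (simp add: L2_inner_def)
  have "(\<Sum>\<^sub>\<infinity>j\<in>J. \<Sum>\<^sub>\<infinity>k. ?h j k) = (\<Sum>\<^sub>\<infinity>k. \<Sum>\<^sub>\<infinity>j\<in>J. ?h j k)"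
    by (rule infsum_swap_banach[OF tot])
  also have "\<dots> = (\<Sum>\<^sub>\<infinity>k. f k * cnj (\<Sum>\<^sub>\<infinity>j\<in>J. F j k))"
  proof (intro infsum_cong)
    fix k
    have "(\<lambda>j. cnj (F j k)) summable_on J"
      using sob_le_infsum_pointwise(2)[OF F d] by (subst summable_on_cnj_iff)
    then show "(\<Sum>\<^sub>\<infinity>j\<in>J. ?h j k) = f k * cnj (\<Sum>\<^sub>\<infinity>j\<in>J. F j k)"
      by (subst infsum_cnj[symmetric]) (rule infsum_cmult_right, simp)
  qed
  finally show "L2_inner f (\<lambda>n. \<Sum>\<^sub>\<infinity>j\<in>J. F j n) = (\<Sum>\<^sub>\<infinity>j\<in>J. L2_inner f (F j))"
    by (simp add: L2_inner_def)
qed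

text \<open>The norm as a real number. A divergent sum has the default value 0, so this is
  meaningful for members of \<open>sobolev s\<close> only; there it is the least c with
  \<open>sob_le s c f\<close>.\<close>

definition sob_val :: "real \<Rightarrow> torus_dist \<Rightarrow> real" where
  "sob_val s f = sqrt (\<Sum>\<^sub>\<infinity>k. bracket k powr s * (cmod (f k))\<^sup>2)"

lemma sobolev_norm_eq:
  assumes "f \<in> sobolev s"
  shows "sobolev_norm s f = ennreal (sob_val s f)" "sob_le s (sob_val s f) f"
    "(\<lambda>k. bracket k powr s * (cmod (f k))\<^sup>2) summable_on UNIV"
proof -
  show s: "(\<lambda>k. bracket k powr s * (cmod (f k))\<^sup>2) summable_on UNIV"
    using assms by (auto simp: sobolev_def sobolev_norm_def split: if_splits)
  then show e: "sobolev_norm s f = ennreal (sob_val s f)" by (simp add: sobolev_norm_def sob_val_def)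
  show "sob_le s (sob_val s f) f"
    by (subst sobolev_norm_le_iff[symmetric]) (auto simp: e sob_val_def infsum_nonneg)
qed

lemma sob_val_nonneg: "0 \<le> sob_val s f"
  by (simp add: sob_val_def infsum_nonneg)

lemma sob_val_le:
  assumes "sob_le s c f"
  shows "sob_val s f \<le> c"
proof -
  have "f \<in> sobolev s" using assms sobolev_iff by blast
  then have "ennreal (sob_val s f) \<le> ennreal c"
    using assms sobolev_norm_le_iff[OF sob_le_nonneg[OF assms]] sobolev_norm_eq(1)[of f s] by metis
  then show ?thesis using sob_le_nonneg[OF assms] by (simp add: ennreal_le_iff)
qed

lemma L2_inner_self:
  assumes "f \<in> sobolev s"
  shows "L2_inner f (\<lambda>k. of_real (bracket k powr s) * f k) = of_real ((sob_val s f)\<^sup>2)"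
proof -
  have "f k * cnj (of_real (bracket k powr s) * f k) = of_real (bracket k powr s * (cmod (f k))\<^sup>2)" for k
    using complex_norm_square[of "f k"] by (simp add: mult_ac)
  then have "L2_inner f (\<lambda>k. of_real (bracket k powr s) * f k)
      = (\<Sum>\<^sub>\<infinity>k. of_real (bracket k powr s * (cmod (f k))\<^sup>2))" by (simp only: L2_inner_def)
  also have "\<dots> = of_real (\<Sum>\<^sub>\<infinity>k. bracket k powr s * (cmod (f k))\<^sup>2)" by (intro infsumI has_sum_of_real has_sum_infsum sobolev_norm_eq(3) assms)
  finally show ?thesis by (simp add: sob_val_def infsum_nonneg)
qed

section \<open>Sup norm bounds through discrete averages\<close>

abbreviation char_at :: "freq \<Rightarrow> plane \<Rightarrow> complex" where
  "char_at k x \<equiv> cis (2 * pi * (vec_of k \<bullet> x))"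

text \<open>Averages over these M * M points stand in for integrals over the torus: they are exact
  for trigonometric polynomials whose frequencies have coordinates below M in modulus.\<close>

definition grid_pt :: "nat \<Rightarrow> nat \<times> nat \<Rightarrow> plane" where
  "grid_pt M p = (real (fst p) / real M, real (snd p) / real M)"

abbreviation grid :: "nat \<Rightarrow> (nat \<times> nat) set" where
  "grid M \<equiv> {..<M} \<times> {..<M}"

definition box :: "nat \<Rightarrow> freq set" where
  "box L = {k. \<bar>fst k\<bar> \<le> int L \<and> \<bar>snd k\<bar> \<le> int L}"

lemma finite_box: "finite (box L)"
proof -
  have "box L \<subseteq> {- int L..int L} \<times> {- int L..int L}" by (auto simp: box_def)
  then show ?thesis by (rule finite_subset) simp
qed

lemma box_mono: "L \<le> L' \<Longrightarrow> box L \<subseteq> box L'"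
  by (auto simp: box_def)

lemma finite_subset_box:
  assumes "finite (F :: freq set)"
  shows "\<exists>L. F \<subseteq> box L"
proof -
  define L where "L = (\<Sum>k\<in>F. nat \<bar>fst k\<bar> + nat \<bar>snd k\<bar>)"
  have "k \<in> box L" if "k \<in> F" for k
  proof -
    have "nat \<bar>fst k\<bar> + nat \<bar>snd k\<bar> \<le> L"
      unfolding L_def using that assms by (intro member_le_sum) auto
    then show ?thesis by (auto simp: box_def)
  qed
  then show ?thesis by blast
qed

lemma norm_vec_of_sq: "(norm (vec_of k))\<^sup>2 = (real_of_int (fst k))\<^sup>2 + (real_of_int (snd k))\<^sup>2"
  by (simp add: vec_of_def norm_Pair)

lemma coord_le_norm_vec_of: "\<bar>real_of_int (fst k)\<bar> \<le> norm (vec_of k)" "\<bar>real_of_int (snd k)\<bar> \<le> norm (vec_of k)"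
  by (auto simp: vec_of_def norm_Pair intro!: real_le_rsqrt)

lemma root_of_unity_sum:
  fixes n :: int
  assumes M: "0 < M"
  shows "(\<Sum>a<M. cis (2 * pi * (of_int n * (real a / real M)))) = (if int M dvd n then of_nat M else 0)"
proof -
  define z where "z = cis (2 * pi * of_int n / real M)"
  have pw: "cis (2 * pi * (of_int n * (real a / real M))) = z ^ a" for a
  proof -
    have "2 * pi * (of_int n * (real a / real M)) = real a * (2 * pi * of_int n / real M)" by simp
    then show ?thesis unfolding z_def by (simp only: Complex.DeMoivre)
  qed
  have zM: "z ^ M = 1"
  proof -
    have "real M * (2 * pi * of_int n / real M) = 2 * pi * of_int n" using M by simp
    then show ?thesis unfolding z_def by (simp only: Complex.DeMoivre cis_multiple_2pi[OF Ints_of_int])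
  qed
  show ?thesis
  proof (cases "z = 1")
    case True
    then have "cos (2 * pi * of_int n / real M) = 1" unfolding z_def by (simp add: complex_eq_iff)
    then obtain m :: int where "2 * pi * of_int n / real M = of_int m * 2 * pi"
      using cos_one_2pi_int by auto
    then have "real_of_int n = real_of_int (m * int M)" using M by (simp add: field_simps)
    then have "int M dvd n" by (simp only: of_int_eq_iff) simp
    then show ?thesis unfolding pw using True by simp
  next
    case False
    have "\<not> int M dvd n"
    proof
      assume "int M dvd n"
      then obtain q where "n = int M * q" by blast
      then have "z = cis (2 * pi * of_int q)" unfolding z_def using M by (simp add: field_simps)
      then show False using False by (simp add: cis_multiple_2pi)
    qed
    then show ?thesis unfolding pw using False zM by (simp add: geometric_sum)
  qed
qed

lemma grid_orthogonality:
  assumes M: "0 < M"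
  shows "(\<Sum>p\<in>grid M. char_at k (grid_pt M p)) = (if int M dvd fst k \<and> int M dvd snd k then of_nat M ^ 2 else 0)"
proof -
  have "(\<Sum>p\<in>grid M. char_at k (grid_pt M p))
      = (\<Sum>a<M. \<Sum>b<M. cis (2 * pi * (of_int (fst k) * (real a / real M)))
          * cis (2 * pi * (of_int (snd k) * (real b / real M))))"
    unfolding sum.cartesian_product
    by (rule sum.cong) (auto simp: grid_pt_def vec_of_def cis_mult ring_distribs)
  also have "\<dots> = (\<Sum>a<M. cis (2 * pi * (of_int (fst k) * (real a / real M))))
      * (\<Sum>b<M. cis (2 * pi * (of_int (snd k) * (real b / real M))))"
    by (simp add: sum_product)
  also have "\<dots> = (if int M dvd fst k \<and> int M dvd snd k then of_nat M ^ 2 else 0)"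
    unfolding root_of_unity_sum[OF M] by (simp add: power2_eq_square)
  finally show ?thesis .
qed

lemma box_congruent_eq:
  assumes "k \<in> box L" "l \<in> box L" "2 * L < M" "int M dvd fst (k - l)" "int M dvd snd (k - l)"
  shows "k = l"
proof -
  have "x = y" if "\<bar>x\<bar> \<le> int L" "\<bar>y\<bar> \<le> int L" "int M dvd x - y" for x y
    using dvd_imp_le_int[of "x - y" "int M"] that assms(3) by linarith
  then show ?thesis using assms by (auto simp: box_def prod_eq_iff)
qed

text \<open>The multiplier with symbol a is convolution with the kernel \<open>eval_at a\<close>.
  For M > 2 * L no two frequencies of the box are congruent modulo M, so the discrete convolution is
  exact.\<close>

lemma grid_convolution:
  assumes a: "\<And>k. k \<notin> box L \<Longrightarrow> a k = 0" and f: "\<And>k. k \<notin> box L \<Longrightarrow> f k = 0" and M: "2 * L < M"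
  shows "(\<Sum>p\<in>grid M. eval_at a (grid_pt M p) * eval_at f (x - grid_pt M p))
    = of_nat M ^ 2 * eval_at (\<lambda>k. a k * f k) x"
proof -
  have ch: "char_at k y * char_at l (x - y) = char_at l x * char_at (k - l) y" for k l y
    by (simp add: cis_mult vec_of_diff inner_diff_left inner_diff_right algebra_simps)
  have o: "(\<Sum>p\<in>grid M. char_at (k - l) (grid_pt M p)) = (if k = l then of_nat M ^ 2 else 0)"
    if "k \<in> box L" "l \<in> box L" for k l
    using box_congruent_eq[OF that M] M by (subst grid_orthogonality) auto
  have "(\<Sum>p\<in>grid M. eval_at a (grid_pt M p) * eval_at f (x - grid_pt M p))
      = (\<Sum>p\<in>grid M. \<Sum>k\<in>box L. \<Sum>l\<in>box L. a k * f l * char_at l x * char_at (k - l) (grid_pt M p))"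
  proof (rule sum.cong[OF refl])
    fix p
    let ?y = "grid_pt M p"
    have "(a k * char_at k ?y) * (f l * char_at l (x - ?y)) = a k * f l * char_at l x * char_at (k - l) ?y" for k l
      using arg_cong[OF ch[of k ?y l], of "\<lambda>z. a k * f l * z"] by (simp only: mult_ac)
    then show "eval_at a ?y * eval_at f (x - ?y)
      = (\<Sum>k\<in>box L. \<Sum>l\<in>box L. a k * f l * char_at l x * char_at (k - l) ?y)"
      by (simp only: eval_at_finite[where f = a, OF finite_box a] eval_at_finite[where f = f, OF finite_box f] sum_product)
  qed
  also have "\<dots> = (\<Sum>k\<in>box L. \<Sum>l\<in>box L. \<Sum>p\<in>grid M. a k * f l * char_at l x * char_at (k - l) (grid_pt M p))"
    by (subst sum.swap) (intro sum.cong refl sum.swap)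
  also have "\<dots> = (\<Sum>k\<in>box L. \<Sum>l\<in>box L. a k * f l * char_at l x * (if k = l then of_nat M ^ 2 else 0))"
    by (intro sum.cong refl) (simp add: sum_distrib_left[symmetric] o)
  also have "\<dots> = (\<Sum>k\<in>box L. a k * f k * char_at k x * of_nat M ^ 2)"
    using finite_box by (intro sum.cong refl) (simp add: if_distrib sum.delta cong: if_cong)
  also have "\<dots> = of_nat M ^ 2 * eval_at (\<lambda>k. a k * f k) x"
    by (subst eval_at_finite[OF finite_box[of L]]) (auto simp: a sum_distrib_left mult_ac)
  finally show ?thesis .
qed

lemma eval_at_cnj:
  assumes f: "\<And>k. k \<notin> box L \<Longrightarrow> f k = 0"
  shows "eval_at (\<lambda>k. cnj (f k)) (- x) = cnj (eval_at f x)"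
proof -
  have "eval_at (\<lambda>k. cnj (f k)) (- x) = (\<Sum>k\<in>box L. cnj (f k) * char_at k (- x))"
    by (rule eval_at_finite[OF finite_box]) (simp add: f)
  then show ?thesis by (simp add: eval_at_finite[OF finite_box f] cis_cnj)
qed

text \<open>This is the convolution of f with its reflected conjugate, evaluated at the
  origin.\<close>

lemma grid_parseval:
  assumes f: "\<And>k. k \<notin> box L \<Longrightarrow> f k = 0" and M: "2 * L < M"
  shows "(\<Sum>p\<in>grid M. (cmod (eval_at f (grid_pt M p)))\<^sup>2) = (real M)\<^sup>2 * (\<Sum>k\<in>box L. (cmod (f k))\<^sup>2)"
proof -
  have "complex_of_real (\<Sum>p\<in>grid M. (cmod (eval_at f (grid_pt M p)))\<^sup>2)
      = (\<Sum>p\<in>grid M. eval_at f (grid_pt M p) * eval_at (\<lambda>k. cnj (f k)) (0 - grid_pt M p))"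
    by (simp add: eval_at_cnj[OF f] complex_norm_square[symmetric] del: of_real_power)
  also have "\<dots> = of_nat M ^ 2 * eval_at (\<lambda>k. f k * cnj (f k)) 0"
    by (rule grid_convolution[OF f _ M]) (auto simp: f)
  also have "eval_at (\<lambda>k. f k * cnj (f k)) 0 = (\<Sum>k\<in>box L. f k * cnj (f k))"
    by (subst eval_at_finite[OF finite_box]) (auto simp: f)
  also have "\<dots> = of_real (\<Sum>k\<in>box L. (cmod (f k))\<^sup>2)"
    by (simp add: complex_norm_square[symmetric] del: of_real_power)
  finally have "complex_of_real (\<Sum>p\<in>grid M. (cmod (eval_at f (grid_pt M p)))\<^sup>2)
      = of_real ((real M)\<^sup>2 * (\<Sum>k\<in>box L. (cmod (f k))\<^sup>2))"
    by (simp only: of_real_mult of_real_power of_real_of_nat_eq)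
  then show ?thesis by (simp only: of_real_eq_iff)
qed

section \<open>Products with trigonometric polynomials\<close>

lemma mult_commute: "mult f g = mult g f"
proof
  fix n
  have "mult f g n = (\<Sum>\<^sub>\<infinity>k\<in>(\<lambda>k. n - k) ` UNIV. f k * g (n - k))"
    unfolding mult_def by (rule arg_cong[where f="infsum _"]) (metis surj_def diff_diff_eq2 add_diff_cancel_left')
  also have "\<dots> = (\<Sum>\<^sub>\<infinity>k. f (n - k) * g k)"
    by (subst infsum_reindex) (auto simp: inj_on_def o_def)
  finally show "mult f g n = mult g f n" by (simp add: mult_def mult.commute)
qed

lemma mult_finite_right:
  assumes "finite G" "\<And>l. l \<notin> G \<Longrightarrow> g l = 0"
  shows "mult f g n = (\<Sum>l\<in>G. f (n - l) * g l)"
proof -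
  have "mult f g n = (\<Sum>\<^sub>\<infinity>l\<in>G. g l * f (n - l))"
    unfolding mult_commute[of f g] unfolding mult_def by (rule infsum_cong_neutral) (auto simp: assms)
  then show ?thesis using assms(1) by (simp add: mult.commute)
qed

text \<open>The support is required to be finite because \<open>eval_at\<close> is an infinite sum
  with default value 0; otherwise the bound on point values could hold vacuously.\<close>

definition sup_le :: "real \<Rightarrow> torus_dist \<Rightarrow> bool" where
  "sup_le G g \<longleftrightarrow> finite {k. g k \<noteq> 0} \<and> (\<forall>x. cmod (eval_at g x) \<le> G)"

lemma sup_le_nonneg: "sup_le G g \<Longrightarrow> 0 \<le> G"
  unfolding sup_le_def by (meson norm_ge_zero order_trans)

lemma sup_le_mono: "sup_le G g \<Longrightarrow> G \<le> G' \<Longrightarrow> sup_le G' g"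
  unfolding sup_le_def by (meson order_trans)

text \<open>Parseval on a grid turns the squared coefficients of the product into squared point
  values, where g can be replaced by G.\<close>

lemma mult_sup_bound_finite:
  assumes g: "sup_le G g" and f: "\<And>k. k \<notin> box L \<Longrightarrow> f k = 0" and F: "finite F"
  shows "(\<Sum>n\<in>F. (cmod (mult f g n))\<^sup>2) \<le> G\<^sup>2 * (\<Sum>k\<in>box L. (cmod (f k))\<^sup>2)"
proof -
  let ?S = "{k. g k \<noteq> 0}"
  have S: "finite ?S" using g by (simp add: sup_le_def)
  have Gx: "cmod (eval_at g x) \<le> G" for x using g unfolding sup_le_def by blast
  \<comment> \<open>Both uses of Parseval are exact only if the larger box contains F, the
    frequencies of f and those of the product.\<close>
  have "finite (F \<union> box L \<union> (\<lambda>(k, l). k + l) ` (box L \<times> ?S))" using F S finite_box by simp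
  from finite_subset_box[OF this]
  obtain L' where L': "F \<union> box L \<union> (\<lambda>(k, l). k + l) ` (box L \<times> ?S) \<subseteq> box L'" ..
  define M where "M = 2 * L' + 1"
  have M: "2 * L' < M" "0 < M" by (auto simp: M_def)
  have fz: "f k = 0" if "k \<notin> box L'" for k using f that L' by blast
  have mz: "mult f g n = 0" if "n \<notin> box L'" for n
  proof -
    have "f (n - l) * g l = 0" if "l \<in> ?S" for l
    proof (rule ccontr)
      assume "f (n - l) * g l \<noteq> 0"
      then have "n - l \<in> box L" "l \<in> ?S" using f[of "n - l"] by fastforce+
      then have "(n - l) + l \<in> (\<lambda>(k, l). k + l) ` (box L \<times> ?S)" by blast
      then show False using L' \<open>n \<notin> box L'\<close> by auto
    qed
    then show ?thesis by (subst mult_finite_right[OF S]) auto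
  qed
  have "(real M)\<^sup>2 * (\<Sum>n\<in>F. (cmod (mult f g n))\<^sup>2) \<le> (real M)\<^sup>2 * (\<Sum>n\<in>box L'. (cmod (mult f g n))\<^sup>2)"
    using L' finite_box by (intro mult_left_mono sum_mono2) auto
  also have "\<dots> = (\<Sum>p\<in>grid M. (cmod (eval_at (mult f g) (grid_pt M p)))\<^sup>2)"
    by (rule grid_parseval[OF mz M(1), symmetric])
  also have "\<dots> \<le> (\<Sum>p\<in>grid M. G\<^sup>2 * (cmod (eval_at f (grid_pt M p)))\<^sup>2)"
  proof (rule sum_mono)
    fix p
    have "eval_at (mult f g) (grid_pt M p) = eval_at f (grid_pt M p) * eval_at g (grid_pt M p)"
      by (rule eval_at_mult[OF finite_box[of L'] fz S]) auto
    then have "cmod (eval_at (mult f g) (grid_pt M p)) \<le> cmod (eval_at f (grid_pt M p)) * G"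
      using Gx by (simp add: norm_mult mult_left_mono)
    then show "(cmod (eval_at (mult f g) (grid_pt M p)))\<^sup>2 \<le> G\<^sup>2 * (cmod (eval_at f (grid_pt M p)))\<^sup>2"
      using power_mono[of _ _ 2] by (fastforce simp: power_mult_distrib mult.commute)
  qed
  also have "\<dots> = (real M)\<^sup>2 * (G\<^sup>2 * (\<Sum>k\<in>box L'. (cmod (f k))\<^sup>2))"
    by (simp add: sum_distrib_left[symmetric] grid_parseval[OF fz M(1)])
  also have "(\<Sum>k\<in>box L'. (cmod (f k))\<^sup>2) = (\<Sum>k\<in>box L. (cmod (f k))\<^sup>2)"
    using L' f by (intro sum.mono_neutral_right finite_box) auto
  finally show ?thesis using M(2) by simp
qed

text \<open>Finitely many outputs n see only the coefficients of f at n - l with l in the finite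
  support of g, so f may be truncated.\<close>

lemma mult_sup_bound:
  assumes g: "sup_le G g" and f: "sob_le 0 c f"
  shows "sob_le 0 (G * c) (mult f g)"
proof -
  let ?S = "{k. g k \<noteq> 0}"
  have S: "finite ?S" using g by (auto simp: sup_le_def)
  have G0: "0 \<le> G * c" using sup_le_nonneg[OF g] sob_le_nonneg[OF f] by simp
  show ?thesis
    unfolding sob_le_iff_sum[OF G0]
  proof safe
    fix F :: "freq set" assume F: "finite F"
    have "finite ((\<lambda>(n, l). n - l) ` (F \<times> ?S))" using F S by simp
    from finite_subset_box[OF this] obtain L where L: "(\<lambda>(n, l). n - l) ` (F \<times> ?S) \<subseteq> box L" ..
    define f' where "f' = (\<lambda>k. if k \<in> box L then f k else 0)"
    have eq: "mult f g n = mult f' g n" if "n \<in> F" for n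
    proof -
      have "n - l \<in> box L" if "l \<in> ?S" for l using \<open>n \<in> F\<close> that L by blast
      then show ?thesis 
        by (subst (1 2) mult_finite_right[OF S]) (auto simp: f'_def intro!: sum.cong)
    qed
    have "(\<Sum>n\<in>F. bracket n powr 0 * (cmod (mult f g n))\<^sup>2) = (\<Sum>n\<in>F. (cmod (mult f' g n))\<^sup>2)"
      using bracket_pos by (intro sum.cong) (auto simp: eq less_le)
    also have "\<dots> \<le> G\<^sup>2 * (\<Sum>k\<in>box L. (cmod (f' k))\<^sup>2)"
      by (rule mult_sup_bound_finite[OF g _ F]) (simp add: f'_def)
    also have "(\<Sum>k\<in>box L. (cmod (f' k))\<^sup>2) = (\<Sum>k\<in>box L. bracket k powr 0 * (cmod (f k))\<^sup>2)"
      using bracket_pos by (intro sum.cong) (auto simp: f'_def less_le)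
    also have "\<dots> \<le> c\<^sup>2"
      using f sob_le_iff_sum[OF sob_le_nonneg[OF f], of 0 f] finite_box by blast
    finally show "(\<Sum>n\<in>F. bracket n powr 0 * (cmod (mult f g n))\<^sup>2) \<le> (G * c)\<^sup>2"
      by (simp add: power_mult_distrib mult_left_mono)
  qed
qed

section \<open>A lattice sum for the weighted kernel estimate\<close>

lemma sin_lower_bound:
  assumes "0 \<le> t" "t \<le> pi / 2"
  shows "t / 3 \<le> sin t"
proof -
  have "(\<Sum>m<3. sin_coeff m * t ^ m) = t"
    by (simp add: eval_nat_numeral sin_coeff_def)
  then have "\<bar>sin t - t\<bar> \<le> inverse (fact 3) * \<bar>t\<bar> ^ 3" using Maclaurin_sin_bound[of t 3] by simp
  also have "\<dots> = t ^ 3 / 6" using assms by (simp add: fact_numeral)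
  also have "\<dots> \<le> t * 4 / 6"
  proof -
    have "t \<le> 2" using assms pi_less_4 by linarith
    then have "t * t \<le> 2 * 2" using assms(1) by (intro mult_mono) auto
    then have "t * (t * t) \<le> t * 4" using assms(1) by (intro mult_left_mono) auto
    then show ?thesis by (simp add: power3_eq_cube)
  qed
  finally show ?thesis by linarith
qed

lemma arctan_increment:
  assumes "0 < c" "0 \<le> x"
  shows "c / (1 + (c * (x + 1))\<^sup>2) \<le> arctan (c * (x + 1)) - arctan (c * x)"
proof -
  have "\<exists>z. c * x < z \<and> z < c * (x + 1) \<and>
      arctan (c * (x + 1)) - arctan (c * x) = (c * (x + 1) - c * x) * inverse (1 + z\<^sup>2)"
    by (rule MVT2) (use assms in \<open>auto intro!: DERIV_arctan\<close>)
  then obtain z where z: "c * x < z" "z < c * (x + 1)"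
    and eq: "arctan (c * (x + 1)) - arctan (c * x) = c * inverse (1 + z\<^sup>2)"
    by (auto simp: algebra_simps)
  have "0 \<le> c * x" using assms by simp
  then have "z\<^sup>2 \<le> (c * (x + 1))\<^sup>2" using z by (intro power_mono) auto
  then have "inverse (1 + (c * (x + 1))\<^sup>2) \<le> inverse (1 + z\<^sup>2)"
    by (intro le_imp_inverse_le) (auto intro: add_pos_nonneg)
  then show ?thesis unfolding eq using assms(1) by (simp add: divide_inverse mult_left_mono)
qed

text \<open>Comparison with the integral of 1 / (1 + (c x)^2) by telescoping its primitive arctan (c
  x) / c. The 1 is the term a = 0, and 2 exceeds pi / 2.\<close>

lemma resolvent_sum_bound:
  assumes "0 < c"
  shows "(\<Sum>a\<le>M. 1 / (1 + (c * real a)\<^sup>2)) \<le> 1 + 2 / c"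
proof -
  have "(\<Sum>a\<le>M. 1 / (1 + (c * real a)\<^sup>2)) \<le> 1 + arctan (c * real M) / c"
  proof (induction M)
    case (Suc M)
    have "c * (1 / (1 + (c * real (Suc M))\<^sup>2)) \<le> arctan (c * real (Suc M)) - arctan (c * real M)"
      using arctan_increment[OF assms, of "real M"] by (simp add: add.commute)
    then have "1 / (1 + (c * real (Suc M))\<^sup>2) \<le> (arctan (c * real (Suc M)) - arctan (c * real M)) / c"
      using assms by (simp add: pos_le_divide_eq mult.commute)
    then show ?case using Suc by (simp add: diff_divide_distrib)
  qed simp
  also have "arctan (c * real M) / c \<le> 2 / c"
    using assms arctan_ubound[of "c * real M"] pi_less_4 by (intro divide_right_mono) auto
  finally show ?thesis by simp
qed

text \<open>Reflecting a to M - a folds the period onto its first half, where 2 - 2 cos (2 pi b / M)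
  is at least (b / M)^2. Two resolvent sums with c = lam / M give 2 + 4 M / lam, which is at most 6
  M / lam because lam \<le> M.\<close>

lemma lattice_resolvent_sum:
  assumes M: "0 < M" and lam: "1 \<le> lam" "lam \<le> real M"
  shows "(\<Sum>a<M. 1 / (1 + lam\<^sup>2 * (2 - 2 * cos (2 * pi * (real a / real M))))) \<le> 6 * real M / lam"
proof -
  define c where "c = lam / real M"
  have c: "0 < c" using M lam by (simp add: c_def)
  define g where "g = (\<lambda>a::nat. 1 / (1 + (c * real a)\<^sup>2))"
  have s: "(real b / real M)\<^sup>2 \<le> 2 - 2 * cos (2 * pi * (real b / real M))" if b: "2 * b \<le> M" for b
  proof -
    let ?t = "pi * (real b / real M)"
    have "real b / real M \<le> 1 / 2" using b M by (simp add: field_simps)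
    then have "pi * (real b / real M) \<le> pi * (1 / 2)" by (intro mult_left_mono) auto
    then have "?t / 3 \<le> sin ?t" by (intro sin_lower_bound) auto
    moreover have "real b / real M / 2 \<le> ?t / 3"
    proof -
      have aux: "r / 2 \<le> pi * r / 3" if "0 \<le> r" for r
        using mult_right_mono[OF pi_ge_two that] that by linarith
      show ?thesis by (rule aux) simp
    qed
    ultimately have "real b / real M / 2 \<le> sin ?t" by linarith
    then have "(real b / real M / 2)\<^sup>2 \<le> (sin ?t)\<^sup>2" by (intro power_mono) auto
    moreover have "2 - 2 * cos (2 * ?t) = 4 * (sin ?t)\<^sup>2" unfolding cos_double_sin by simp
    ultimately show ?thesis by (simp add: power_divide mult.assoc)
  qed
  have trm: "1 / (1 + lam\<^sup>2 * (2 - 2 * cos (2 * pi * (real a / real M)))) \<le> g a + g (M - a)"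
    if a: "a < M" for a
  proof -
    have one: "1 / (1 + lam\<^sup>2 * (2 - 2 * cos (2 * pi * (real a / real M)))) \<le> g b"
      if b: "2 * b \<le> M" and e: "cos (2 * pi * (real a / real M)) = cos (2 * pi * (real b / real M))" for b
    proof -
      have "(c * real b)\<^sup>2 = lam\<^sup>2 * (real b / real M)\<^sup>2" by (simp add: c_def power_mult_distrib power_divide)
      also have "\<dots> \<le> lam\<^sup>2 * (2 - 2 * cos (2 * pi * (real a / real M)))"
        unfolding e using s[OF b] by (intro mult_left_mono) auto
      finally show ?thesis unfolding g_def by (intro divide_left_mono) (auto intro!: mult_pos_pos add_pos_nonneg)
    qed
    have pos: "0 \<le> g b" for b by (simp add: g_def)
    show ?thesis
    proof (cases "2 * a \<le> M")
      case True
      then show ?thesis using one[of a] pos[of "M - a"] by simp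
    next
      case False
      have "2 * pi * (real (M - a) / real M) = 2 * pi - 2 * pi * (real a / real M)"
        using a M by (simp add: of_nat_diff field_simps)
      then have "cos (2 * pi * (real a / real M)) = cos (2 * pi * (real (M - a) / real M))"
        by (simp only: cos_2pi_minus)
      moreover have "2 * (M - a) \<le> M" using False by linarith
      ultimately show ?thesis using one[of "M - a"] pos[of a] by linarith
    qed
  qed
  have g0: "0 \<le> g a" for a by (simp add: g_def)
  have "(\<Sum>a<M. 1 / (1 + lam\<^sup>2 * (2 - 2 * cos (2 * pi * (real a / real M))))) \<le> (\<Sum>a<M. g a + g (M - a))"
    using trm by (intro sum_mono) auto
  also have "\<dots> = (\<Sum>a<M. g a) + (\<Sum>a<M. g (M - a))" by (simp add: sum.distrib)
  also have "(\<Sum>a<M. g (M - a)) = (\<Sum>a\<in>{1..M}. g a)"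
    by (rule sum.reindex_bij_witness[where i = "\<lambda>a. M - a" and j = "\<lambda>a. M - a"]) auto
  also have "(\<Sum>a<M. g a) \<le> (\<Sum>a\<le>M. g a)" by (rule sum_mono2) (auto simp: g0)
  also have "(\<Sum>a\<in>{1..M}. g a) \<le> (\<Sum>a\<le>M. g a)" by (rule sum_mono2) (auto simp: g0)
  also have "(\<Sum>a\<le>M. g a) \<le> 1 + 2 / c" unfolding g_def by (rule resolvent_sum_bound[OF c])
  finally have "(\<Sum>a<M. 1 / (1 + lam\<^sup>2 * (2 - 2 * cos (2 * pi * (real a / real M))))) \<le> 2 * (1 + 2 / c)"
    by simp
  also have "2 / c = 2 * real M / lam" by (simp add: c_def)
  also have "1 \<le> real M / lam" using lam by simp
  finally show ?thesis by simp
qed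

section \<open>Rescaled Fourier multipliers on the sup norm\<close>

lemma eval_at_shift: "eval_at (\<lambda>k. a (k - e)) y = char_at e y * eval_at a y"
proof -
  have "eval_at (\<lambda>k. a (k - e)) y = (\<Sum>\<^sub>\<infinity>k\<in>range (\<lambda>k. k + e). a (k - e) * char_at k y)"
    unfolding eval_at_def by (rule arg_cong[where f = "infsum _"]) (metis surj_def diff_add_cancel)
  also have "\<dots> = (\<Sum>\<^sub>\<infinity>k. a k * char_at (k + e) y)"
    by (subst infsum_reindex) (auto simp: inj_on_def o_def)
  also have "\<dots> = (\<Sum>\<^sub>\<infinity>k. char_at e y * (a k * char_at k y))"
  proof (rule infsum_cong)
    fix k
    have "vec_of (k + e) = vec_of k + vec_of e" by (simp add: vec_of_def)
    then have "char_at (k + e) y = char_at e y * char_at k y"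
      by (simp add: cis_mult inner_add_left distrib_left add.commute)
    then show "a k * char_at (k + e) y = char_at e y * (a k * char_at k y)" by (simp only: mult_ac)
  qed
  also have "\<dots> = char_at e y * eval_at a y"
    unfolding eval_at_def by (rule infsum_cmult_right')
  finally show ?thesis .
qed

lemma vec_of_uminus: "vec_of (- e) = - vec_of e"
  by (simp add: vec_of_def)

lemma vec_of_shift: "vec_of (k - e) /\<^sub>R lam = vec_of k /\<^sub>R lam - vec_of e /\<^sub>R lam"
  by (simp add: vec_of_diff scaleR_diff_right)

lemma product_le_square_sum: "0 \<le> a \<Longrightarrow> 0 \<le> b \<Longrightarrow> (1 + a) * (1 + b) \<le> (1 + a + b)\<^sup>2" for a b :: real
  by (simp add: power2_eq_square algebra_simps)

lemma factor_weight:
  "z + l * (2 * z - a * z - b * z) + l * (2 * z - c * z - d * z)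
    = (1 + l * (2 - (a + b)) + l * (2 - (c + d))) * z" for z l a b c d :: complex
  by (simp add: algebra_simps)

lemma cancel_scale: "l \<noteq> 0 \<Longrightarrow> 6 * x / l * (x * (3 * b * (y * l))) = x\<^sup>2 * (18 * b * y)" for l x y b :: real
  by (simp add: power2_eq_square)

text \<open>
  The kernel of the multiplier is bounded in \<open>L\<^sup>1\<close> by Cauchy--Schwarz against the weight
  \<open>1 + lam\<^sup>2 (2 - 2 cos (2 \<pi> y\<^sub>1)) + lam\<^sup>2 (2 - 2 cos (2 \<pi> y\<^sub>2))\<close>, which acts on symbols by second differences.
\<close>

lemma rescaled_multiplier_sup_bound:
  fixes \<Psi> :: "plane \<Rightarrow> real"
  assumes supp: "\<And>x. R < norm x \<Longrightarrow> \<Psi> x = 0" and bd: "\<And>x. \<bar>\<Psi> x\<bar> \<le> B"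
    and sd: "\<And>x h. \<bar>\<Psi> (x + h) + \<Psi> (x - h) - 2 * \<Psi> x\<bar> \<le> B * (norm h)\<^sup>2"
    and R: "0 \<le> R" and lam: "1 \<le> lam" and f: "sup_le G f"
  shows "sup_le (18 * B * (2 * R + 5) * G) (\<lambda>k. of_real (\<Psi> (vec_of k /\<^sub>R lam)) * f k)"
proof -
  define a where "a = (\<lambda>k. complex_of_real (\<Psi> (vec_of k /\<^sub>R lam)))"
  define D where "D = (\<lambda>e k. 2 * a k - a (k - e) - a (k - (- e)))"
  \<comment> \<open>The symbol of the kernel multiplied by the weight \<open>w\<close> defined
    further down, as \<open>ev'\<close> shows.\<close>
  define a' where "a' = (\<lambda>k. a k + of_real (lam\<^sup>2) * D (1, 0) k + of_real (lam\<^sup>2) * D (0, 1) k)"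
  \<comment> \<open>The radius is (R + 1) * lam rather than R * lam, so that shifts of a by one
    lattice step still vanish outside \<open>box L0\<close>.\<close>
  define L0 where "L0 = nat \<lceil>(R + 1) * lam\<rceil>"
  have B: "0 \<le> B" using bd[of 0] by linarith
  have G: "0 \<le> G" using f by (rule sup_le_nonneg)
  have L0: "(R + 1) * lam \<le> real L0" "real L0 \<le> (R + 2) * lam"
  proof -
    show "(R + 1) * lam \<le> real L0" unfolding L0_def by (rule real_nat_ceiling_ge)
    have "0 \<le> (R + 1) * lam" using R lam by simp
    then have "real L0 \<le> (R + 1) * lam + 1" unfolding L0_def by linarith
    also have "\<dots> \<le> (R + 2) * lam" using lam by (simp add: algebra_simps)
    finally show "real L0 \<le> (R + 2) * lam" .
  qed
  have a0: "a k = 0" if "R * lam < norm (vec_of k)" for k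
    unfolding a_def using that supp lam by (simp add: field_simps)
  have far: "R * lam < norm (vec_of (k - e))"
    if "k \<notin> box L0" "norm (vec_of e) \<le> 1" for k e
  proof -
    have "int L0 < \<bar>fst k\<bar> \<or> int L0 < \<bar>snd k\<bar>" using that(1) by (auto simp: box_def)
    then have "real L0 < \<bar>real_of_int (fst k)\<bar> \<or> real L0 < \<bar>real_of_int (snd k)\<bar>" by linarith
    then have "real L0 < norm (vec_of k)" using coord_le_norm_vec_of[of k] by linarith
    then have "(R + 1) * lam < norm (vec_of k)" using L0(1) by linarith
    moreover have "norm (vec_of k) \<le> norm (vec_of (k - e)) + norm (vec_of e)"
      using norm_triangle_ineq[of "vec_of (k - e)" "vec_of e"] by (simp add: vec_of_diff)
    ultimately show ?thesis using that(2) lam by (simp add: algebra_simps)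
  qed
  have unit: "norm (vec_of (1, 0)) = 1" "norm (vec_of (0, 1)) = 1" "norm (vec_of (- (1, 0))) = 1"
    "norm (vec_of (- (0, 1))) = 1" "norm (vec_of 0) = 0"
    by (simp_all add: vec_of_def norm_Pair zero_prod_def)
  have az: "a k = 0" if "k \<notin> box L0" for k
    using a0[of k] far[OF that, of 0] unit by simp
  have a'z: "a' k = 0" if k: "k \<notin> box L0" for k
    unfolding a'_def D_def using a0[OF far[OF k]] az[OF k] unit by simp
  have Dbd: "cmod (of_real (lam\<^sup>2) * D e k) \<le> B" if e: "norm (vec_of e) = 1" for e k
  proof -
    have "D e k = - of_real (\<Psi> (vec_of k /\<^sub>R lam + vec_of e /\<^sub>R lam)
        + \<Psi> (vec_of k /\<^sub>R lam - vec_of e /\<^sub>R lam) - 2 * \<Psi> (vec_of k /\<^sub>R lam))"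
      unfolding D_def a_def vec_of_shift by (simp add: vec_of_uminus)
    then have "cmod (D e k) \<le> B * (norm (vec_of e /\<^sub>R lam))\<^sup>2"
      using sd by (simp only: norm_minus_cancel norm_of_real)
    also have "\<dots> = B / lam\<^sup>2" using e lam by (simp add: power_divide field_simps)
    finally have "lam\<^sup>2 * cmod (D e k) \<le> B" using lam by (simp add: field_simps)
    then show ?thesis by (simp only: norm_mult norm_of_real abs_power2)
  qed
  have a'bd: "cmod (a' k) \<le> 3 * B" for k
  proof -
    have "cmod (a' k) \<le> cmod (a k) + cmod (of_real (lam\<^sup>2) * D (1, 0) k) + cmod (of_real (lam\<^sup>2) * D (0, 1) k)"
      unfolding a'_def by (intro norm_triangle_le add_mono order_refl norm_triangle_ineq)
    moreover have "cmod (a k) \<le> B" using bd by (simp add: a_def)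
    ultimately show ?thesis using Dbd[OF unit(1), of k] Dbd[OF unit(2), of k] by linarith
  qed
  define w where "w = (\<lambda>y :: plane. 1 + lam\<^sup>2 * (2 - 2 * cos (2 * pi * fst y)) + lam\<^sup>2 * (2 - 2 * cos (2 * pi * snd y)))"
  have ev': "eval_at a' y = of_real (w y) * eval_at a y" for y
  proof -
    have lin: "eval_at a' y = eval_at a y + of_real (lam\<^sup>2) * (2 * eval_at a y - eval_at (\<lambda>k. a (k - (1, 0))) y - eval_at (\<lambda>k. a (k - (- (1, 0)))) y)
        + of_real (lam\<^sup>2) * (2 * eval_at a y - eval_at (\<lambda>k. a (k - (0, 1))) y - eval_at (\<lambda>k. a (k - (- (0, 1)))) y)"
    proof -
      have e: "eval_at (\<lambda>k. a (k - e)) y = (\<Sum>k\<in>box L0. a (k - e) * char_at k y)" if "norm (vec_of e) \<le> 1" for e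
        by (rule eval_at_finite[OF finite_box]) (use a0 far that in auto)
      have e0: "eval_at a y = (\<Sum>k\<in>box L0. a k * char_at k y)" by (rule eval_at_finite[OF finite_box az])
      have e': "eval_at a' y = (\<Sum>k\<in>box L0. a' k * char_at k y)" by (rule eval_at_finite[OF finite_box a'z])
      show ?thesis
        unfolding e' e0
        apply (subst (1 2 3 4) e)
        using unit apply (simp_all only: order_refl)
        unfolding sum_distrib_left sum_subtractf[symmetric] sum.distrib[symmetric]
        by (rule sum.cong) (auto simp: a'_def D_def algebra_simps)
    qed
    have c1: "char_at (1, 0) y + char_at (- (1, 0)) y = of_real (2 * cos (2 * pi * fst y))"
      and c2: "char_at (0, 1) y + char_at (- (0, 1)) y = of_real (2 * cos (2 * pi * snd y))"
      by (simp_all add: complex_eq_iff vec_of_def inner_prod_def)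
    have "eval_at a' y = (1 + of_real (lam\<^sup>2) * (2 - (char_at (1, 0) y + char_at (- (1, 0)) y))
        + of_real (lam\<^sup>2) * (2 - (char_at (0, 1) y + char_at (- (0, 1)) y))) * eval_at a y"
      unfolding lin eval_at_shift by (rule factor_weight)
    also have "\<dots> = of_real (w y) * eval_at a y" unfolding c1 c2 w_def by simp
    finally show ?thesis .
  qed
  have w1: "1 \<le> w y" for y unfolding w_def by (simp add: add_nonneg_nonneg)
  have wne: "w y \<noteq> 0" for y using w1[of y] by linarith
  have kernel: "(\<Sum>p\<in>grid M. cmod (eval_at a (grid_pt M p))) \<le> (real M)\<^sup>2 * (18 * B * (2 * R + 5))"
    if M: "2 * L0 < M" "lam \<le> real M" for M
  proof -
    have M0: "0 < M" using M by simp
    let ?K = "\<lambda>p. cmod (eval_at a (grid_pt M p))" and ?w = "\<lambda>p. w (grid_pt M p)"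
    \<comment> \<open>Cauchy-Schwarz with 1 / w and w: the first factor is a lattice sum; the second
      is by Parseval the L^2 norm of a', at most its sup norm times the root of the number of
      frequencies.\<close>
    have "(\<Sum>p\<in>grid M. ?K p)\<^sup>2 = (\<Sum>p\<in>grid M. (1 / ?w p) * (?w p * ?K p))\<^sup>2"
      by (simp add: wne)
    also have "\<dots> \<le> (\<Sum>p\<in>grid M. (1 / ?w p)\<^sup>2) * (\<Sum>p\<in>grid M. (?w p * ?K p)\<^sup>2)"
      by (rule Cauchy_Schwarz_ineq_sum)
    also have "\<dots> \<le> (6 * real M / lam)\<^sup>2 * ((real M)\<^sup>2 * (3 * B * ((2 * R + 5) * lam))\<^sup>2)"
    proof (rule mult_mono)
      let ?v = "\<lambda>a. 1 / (1 + lam\<^sup>2 * (2 - 2 * cos (2 * pi * (real a / real M))))"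
      have "(\<Sum>p\<in>grid M. (1 / ?w p)\<^sup>2) \<le> (\<Sum>p\<in>grid M. ?v (fst p) * ?v (snd p))"
      proof (rule sum_mono)
        fix p :: "nat \<times> nat"
        let ?a = "lam\<^sup>2 * (2 - 2 * cos (2 * pi * (real (fst p) / real M)))"
        let ?b = "lam\<^sup>2 * (2 - 2 * cos (2 * pi * (real (snd p) / real M)))"
        have ab: "0 \<le> ?a" "0 \<le> ?b" by simp_all
        \<comment> \<open>The squared weight dominates a product of two one-dimensional weights, so
          the lattice sum factorizes.\<close>
        have "(1 + ?a) * (1 + ?b) \<le> (1 + ?a + ?b)\<^sup>2"
          using ab by (rule product_le_square_sum)
        then have "1 / (1 + ?a + ?b)\<^sup>2 \<le> 1 / ((1 + ?a) * (1 + ?b))"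
          using ab by (intro frac_le mult_pos_pos) linarith+
        then show "(1 / ?w p)\<^sup>2 \<le> ?v (fst p) * ?v (snd p)"
          by (simp add: w_def grid_pt_def power_one_over)
      qed
      also have "\<dots> = (\<Sum>a<M. ?v a) * (\<Sum>b<M. ?v b)"
        by (simp add: sum_product sum.cartesian_product split_beta)
      also have "\<dots> \<le> (6 * real M / lam) * (6 * real M / lam)"
        using lattice_resolvent_sum[OF M0 lam M(2)] M0 lam
        by (intro mult_mono) (auto intro!: sum_nonneg divide_nonneg_nonneg add_nonneg_nonneg)
      finally show "(\<Sum>p\<in>grid M. (1 / ?w p)\<^sup>2) \<le> (6 * real M / lam)\<^sup>2" by (simp only: power2_eq_square)
      have "(\<Sum>p\<in>grid M. (?w p * ?K p)\<^sup>2) = (\<Sum>p\<in>grid M. (cmod (eval_at a' (grid_pt M p)))\<^sup>2)"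
        using w1 by (intro sum.cong) (auto simp: ev' norm_mult power_mult_distrib)
      also have "\<dots> = (real M)\<^sup>2 * (\<Sum>k\<in>box L0. (cmod (a' k))\<^sup>2)"
        by (rule grid_parseval[OF a'z M(1)])
      also have "\<dots> \<le> (real M)\<^sup>2 * (((2 * R + 5) * lam)\<^sup>2 * (3 * B)\<^sup>2)"
      proof (rule mult_left_mono)
        have "card (box L0) \<le> card ({- int L0..int L0} \<times> {- int L0..int L0})"
          by (intro card_mono) (auto simp: box_def)
        also have "\<dots> = (2 * L0 + 1)\<^sup>2" 
        proof -
          have "nat (int L0 - (- int L0) + 1) = 2 * L0 + 1" by linarith
          then show ?thesis by (simp only: card_cartesian_product card_atLeastAtMost_int power2_eq_square)
        qed
        finally have "real (card (box L0)) \<le> (real (2 * L0 + 1))\<^sup>2" by (simp only: of_nat_power[symmetric] of_nat_le_iff)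
        also have "\<dots> \<le> ((2 * R + 5) * lam)\<^sup>2"
          using L0(2) lam by (intro power_mono) (simp_all add: algebra_simps)
        finally have card: "real (card (box L0)) \<le> ((2 * R + 5) * lam)\<^sup>2" .
        have "(\<Sum>k\<in>box L0. (cmod (a' k))\<^sup>2) \<le> (\<Sum>k\<in>box L0. (3 * B)\<^sup>2)"
          using a'bd by (intro sum_mono power_mono) auto
        also have "\<dots> = real (card (box L0)) * (3 * B)\<^sup>2" by simp
        also have "\<dots> \<le> ((2 * R + 5) * lam)\<^sup>2 * (3 * B)\<^sup>2" using card by (rule mult_right_mono) simp
        finally show "(\<Sum>k\<in>box L0. (cmod (a' k))\<^sup>2) \<le> ((2 * R + 5) * lam)\<^sup>2 * (3 * B)\<^sup>2" .
      qed simp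
      also have "\<dots> = (real M)\<^sup>2 * (3 * B * ((2 * R + 5) * lam))\<^sup>2"
        by (simp only: power_mult_distrib mult_ac)
      finally show "(\<Sum>p\<in>grid M. (?w p * ?K p)\<^sup>2) \<le> (real M)\<^sup>2 * (3 * B * ((2 * R + 5) * lam))\<^sup>2" .
    next
      show "0 \<le> (6 * real M / lam)\<^sup>2" by (rule zero_le_power2)
      show "0 \<le> (\<Sum>p\<in>grid M. (?w p * ?K p)\<^sup>2)" by (intro sum_nonneg zero_le_power2)
    qed
    also have "\<dots> = ((real M)\<^sup>2 * (18 * B * (2 * R + 5)))\<^sup>2"
    proof -
      have "(6 * real M / lam) * (real M * (3 * B * ((2 * R + 5) * lam))) = (real M)\<^sup>2 * (18 * B * (2 * R + 5))"
        using lam by (intro cancel_scale) simp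
      then show ?thesis by (simp only: power_mult_distrib[symmetric])
    qed
    finally show ?thesis
      by (rule power2_le_imp_le) (use B R in simp)
  qed
  show ?thesis
    unfolding sup_le_def
  proof safe
    have S: "finite {k. f k \<noteq> 0}" using f by (simp add: sup_le_def)
    then show "finite {k. of_real (\<Psi> (vec_of k /\<^sub>R lam)) * f k \<noteq> 0}"
      by (rule finite_subset[rotated]) auto
    fix x
    from finite_subset_box[OF S] obtain L1 where L1: "{k. f k \<noteq> 0} \<subseteq> box L1" ..
    define L where "L = max L0 L1"
    \<comment> \<open>Large enough for the convolution with f, for Parseval on the kernel, and for
      the condition lam \<le> M of the lattice sum.\<close>
    define M where "M = 2 * L + 1 + nat \<lceil>lam\<rceil>"
    have M: "2 * L < M" "2 * L0 < M" "lam \<le> real M" by (auto simp: M_def L_def) linarith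
    have fz: "f k = 0" if "k \<notin> box L" for k using that L1 box_mono[of L1 L] by (auto simp: L_def)
    have az': "a k = 0" if "k \<notin> box L" for k
    proof (rule az)
      show "k \<notin> box L0" using that box_mono[of L0 L] unfolding L_def by auto
    qed
    have "(real M)\<^sup>2 * cmod (eval_at (\<lambda>k. a k * f k) x)
        = cmod (\<Sum>p\<in>grid M. eval_at a (grid_pt M p) * eval_at f (x - grid_pt M p))"
      by (simp add: grid_convolution[OF az' fz M(1)] norm_mult norm_power)
    also have "\<dots> \<le> (\<Sum>p\<in>grid M. cmod (eval_at a (grid_pt M p)) * G)"
    proof (rule sum_norm_le)
      fix p
      have "cmod (eval_at f (x - grid_pt M p)) \<le> G" using f unfolding sup_le_def by blast
      then show "norm (eval_at a (grid_pt M p) * eval_at f (x - grid_pt M p)) \<le> cmod (eval_at a (grid_pt M p)) * G"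
        by (simp add: norm_mult mult_left_mono)
    qed
    also have "\<dots> = (\<Sum>p\<in>grid M. cmod (eval_at a (grid_pt M p))) * G" by (simp add: sum_distrib_right)
    also have "\<dots> \<le> (real M)\<^sup>2 * (18 * B * (2 * R + 5)) * G"
      using kernel[OF M(2,3)] G by (rule mult_right_mono)
    finally have "cmod (eval_at (\<lambda>k. a k * f k) x) \<le> 18 * B * (2 * R + 5) * G"
      using M(1) by (simp add: mult.assoc)
    then show "cmod (eval_at (\<lambda>k. of_real (\<Psi> (vec_of k /\<^sub>R lam)) * f k) x) \<le> 18 * B * (2 * R + 5) * G"
      by (simp add: a_def)
  qed
qed

section \<open>Second differences of smooth functions of compact support\<close>

lemma line_derivative:
  fixes f :: "plane \<Rightarrow> real"
  assumes "(f has_derivative f') (at (x + t *\<^sub>R h))"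
  shows "((\<lambda>t. f (x + t *\<^sub>R h)) has_real_derivative f' h) (at t)"
proof -
  have "((\<lambda>t. f (x + t *\<^sub>R h)) has_derivative (\<lambda>s. f' (s *\<^sub>R h))) (at t)"
    by (rule has_derivative_compose[where f = "\<lambda>t. x + t *\<^sub>R h" and g = f, OF _ assms])
       (auto intro!: derivative_eq_intros)
  moreover have "f' (s *\<^sub>R h) = f' h * s" for s
    using has_derivative_bounded_linear[OF assms] by (simp add: bounded_linear.linear linear_cmul)
  ultimately show ?thesis by (simp add: has_field_derivative_def)
qed

lemma plane_decomposition: "h = fst h *\<^sub>R (1, 0) + snd h *\<^sub>R (0 :: real, 1 :: real)"
  by (simp add: prod_eq_iff)

lemma coord_le_norm: "\<bar>fst h\<bar> \<le> norm h" "\<bar>snd h\<bar> \<le> norm h" for h :: plane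
  using norm_fst_le[of "fst h" "snd h"] norm_snd_le[of "snd h" "fst h"] by simp_all

lemma frechet_linear:
  fixes f :: "plane \<Rightarrow> real"
  assumes "f differentiable (at x)"
  shows "frechet_derivative f (at x) h
    = fst h * frechet_derivative f (at x) (1, 0) + snd h * frechet_derivative f (at x) (0 :: real, 1 :: real)"
proof -
  have l: "linear (frechet_derivative f (at x))" by (rule linear_frechet_derivative[OF assms])
  show ?thesis
    by (subst plane_decomposition[of h]) (simp add: linear_add[OF l] linear_cmul[OF l] del: scaleR_Pair)
qed

lemma lipschitz_of_partials:
  fixes f :: "plane \<Rightarrow> real"
  assumes d: "\<And>x. f differentiable (at x)"
    and b: "\<And>x. \<bar>frechet_derivative f (at x) (1, 0)\<bar> \<le> B" "\<And>x. \<bar>frechet_derivative f (at x) (0, 1)\<bar> \<le> B"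
  shows "\<bar>f (x + h) - f x\<bar> \<le> 2 * B * norm h"
proof -
  let ?D = "\<lambda>x. frechet_derivative f (at x)"
  have d': "(f has_derivative ?D y) (at y)" for y using d[of y] frechet_derivative_works by blast
  have "\<exists>z. 0 < z \<and> z < (1::real) \<and> f (x + 1 *\<^sub>R h) - f (x + 0 *\<^sub>R h) = (1 - 0) * ?D (x + z *\<^sub>R h) h"
    by (rule MVT2) (auto intro: line_derivative[OF d'])
  then obtain z where "f (x + h) - f x = ?D (x + z *\<^sub>R h) h" by auto
  then have "\<bar>f (x + h) - f x\<bar> \<le> \<bar>fst h\<bar> * \<bar>?D (x + z *\<^sub>R h) (1, 0)\<bar> + \<bar>snd h\<bar> * \<bar>?D (x + z *\<^sub>R h) (0, 1)\<bar>"
    by (simp only: frechet_linear[OF d, of "x + z *\<^sub>R h" h] abs_mult[symmetric] abs_triangle_ineq)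
  also have "\<dots> \<le> norm h * B + norm h * B"
    by (intro add_mono mult_mono coord_le_norm b) auto
  finally show ?thesis by simp
qed

lemma bounded_of_compact_support:
  fixes f :: "plane \<Rightarrow> real"
  assumes "continuous_on UNIV f" "\<And>x. R < norm x \<Longrightarrow> f x = 0"
  shows "\<exists>B\<ge>0. \<forall>x. \<bar>f x\<bar> \<le> B"
proof -
  have "compact (f ` cball 0 R)"
    by (intro compact_continuous_image continuous_on_subset[OF assms(1)]) auto
  then obtain B where B: "\<And>x. x \<in> cball 0 R \<Longrightarrow> \<bar>f x\<bar> \<le> B"
    using compact_imp_bounded bounded_iff by (metis (no_types, lifting) imageI real_norm_def)
  have "\<bar>f x\<bar> \<le> max B 0" for x
    using B[of x] assms(2)[of x] by (cases "norm x \<le> R") auto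
  then show ?thesis by (intro exI[of _ "max B 0"]) auto
qed

lemma frechet_derivative_outside_support:
  fixes f :: "plane \<Rightarrow> real"
  assumes "\<And>x. R < norm x \<Longrightarrow> f x = 0" "R < norm x"
  shows "frechet_derivative f (at x) v = 0"
proof -
  have "(f has_derivative (\<lambda>_. 0)) (at x)"
  proof (rule has_derivative_transform_within_open[of "\<lambda>_. 0" _ _ _ "- cball 0 R"])
    show "open (- cball (0::plane) R)" by auto
  qed (use assms in auto)
  then show ?thesis using frechet_derivative_at by metis
qed

text \<open>C^{1,1} data with a single constant. Second differences, rather than derivatives, are
  what the kernel estimate and the quadratic smallness near zeros consume.\<close>

definition smooth_bound :: "real \<Rightarrow> (plane \<Rightarrow> real) \<Rightarrow> bool" where
  "smooth_bound B f \<longleftrightarrow> (\<forall>x. \<bar>f x\<bar> \<le> B) \<and> (\<forall>x h. \<bar>f (x + h) - f x\<bar> \<le> B * norm h) \<and>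
     (\<forall>x h. \<bar>f (x + h) + f (x - h) - 2 * f x\<bar> \<le> B * (norm h)\<^sup>2)"

lemma smooth_bound_mono:
  assumes "smooth_bound B f" "B \<le> B'"
  shows "smooth_bound B' f"
proof -
  have "B * norm h \<le> B' * norm h" "B * (norm h)\<^sup>2 \<le> B' * (norm h)\<^sup>2" for h :: plane
    using assms(2) by (auto intro: mult_right_mono)
  then show ?thesis using assms unfolding smooth_bound_def by (meson order_trans)
qed

lemma smooth_compact_bound:
  assumes smooth: "smooth_on UNIV f" and supp: "\<And>x. f x \<noteq> 0 \<Longrightarrow> norm x \<le> R"
  shows "\<exists>B\<ge>0. smooth_bound B f"
proof -
  let ?D = "\<lambda>v x. frechet_derivative f (at x) v"
  have "Ck_on (Suc (Suc 0)) UNIV f" using smooth unfolding smooth_on_def by blast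
  then have d: "\<And>x. f differentiable (at x)" and dd: "\<And>v x. ?D v differentiable (at x)"
    and cont: "\<And>v w. continuous_on UNIV (\<lambda>x. frechet_derivative (?D v) (at x) w)"
    by auto
  have z: "f x = 0" if "R < norm x" for x using supp[of x] that by linarith
  have zd: "?D v x = 0" if "R < norm x" for v x
    using frechet_derivative_outside_support[OF z that] .
  have zdd: "frechet_derivative (?D v) (at x) w = 0" if "R < norm x" for v w x
    using frechet_derivative_outside_support[OF zd that] .
  have c0: "continuous_on UNIV f"
    by (intro continuous_at_imp_continuous_on ballI differentiable_imp_continuous_within d)
  have cd: "continuous_on UNIV (?D v)" for v
    by (intro continuous_at_imp_continuous_on ballI differentiable_imp_continuous_within dd)
  obtain B0 where B0: "0 \<le> B0" "\<And>x. \<bar>f x\<bar> \<le> B0" using bounded_of_compact_support[OF c0 z] by blast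
  have "\<exists>B\<ge>0. \<forall>x. \<bar>?D v x\<bar> \<le> B" for v by (rule bounded_of_compact_support[OF cd zd])
  then obtain B1 where B1: "\<And>v. 0 \<le> B1 v" "\<And>v x. \<bar>?D v x\<bar> \<le> B1 v" by metis
  have "\<exists>B\<ge>0. \<forall>x. \<bar>frechet_derivative (?D v) (at x) w\<bar> \<le> B" for v w
    by (rule bounded_of_compact_support[OF cont zdd])
  then obtain B2 where B2: "\<And>v w. 0 \<le> B2 v w" "\<And>v w x. \<bar>frechet_derivative (?D v) (at x) w\<bar> \<le> B2 v w"
    by metis
  define L where "L = B1 (1, 0) + B1 (0, 1)"
  define Q where "Q = B2 (1, 0) (1, 0) + B2 (1, 0) (0, 1) + B2 (0, 1) (1, 0) + B2 (0, 1) (0, 1)"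
  have lip: "\<bar>f (x + h) - f x\<bar> \<le> 2 * L * norm h" for x h
  proof (rule lipschitz_of_partials[OF d])
    show "\<bar>?D (1, 0) x\<bar> \<le> L" "\<bar>?D (0, 1) x\<bar> \<le> L" for x
      by (rule order_trans[OF B1(2)], simp add: L_def B1(1))+
  qed
  have Qge: "B2 v w \<le> Q" if "v \<in> {(1, 0), (0, 1)}" "w \<in> {(1, 0), (0, 1)}" for v w
    using that B2(1)[of "(1, 0)" "(1, 0)"] B2(1)[of "(1, 0)" "(0, 1)"] B2(1)[of "(0, 1)" "(1, 0)"]
      B2(1)[of "(0, 1)" "(0, 1)"] by (auto simp: Q_def)
  have Q0: "0 \<le> Q" using Qge[of "(1, 0)" "(1, 0)"] B2(1)[of "(1, 0)" "(1, 0)"] by simp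
  have lipd: "\<bar>?D v (x + h) - ?D v x\<bar> \<le> 2 * Q * norm h" if "v \<in> {(1, 0), (0, 1)}" for v x h
    by (intro lipschitz_of_partials dd order_trans[OF B2(2) Qge[OF that]]) auto
  have sd: "\<bar>f (x + h) + f (x - h) - 2 * f x\<bar> \<le> 8 * Q * (norm h)\<^sup>2" for x h
  proof -
    \<comment> \<open>The second difference is the increment of this function over [0, 1]; its
      derivative compares the same partial derivatives at x + t h and x - t h and is therefore small
      with h once more.\<close>
    let ?\<phi> = "\<lambda>t. f (x + t *\<^sub>R h) + f (x + t *\<^sub>R (- h))"
    have dv: "(?\<phi> has_real_derivative ?D h (x + t *\<^sub>R h) + ?D (- h) (x + t *\<^sub>R (- h))) (at t)" for t
      by (intro DERIV_add line_derivative d frechet_derivative_works[THEN iffD1])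
    have "\<exists>t. 0 < t \<and> t < (1::real) \<and> ?\<phi> 1 - ?\<phi> 0
        = (1 - 0) * (?D h (x + t *\<^sub>R h) + ?D (- h) (x + t *\<^sub>R (- h)))"
      by (rule MVT2) (use dv in auto)
    then obtain t where t: "0 < t" "t < 1"
      and eq: "f (x + h) + f (x - h) - 2 * f x = ?D h (x + t *\<^sub>R h) + ?D (- h) (x + t *\<^sub>R (- h))" by auto
    have diff: "\<bar>?D v (x + t *\<^sub>R h) - ?D v (x + t *\<^sub>R (- h))\<bar> \<le> 4 * Q * norm h"
      if "v \<in> {(1, 0), (0, 1)}" for v
    proof -
      let ?y = "x + t *\<^sub>R (- h)"
      have e: "?y + (2 * t) *\<^sub>R h = x + t *\<^sub>R h"
        by (simp add: algebra_simps scaleR_2 flip: scaleR_scaleR)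
      have "\<bar>?D v (?y + (2 * t) *\<^sub>R h) - ?D v ?y\<bar> \<le> 2 * Q * norm ((2 * t) *\<^sub>R h)"
        by (rule lipd[OF that])
      then have "\<bar>?D v (x + t *\<^sub>R h) - ?D v ?y\<bar> \<le> 2 * Q * norm ((2 * t) *\<^sub>R h)"
        by (simp only: e)
      also have "norm ((2 * t) *\<^sub>R h) \<le> 2 * norm h" using t by (simp add: mult_right_mono)
      finally show ?thesis using Q0 by (simp add: mult_left_mono mult.assoc)
    qed
    have "f (x + h) + f (x - h) - 2 * f x
        = fst h * (?D (1, 0) (x + t *\<^sub>R h) - ?D (1, 0) (x + t *\<^sub>R (- h)))
          + snd h * (?D (0, 1) (x + t *\<^sub>R h) - ?D (0, 1) (x + t *\<^sub>R (- h)))"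
      unfolding eq frechet_linear[OF d, of _ h] frechet_linear[OF d, of _ "- h"] by (simp add: algebra_simps)
    then have "\<bar>f (x + h) + f (x - h) - 2 * f x\<bar>
        \<le> \<bar>fst h\<bar> * \<bar>?D (1, 0) (x + t *\<^sub>R h) - ?D (1, 0) (x + t *\<^sub>R (- h))\<bar>
          + \<bar>snd h\<bar> * \<bar>?D (0, 1) (x + t *\<^sub>R h) - ?D (0, 1) (x + t *\<^sub>R (- h))\<bar>"
      by (simp only: abs_mult[symmetric] abs_triangle_ineq)
    also have "\<dots> \<le> norm h * (4 * Q * norm h) + norm h * (4 * Q * norm h)"
      by (intro add_mono mult_mono coord_le_norm diff) auto
    finally show ?thesis by (simp add: power2_eq_square algebra_simps)
  qed
  have L0: "0 \<le> L" using B1(1) by (simp add: L_def)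
  have "B0 \<le> B0 + 2 * L + 8 * Q" "2 * L * norm h \<le> (B0 + 2 * L + 8 * Q) * norm h"
    "8 * Q * (norm h)\<^sup>2 \<le> (B0 + 2 * L + 8 * Q) * (norm h)\<^sup>2" for h :: plane
    using B0(1) L0 Q0 by (auto intro!: mult_right_mono)
  then have "smooth_bound (B0 + 2 * L + 8 * Q) f"
    unfolding smooth_bound_def using B0(2) lip sd by (meson order_trans)
  then show ?thesis using B0(1) L0 Q0 by (intro exI[of _ "B0 + 2 * L + 8 * Q"]) auto
qed

lemma smooth_bound_nonneg: "smooth_bound B f \<Longrightarrow> 0 \<le> B"
  unfolding smooth_bound_def by (meson abs_ge_zero order_trans)

lemma second_difference_product:
  fixes f g :: "plane \<Rightarrow> real"
  shows "f (x + h) * g (x + h) + f (x - h) * g (x - h) - 2 * (f x * g x)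
    = g x * (f (x + h) + f (x - h) - 2 * f x) + f x * (g (x + h) + g (x - h) - 2 * g x)
      + (f (x + h) - f x) * (g (x + h) - g x) + (f (x - h) - f x) * (g (x - h) - g x)"
  by (simp add: algebra_simps)

text \<open>At the zero y the second difference is f (y + h) + f (y - h), and the reflected term is
  nonnegative.\<close>

lemma flat_at_zero:
  assumes f: "smooth_bound B f" and nn: "\<And>x. 0 \<le> f x" and z: "f y = 0"
  shows "f x \<le> B * (norm (x - y))\<^sup>2"
proof -
  have "\<bar>f (y + (x - y)) + f (y - (x - y)) - 2 * f y\<bar> \<le> B * (norm (x - y))\<^sup>2"
    using f unfolding smooth_bound_def by blast
  then show ?thesis using nn[of "y - (x - y)"] nn[of x] z by simp
qed

lemma smooth_bound_add:
  assumes f: "smooth_bound B f" and g: "smooth_bound B' g"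
  shows "smooth_bound (B + B') (\<lambda>x. f x + g x)"
  unfolding smooth_bound_def
proof (intro conjI allI)
  fix x h :: plane
  have "\<bar>f x\<bar> \<le> B" "\<bar>g x\<bar> \<le> B'" using f g unfolding smooth_bound_def by blast+
  then show "\<bar>f x + g x\<bar> \<le> B + B'" by linarith
  have "\<bar>f (x + h) - f x\<bar> \<le> B * norm h" "\<bar>g (x + h) - g x\<bar> \<le> B' * norm h"
    using f g unfolding smooth_bound_def by blast+
  then have "\<bar>(f (x + h) - f x) + (g (x + h) - g x)\<bar> \<le> (B + B') * norm h"
    unfolding distrib_right by (intro order_trans[OF abs_triangle_ineq] add_mono)
  then show "\<bar>f (x + h) + g (x + h) - (f x + g x)\<bar> \<le> (B + B') * norm h" by (simp add: algebra_simps)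
  have "\<bar>f (x + h) + f (x - h) - 2 * f x\<bar> \<le> B * (norm h)\<^sup>2" "\<bar>g (x + h) + g (x - h) - 2 * g x\<bar> \<le> B' * (norm h)\<^sup>2"
    using f g unfolding smooth_bound_def by blast+
  then have "\<bar>(f (x + h) + f (x - h) - 2 * f x) + (g (x + h) + g (x - h) - 2 * g x)\<bar> \<le> (B + B') * (norm h)\<^sup>2"
    unfolding distrib_right by (intro order_trans[OF abs_triangle_ineq] add_mono)
  then show "\<bar>f (x + h) + g (x + h) + (f (x - h) + g (x - h)) - 2 * (f x + g x)\<bar> \<le> (B + B') * (norm h)\<^sup>2"
    by (simp add: algebra_simps)
qed

lemma smooth_bound_dilate:
  assumes f: "smooth_bound B f" and s: "\<bar>s\<bar> \<le> S" "1 \<le> S"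
  shows "smooth_bound (S\<^sup>2 * B) (\<lambda>x. f (s *\<^sub>R x))"
  unfolding smooth_bound_def
proof (intro conjI allI)
  fix x h :: plane
  have B: "0 \<le> B" using f by (rule smooth_bound_nonneg)
  have S: "1 \<le> S\<^sup>2" "S \<le> S\<^sup>2" using s by (auto simp: power2_eq_square mult_le_cancel_left1 intro: order_trans)
  have "\<bar>f (s *\<^sub>R x)\<bar> \<le> B" using f unfolding smooth_bound_def by blast
  also have "\<dots> \<le> S\<^sup>2 * B" using S B by (simp add: mult_le_cancel_right1)
  finally show "\<bar>f (s *\<^sub>R x)\<bar> \<le> S\<^sup>2 * B" .
  have sn: "norm (s *\<^sub>R h) \<le> S * norm h" using s by (simp add: mult_right_mono)
  have "\<bar>f (s *\<^sub>R x + s *\<^sub>R h) - f (s *\<^sub>R x)\<bar> \<le> B * norm (s *\<^sub>R h)" using f unfolding smooth_bound_def by blast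
  also have "\<dots> \<le> B * (S\<^sup>2 * norm h)"
    using sn S(2) B by (intro mult_left_mono) (auto intro: order_trans[OF _ mult_right_mono])
  finally show "\<bar>f (s *\<^sub>R (x + h)) - f (s *\<^sub>R x)\<bar> \<le> S\<^sup>2 * B * norm h" by (simp add: scaleR_add_right mult_ac)
  have "\<bar>f (s *\<^sub>R x + s *\<^sub>R h) + f (s *\<^sub>R x - s *\<^sub>R h) - 2 * f (s *\<^sub>R x)\<bar> \<le> B * (norm (s *\<^sub>R h))\<^sup>2"
    using f unfolding smooth_bound_def by blast
  also have "\<dots> \<le> B * (S * norm h)\<^sup>2" using sn B by (intro mult_left_mono power_mono) auto
  finally show "\<bar>f (s *\<^sub>R (x + h)) + f (s *\<^sub>R (x - h)) - 2 * f (s *\<^sub>R x)\<bar> \<le> S\<^sup>2 * B * (norm h)\<^sup>2"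
    by (simp add: scaleR_add_right scaleR_diff_right power_mult_distrib mult_ac)
qed

section \<open>Symbols of the resolvent and of partial derivatives on an annulus\<close>

lemma inverse_square_difference:
  fixes x y :: plane
  assumes d: "0 < d" "d \<le> norm x" "d \<le> norm y"
  shows "\<bar>1 / (norm y)\<^sup>2 - 1 / (norm x)\<^sup>2\<bar> \<le> norm (y - x) * (2 / d ^ 3)"
proof -
  let ?p = "norm x" and ?q = "norm y"
  have p: "0 < ?p" "0 < ?q" using d by linarith+
  have "1 / ?q\<^sup>2 - 1 / ?p\<^sup>2 = (?p - ?q) * (1 / (?p * ?q\<^sup>2) + 1 / (?p\<^sup>2 * ?q))"
    using p by (simp add: field_simps power2_eq_square)
  then have "\<bar>1 / ?q\<^sup>2 - 1 / ?p\<^sup>2\<bar> = \<bar>?p - ?q\<bar> * (1 / (?p * ?q\<^sup>2) + 1 / (?p\<^sup>2 * ?q))"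
    using p by (simp add: abs_mult)
  also have "\<dots> \<le> norm (y - x) * (1 / d ^ 3 + 1 / d ^ 3)"
  proof (intro mult_mono add_mono)
    show "\<bar>?p - ?q\<bar> \<le> norm (y - x)" using norm_triangle_ineq3[of x y] by (simp add: norm_minus_commute)
    have "d * d\<^sup>2 \<le> ?p * ?q\<^sup>2" "d\<^sup>2 * d \<le> ?p\<^sup>2 * ?q" using d p by (auto intro!: mult_mono power_mono)
    then have "d ^ 3 \<le> ?p * ?q\<^sup>2" "d ^ 3 \<le> ?p\<^sup>2 * ?q" by (simp_all add: power2_eq_square power3_eq_cube)
    then show "1 / (?p * ?q\<^sup>2) \<le> 1 / d ^ 3" "1 / (?p\<^sup>2 * ?q) \<le> 1 / d ^ 3"
      using d(1) p by (auto intro!: divide_left_mono)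
  qed (use p in auto)
  finally show ?thesis by simp
qed

lemma inverse_square_second_difference:
  fixes x h :: plane
  assumes d: "0 < d" "d \<le> norm x" "d \<le> norm (x + h)" "d \<le> norm (x - h)" "norm h \<le> d"
  shows "\<bar>1 / (norm (x + h))\<^sup>2 + 1 / (norm (x - h))\<^sup>2 - 2 / (norm x)\<^sup>2\<bar> \<le> 12 / d ^ 4 * (norm h)\<^sup>2"
proof -
  define P Q S e m where "P = (norm x)\<^sup>2" and "Q = (norm (x + h))\<^sup>2" and "S = (norm (x - h))\<^sup>2"
    and "e = (norm h)\<^sup>2" and "m = 2 * (x \<bullet> h)"
  have ge: "d\<^sup>2 \<le> P" "d\<^sup>2 \<le> Q" "d\<^sup>2 \<le> S" unfolding P_def Q_def S_def using d by (auto intro!: power_mono)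
  have d2: "0 < d\<^sup>2" using d(1) by simp
  have pos: "0 < P" "0 < Q" "0 < S" using ge d2 by linarith+
  have e: "0 \<le> e" "e \<le> d\<^sup>2" unfolding e_def using d by (auto intro!: power_mono)
  \<comment> \<open>The part m, linear in h, enters with opposite signs, so only m^2 and e, both
    quadratic in h, survive in the second difference.\<close>
  have Q: "Q = P + e + m" and S: "S = P + e - m"
    by (simp_all add: P_def Q_def S_def e_def m_def power2_norm_eq_inner algebra_simps inner_commute)
  have "\<bar>x \<bullet> h\<bar>\<^sup>2 \<le> (norm x * norm h)\<^sup>2" by (intro power_mono Cauchy_Schwarz_ineq2) auto
  then have m: "m\<^sup>2 \<le> 4 * (P * e)" by (simp add: m_def P_def e_def power_mult_distrib)
  have "1 / Q + 1 / S - 2 / P = (P * S + P * Q - 2 * (Q * S)) / (P * Q * S)"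
    using pos by (simp add: field_simps)
  also have "P * S + P * Q - 2 * (Q * S) = 2 * m\<^sup>2 - 2 * (e * (P + e))"
    unfolding Q S by (simp add: algebra_simps power2_eq_square)
  finally have eq: "1 / Q + 1 / S - 2 / P = (2 * m\<^sup>2 - 2 * (e * (P + e))) / (P * Q * S)" .
  have pe: "0 \<le> e * (P + e)" using e pos by simp
  have "\<bar>2 * m\<^sup>2 - 2 * (e * (P + e))\<bar> \<le> 2 * m\<^sup>2 + 2 * (e * (P + e))"
    using pe zero_le_power2[of m] by linarith
  also have "\<dots> \<le> 8 * (P * e) + 2 * (e * (P + e))" using m by simp
  also have "\<dots> = e * (10 * P + 2 * e)" by (simp add: algebra_simps)
  also have "\<dots> \<le> e * (12 * P)" using e ge by (intro mult_left_mono) auto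
  finally have num: "\<bar>2 * m\<^sup>2 - 2 * (e * (P + e))\<bar> \<le> e * (12 * P)" .
  have den: "\<bar>P * Q * S\<bar> = P * Q * S" "0 \<le> P * Q * S" using pos by simp_all
  have "\<bar>1 / Q + 1 / S - 2 / P\<bar> \<le> e * (12 * P) / (P * Q * S)"
    unfolding eq abs_divide den(1) by (rule divide_right_mono[OF num den(2)])
  also have "\<dots> = 12 * e / (Q * S)" using pos by simp
  also have "\<dots> \<le> 12 * e / (d\<^sup>2 * d\<^sup>2)"
    using ge d2 e pos by (intro divide_left_mono mult_mono) auto
  also have "\<dots> = 12 / d ^ 4 * e" by (simp add: power2_eq_square power4_eq_xxxx)
  finally show ?thesis by (simp add: P_def Q_def S_def e_def)
qed

lemma second_difference_trivial:
  fixes c :: "plane \<Rightarrow> real"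
  assumes c: "\<And>x. \<bar>c x\<bar> \<le> E" and h: "a \<le> norm h" "0 < a"
  shows "\<bar>c (x + h) + c (x - h) - 2 * c x\<bar> \<le> 4 * E / a\<^sup>2 * (norm h)\<^sup>2"
proof -
  have E: "0 \<le> E" using c[of 0] by linarith
  have "\<bar>c (x + h) + c (x - h) - 2 * c x\<bar> \<le> 4 * E" using c[of "x + h"] c[of "x - h"] c[of x] by linarith
  also have "4 * E = 4 * E / a\<^sup>2 * a\<^sup>2" using h by simp
  also have "\<dots> \<le> 4 * E / a\<^sup>2 * (norm h)\<^sup>2" using h E by (intro mult_left_mono power_mono) auto
  finally show ?thesis .
qed

text \<open>The singularity of 1 / |x|^2 is never met: for small h, either all three points lie
  where f vanishes, or all keep the distance d = r / 2 from the origin and the product formula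
  applies. Increments of length at least r / 4 need only the sup bound.\<close>

lemma second_difference_div_square:
  fixes f :: "plane \<Rightarrow> real"
  assumes f: "smooth_bound B f" and z: "\<And>x. norm x < r \<Longrightarrow> f x = 0" and r: "0 < r"
  shows "\<exists>B'\<ge>0. (\<forall>x. \<bar>f x / (norm x)\<^sup>2\<bar> \<le> B') \<and>
    (\<forall>x h. \<bar>f (x + h) / (norm (x + h))\<^sup>2 + f (x - h) / (norm (x - h))\<^sup>2 - 2 * (f x / (norm x)\<^sup>2)\<bar> \<le> B' * (norm h)\<^sup>2)"
proof -
  have B: "0 \<le> B" using f by (rule smooth_bound_nonneg)
  have f0: "\<bar>f x\<bar> \<le> B" and f1: "\<bar>f (x + h) - f x\<bar> \<le> B * norm h"
    and f2: "\<bar>f (x + h) + f (x - h) - 2 * f x\<bar> \<le> B * (norm h)\<^sup>2" for x h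
    using f unfolding smooth_bound_def by blast+
  define d where "d = r / 2"
  have d: "0 < d" using r by (simp add: d_def)
  let ?c = "\<lambda>x. f x / (norm x)\<^sup>2" and ?v = "\<lambda>x :: plane. 1 / (norm x)\<^sup>2"
  have sup: "\<bar>?c x\<bar> \<le> B / r\<^sup>2" for x
  proof (cases "norm x < r")
    case True
    then show ?thesis using z B by simp
  next
    case False
    then have "r\<^sup>2 \<le> (norm x)\<^sup>2" using r by (intro power_mono) auto
    then have "\<bar>f x\<bar> / (norm x)\<^sup>2 \<le> B / r\<^sup>2" using f0 r B by (intro frac_le) auto
    then show ?thesis by simp
  qed
  define B1 where "B1 = 4 * (B / r\<^sup>2) / (r / 4)\<^sup>2"
  define B2 where "B2 = 1 / d\<^sup>2 * B + B * (12 / d ^ 4) + 2 * (B * (2 / d ^ 3))"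
  have B12: "0 \<le> B1" "0 \<le> B2" using B d by (auto simp: B1_def B2_def)
  have near: "\<bar>?c (x + h) + ?c (x - h) - 2 * ?c x\<bar> \<le> B2 * (norm h)\<^sup>2" if h: "norm h < r / 4" for x h
  proof (cases "norm x < 3 * r / 4")
    case True
    have "norm (x + h) < r" "norm (x - h) < r" "norm x < r"
      using True h r norm_triangle_ineq[of x h] norm_triangle_ineq4[of x h] by linarith+
    then show ?thesis using z B12 by simp
  next
    case False
    have n: "d \<le> norm x" "d \<le> norm (x + h)" "d \<le> norm (x - h)" "norm h \<le> d"
      using False h r norm_triangle_ineq2[of x "- h"] norm_triangle_ineq2[of x h] by (auto simp: d_def)
    have v0: "\<bar>?v x\<bar> \<le> 1 / d\<^sup>2" using n(1) d by (simp add: frac_le power_mono)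
    have v1: "\<bar>?v (x + h) - ?v x\<bar> \<le> norm h * (2 / d ^ 3)" "\<bar>?v (x - h) - ?v x\<bar> \<le> norm h * (2 / d ^ 3)"
      using inverse_square_difference[OF d n(1,2)] inverse_square_difference[OF d n(1,3)] by simp_all
    have v2: "\<bar>?v (x + h) + ?v (x - h) - 2 * ?v x\<bar> \<le> 12 / d ^ 4 * (norm h)\<^sup>2"
      using inverse_square_second_difference[OF d n] by simp
    have f1': "\<bar>f (x - h) - f x\<bar> \<le> B * norm h" using f1[of x "- h"] by simp
    have "?c (x + h) + ?c (x - h) - 2 * ?c x = f (x + h) * ?v (x + h) + f (x - h) * ?v (x - h) - 2 * (f x * ?v x)"
      by simp
    also have "\<dots> = ?v x * (f (x + h) + f (x - h) - 2 * f x) + f x * (?v (x + h) + ?v (x - h) - 2 * ?v x)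
      + (f (x + h) - f x) * (?v (x + h) - ?v x) + (f (x - h) - f x) * (?v (x - h) - ?v x)"
      by (rule second_difference_product)
    finally have "\<bar>?c (x + h) + ?c (x - h) - 2 * ?c x\<bar>
      \<le> \<bar>?v x * (f (x + h) + f (x - h) - 2 * f x)\<bar> + \<bar>f x * (?v (x + h) + ?v (x - h) - 2 * ?v x)\<bar>
      + \<bar>(f (x + h) - f x) * (?v (x + h) - ?v x)\<bar> + \<bar>(f (x - h) - f x) * (?v (x - h) - ?v x)\<bar>"
      by linarith
    also have "\<dots> \<le> 1 / d\<^sup>2 * (B * (norm h)\<^sup>2) + B * (12 / d ^ 4 * (norm h)\<^sup>2)
      + (B * norm h) * (norm h * (2 / d ^ 3)) + (B * norm h) * (norm h * (2 / d ^ 3))"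
      unfolding abs_mult using B d by (intro add_mono mult_mono v0 v1 v2 f0 f1 f1' f2) auto
    also have "\<dots> = B2 * (norm h)\<^sup>2" by (simp add: B2_def power2_eq_square algebra_simps)
    finally show ?thesis .
  qed
  have "\<bar>?c (x + h) + ?c (x - h) - 2 * ?c x\<bar> \<le> (B / r\<^sup>2 + B1 + B2) * (norm h)\<^sup>2" for x h
  proof (cases "norm h < r / 4")
    case True
    have "B2 * (norm h)\<^sup>2 \<le> (B / r\<^sup>2 + B1 + B2) * (norm h)\<^sup>2" using B B12 by (intro mult_right_mono) auto
    then show ?thesis using near[OF True, of x] by linarith
  next
    case False
    have "B1 * (norm h)\<^sup>2 \<le> (B / r\<^sup>2 + B1 + B2) * (norm h)\<^sup>2" using B B12 by (intro mult_right_mono) auto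
    moreover have "\<bar>?c (x + h) + ?c (x - h) - 2 * ?c x\<bar> \<le> B1 * (norm h)\<^sup>2"
      unfolding B1_def by (rule second_difference_trivial[OF sup]) (use False r in auto)
    ultimately show ?thesis by linarith
  qed
  moreover have "\<bar>?c x\<bar> \<le> B / r\<^sup>2 + B1 + B2" for x using sup[of x] B12 by linarith
  ultimately show ?thesis using B B12 by (intro exI[of _ "B / r\<^sup>2 + B1 + B2"]) auto
qed

text \<open>With g a coordinate function this is the symbol of a partial derivative on an annulus.
  The second difference of g is zero, and g is bounded where f lives.\<close>

lemma second_difference_mult_linear:
  fixes f g :: "plane \<Rightarrow> real"
  assumes f: "smooth_bound B f" and z: "\<And>x. R < norm x \<Longrightarrow> f x = 0" and R: "0 \<le> R"
    and g: "linear g" "\<And>x. \<bar>g x\<bar> \<le> norm x"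
  shows "\<exists>B'\<ge>0. (\<forall>x. \<bar>g x * f x\<bar> \<le> B') \<and>
    (\<forall>x h. \<bar>g (x + h) * f (x + h) + g (x - h) * f (x - h) - 2 * (g x * f x)\<bar> \<le> B' * (norm h)\<^sup>2)"
proof -
  have B: "0 \<le> B" using f by (rule smooth_bound_nonneg)
  have f0: "\<bar>f x\<bar> \<le> B" and f1: "\<bar>f (x + h) - f x\<bar> \<le> B * norm h"
    and f2: "\<bar>f (x + h) + f (x - h) - 2 * f x\<bar> \<le> B * (norm h)\<^sup>2" for x h
    using f unfolding smooth_bound_def by blast+
  let ?c = "\<lambda>x. g x * f x"
  have sup: "\<bar>?c x\<bar> \<le> R * B" for x
  proof (cases "R < norm x")
    case False
    then have "\<bar>g x\<bar> * \<bar>f x\<bar> \<le> R * B" using g(2)[of x] f0 by (intro mult_mono) auto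
    then show ?thesis by (simp add: abs_mult)
  qed (use z R B in simp)
  define B2 where "B2 = (R + 1) * B + 2 * B"
  have near: "\<bar>?c (x + h) + ?c (x - h) - 2 * ?c x\<bar> \<le> B2 * (norm h)\<^sup>2" if h: "norm h < 1" for x h
  proof (cases "R + 1 < norm x")
    case True
    have "R < norm (x + h)" "R < norm (x - h)" "R < norm x"
      using True h norm_triangle_ineq2[of x "- h"] norm_triangle_ineq2[of x h] by auto
    then show ?thesis using z B R by (simp add: B2_def)
  next
    case False
    have gx: "\<bar>g x\<bar> \<le> R + 1" using False g(2)[of x] by linarith
    have gh: "g (x + h) - g x = g h" "g (x - h) - g x = - g h" "g (x + h) + g (x - h) - 2 * g x = 0"
      using g(1) by (simp_all add: linear_add linear_diff)
    have f1': "\<bar>f (x - h) - f x\<bar> \<le> B * norm h" using f1[of x "- h"] by simp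
    have "?c (x + h) + ?c (x - h) - 2 * ?c x = f x * (g (x + h) + g (x - h) - 2 * g x)
      + g x * (f (x + h) + f (x - h) - 2 * f x)
      + (g (x + h) - g x) * (f (x + h) - f x) + (g (x - h) - g x) * (f (x - h) - f x)"
      by (rule second_difference_product)
    then have "\<bar>?c (x + h) + ?c (x - h) - 2 * ?c x\<bar> \<le> \<bar>g x * (f (x + h) + f (x - h) - 2 * f x)\<bar>
      + \<bar>g h * (f (x + h) - f x)\<bar> + \<bar>g h * (f (x - h) - f x)\<bar>"
      unfolding gh by simp
    also have "\<dots> \<le> (R + 1) * (B * (norm h)\<^sup>2) + norm h * (B * norm h) + norm h * (B * norm h)"
      unfolding abs_mult using R B by (intro add_mono mult_mono gx g(2) f1 f1' f2) auto
    also have "\<dots> = B2 * (norm h)\<^sup>2" by (simp add: B2_def power2_eq_square algebra_simps)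
    finally show ?thesis .
  qed
  let ?B = "4 * (R * B) + B2"
  have B0: "0 \<le> R * B" "0 \<le> B2" using R B by (auto simp: B2_def)
  have "\<bar>?c (x + h) + ?c (x - h) - 2 * ?c x\<bar> \<le> ?B * (norm h)\<^sup>2" for x h
  proof (cases "norm h < 1")
    case True
    have "B2 * (norm h)\<^sup>2 \<le> ?B * (norm h)\<^sup>2" using B0 by (intro mult_right_mono) auto
    then show ?thesis using near[OF True, of x] by linarith
  next
    case False
    have "4 * (R * B) * (norm h)\<^sup>2 \<le> ?B * (norm h)\<^sup>2" using B0 by (intro mult_right_mono) auto
    then show ?thesis using second_difference_trivial[of ?c, OF sup, where a = 1 and h = h and x = x] False by simp
  qed
  moreover have "\<bar>?c x\<bar> \<le> ?B" for x using sup[of x] B0 by linarith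
  ultimately show ?thesis using B0 by (intro exI[of _ ?B]) auto
qed

section \<open>Symbols of the Littlewood--Paley blocks\<close>

definition lam :: "int \<Rightarrow> real" where
  "lam j = 2 powr of_int j"

lemma lam_pos: "0 < lam j"
  by (simp add: lam_def)

lemma lam_ge1: "0 \<le> j \<Longrightarrow> 1 \<le> lam j"
  unfolding lam_def by (rule ge_one_powr_ge_zero) auto

lemma lam_nat: "0 \<le> j \<Longrightarrow> 2 ^ nat j = lam j"
  by (simp add: lam_def powr_realpow[symmetric])

lemma lam_add: "lam (i + j) = lam i * lam j"
  by (simp add: lam_def powr_add)

lemma lam_mono: "i \<le> j \<Longrightarrow> lam i \<le> lam j"
  by (simp add: lam_def)

lemma lam_simps [simp]: "lam 0 = 1" "lam 1 = 2" "lam (- 1) = 1 / 2"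
  by (simp_all add: lam_def powr_minus_divide)

lemma lam_diff1: "lam (j - 1) = lam j / 2"
  using lam_add[of j "- 1"] by simp

lemma bracket_ge_norm: "(norm (vec_of k))\<^sup>2 \<le> bracket k"
proof -
  have "1 \<le> pi\<^sup>2" using pi_ge_two by (intro one_le_power) linarith
  then have "1 \<le> 4 * pi\<^sup>2" by linarith
  then have "1 * (norm (vec_of k))\<^sup>2 \<le> 4 * pi\<^sup>2 * (norm (vec_of k))\<^sup>2" by (rule mult_right_mono) simp
  then show ?thesis by (simp add: bracket_def)
qed

definition phi :: "dyadic \<Rightarrow> int \<Rightarrow> freq \<Rightarrow> real" where
  "phi P j k = (if j = -1 then fst P (vec_of k)
      else if j \<ge> 0 then snd P (vec_of k /\<^sub>R lam j) else 0)"

lemma lp_block_phi: "lp_block P j f = (\<lambda>k. of_real (phi P j k) * f k)"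
  by (auto simp: lp_block_def phi_def lam_nat fun_eq_iff)

text \<open>With this cut-off the double sum of a paraproduct becomes a single sum over j of a
  truncated factor times a block; \<open>mid\<close> does the same for the resonant product.\<close>

definition low :: "dyadic \<Rightarrow> int \<Rightarrow> freq \<Rightarrow> real" where
  "low P j k = (\<Sum>i\<in>{-1..j - 2}. phi P i k)"

definition mid :: "dyadic \<Rightarrow> int \<Rightarrow> freq \<Rightarrow> real" where
  "mid P j k = (\<Sum>i\<in>{max (-1) (j - 1)..j + 1}. phi P i k)"

text \<open>The scale-free shape of \<open>mid P j\<close> for j \<ge> 1: a fattened annulus that
  equals 1 on the support of \<open>rho\<close>.\<close>

definition mid_profile :: "dyadic \<Rightarrow> plane \<Rightarrow> real" where
  "mid_profile P x = snd P (2 *\<^sub>R x) + snd P x + snd P (x /\<^sub>R 2)"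

locale dyadic_blocks =
  fixes P :: dyadic
  assumes dyadic: "dyadic_partition P"
begin

abbreviation chi :: "plane \<Rightarrow> real" where "chi \<equiv> fst P"
abbreviation rho :: "plane \<Rightarrow> real" where "rho \<equiv> snd P"

lemma chi_nonneg: "0 \<le> chi x" and rho_nonneg: "0 \<le> rho x"
  and chi_radial: "norm x = norm y \<Longrightarrow> chi x = chi y"
  and rho_radial: "norm x = norm y \<Longrightarrow> rho x = rho y"
  and chi_rho: "1 \<le> j \<Longrightarrow> chi x * rho (x /\<^sub>R 2 ^ j) = 0"
  and rho_rho: "\<bar>int i - int j\<bar> > 1 \<Longrightarrow> rho (x /\<^sub>R 2 ^ i) * rho (x /\<^sub>R 2 ^ j) = 0"
  and partition: "(\<lambda>j. rho (x /\<^sub>R 2 ^ j)) sums (1 - chi x)"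
  using dyadic unfolding dyadic_partition_def radial_def case_prod_beta by blast+

lemma support_bounds:
  obtains r R where "0 < r" "1 \<le> R" "\<And>x. chi x \<noteq> 0 \<Longrightarrow> norm x \<le> R"
    "\<And>x. rho x \<noteq> 0 \<Longrightarrow> r \<le> norm x" "\<And>x. rho x \<noteq> 0 \<Longrightarrow> norm x \<le> R"
proof -
  have "(\<exists>R. \<forall>x. chi x \<noteq> 0 \<longrightarrow> norm x \<le> R)"
    "(\<exists>r>0. \<exists>R. \<forall>x. rho x \<noteq> 0 \<longrightarrow> r \<le> norm x \<and> norm x \<le> R)"
    using dyadic unfolding dyadic_partition_def case_prod_beta by blast+
  then obtain R1 r R2 where "\<And>x. chi x \<noteq> 0 \<Longrightarrow> norm x \<le> R1" "0 < r"
    "\<And>x. rho x \<noteq> 0 \<Longrightarrow> r \<le> norm x \<and> norm x \<le> R2" by blast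
  then show thesis
    by (intro that[of r "max 1 (max R1 R2)"]) (auto simp: le_max_iff_disj)
qed

lemma chi_rho_smooth:
  obtains B where "smooth_bound B chi" "smooth_bound B rho" "0 \<le> B"
proof -
  have s: "smooth_on UNIV chi" "smooth_on UNIV rho"
    using dyadic unfolding dyadic_partition_def case_prod_beta by blast+
  obtain r R where R: "0 < r" "1 \<le> R" "\<And>x. chi x \<noteq> 0 \<Longrightarrow> norm x \<le> R" "\<And>x. rho x \<noteq> 0 \<Longrightarrow> r \<le> norm x"
    "\<And>x. rho x \<noteq> 0 \<Longrightarrow> norm x \<le> R" by (rule support_bounds) (rule that; blast)
  obtain B1 where B1: "0 \<le> B1" "smooth_bound B1 chi" using smooth_compact_bound[OF s(1) R(3)] by blast
  obtain B2 where B2: "0 \<le> B2" "smooth_bound B2 rho" using smooth_compact_bound[OF s(2) R(5)] by blast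
  show thesis
    by (rule that[of "max B1 B2"]) (use B1 B2 in \<open>auto intro: smooth_bound_mono\<close>)
qed

text \<open>The partitions of unity at x and at x / 2^n share their tail; comparing them gives a
  closed form for the partial sum.\<close>

lemma telescope: "chi x + (\<Sum>i<n. rho (x /\<^sub>R 2 ^ i)) = chi (x /\<^sub>R 2 ^ n)"
proof -
  have "(\<lambda>j. rho (x /\<^sub>R 2 ^ (j + n))) sums (1 - chi x - (\<Sum>i<n. rho (x /\<^sub>R 2 ^ i)))"
    by (rule sums_split_initial_segment[OF partition])
  moreover have "(\<lambda>j. rho (x /\<^sub>R 2 ^ (j + n))) sums (1 - chi (x /\<^sub>R 2 ^ n))"
    using partition[of "x /\<^sub>R 2 ^ n"] by (simp add: power_add mult.commute)
  ultimately have "1 - chi x - (\<Sum>i<n. rho (x /\<^sub>R 2 ^ i)) = 1 - chi (x /\<^sub>R 2 ^ n)"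
    by (rule sums_unique2)
  then show ?thesis by linarith
qed

lemma chi_le1: "chi x \<le> 1"
  using sums_le[OF _ sums_zero partition[of x]] rho_nonneg by simp

lemma partial_sum_le1: "(\<Sum>i<n. rho (x /\<^sub>R 2 ^ i)) \<le> 1"
  using telescope[of x n] chi_le1[of "x /\<^sub>R 2 ^ n"] chi_nonneg[of x] by linarith

lemma mid_profile_le1: "mid_profile P x \<le> 1"
proof -
  have "(\<Sum>i<3. rho ((2 *\<^sub>R x) /\<^sub>R 2 ^ i)) = mid_profile P x"
    by (simp add: mid_profile_def eval_nat_numeral)
  then show ?thesis using partial_sum_le1[where x = "2 *\<^sub>R x" and n = 3] by simp
qed

lemma mid_profile_smooth:
  obtains B where "smooth_bound B (mid_profile P)" "0 \<le> B"
proof -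
  obtain B where "smooth_bound B chi" and B: "smooth_bound B rho" "0 \<le> B" by (rule chi_rho_smooth)
  have "smooth_bound (2\<^sup>2 * B + B + 2\<^sup>2 * B) (mid_profile P)"
    unfolding mid_profile_def
    by (intro smooth_bound_add smooth_bound_dilate[where S = 2] B) auto
  then show thesis using that B(2) by simp
qed

lemma phi_nonneg: "0 \<le> phi P j k"
  by (simp add: phi_def chi_nonneg rho_nonneg)

lemma phi_low_chi:
  assumes "0 \<le> m"
  shows "(\<Sum>i\<in>{-1..m - 1}. phi P i k) = chi (vec_of k /\<^sub>R lam m)"
proof -
  have "{-1..m - 1} = insert (-1) (int ` {..<nat m})"
  proof -
    have "i \<in> insert (-1) (int ` {..<nat m})" if "i \<in> {-1..m - 1}" for i
    proof (cases "i = -1")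
      case False
      then have "0 \<le> i" "i < m" using that by auto
      then show ?thesis by (intro insertI2 image_eqI[of _ _ "nat i"]) auto
    qed simp
    then show ?thesis using assms by (intro equalityI subsetI) auto
  qed
  then have "(\<Sum>i\<in>{-1..m - 1}. phi P i k) = phi P (-1) k + (\<Sum>i\<in>int ` {..<nat m}. phi P i k)"
    by (simp add: image_iff)
  also have "(\<Sum>i\<in>int ` {..<nat m}. phi P i k) = (\<Sum>i<nat m. rho (vec_of k /\<^sub>R 2 ^ i))"
    by (subst sum.reindex) (auto simp: phi_def lam_def powr_realpow)
  finally show ?thesis
    using telescope[of "vec_of k" "nat m"] assms by (simp add: phi_def lam_nat)
qed

lemma low_chi: "1 \<le> j \<Longrightarrow> low P j k = chi (vec_of k /\<^sub>R lam (j - 1))"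
  unfolding low_def using phi_low_chi[of "j - 1" k] by simp

lemma low_zero: "j \<le> 0 \<Longrightarrow> low P j k = 0"
  by (simp add: low_def)

lemma mid_mid_profile:
  assumes "1 \<le> j"
  shows "mid P j k = mid_profile P (vec_of k /\<^sub>R lam j)"
proof -
  have "{max (-1) (j - 1)..j + 1} = {j - 1, j, j + 1}" using assms by auto
  then have "mid P j k = phi P (j - 1) k + phi P j k + phi P (j + 1) k" by (simp add: mid_def)
  moreover have "vec_of k /\<^sub>R lam (j - 1) = 2 *\<^sub>R (vec_of k /\<^sub>R lam j)"
    by (simp only: lam_diff1 scaleR_scaleR divide_inverse inverse_mult_distrib inverse_inverse_eq mult.commute)
  moreover have "vec_of k /\<^sub>R lam (j + 1) = (vec_of k /\<^sub>R lam j) /\<^sub>R 2"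
    by (simp only: lam_add lam_simps scaleR_scaleR inverse_mult_distrib mult.commute)
  ultimately show ?thesis using assms by (simp add: mid_profile_def phi_def)
qed

lemma phi_sum_le1:
  assumes "finite I"
  shows "(\<Sum>i\<in>I. phi P i k) \<le> 1"
proof -
  define m where "m = nat (Max (insert 0 I)) + 1"
  have "(\<Sum>i\<in>I. phi P i k) = (\<Sum>i\<in>I \<inter> {-1..}. phi P i k)"
    by (rule sum.mono_neutral_right) (use assms in \<open>auto simp: phi_def\<close>)
  also have "\<dots> \<le> (\<Sum>i\<in>{-1..int m - 1}. phi P i k)"
  proof (rule sum_mono2)
    have "i \<le> Max (insert 0 I)" if "i \<in> I" for i using assms that by simp
    then show "I \<inter> {-1..} \<subseteq> {-1..int m - 1}" by (fastforce simp: m_def)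
  qed (auto simp: phi_nonneg)
  also have "\<dots> \<le> 1" by (subst phi_low_chi) (auto simp: chi_le1)
  finally show ?thesis .
qed

lemma low_bounds: "0 \<le> low P j k" "low P j k \<le> 1"
  by (auto simp: low_def phi_nonneg phi_sum_le1 intro!: sum_nonneg)

lemma mid_bounds: "0 \<le> mid P j k" "mid P j k \<le> 1"
  by (auto simp: mid_def phi_nonneg phi_sum_le1 intro!: sum_nonneg)

lemma phi_disjoint:
  assumes "-1 \<le> i" "-1 \<le> j" "1 < \<bar>i - j\<bar>"
  shows "phi P i k * phi P j k = 0"
proof -
  have cr: "phi P (-1) k * phi P j k = 0" if "1 \<le> j" for j
    using chi_rho[of "nat j" "vec_of k"] that by (simp add: phi_def lam_nat)
  consider "i = -1" "1 \<le> j" | "j = -1" "1 \<le> i" | "0 \<le> i" "0 \<le> j" using assms by linarith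
  then show ?thesis
  proof cases
    case 3
    then have "1 < \<bar>int (nat i) - int (nat j)\<bar>" using assms by simp
    from rho_rho[OF this, of "vec_of k"] 3 show ?thesis by (simp add: phi_def lam_nat)
  qed (use cr mult.commute in \<open>metis\<close>)+
qed

text \<open>Only finitely many blocks see a given frequency, so sums over all blocks at a fixed
  frequency are finite.\<close>

lemma phi_sum_eq1:
  obtains J where "-1 \<le> J" "\<And>j. J < j \<Longrightarrow> phi P j k = 0" "\<And>J'. J \<le> J' \<Longrightarrow> (\<Sum>j\<in>{-1..J'}. phi P j k) = 1"
proof -
  obtain r R where r: "0 < r" and "1 \<le> R" and "\<And>x. chi x \<noteq> 0 \<Longrightarrow> norm x \<le> R"
    and r': "\<And>x. rho x \<noteq> 0 \<Longrightarrow> r \<le> norm x" and "\<And>x. rho x \<noteq> 0 \<Longrightarrow> norm x \<le> R" by (rule support_bounds) (rule that; blast)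
  obtain n :: nat where n: "norm (vec_of k) / r < 2 ^ n" using real_arch_pow[of 2 "norm (vec_of k) / r"] by auto
  have z: "rho (vec_of k /\<^sub>R 2 ^ i) = 0" if "n \<le> i" for i
  proof (rule ccontr)
    assume "rho (vec_of k /\<^sub>R 2 ^ i) \<noteq> 0"
    then have "r \<le> norm (vec_of k) / 2 ^ i" using r'[of "vec_of k /\<^sub>R 2 ^ i"] by (simp add: divide_inverse mult.commute)
    then have "2 ^ i \<le> norm (vec_of k) / r" using r by (simp add: field_simps)
    moreover have "(2::real) ^ n \<le> 2 ^ i" using that by (rule power_increasing) simp
    ultimately show False using n by linarith
  qed
  have pz: "phi P j k = 0" if "int n \<le> j" for j
    using z[of "nat j"] that by (simp add: phi_def lam_nat le_nat_iff)
  have c1: "chi (vec_of k /\<^sub>R 2 ^ n) = 1"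
  proof -
    have "(\<lambda>j. rho ((vec_of k /\<^sub>R 2 ^ n) /\<^sub>R 2 ^ j)) = (\<lambda>j. 0)"
      using z[of "n + j" for j] by (auto simp: power_add mult.commute fun_eq_iff)
    then show ?thesis using partition[of "vec_of k /\<^sub>R 2 ^ n"] sums_unique2[OF sums_zero] by fastforce
  qed
  show thesis
  proof (rule that[of "int n"])
    fix J' assume J': "int n \<le> J'"
    have "(\<Sum>j\<in>{-1..J'}. phi P j k) = (\<Sum>j\<in>{-1..int n - 1}. phi P j k)"
      by (rule sum.mono_neutral_right) (use J' pz in auto)
    also have "\<dots> = 1" using c1 by (subst phi_low_chi) (auto simp: lam_def powr_realpow)
    finally show "(\<Sum>j\<in>{-1..J'}. phi P j k) = 1" .
  qed (use pz in auto)
qed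

text \<open>Blocks that are not neighbours of j vanish at k, so the neighbours carry the whole
  partition of unity.\<close>

lemma mid_eq1:
  assumes "-1 \<le> j" "phi P j k \<noteq> 0"
  shows "mid P j k = 1"
proof -
  obtain J where "-1 \<le> J" "\<And>j. J < j \<Longrightarrow> phi P j k = 0"
    and J: "\<And>J'. J \<le> J' \<Longrightarrow> (\<Sum>j\<in>{-1..J'}. phi P j k) = 1" by (rule phi_sum_eq1[of k]) (rule that; blast)
  define J' where "J' = max J (j + 1)"
  have "(\<Sum>i\<in>{-1..J'}. phi P i k) = mid P j k"
    unfolding mid_def
  proof (rule sum.mono_neutral_right)
    show "{max (- 1) (j - 1)..j + 1} \<subseteq> {- 1..J'}" by (auto simp: J'_def)
    show "\<forall>i\<in>{- 1..J'} - {max (- 1) (j - 1)..j + 1}. phi P i k = 0"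
    proof
      fix i assume "i \<in> {- 1..J'} - {max (- 1) (j - 1)..j + 1}"
      then have "phi P i k * phi P j k = 0" using assms(1) by (intro phi_disjoint) auto
      then show "phi P i k = 0" using assms(2) by simp
    qed
  qed simp
  then show ?thesis using J[of J'] by (simp add: J'_def)
qed

text \<open>All frequency localization is expressed through \<open>bracket\<close> with two
  constants. Where the low cut-off is not yet 1, the frequency is already of order 2^j, because
  \<open>chi\<close> equals 1 near the origin.\<close>

lemma symbol_supports:
  obtains r R where "0 < r" "1 \<le> R"
    "\<And>j k. -1 \<le> j \<Longrightarrow> phi P j k \<noteq> 0 \<Longrightarrow> r * (lam j)\<^sup>2 \<le> bracket k \<and> bracket k \<le> R * (lam j)\<^sup>2"
    "\<And>j k. low P j k \<noteq> 0 \<Longrightarrow> bracket k \<le> R * (lam j)\<^sup>2"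
    "\<And>j k. -1 \<le> j \<Longrightarrow> low P j k \<noteq> 1 \<Longrightarrow> r * (lam j)\<^sup>2 \<le> bracket k"
    "\<And>j k. -1 \<le> j \<Longrightarrow> mid P j k \<noteq> 0 \<Longrightarrow> r * (lam j)\<^sup>2 \<le> bracket k \<and> bracket k \<le> R * (lam j)\<^sup>2"
proof -
  obtain r0 R0 where r0: "0 < r0" "1 \<le> R0" "\<And>x. chi x \<noteq> 0 \<Longrightarrow> norm x \<le> R0"
    "\<And>x. rho x \<noteq> 0 \<Longrightarrow> r0 \<le> norm x" "\<And>x. rho x \<noteq> 0 \<Longrightarrow> norm x \<le> R0" by (rule support_bounds) (rule that; blast)
  define r where "r = min 1 (r0\<^sup>2)"
  define R where "R = 4 * (1 + 4 * pi\<^sup>2 * R0\<^sup>2)"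
  have r: "0 < r" "r \<le> 1" "r \<le> r0\<^sup>2" using r0(1) by (auto simp: r_def)
  have R: "1 \<le> R" by (simp add: R_def)
  have lam1: "(lam j)\<^sup>2 \<le> 1" if "j \<le> 0" for j
    using lam_mono[OF that] lam_pos[of j] by (simp add: power_le_one)
  have phi: "r * (lam j)\<^sup>2 \<le> bracket k \<and> bracket k \<le> R * (lam j)\<^sup>2" if j: "-1 \<le> j" "phi P j k \<noteq> 0" for j k
  proof (cases "j = -1")
    case True
    then have "norm (vec_of k) \<le> R0" using j r0(3) by (simp add: phi_def)
    then have "(norm (vec_of k))\<^sup>2 \<le> R0\<^sup>2" by (intro power_mono) auto
    then have "4 * pi\<^sup>2 * (norm (vec_of k))\<^sup>2 \<le> 4 * pi\<^sup>2 * R0\<^sup>2" by (intro mult_left_mono) auto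
    moreover have "r * (1 / 4) \<le> 1" using r by simp
    ultimately show ?thesis using True bracket_ge1[of k]
      by (auto simp: R_def bracket_def power2_eq_square[of "1 / 2 :: real"] power_one_over intro: order_trans)
  next
    case False
    then have j0: "0 \<le> j" using j by simp
    have lam: "1 \<le> lam j" using j0 by (rule lam_ge1)
    have n: "norm (vec_of k /\<^sub>R lam j) = norm (vec_of k) / lam j" using lam by (simp add: divide_inverse mult.commute)
    have "rho (vec_of k /\<^sub>R lam j) \<noteq> 0" using j j0 by (simp add: phi_def)
    then have "r0 \<le> norm (vec_of k) / lam j" "norm (vec_of k) / lam j \<le> R0" using r0(4,5) n by metis+
    then have b: "r0 * lam j \<le> norm (vec_of k)" "norm (vec_of k) \<le> R0 * lam j" using lam by (simp_all add: field_simps)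
    have "r * (lam j)\<^sup>2 \<le> r0\<^sup>2 * (lam j)\<^sup>2" using r by (intro mult_right_mono) auto
    also have "\<dots> = (r0 * lam j)\<^sup>2" by (simp add: power_mult_distrib)
    also have "\<dots> \<le> (norm (vec_of k))\<^sup>2" using b r0 lam by (intro power_mono) auto
    also have "\<dots> \<le> bracket k" by (rule bracket_ge_norm)
    finally have lo: "r * (lam j)\<^sup>2 \<le> bracket k" .
    have "(norm (vec_of k))\<^sup>2 \<le> (R0 * lam j)\<^sup>2" using b by (intro power_mono) auto
    then have "4 * pi\<^sup>2 * (norm (vec_of k))\<^sup>2 \<le> 4 * pi\<^sup>2 * (R0 * lam j)\<^sup>2" by (intro mult_left_mono) auto
    then have "bracket k \<le> 1 + 4 * pi\<^sup>2 * R0\<^sup>2 * (lam j)\<^sup>2" by (simp add: bracket_def power_mult_distrib mult.assoc)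
    also have "1 \<le> (lam j)\<^sup>2" using lam by simp
    finally have "bracket k \<le> (1 + 4 * pi\<^sup>2 * R0\<^sup>2) * (lam j)\<^sup>2" by (simp add: algebra_simps)
    also have "\<dots> \<le> R * (lam j)\<^sup>2" unfolding R_def by (intro mult_right_mono) auto
    finally show ?thesis using lo by simp
  qed
  have low: "bracket k \<le> R * (lam j)\<^sup>2" if l: "low P j k \<noteq> 0" for j k
  proof -
    obtain i where "i \<in> {-1..j - 2}" "phi P i k \<noteq> 0"
      using l unfolding low_def by (rule sum.not_neutral_contains_not_neutral)
    then have i: "-1 \<le> i" "i \<le> j - 2" "phi P i k \<noteq> 0" by auto
    have "bracket k \<le> R * (lam i)\<^sup>2" using phi i by blast
    also have "\<dots> \<le> R * (lam j)\<^sup>2"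
      using i R lam_mono[of i j] lam_pos[of i] by (intro mult_left_mono power_mono) auto
    finally show ?thesis .
  qed
  have low1: "r / 4 * (lam j)\<^sup>2 \<le> bracket k" if j: "-1 \<le> j" "low P j k \<noteq> 1" for j k
  proof (cases "j \<le> 0")
    case True
    have "r / 4 * (lam j)\<^sup>2 \<le> 1 * 1" using r lam1[OF True] by (intro mult_mono) auto
    then show ?thesis using bracket_ge1[of k] by linarith
  next
    case False
    then have j1: "1 \<le> j" by simp
    define x where "x = vec_of k /\<^sub>R lam (j - 1)"
    \<comment> \<open>If |x| < r0, no x / 2^i meets the support of \<open>rho\<close>, and the
      partition leaves \<open>chi x\<close> = 1.\<close>
    have "r0 \<le> norm x"
    proof (rule ccontr)
      assume c: "\<not> r0 \<le> norm x"
      have "rho (x /\<^sub>R 2 ^ i) = 0" for i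
      proof (rule ccontr)
        assume "rho (x /\<^sub>R 2 ^ i) \<noteq> 0"
        then have "r0 \<le> norm (x /\<^sub>R 2 ^ i)" by (rule r0(4))
        also have "\<dots> = norm x * (1 / 2 ^ i)" by (simp add: divide_inverse)
        also have "\<dots> \<le> norm x * 1"
        proof (rule mult_left_mono)
          show "1 / 2 ^ i \<le> (1 :: real)" using one_le_power[of "2 :: real" i] by (simp add: divide_le_eq_1)
        qed simp
        finally show False using c by simp
      qed
      then have "chi x = 1" using partition[of x] sums_unique2[OF sums_zero] by fastforce
      then show False using j(2) low_chi[OF j1] by (simp add: x_def)
    qed
    then have "r0 * (lam j / 2) \<le> norm (vec_of k)"
      using lam_pos[of j] by (simp add: x_def lam_diff1 field_simps)
    then have "(r0 * (lam j / 2))\<^sup>2 \<le> (norm (vec_of k))\<^sup>2" using r0 lam_pos[of j] by (intro power_mono) auto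
    then have "r0\<^sup>2 / 4 * (lam j)\<^sup>2 \<le> bracket k"
      using bracket_ge_norm[of k] by (simp add: power_mult_distrib power_divide)
    moreover have "r / 4 * (lam j)\<^sup>2 \<le> r0\<^sup>2 / 4 * (lam j)\<^sup>2" using r by (intro mult_right_mono) auto
    ultimately show ?thesis by linarith
  qed
  have mid: "r / 4 * (lam j)\<^sup>2 \<le> bracket k \<and> bracket k \<le> 4 * R * (lam j)\<^sup>2" if j: "-1 \<le> j" "mid P j k \<noteq> 0" for j k
  proof -
    obtain i where "i \<in> {max (-1) (j - 1)..j + 1}" "phi P i k \<noteq> 0"
      using j(2) unfolding mid_def by (rule sum.not_neutral_contains_not_neutral)
    then have i: "-1 \<le> i" "j - 1 \<le> i" "i \<le> j + 1" "phi P i k \<noteq> 0" by auto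
    have b: "r * (lam i)\<^sup>2 \<le> bracket k" "bracket k \<le> R * (lam i)\<^sup>2" using phi i by blast+
    have "lam j / 2 \<le> lam i" using lam_mono[OF i(2)] by (simp add: lam_diff1)
    then have "(lam j / 2)\<^sup>2 \<le> (lam i)\<^sup>2" using lam_pos[of j] by (intro power_mono) auto
    then have "r * (lam j / 2)\<^sup>2 \<le> r * (lam i)\<^sup>2" using r by (intro mult_left_mono) auto
    moreover have "lam i \<le> lam j * 2" using lam_mono[OF i(3)] by (simp add: lam_add)
    then have "(lam i)\<^sup>2 \<le> (lam j * 2)\<^sup>2" using lam_pos[of i] by (intro power_mono) auto
    then have "R * (lam i)\<^sup>2 \<le> R * (lam j * 2)\<^sup>2" using R by (intro mult_left_mono) auto
    ultimately show ?thesis using b by (auto simp: power_divide power_mult_distrib)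
  qed
  show thesis
  proof (rule that[of "r / 4" "4 * R"])
    fix j k
    show "r / 4 * (lam j)\<^sup>2 \<le> bracket k \<and> bracket k \<le> 4 * R * (lam j)\<^sup>2" if "-1 \<le> j" "phi P j k \<noteq> 0"
    proof -
      have "r / 4 * (lam j)\<^sup>2 \<le> r * (lam j)\<^sup>2" "R * (lam j)\<^sup>2 \<le> 4 * R * (lam j)\<^sup>2"
        using r R by (auto intro!: mult_right_mono)
      then show ?thesis using phi[OF that] by linarith
    qed
    show "bracket k \<le> 4 * R * (lam j)\<^sup>2" if "low P j k \<noteq> 0"
    proof -
      have "R * (lam j)\<^sup>2 \<le> 4 * R * (lam j)\<^sup>2" using R by (auto intro!: mult_right_mono)
      then show ?thesis using low[OF that] by linarith
    qed
  qed (use r R low1 mid in auto)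
qed

text \<open>This replaces a gap between the supports. Radiality turns a point l of the support of
  one symbol into a zero -l of the other, around which the latter is quadratically small. The third
  estimate uses that 1 - \<open>mid P j\<close> vanishes on the support of
  \<open>phi P j\<close>.\<close>

lemma symbol_flatness:
  obtains B where "0 \<le> B"
    "\<And>j k l. 1 \<le> j \<Longrightarrow> phi P j l \<noteq> 0 \<Longrightarrow> low P j k \<le> B * (norm (vec_of (k + l)) / lam j)\<^sup>2"
    "\<And>j k l. 1 \<le> j \<Longrightarrow> low P j k \<noteq> 0 \<Longrightarrow> phi P j l \<le> B * (norm (vec_of (k + l)) / lam j)\<^sup>2"
    "\<And>j k l. 1 \<le> j \<Longrightarrow> phi P j l \<noteq> 0 \<Longrightarrow> 1 - mid P j k \<le> B * (norm (vec_of (k - l)) / lam j)\<^sup>2"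
proof -
  obtain B1 where B1: "smooth_bound B1 chi" "smooth_bound B1 rho" "0 \<le> B1" by (rule chi_rho_smooth)
  obtain B2 where B2: "smooth_bound B2 (mid_profile P)" "0 \<le> B2" by (rule mid_profile_smooth)
  have add: "vec_of (k + l) = vec_of k + vec_of l" for k l by (simp add: vec_of_def)
  have cr: "chi (vec_of k /\<^sub>R lam (j - 1)) * rho (vec_of k /\<^sub>R lam j) = 0" if "1 \<le> j" for j k
  proof -
    have "inverse 2 * inverse (lam j / 2) = inverse (lam j)" by (simp add: field_simps)
    then have "vec_of k /\<^sub>R lam j = (vec_of k /\<^sub>R lam (j - 1)) /\<^sub>R 2 ^ 1"
      by (simp only: lam_diff1 scaleR_scaleR power_one_right)
    then show ?thesis using chi_rho[of 1 "vec_of k /\<^sub>R lam (j - 1)"] by (simp only:)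
  qed
  have nn: "(norm (x /\<^sub>R lam j))\<^sup>2 = (norm x / lam j)\<^sup>2" for x :: plane and j
  proof -
    have "norm (x /\<^sub>R lam j) = norm x / lam j" using lam_pos[of j] by (simp add: divide_inverse)
    then show ?thesis by (simp only:)
  qed
  have a: "low P j k \<le> (4 * B1) * (norm (vec_of (k + l)) / lam j)\<^sup>2" if j: "1 \<le> j" "phi P j l \<noteq> 0" for j k l
  proof -
    have "rho (vec_of l /\<^sub>R lam j) \<noteq> 0" using j by (simp add: phi_def)
    then have "chi (vec_of l /\<^sub>R lam (j - 1)) = 0" using cr[OF j(1), of l] by simp
    then have z: "chi (- (vec_of l /\<^sub>R lam (j - 1))) = 0" using chi_radial by (metis norm_minus_cancel)
    have "low P j k \<le> B1 * (norm (vec_of k /\<^sub>R lam (j - 1) - - (vec_of l /\<^sub>R lam (j - 1))))\<^sup>2"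
      unfolding low_chi[OF j(1)] by (rule flat_at_zero[OF B1(1) chi_nonneg z])
    also have "vec_of k /\<^sub>R lam (j - 1) - - (vec_of l /\<^sub>R lam (j - 1)) = vec_of (k + l) /\<^sub>R lam (j - 1)"
      by (simp add: add scaleR_add_right)
    finally show ?thesis unfolding nn by (simp add: lam_diff1 power_mult_distrib power_divide mult_ac)
  qed
  have b: "phi P j l \<le> B1 * (norm (vec_of (k + l)) / lam j)\<^sup>2" if j: "1 \<le> j" "low P j k \<noteq> 0" for j k l
  proof -
    have "rho (vec_of k /\<^sub>R lam j) = 0" using cr[OF j(1), of k] j low_chi by simp
    then have z: "rho (- (vec_of k /\<^sub>R lam j)) = 0" using rho_radial by (metis norm_minus_cancel)
    have "rho (vec_of l /\<^sub>R lam j) \<le> B1 * (norm (vec_of l /\<^sub>R lam j - - (vec_of k /\<^sub>R lam j)))\<^sup>2"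
      by (rule flat_at_zero[OF B1(2) rho_nonneg z])
    also have "vec_of l /\<^sub>R lam j - - (vec_of k /\<^sub>R lam j) = vec_of (k + l) /\<^sub>R lam j"
      by (simp add: add scaleR_add_right)
    finally show ?thesis unfolding nn using j by (simp add: phi_def)
  qed
  have c: "1 - mid P j k \<le> (1 + B2) * (norm (vec_of (k - l)) / lam j)\<^sup>2" if j: "1 \<le> j" "phi P j l \<noteq> 0" for j k l
  proof -
    have sb: "smooth_bound (1 + B2) (\<lambda>x. 1 - mid_profile P x)"
      unfolding smooth_bound_def
    proof (intro conjI allI)
      fix x h :: plane
      have m: "\<bar>mid_profile P x\<bar> \<le> B2" "\<bar>mid_profile P (x + h) - mid_profile P x\<bar> \<le> B2 * norm h"
        "\<bar>mid_profile P (x + h) + mid_profile P (x - h) - 2 * mid_profile P x\<bar> \<le> B2 * (norm h)\<^sup>2"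
        using B2(1) unfolding smooth_bound_def by blast+
      have second: "\<bar>1 - a + (1 - b) - 2 * (1 - c)\<bar> = \<bar>a + b - 2 * c\<bar>" for a b c :: real by simp
      show "\<bar>1 - mid_profile P x\<bar> \<le> 1 + B2" using m(1) by linarith
      have "B2 * norm h \<le> (1 + B2) * norm h" "B2 * (norm h)\<^sup>2 \<le> (1 + B2) * (norm h)\<^sup>2"
        by (auto intro!: mult_right_mono)
      then show "\<bar>1 - mid_profile P (x + h) - (1 - mid_profile P x)\<bar> \<le> (1 + B2) * norm h"
        "\<bar>1 - mid_profile P (x + h) + (1 - mid_profile P (x - h)) - 2 * (1 - mid_profile P x)\<bar> \<le> (1 + B2) * (norm h)\<^sup>2"
        unfolding second using m(2,3) by linarith+
    qed
    have z: "1 - mid_profile P (vec_of l /\<^sub>R lam j) = 0"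
      using mid_eq1[of j l] j mid_mid_profile[OF j(1), of l] by simp
    have "1 - mid P j k \<le> (1 + B2) * (norm (vec_of k /\<^sub>R lam j - vec_of l /\<^sub>R lam j))\<^sup>2"
      unfolding mid_mid_profile[OF j(1)]
      by (rule flat_at_zero[OF sb _ z]) (simp add: mid_profile_le1)
    also have "vec_of k /\<^sub>R lam j - vec_of l /\<^sub>R lam j = vec_of (k - l) /\<^sub>R lam j"
      by (simp add: vec_of_diff scaleR_diff_right)
    finally show ?thesis unfolding nn .
  qed
  show thesis
  proof (rule that[of "4 * B1 + (1 + B2)"])
    fix j k l
    let ?C = "4 * B1 + (1 + B2)"
    have le: "4 * B1 * y\<^sup>2 \<le> ?C * y\<^sup>2" "B1 * y\<^sup>2 \<le> ?C * y\<^sup>2" "(1 + B2) * y\<^sup>2 \<le> ?C * y\<^sup>2" for y :: real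
      using B1(3) B2(2) by (auto intro!: mult_right_mono)
    show "low P j k \<le> ?C * (norm (vec_of (k + l)) / lam j)\<^sup>2" if "1 \<le> j" "phi P j l \<noteq> 0"
      by (rule order_trans[OF a[OF that] le(1)])
    show "phi P j l \<le> ?C * (norm (vec_of (k + l)) / lam j)\<^sup>2" if "1 \<le> j" "low P j k \<noteq> 0"
      by (rule order_trans[OF b[OF that] le(2)])
    show "1 - mid P j k \<le> ?C * (norm (vec_of (k - l)) / lam j)\<^sup>2" if "1 \<le> j" "phi P j l \<noteq> 0"
      by (rule order_trans[OF c[OF that] le(3)])
  qed (use B1 B2 in auto)
qed

end

section \<open>Products of blocks\<close>

definition weighted :: "(freq \<Rightarrow> real) \<Rightarrow> torus_dist \<Rightarrow> torus_dist" where
  "weighted a f = (\<lambda>k. of_real (a k) * f k)"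

lemma lp_block_weighted: "lp_block P j f = weighted (phi P j) f"
  by (simp add: lp_block_phi weighted_def)

lemma weighted_le1:
  assumes "sob_le s c f" "\<And>k. \<bar>a k\<bar> \<le> 1"
  shows "sob_le s c (weighted a f)"
proof (rule sob_le_smaller[OF assms(1)])
  fix k
  have "\<bar>a k\<bar> * cmod (f k) \<le> 1 * cmod (f k)" by (rule mult_right_mono[OF assms(2)]) simp
  then show "cmod (weighted a f k) \<le> cmod (f k)" by (simp add: weighted_def norm_mult)
qed

lemma powr_scale:
  fixes R x :: real
  assumes "0 < R" "0 < x"
  shows "(R * x\<^sup>2) powr s = R powr s * x powr (2 * s)"
proof -
  have "x\<^sup>2 = x powr 2" using assms by simp
  then show ?thesis using assms by (simp only: powr_mult powr_powr)
qed

lemma weighted_localized_above: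
  assumes u: "sob_le s c u" and s: "0 \<le> s" and r: "0 < r" "0 < x"
    and a: "\<And>k. \<bar>a k\<bar> \<le> 1" "\<And>k. a k \<noteq> 0 \<Longrightarrow> r * x\<^sup>2 \<le> bracket k"
  shows "sob_le 0 (r powr (- s / 2) * x powr (- s) * c) (weighted a u)"
proof (rule sob_le_localized[OF weighted_le1[OF u a(1)]])
  fix k assume "weighted a u k \<noteq> 0"
  then have "r * x\<^sup>2 \<le> bracket k" using a(2) by (auto simp: weighted_def)
  then have "bracket k powr (- s / 2) \<le> (r * x\<^sup>2) powr (- s / 2)"
    using r s by (intro powr_mono2') auto
  then show "bracket k powr ((0 - s) / 2) \<le> r powr (- s / 2) * x powr (- s)"
    using r by (simp add: powr_scale)
qed simp

lemma weighted_localized_below: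
  assumes u: "sob_le s c u" and s: "s \<le> 0" and r: "0 < r" "0 < x"
    and a: "\<And>k. \<bar>a k\<bar> \<le> 1" "\<And>k. a k \<noteq> 0 \<Longrightarrow> bracket k \<le> r * x\<^sup>2"
  shows "sob_le 0 (r powr (- s / 2) * x powr (- s) * c) (weighted a u)"
proof (rule sob_le_localized[OF weighted_le1[OF u a(1)]])
  fix k assume "weighted a u k \<noteq> 0"
  then have "bracket k \<le> r * x\<^sup>2" using a(2) by (auto simp: weighted_def)
  then have "bracket k powr (- s / 2) \<le> (r * x\<^sup>2) powr (- s / 2)"
    using bracket_pos[of k] s by (intro powr_mono2) auto
  then show "bracket k powr ((0 - s) / 2) \<le> r powr (- s / 2) * x powr (- s)"
    using r by (simp add: powr_scale)
qed simp

text \<open>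
  The hypothesis on \<open>A\<close> makes the low frequencies of the product small: for output frequencies \<open>n\<close>
  of size \<open>2\<^sup>b\<close>, only the \<open>k\<close> with \<open>A k = O((2\<^sup>b / x)\<^sup>2)\<close> contribute.
\<close>

lemma flat_product:
  assumes t: "-2 < t" and R: "1 \<le> R" and Cf: "0 \<le> Cf"
  obtains D where "0 \<le> D"
    "\<And>x A h f c G. 1 \<le> x \<Longrightarrow> (\<And>k l. h l \<noteq> 0 \<Longrightarrow> \<bar>A k\<bar> \<le> Cf * (norm (vec_of (k + l)) / x)\<^sup>2) \<Longrightarrow>
      sup_le G h \<Longrightarrow> sob_le 0 c f \<Longrightarrow>
      sob_le t (D * x powr t * G * c) (\<lambda>n. if bracket n \<le> R * x\<^sup>2 then mult (weighted A f) h n else 0)"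
proof -
  define Q where "Q = max 1 (2 powr t)"
  \<comment> \<open>Ratio of the geometric sum over shells: 4 from the flatness of A times 2^t from
    the weight. It exceeds 1 because -2 < t, so the largest shell dominates.\<close>
  define y where "y = 2 powr (t + 2)"
  define D where "D = 4 * Q * Cf * (y / (y - 1)) * R powr ((t + 2) / 2)"
  have y: "1 < y" using t by (simp add: y_def)
  have Q: "1 \<le> Q" by (simp add: Q_def)
  have D: "0 \<le> D" using y Q Cf by (simp add: D_def)
  show thesis
  proof (rule that[OF D])
    fix x :: real and A h f and c G :: real
    assume x: "1 \<le> x" and A: "\<And>k l. h l \<noteq> 0 \<Longrightarrow> \<bar>A k\<bar> \<le> Cf * (norm (vec_of (k + l)) / x)\<^sup>2"
      and h: "sup_le G h" and f: "sob_le 0 c f"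
    let ?F = "\<lambda>n. if bracket n \<le> R * x\<^sup>2 then mult (weighted A f) h n else 0"
    \<comment> \<open>Output frequencies of size about 2^b; powers of 4 appear because
      \<open>bracket\<close> is quadratic.\<close>
    define shell where "shell = (\<lambda>b::nat. {n. 4 ^ b \<le> bracket n \<and> bracket n < 4 ^ (b + 1)})"
    have Rx: "1 \<le> R * x\<^sup>2" using R x by (metis mult_mono' mult_1 one_le_power zero_le_one)
    have fl: "\<exists>b::nat. 4 ^ b \<le> z \<and> z < 4 ^ (b + 1)" if z: "1 \<le> z" for z :: real
    proof
      have "0 \<le> log 4 z" using z by simp
      then have n: "real (nat \<lfloor>log 4 z\<rfloor>) \<le> log 4 z" "log 4 z < real (nat \<lfloor>log 4 z\<rfloor> + 1)" by linarith+
      then have "4 powr real (nat \<lfloor>log 4 z\<rfloor>) \<le> z" "z < 4 powr real (nat \<lfloor>log 4 z\<rfloor> + 1)"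
        using z le_log_iff[THEN iffD1, OF _ _ n(1)] log_less_iff[THEN iffD1, OF _ _ n(2)] by simp_all
      then show "4 ^ nat \<lfloor>log 4 z\<rfloor> \<le> z \<and> z < 4 ^ (nat \<lfloor>log 4 z\<rfloor> + 1)"
        by (simp only: powr_realpow[of 4, simplified])
    qed
    obtain B where B: "4 ^ B \<le> R * x\<^sup>2" "R * x\<^sup>2 < 4 ^ (B + 1)" using fl[OF Rx] by blast
    have S: "finite {l. h l \<noteq> 0}" using h by (simp add: sup_le_def)
    have mf: "mult u h n = (\<Sum>l\<in>{l. h l \<noteq> 0}. u (n - l) * h l)" for u n
      by (rule mult_finite_right[OF S]) auto
    have G: "0 \<le> G" using h by (rule sup_le_nonneg)
    have c: "0 \<le> c" using f by (rule sob_le_nonneg)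
    define Fb where "Fb = (\<lambda>b n. if n \<in> shell b then ?F n else 0)"
    have Fb: "sob_le t (Q * 2 powr (t * real b) * (G * (Cf * 4 ^ (b + 1) / x\<^sup>2 * c))) (Fb b)" for b
    proof -
      \<comment> \<open>The only frequencies of f that reach this shell through h; on them A is of
        order 4^b / x^2.\<close>
      define Z where "Z = {k. \<bar>A k\<bar> \<le> Cf * 4 ^ (b + 1) / x\<^sup>2}"
      define g where "g = (\<lambda>k. if k \<in> Z then of_real (A k) * f k else 0)"
      have g: "sob_le 0 (Cf * 4 ^ (b + 1) / x\<^sup>2 * c) g"
      proof (rule sob_le_dominated[OF f])
        fix k
        have "cmod (g k) \<le> Cf * 4 ^ (b + 1) / x\<^sup>2 * cmod (f k)"
          using Cf by (auto simp: g_def Z_def norm_mult simp del: times_divide_eq_left intro!: mult_right_mono)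
        then show "bracket k powr (0 / 2) * cmod (g k) \<le> Cf * 4 ^ (b + 1) / x\<^sup>2 * (bracket k powr (0 / 2) * cmod (f k))"
          using bracket_pos[of k] by simp
      qed (use Cf in simp)
      have m: "sob_le 0 (G * (Cf * 4 ^ (b + 1) / x\<^sup>2 * c)) (mult g h)" by (rule mult_sup_bound[OF h g])
      have eq: "mult (weighted A f) h n = mult g h n" if n: "n \<in> shell b" for n
        unfolding mf
      proof (rule sum.cong[OF refl])
        fix l assume l: "l \<in> {l. h l \<noteq> 0}"
        have "\<bar>A (n - l)\<bar> \<le> Cf * (norm (vec_of (n - l + l)) / x)\<^sup>2" using A l by blast
        also have "\<dots> = Cf * ((norm (vec_of n))\<^sup>2 / x\<^sup>2)" by (simp add: power_divide)
        also have "\<dots> \<le> Cf * (4 ^ (b + 1) / x\<^sup>2)"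
          using bracket_ge_norm[of n] n Cf by (intro mult_left_mono divide_right_mono) (auto simp: shell_def)
        finally have "n - l \<in> Z" by (simp add: Z_def)
        then show "weighted A f (n - l) * h l = g (n - l) * h l" by (simp add: g_def weighted_def)
      qed
      have "sob_le 0 (G * (Cf * 4 ^ (b + 1) / x\<^sup>2 * c)) (Fb b)"
        by (rule sob_le_smaller[OF m]) (simp add: Fb_def eq)
      then show ?thesis
      proof (rule sob_le_localized)
        fix n assume "Fb b n \<noteq> 0"
        then have n: "4 ^ b \<le> bracket n" "bracket n \<le> 4 ^ (b + 1)" by (auto simp: Fb_def shell_def split: if_splits)
        have p: "(4 ^ m) powr (t / 2) = 2 powr (t * real m)" for m :: nat
        proof -
          have "(4::real) ^ m = 2 powr (2 * real m)" by (simp add: powr_mult powr_powr[symmetric] powr_realpow)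
          then show ?thesis by (simp only: powr_powr) (simp add: mult.commute)
        qed
        show "bracket n powr ((t - 0) / 2) \<le> Q * 2 powr (t * real b)"
        proof (cases "0 \<le> t")
          case True
          have "bracket n powr (t / 2) \<le> (4 ^ (b + 1)) powr (t / 2)"
            using n True bracket_pos[of n] by (intro powr_mono2) auto
          also have "\<dots> = 2 powr t * 2 powr (t * real b)"
            unfolding p by (simp add: powr_add[symmetric] algebra_simps)
          also have "\<dots> \<le> Q * 2 powr (t * real b)" by (intro mult_right_mono) (auto simp: Q_def)
          finally show ?thesis by simp
        next
          case False
          have "bracket n powr (t / 2) \<le> (4 ^ b) powr (t / 2)"
            using n False by (intro powr_mono2') auto
          also have "\<dots> = 1 * 2 powr (t * real b)" unfolding p by simp
          also have "\<dots> \<le> Q * 2 powr (t * real b)" by (intro mult_right_mono) (auto simp: Q_def)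
          finally show ?thesis by simp
        qed
      qed (use Q in simp)
    qed
    have sum: "?F n = (\<Sum>b\<le>B. Fb b n)" for n
    proof (cases "bracket n \<le> R * x\<^sup>2")
      case True
      obtain b where b: "4 ^ b \<le> bracket n" "bracket n < 4 ^ (b + 1)" using fl[OF bracket_ge1[of n]] by blast
      have uniq: "n \<in> shell b' \<longleftrightarrow> b' = b" for b'
      proof
        assume "n \<in> shell b'"
        then have "(4::real) ^ b' < 4 ^ (b + 1)" "(4::real) ^ b < 4 ^ (b' + 1)" using b by (auto simp: shell_def)
        then have "b' < b + 1" "b < b' + 1" by (auto simp only: power_strict_increasing_iff one_less_numeral_iff semiring_norm)
        then show "b' = b" by simp
      qed (use b in \<open>auto simp: shell_def\<close>)
      have "(4::real) ^ b < 4 ^ (B + 1)" using b True B by linarith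
      then have "b < B + 1" by (auto simp only: power_strict_increasing_iff one_less_numeral_iff semiring_norm)
      then have "(\<Sum>b'\<le>B. Fb b' n) = Fb b n"
        unfolding Fb_def uniq by (simp add: sum.delta)
      then show ?thesis by (simp add: Fb_def uniq)
    qed (simp add: Fb_def)
    have "sob_le t (\<Sum>b\<le>B. Q * 2 powr (t * real b) * (G * (Cf * 4 ^ (b + 1) / x\<^sup>2 * c))) ?F"
      unfolding sum by (rule sob_le_sum[OF Fb])
    then show "sob_le t (D * x powr t * G * c) ?F"
    proof (rule sob_le_mono)
      have four: "2 powr (t * real b) * 4 ^ b = y ^ b" for b :: nat
      proof -
        have "y = 2 powr t * 4" by (simp add: y_def powr_add)
        then have "y ^ b = (2 powr t) ^ b * 4 ^ b" by (simp only: power_mult_distrib)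
        moreover have "(2 powr t) ^ b = 2 powr (t * real b)" by (simp add: powr_powr flip: powr_realpow)
        ultimately show ?thesis by simp
      qed
      have "(\<Sum>b\<le>B. y ^ b) = (y ^ (B + 1) - 1) / (y - 1)"
        using geometric_sum[of y "B + 1"] y by (simp add: lessThan_Suc_atMost)
      also have "\<dots> \<le> y ^ (B + 1) / (y - 1)" using y by (intro divide_right_mono) auto
      also have "\<dots> = y / (y - 1) * y ^ B" by simp
      also have "y ^ B = (4 ^ B) powr ((t + 2) / 2)"
      proof -
        have "(4::real) ^ B = 2 powr (2 * real B)" by (simp add: powr_powr[symmetric] powr_realpow)
        moreover have "y ^ B = 2 powr ((t + 2) * real B)" by (simp add: y_def powr_powr flip: powr_realpow)
        ultimately show ?thesis by (simp only: powr_powr) (simp add: mult.commute)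
      qed
      also have "y / (y - 1) * (4 ^ B) powr ((t + 2) / 2) \<le> y / (y - 1) * (R * x\<^sup>2) powr ((t + 2) / 2)"
        using B(1) t y by (intro mult_left_mono powr_mono2) auto
      also have "(R * x\<^sup>2) powr ((t + 2) / 2) = R powr ((t + 2) / 2) * x powr (t + 2)"
      proof -
        have e: "2 * ((t + 2) / 2) = t + 2" by simp
        show ?thesis using powr_scale[of R x "(t + 2) / 2"] R x unfolding e by simp
      qed
      also have "x powr (t + 2) = x powr t * x\<^sup>2" using x by (simp add: powr_add)
      finally have geo: "(\<Sum>b\<le>B. y ^ b) \<le> y / (y - 1) * (R powr ((t + 2) / 2) * (x powr t * x\<^sup>2))" .
      let ?E = "4 * Q * G * Cf * c / x\<^sup>2"
      have "(\<Sum>b\<le>B. Q * 2 powr (t * real b) * (G * (Cf * 4 ^ (b + 1) / x\<^sup>2 * c))) = ?E * (\<Sum>b\<le>B. y ^ b)"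
        unfolding sum_distrib_left by (rule sum.cong) (simp_all add: four[symmetric])
      also have "\<dots> \<le> ?E * (y / (y - 1) * (R powr ((t + 2) / 2) * (x powr t * x\<^sup>2)))"
        using geo Q G Cf c by (intro mult_left_mono) auto
      also have "\<dots> = D * x powr t * G * c" using x by (simp add: D_def)
      finally show "(\<Sum>b\<le>B. Q * 2 powr (t * real b) * (G * (Cf * 4 ^ (b + 1) / x\<^sup>2 * c))) \<le> D * x powr t * G * c" .
    qed
  qed
qed

lemma bracket_add: "bracket (k + l) \<le> 2 * (bracket k + bracket l)"
proof -
  have "(norm (vec_of (k + l)))\<^sup>2 \<le> (norm (vec_of k) + norm (vec_of l))\<^sup>2"
    by (intro power_mono) (auto simp: vec_of_def norm_triangle_ineq intro: norm_triangle_ineq[of "vec_of k" "vec_of l", unfolded vec_of_def, simplified])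
  also have "\<dots> \<le> 2 * (norm (vec_of k))\<^sup>2 + 2 * (norm (vec_of l))\<^sup>2"
    using zero_le_power2[of "norm (vec_of k) - norm (vec_of l)"] by (simp add: power2_eq_square algebra_simps)
  finally have "4 * pi\<^sup>2 * (norm (vec_of (k + l)))\<^sup>2
      \<le> 4 * pi\<^sup>2 * (2 * (norm (vec_of k))\<^sup>2 + 2 * (norm (vec_of l))\<^sup>2)" by (intro mult_left_mono) auto
  then show ?thesis by (simp add: bracket_def algebra_simps)
qed

lemma bracket_uminus: "bracket (- k) = bracket k"
  by (simp add: bracket_def vec_of_uminus)

lemma mult_nonzero:
  assumes "mult f g n \<noteq> 0"
  obtains k where "f k \<noteq> 0" "g (n - k) \<noteq> 0"
proof -
  have "\<exists>k. f k * g (n - k) \<noteq> 0"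
  proof (rule ccontr)
    assume "\<not> ?thesis"
    then have "f k * g (n - k) = 0" for k by blast
    then have "mult f g n = 0" unfolding mult_def by (simp only: infsum_0_simp)
    then show False using assms by simp
  qed
  then show thesis using that by auto
qed

lemma lam_powr_diff: "lam j powr (t - a) = lam j powr t * lam j powr (- a)"
  by (simp flip: powr_add)

context dyadic_blocks
begin

text \<open>For a \<le> 0 the L^2 norm of the truncated factor is worst at its top frequency, which
  produces lam j powr (- a); flatness of the low cut-off handles the low outputs.\<close>

lemma low_high_block:
  assumes t: "-2 < t" and a: "a \<le> 0"
  obtains D where "0 \<le> D" "\<And>j u g c G. 1 \<le> j \<Longrightarrow> sob_le a c u \<Longrightarrow> sup_le G (lp_block P j g) \<Longrightarrow>
    sob_le t (D * lam j powr (t - a) * G * c) (mult (weighted (low P j) u) (lp_block P j g))"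
proof -
  obtain r R where rR: "0 < r" "1 \<le> R"
    "\<And>j k. -1 \<le> j \<Longrightarrow> phi P j k \<noteq> 0 \<Longrightarrow> r * (lam j)\<^sup>2 \<le> bracket k \<and> bracket k \<le> R * (lam j)\<^sup>2"
    "\<And>j k. low P j k \<noteq> 0 \<Longrightarrow> bracket k \<le> R * (lam j)\<^sup>2"
    by (rule symbol_supports) (rule that; blast)
  obtain B where B: "0 \<le> B"
    "\<And>j k l. 1 \<le> j \<Longrightarrow> phi P j l \<noteq> 0 \<Longrightarrow> low P j k \<le> B * (norm (vec_of (k + l)) / lam j)\<^sup>2"
    by (rule symbol_flatness) (rule that; blast)
  \<comment> \<open>Both factors have \<open>bracket\<close> at most R * (lam j)^2, so by
    \<open>bracket_add\<close> the output stays below 4 * R * (lam j)^2 and the restriction in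
    \<open>flat_product\<close> cuts nothing.\<close>
  have R4: "1 \<le> 4 * R" using rR(2) by simp
  obtain D where D: "0 \<le> D"
    "\<And>x A h f c G. 1 \<le> x \<Longrightarrow> (\<And>k l. h l \<noteq> 0 \<Longrightarrow> \<bar>A k\<bar> \<le> B * (norm (vec_of (k + l)) / x)\<^sup>2) \<Longrightarrow>
      sup_le G h \<Longrightarrow> sob_le 0 c f \<Longrightarrow>
      sob_le t (D * x powr t * G * c) (\<lambda>n. if bracket n \<le> (4 * R) * x\<^sup>2 then mult (weighted A f) h n else 0)"
    by (rule flat_product[OF t R4 B(1)]) (rule that; blast)
  show thesis
  proof (rule that[of "D * R powr (- a / 2)"])
    show "0 \<le> D * R powr (- a / 2)" using D(1) by simp
    fix j u g c G assume j: "1 \<le> j" and u: "sob_le a c u" and g: "sup_le G (lp_block P j g)"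
    have lam1: "1 \<le> lam j" using lam_ge1[of j] j by simp
    let ?h = "lp_block P j g" and ?f = "weighted (\<lambda>k. if low P j k \<noteq> 0 then 1 else 0) u"
    have hnz: "phi P j l \<noteq> 0" if "?h l \<noteq> 0" for l using that by (auto simp: lp_block_weighted weighted_def)
    have f: "sob_le 0 (R powr (- a / 2) * lam j powr (- a) * c) ?f"
      by (rule weighted_localized_below[OF u a]) (use rR lam_pos[of j] in \<open>auto split: if_splits\<close>)
    have A: "\<bar>low P j k\<bar> \<le> B * (norm (vec_of (k + l)) / lam j)\<^sup>2" if "?h l \<noteq> 0" for k l
      using B(2)[OF j hnz[OF that]] low_bounds(1)[of j k] by simp
    have main: "sob_le t (D * lam j powr t * G * (R powr (- a / 2) * lam j powr (- a) * c))
        (\<lambda>n. if bracket n \<le> (4 * R) * (lam j)\<^sup>2 then mult (weighted (low P j) ?f) ?h n else 0)"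
      by (rule D(2)[OF lam1 A g f])
    have wf: "weighted (low P j) ?f = weighted (low P j) u" by (auto simp: weighted_def fun_eq_iff)
    have out: "bracket n \<le> (4 * R) * (lam j)\<^sup>2" if nz: "mult (weighted (low P j) u) ?h n \<noteq> 0" for n
    proof -
      obtain k where k: "weighted (low P j) u k \<noteq> 0" "?h (n - k) \<noteq> 0" by (rule mult_nonzero[OF nz])
      then have "bracket k \<le> R * (lam j)\<^sup>2" using rR(4)[of j k] by (auto simp: weighted_def)
      moreover have "bracket (n - k) \<le> R * (lam j)\<^sup>2" using rR(3)[of j "n - k"] hnz[OF k(2)] j by auto
      ultimately show ?thesis using bracket_add[of k "n - k"] by simp
    qed
    have "(\<lambda>n. if bracket n \<le> (4 * R) * (lam j)\<^sup>2 then mult (weighted (low P j) ?f) ?h n else 0)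
        = mult (weighted (low P j) u) ?h"
      unfolding wf using out by (auto simp: fun_eq_iff)
    then show "sob_le t (D * R powr (- a / 2) * lam j powr (t - a) * G * c) (mult (weighted (low P j) u) ?h)"
      using main unfolding lam_powr_diff by (simp only: mult_ac)
  qed
qed

text \<open>On a band the weight is comparable to a power of x from both sides, so a may have either
  sign.\<close>

lemma weighted_localized_band:
  assumes r: "0 < r" "0 < R"
  obtains D where "0 \<le> D" "\<And>x w c u. 0 < x \<Longrightarrow> sob_le a c u \<Longrightarrow> (\<And>k. \<bar>w k\<bar> \<le> 1) \<Longrightarrow>
    (\<And>k. w k \<noteq> 0 \<Longrightarrow> r * x\<^sup>2 \<le> bracket k \<and> bracket k \<le> R * x\<^sup>2) \<Longrightarrow>
    sob_le 0 (D * x powr (- a) * c) (weighted w u)"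
proof (cases "0 \<le> a")
  case True
  show thesis
    by (rule that[of "r powr (- a / 2)"]) (use weighted_localized_above[OF _ True r(1)] in auto)
next
  case False
  show thesis
    by (rule that[of "R powr (- a / 2)"]) (use weighted_localized_below[OF _ _ r(2)] False in auto)
qed

text \<open>The mechanism of \<open>low_high_block\<close> with exchanged roles: the block symbol is
  quadratically small near -l for l in the spectrum of the truncated factor. As u is localized in a
  band, its order a is arbitrary.\<close>

lemma high_low_block:
  assumes t: "-2 < t"
  obtains D where "0 \<le> D" "\<And>j u g c G. 1 \<le> j \<Longrightarrow> sob_le a c u \<Longrightarrow> sup_le G (weighted (low P j) g) \<Longrightarrow>
    sob_le t (D * lam j powr (t - a) * G * c) (mult (lp_block P j u) (weighted (low P j) g))"
proof -
  obtain r R where rR: "0 < r" "1 \<le> R"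
    "\<And>j k. -1 \<le> j \<Longrightarrow> phi P j k \<noteq> 0 \<Longrightarrow> r * (lam j)\<^sup>2 \<le> bracket k \<and> bracket k \<le> R * (lam j)\<^sup>2"
    "\<And>j k. low P j k \<noteq> 0 \<Longrightarrow> bracket k \<le> R * (lam j)\<^sup>2"
    by (rule symbol_supports) (rule that; blast)
  obtain B where B: "0 \<le> B"
    "\<And>j k l. 1 \<le> j \<Longrightarrow> low P j k \<noteq> 0 \<Longrightarrow> phi P j l \<le> B * (norm (vec_of (k + l)) / lam j)\<^sup>2"
    by (rule symbol_flatness) (rule that; blast)
  have R4: "1 \<le> 4 * R" and R0: "0 < R" using rR(2) by simp_all
  obtain D where D: "0 \<le> D"
    "\<And>x A h f c G. 1 \<le> x \<Longrightarrow> (\<And>k l. h l \<noteq> 0 \<Longrightarrow> \<bar>A k\<bar> \<le> B * (norm (vec_of (k + l)) / x)\<^sup>2) \<Longrightarrow>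
      sup_le G h \<Longrightarrow> sob_le 0 c f \<Longrightarrow>
      sob_le t (D * x powr t * G * c) (\<lambda>n. if bracket n \<le> (4 * R) * x\<^sup>2 then mult (weighted A f) h n else 0)"
    by (rule flat_product[OF t R4 B(1)]) (rule that; blast)
  obtain E where E: "0 \<le> E" "\<And>x w c u. 0 < x \<Longrightarrow> sob_le a c u \<Longrightarrow> (\<And>k. \<bar>w k\<bar> \<le> 1) \<Longrightarrow>
    (\<And>k. w k \<noteq> 0 \<Longrightarrow> r * x\<^sup>2 \<le> bracket k \<and> bracket k \<le> R * x\<^sup>2) \<Longrightarrow>
    sob_le 0 (E * x powr (- a) * c) (weighted w u)"
    by (rule weighted_localized_band[OF rR(1) R0]) (rule that; blast)
  show thesis
  proof (rule that[of "D * E"])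
    show "0 \<le> D * E" using D(1) E(1) by simp
    fix j u g c G assume j: "1 \<le> j" and u: "sob_le a c u" and g: "sup_le G (weighted (low P j) g)"
    have lam1: "1 \<le> lam j" using lam_ge1[of j] j by simp
    let ?h = "weighted (low P j) g" and ?f = "weighted (\<lambda>k. if phi P j k \<noteq> 0 then 1 else 0) u"
    have hnz: "low P j l \<noteq> 0" if "?h l \<noteq> 0" for l using that by (auto simp: weighted_def)
    have f: "sob_le 0 (E * lam j powr (- a) * c) ?f"
      by (rule E(2)[OF lam_pos u]) (use rR(3)[of j] j in \<open>auto split: if_splits\<close>)
    have A: "\<bar>phi P j k\<bar> \<le> B * (norm (vec_of (k + l)) / lam j)\<^sup>2" if "?h l \<noteq> 0" for k l
      using B(2)[OF j hnz[OF that], of k] phi_nonneg[of j k] by (simp add: add.commute)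
    have main: "sob_le t (D * lam j powr t * G * (E * lam j powr (- a) * c))
        (\<lambda>n. if bracket n \<le> (4 * R) * (lam j)\<^sup>2 then mult (weighted (phi P j) ?f) ?h n else 0)"
      by (rule D(2)[OF lam1 A g f])
    have wf: "weighted (phi P j) ?f = lp_block P j u" by (auto simp: weighted_def lp_block_phi fun_eq_iff)
    have out: "bracket n \<le> (4 * R) * (lam j)\<^sup>2" if nz: "mult (lp_block P j u) ?h n \<noteq> 0" for n
    proof -
      obtain k where k: "lp_block P j u k \<noteq> 0" "?h (n - k) \<noteq> 0" by (rule mult_nonzero[OF nz])
      then have "bracket k \<le> R * (lam j)\<^sup>2" using rR(3)[of j k] j by (auto simp: lp_block_phi)
      moreover have "bracket (n - k) \<le> R * (lam j)\<^sup>2" using rR(4) hnz[OF k(2)] by auto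
      ultimately show ?thesis using bracket_add[of k "n - k"] by simp
    qed
    have "(\<lambda>n. if bracket n \<le> (4 * R) * (lam j)\<^sup>2 then mult (weighted (phi P j) ?f) ?h n else 0)
        = mult (lp_block P j u) ?h"
      unfolding wf using out by (auto simp: fun_eq_iff)
    then show "sob_le t (D * E * lam j powr (t - a) * G * c) (mult (lp_block P j u) ?h)"
      using main unfolding lam_powr_diff by (simp only: mult_ac)
  qed
qed

text \<open>Two factors of comparable frequency can produce any lower frequency; there is no
  flatness to exploit and the bound is in L^2.\<close>

lemma resonant_block:
  obtains D where "0 \<le> D" "\<And>j u g c G. -1 \<le> j \<Longrightarrow> sob_le a c u \<Longrightarrow> sup_le G (lp_block P j g) \<Longrightarrow>
    sob_le 0 (D * lam j powr (- a) * G * c) (mult (weighted (mid P j) u) (lp_block P j g))"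
proof -
  obtain r R where rR: "0 < r" "1 \<le> R"
    "\<And>j k. -1 \<le> j \<Longrightarrow> mid P j k \<noteq> 0 \<Longrightarrow> r * (lam j)\<^sup>2 \<le> bracket k \<and> bracket k \<le> R * (lam j)\<^sup>2"
    by (rule symbol_supports) (rule that; blast)
  have R0: "0 < R" using rR(2) by simp
  obtain E where E: "0 \<le> E" "\<And>x w c u. 0 < x \<Longrightarrow> sob_le a c u \<Longrightarrow> (\<And>k. \<bar>w k\<bar> \<le> 1) \<Longrightarrow>
    (\<And>k. w k \<noteq> 0 \<Longrightarrow> r * x\<^sup>2 \<le> bracket k \<and> bracket k \<le> R * x\<^sup>2) \<Longrightarrow>
    sob_le 0 (E * x powr (- a) * c) (weighted w u)"
    by (rule weighted_localized_band[OF rR(1) R0]) (rule that; blast)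
  show thesis
  proof (rule that[OF E(1)])
    fix j u g c G assume j: "-1 \<le> j" and u: "sob_le a c u" and g: "sup_le G (lp_block P j g)"
    have "sob_le 0 (E * lam j powr (- a) * c) (weighted (mid P j) u)"
      by (rule E(2)[OF lam_pos u]) (use rR(3)[OF j] mid_bounds in auto)
    from mult_sup_bound[OF g this]
    show "sob_le 0 (E * lam j powr (- a) * G * c) (mult (weighted (mid P j) u) (lp_block P j g))"
      by (simp add: mult_ac)
  qed
qed

text \<open>The symbol 1 - \<open>low P j\<close> lives at frequencies at least of order 2^j, so
  nonnegative regularity of u turns into the factor lam j powr (- a).\<close>

lemma complement_block:
  assumes a: "0 \<le> a"
  obtains D where "0 \<le> D" "\<And>j u c. -1 \<le> j \<Longrightarrow> sob_le a c u \<Longrightarrow>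
      sob_le 0 (D * lam j powr (- a) * c) (weighted (\<lambda>k. 1 - low P j k) u)"
    "\<And>j u g c G. -1 \<le> j \<Longrightarrow> sob_le a c u \<Longrightarrow> sup_le G (lp_block P j g) \<Longrightarrow>
      sob_le 0 (D * lam j powr (- a) * G * c) (mult (weighted (\<lambda>k. 1 - low P j k) u) (lp_block P j g))"
proof -
  obtain r where r: "0 < r"
    "\<And>j k. -1 \<le> j \<Longrightarrow> low P j k \<noteq> 1 \<Longrightarrow> r * (lam j)\<^sup>2 \<le> bracket k"
    by (rule symbol_supports) (rule that; blast)
  have one: "sob_le 0 (r powr (- a / 2) * lam j powr (- a) * c) (weighted (\<lambda>k. 1 - low P j k) u)"
    if j: "-1 \<le> j" and u: "sob_le a c u" for j u c
    by (rule weighted_localized_above[OF u a r(1) lam_pos])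
       (use r(2)[OF j] low_bounds in \<open>auto simp: abs_le_iff intro: order_trans[OF low_bounds(2)]\<close>)
  show thesis
  proof (rule that[OF _ one])
    fix j u g c G assume j: "-1 \<le> j" and u: "sob_le a c u" and g: "sup_le G (lp_block P j g)"
    from mult_sup_bound[OF g one[OF j u]]
    show "sob_le 0 (r powr (- a / 2) * lam j powr (- a) * G * c) (mult (weighted (\<lambda>k. 1 - low P j k) u) (lp_block P j g))"
      by (simp add: mult_ac)
  qed simp
qed

text \<open>If the output is much lower than 2^j, the frequency of u nearly cancels one of the
  block, and there 1 - \<open>mid P j\<close> is quadratically small. The restriction on outputs
  matches the region where \<open>low P j\<close> is 1.\<close>

lemma mid_complement_block:
  assumes t: "-2 < t" and a: "0 \<le> a"
  obtains r D where "0 < r" "0 \<le> D" "\<And>j k. 1 \<le> j \<Longrightarrow> bracket k \<le> r * (lam j)\<^sup>2 \<Longrightarrow> low P j k = 1"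
    "\<And>j u g c G. 1 \<le> j \<Longrightarrow> sob_le a c u \<Longrightarrow> sup_le G (lp_block P j g) \<Longrightarrow>
    sob_le t (D * lam j powr (t - a) * G * c)
      (\<lambda>n. if bracket n \<le> r * (lam j)\<^sup>2 then mult (weighted (\<lambda>k. 1 - mid P j k) u) (lp_block P j g) n else 0)"
proof -
  obtain r where r: "0 < r"
    "\<And>j k. -1 \<le> j \<Longrightarrow> phi P j k \<noteq> 0 \<Longrightarrow> r * (lam j)\<^sup>2 \<le> bracket k"
    "\<And>j k. -1 \<le> j \<Longrightarrow> low P j k \<noteq> 1 \<Longrightarrow> r * (lam j)\<^sup>2 \<le> bracket k"
    by (rule symbol_supports) (rule that; blast)
  obtain B where B: "0 \<le> B"
    "\<And>j k l. 1 \<le> j \<Longrightarrow> phi P j l \<noteq> 0 \<Longrightarrow> 1 - mid P j k \<le> B * (norm (vec_of (k - l)) / lam j)\<^sup>2"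
    by (rule symbol_flatness) (rule that; blast)
  \<comment> \<open>From r * (lam j)^2 \<le> 2 * (bracket n + bracket k) and bracket n \<le> q *
    (lam j)^2 follows bracket k \<ge> q * (lam j)^2.\<close>
  define q where "q = r / 4"
  have q: "0 < q" using r by (simp add: q_def)
  have R1: "1 \<le> max 1 q" by simp
  obtain D where D: "0 \<le> D"
    "\<And>x A h f c G. 1 \<le> x \<Longrightarrow> (\<And>k l. h l \<noteq> 0 \<Longrightarrow> \<bar>A k\<bar> \<le> B * (norm (vec_of (k + l)) / x)\<^sup>2) \<Longrightarrow>
      sup_le G h \<Longrightarrow> sob_le 0 c f \<Longrightarrow>
      sob_le t (D * x powr t * G * c) (\<lambda>n. if bracket n \<le> max 1 q * x\<^sup>2 then mult (weighted A f) h n else 0)"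
    by (rule flat_product[OF t R1 B(1)]) (rule that; blast)
  show thesis
  proof (rule that[of q "D * q powr (- a / 2)"])
    show "0 < q" "0 \<le> D * q powr (- a / 2)" using q D(1) by simp_all
    show "low P j k = 1" if "1 \<le> j" "bracket k \<le> q * (lam j)\<^sup>2" for j k
    proof (rule ccontr)
      assume "low P j k \<noteq> 1"
      then have "r * (lam j)\<^sup>2 \<le> bracket k" using r(3)[of j k] that(1) by simp
      moreover have "q * (lam j)\<^sup>2 < r * (lam j)\<^sup>2" using r(1) lam_pos[of j] by (simp add: q_def)
      ultimately show False using that(2) by linarith
    qed
    fix j u g c G assume j: "1 \<le> j" and u: "sob_le a c u" and g: "sup_le G (lp_block P j g)"
    have lam1: "1 \<le> lam j" using lam_ge1[of j] j by simp
    let ?h = "lp_block P j g" and ?f = "weighted (\<lambda>k. if q * (lam j)\<^sup>2 \<le> bracket k then 1 else 0) u"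
    let ?A = "\<lambda>k. 1 - mid P j k"
    have hnz: "phi P j l \<noteq> 0" if "?h l \<noteq> 0" for l using that by (auto simp: lp_block_weighted weighted_def)
    have f: "sob_le 0 (q powr (- a / 2) * lam j powr (- a) * c) ?f"
      by (rule weighted_localized_above[OF u a q lam_pos]) (auto split: if_splits)
    have A: "\<bar>?A k\<bar> \<le> B * (norm (vec_of (k + l)) / lam j)\<^sup>2" if "?h l \<noteq> 0" for k l
    proof -
      have "phi P j (- l) = phi P j l"
        using chi_radial[of "vec_of (- l)" "vec_of l"] rho_radial[of "vec_of (- l) /\<^sub>R lam j" "vec_of l /\<^sub>R lam j"]
        by (simp add: phi_def vec_of_uminus)
      then have "phi P j (- l) \<noteq> 0" using hnz[OF that] by simp
      from B(2)[OF j this, of k] show ?thesis using mid_bounds(2)[of j k] by simp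
    qed
    have main: "sob_le t (D * lam j powr t * G * (q powr (- a / 2) * lam j powr (- a) * c))
        (\<lambda>n. if bracket n \<le> max 1 q * (lam j)\<^sup>2 then mult (weighted ?A ?f) ?h n else 0)"
      by (rule D(2)[OF lam1 A g f])
    have eq: "mult (weighted ?A u) ?h n = mult (weighted ?A ?f) ?h n" if n: "bracket n \<le> q * (lam j)\<^sup>2" for n
      unfolding mult_def
    proof (rule infsum_cong)
      fix k
      show "weighted ?A u k * ?h (n - k) = weighted ?A ?f k * ?h (n - k)"
      proof (cases "?h (n - k) = 0")
        case False
        then have "r * (lam j)\<^sup>2 \<le> bracket (n - k)" using r(2)[of j "n - k"] hnz j by simp
        also have "\<dots> \<le> 2 * (bracket n + bracket k)" using bracket_add[of n "- k"] by (simp add: bracket_uminus)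
        finally have "q * (lam j)\<^sup>2 \<le> bracket k" using n by (simp add: q_def)
        then show ?thesis by (simp add: weighted_def)
      qed simp
    qed
    have "sob_le t (D * lam j powr t * G * (q powr (- a / 2) * lam j powr (- a) * c))
        (\<lambda>n. if bracket n \<le> q * (lam j)\<^sup>2 then mult (weighted ?A u) ?h n else 0)"
    proof (rule sob_le_smaller[OF main])
      fix n
      have "q * (lam j)\<^sup>2 \<le> max 1 q * (lam j)\<^sup>2" by (intro mult_right_mono) auto
      then show "cmod (if bracket n \<le> q * (lam j)\<^sup>2 then mult (weighted ?A u) ?h n else 0)
          \<le> cmod (if bracket n \<le> max 1 q * (lam j)\<^sup>2 then mult (weighted ?A ?f) ?h n else 0)"
        using eq[of n] by auto
    qed
    then show "sob_le t (D * q powr (- a / 2) * lam j powr (t - a) * G * c)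
        (\<lambda>n. if bracket n \<le> q * (lam j)\<^sup>2 then mult (weighted ?A u) ?h n else 0)"
      unfolding lam_powr_diff by (simp only: mult_ac)
  qed
qed

end

section \<open>Paraproducts and resonant products\<close>

lemma eval_at_add:
  assumes "finite {k. f k \<noteq> 0}" "finite {k. g k \<noteq> 0}"
  shows "eval_at (\<lambda>k. f k + g k) x = eval_at f x + eval_at g x"
proof -
  let ?S = "{k. f k \<noteq> 0} \<union> {k. g k \<noteq> 0}"
  have S: "finite ?S" using assms by simp
  have "eval_at (\<lambda>k. f k + g k) x = (\<Sum>k\<in>?S. (f k + g k) * char_at k x)"
    by (rule eval_at_finite[OF S]) auto
  moreover have "eval_at f x = (\<Sum>k\<in>?S. f k * char_at k x)" by (rule eval_at_finite[OF S]) auto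
  moreover have "eval_at g x = (\<Sum>k\<in>?S. g k * char_at k x)" by (rule eval_at_finite[OF S]) auto
  ultimately show ?thesis by (simp only: distrib_right sum.distrib)
qed

lemma sup_le_add:
  assumes f: "sup_le F f" and g: "sup_le G g"
  shows "sup_le (F + G) (\<lambda>k. f k + g k)"
proof -
  have fin: "finite {k. f k \<noteq> 0}" "finite {k. g k \<noteq> 0}" using f g by (auto simp: sup_le_def)
  have "finite {k. f k + g k \<noteq> 0}" by (rule finite_subset[OF _ finite_UnI[OF fin]]) auto
  moreover have "cmod (eval_at (\<lambda>k. f k + g k) x) \<le> F + G" for x
  proof -
    have "cmod (eval_at f x) \<le> F" "cmod (eval_at g x) \<le> G" using f g unfolding sup_le_def by blast+
    then show ?thesis unfolding eval_at_add[OF fin] by (intro norm_triangle_le) linarith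
  qed
  ultimately show ?thesis by (simp add: sup_le_def)
qed

lemma sup_le_zero: "0 \<le> G \<Longrightarrow> sup_le G (\<lambda>k. 0)"
  by (simp add: sup_le_def eval_at_def)

lemma sup_le_sum:
  assumes "finite I" "\<And>i. i \<in> I \<Longrightarrow> sup_le (G i) (g i)"
  shows "sup_le (\<Sum>i\<in>I. G i) (\<lambda>k. \<Sum>i\<in>I. g i k)"
  using assms
proof (induction I rule: finite_induct)
  case (insert i I)
  then have "sup_le (G i + (\<Sum>i\<in>I. G i)) (\<lambda>k. g i k + (\<Sum>i\<in>I. g i k))"
    by (intro sup_le_add) auto
  then show ?case using insert by simp
qed (simp add: sup_le_zero)

lemma sup_le_finite_support:
  assumes "finite {k. g k \<noteq> 0}"
  shows "sup_le (\<Sum>k\<in>{k. g k \<noteq> 0}. cmod (g k)) g"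
  unfolding sup_le_def
proof safe
  fix x
  have "eval_at g x = (\<Sum>k\<in>{k. g k \<noteq> 0}. g k * char_at k x)" by (rule eval_at_finite[OF assms]) auto
  also have "cmod \<dots> \<le> (\<Sum>k\<in>{k. g k \<noteq> 0}. cmod (g k))" by (rule sum_norm_le) (simp add: norm_mult)
  finally show "cmod (eval_at g x) \<le> (\<Sum>k\<in>{k. g k \<noteq> 0}. cmod (g k))" .
qed (rule assms)

text \<open>The product bound applied to the constant function 1, whose coefficients
  \<open>?d\<close> are a unit mass at frequency 0.\<close>

lemma sup_le_sobolev:
  assumes g: "sup_le G g"
  shows "sob_le 0 G g"
proof -
  let ?d = "\<lambda>k::freq. if k = 0 then 1 else 0 :: complex"
  have S: "finite {k. g k \<noteq> 0}" using g by (simp add: sup_le_def)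
  have d: "sob_le 0 1 ?d"
    unfolding sob_le_iff_sum[OF zero_le_one]
  proof safe
    fix F :: "freq set" assume F: "finite F"
    have "(\<Sum>k\<in>F. bracket k powr 0 * (cmod (?d k))\<^sup>2) \<le> (\<Sum>k\<in>F. if k = 0 then 1 else 0)"
      by (rule sum_mono) (simp add: powr_def)
    also have "\<dots> \<le> 1" using F by (simp add: sum.delta)
    finally show "(\<Sum>k\<in>F. bracket k powr 0 * (cmod (?d k))\<^sup>2) \<le> 1\<^sup>2" by simp
  qed
  have "mult ?d g n = g n" for n
  proof -
    have "mult ?d g n = (\<Sum>\<^sub>\<infinity>k\<in>{0}. ?d k * g (n - k))"
      unfolding mult_def by (rule infsum_cong_neutral) auto
    then show ?thesis by simp
  qed
  then have "mult ?d g = g" by (simp add: fun_eq_iff)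
  then show ?thesis using mult_sup_bound[OF g d] by simp
qed

lemma mult_add_left:
  assumes "finite {l. h l \<noteq> 0}"
  shows "mult (\<lambda>k. f k + g k) h n = mult f h n + mult g h n"
proof -
  have e: "mult u h n = (\<Sum>l\<in>{l. h l \<noteq> 0}. u (n - l) * h l)" for u
    by (rule mult_finite_right[OF assms]) auto
  show ?thesis unfolding e by (simp add: distrib_right sum.distrib)
qed

lemma mult_diff_left:
  assumes "finite {l. h l \<noteq> 0}"
  shows "mult (\<lambda>k. f k - g k) h n = mult f h n - mult g h n"
proof -
  have e: "mult u h n = (\<Sum>l\<in>{l. h l \<noteq> 0}. u (n - l) * h l)" for u
    by (rule mult_finite_right[OF assms]) auto
  show ?thesis unfolding e by (simp add: left_diff_distrib sum_subtractf)
qed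

lemma mult_sum_left:
  assumes "finite {l. h l \<noteq> 0}"
  shows "mult (\<lambda>k. \<Sum>i\<in>I. f i k) h n = (\<Sum>i\<in>I. mult (f i) h n)"
proof -
  have e: "mult u h n = (\<Sum>l\<in>{l. h l \<noteq> 0}. u (n - l) * h l)" for u
    by (rule mult_finite_right[OF assms]) auto
  show ?thesis unfolding e by (simp add: sum_distrib_right) (rule sum.swap)
qed

lemma lam_series:
  assumes e: "0 < e"
  shows "(\<lambda>j. lam j powr (- e)) summable_on {-1..}"
proof -
  define q where "q = (2::real) powr (- e)"
  have q: "0 < q" "q < 1" using e powr_less_mono[of "- e" 0 2] by (auto simp: q_def)
  have r: "range (\<lambda>n. int n - 1) = {-1..}"
  proof -
    have "j \<in> range (\<lambda>n. int n - 1)" if "-1 \<le> j" for j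
      using that by (intro image_eqI[of _ _ "nat (j + 1)"]) auto
    then show ?thesis by auto
  qed
  have "lam (int n - 1) powr (- e) = 2 powr e * q ^ n" for n
  proof -
    have "lam (int n - 1) powr (- e) = 2 powr (e - e * real n)"
      by (simp add: lam_def powr_powr algebra_simps)
    moreover have "q ^ n = 2 powr (- (e * real n))" using q(1) by (simp add: q_def powr_powr flip: powr_realpow)
    ultimately show ?thesis by (simp flip: powr_add)
  qed
  moreover have "(\<lambda>n. 2 powr e * q ^ n) summable_on UNIV"
    using q by (intro summable_on_cmult_right norm_summable_imp_summable_on) (simp add: summable_geometric)
  ultimately have "((\<lambda>j. lam j powr (- e)) \<circ> (\<lambda>n. int n - 1)) summable_on UNIV"
    by (simp add: o_def)
  then have "(\<lambda>j. lam j powr (- e)) summable_on range (\<lambda>n. int n - 1)"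
    by (subst summable_on_reindex) (auto simp: inj_on_def)
  then show ?thesis by (simp only: r)
qed

context dyadic_blocks
begin

text \<open>Real-valued form of the bound \<open>holder_norm P b g\<close> \<le> G;
  \<open>sup_le\<close> also records that each block is a trigonometric polynomial.\<close>

definition hold_le :: "real \<Rightarrow> real \<Rightarrow> torus_dist \<Rightarrow> bool" where
  "hold_le b G g \<longleftrightarrow> (\<forall>j\<ge>-1. sup_le (G * lam j powr (- b)) (lp_block P j g))"

lemma hold_leD: "hold_le b G g \<Longrightarrow> -1 \<le> j \<Longrightarrow> sup_le (G * lam j powr (- b)) (lp_block P j g)"
  by (simp add: hold_le_def)

lemma hold_le_nonneg:
  assumes "hold_le b G g"
  shows "0 \<le> G"
  using sup_le_nonneg[OF hold_leD[OF assms, of 0]] by simp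

lemma finite_bracket_le: "finite {k. bracket k \<le> C}"
proof -
  define L where "L = nat \<lceil>C\<rceil> + 1"
  have "k \<in> box L" if "bracket k \<le> C" for k
  proof -
    have i: "\<bar>x\<bar> \<le> x\<^sup>2 + 1" for x :: real
      using zero_le_power2[of "\<bar>x\<bar> - 1 / 2"] by (simp add: power2_eq_square algebra_simps abs_if split: if_splits)
    have "(real_of_int (fst k))\<^sup>2 \<le> bracket k" "(real_of_int (snd k))\<^sup>2 \<le> bracket k"
      using bracket_ge_norm[of k] zero_le_power2[of "real_of_int (fst k)"] zero_le_power2[of "real_of_int (snd k)"]
      unfolding norm_vec_of_sq by linarith+
    then have "\<bar>real_of_int (fst k)\<bar> \<le> C + 1" "\<bar>real_of_int (snd k)\<bar> \<le> C + 1"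
      using that i[of "real_of_int (fst k)"] i[of "real_of_int (snd k)"] by linarith+
    moreover have "C + 1 \<le> real L" unfolding L_def by linarith
    ultimately have "\<bar>real_of_int (fst k)\<bar> \<le> real L" "\<bar>real_of_int (snd k)\<bar> \<le> real L" by linarith+
    then show ?thesis unfolding box_def by simp linarith
  qed
  then show ?thesis by (intro finite_subset[OF _ finite_box[of L]]) auto
qed

lemma finite_phi: "finite {k. phi P j k \<noteq> 0}"
proof (cases "-1 \<le> j")
  case True
  obtain R where "\<And>j k. -1 \<le> j \<Longrightarrow> phi P j k \<noteq> 0 \<Longrightarrow> bracket k \<le> R * (lam j)\<^sup>2"
    by (rule symbol_supports) (rule that; blast)
  then show ?thesis using True by (intro finite_subset[OF _ finite_bracket_le[of "R * (lam j)\<^sup>2"]]) auto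
qed (auto simp: phi_def)

lemma finite_lp_block: "finite {k. lp_block P j g k \<noteq> 0}"
  by (rule finite_subset[OF _ finite_phi[of j]]) (auto simp: lp_block_phi)

lemma weighted_low_sum: "weighted (low P j) f = (\<lambda>k. \<Sum>i\<in>{-1..j - 2}. lp_block P i f k)"
  by (simp add: weighted_def low_def lp_block_phi sum_distrib_right)

lemma weighted_mid_sum: "weighted (mid P j) f = (\<lambda>k. \<Sum>i\<in>{max (-1) (j - 1)..j + 1}. lp_block P i f k)"
  by (simp add: weighted_def mid_def lp_block_phi sum_distrib_right)

lemma paraproduct_eq:
  "paraproduct P f g = (\<lambda>n. \<Sum>\<^sub>\<infinity>j\<in>{-1..}. mult (weighted (low P j) f) (lp_block P j g) n)"
  unfolding paraproduct_def weighted_low_sum mult_sum_left[OF finite_lp_block] ..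

lemma resonant_eq:
  "resonant P f g = (\<lambda>n. \<Sum>\<^sub>\<infinity>j\<in>{-1..}. mult (weighted (mid P j) f) (lp_block P j g) n)"
  unfolding resonant_def weighted_mid_sum mult_sum_left[OF finite_lp_block] ..

text \<open>For b < 0 the bounds on the blocks grow geometrically, so their sum is comparable to the
  last one.\<close>

lemma low_sup:
  assumes b: "b < 0"
  obtains D where "0 \<le> D" "\<And>j g G. hold_le b G g \<Longrightarrow> sup_le (D * G * lam j powr (- b)) (weighted (low P j) g)"
proof -
  define Z where "Z = infsum (\<lambda>j. lam j powr (- (- b))) {-1..}"
  have s: "(\<lambda>j. lam j powr (- (- b))) summable_on {-1..}" using lam_series[of "- b"] b by simp
  show thesis
  proof (rule that[of Z])
    show "0 \<le> Z" unfolding Z_def by (rule infsum_nonneg) simp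
    fix j g G assume g: "hold_le b G g"
    have G: "0 \<le> G" using g by (rule hold_le_nonneg)
    have "sup_le (\<Sum>i\<in>{-1..j - 2}. G * lam i powr (- b)) (weighted (low P j) g)"
      unfolding weighted_low_sum by (rule sup_le_sum) (auto intro: hold_leD[OF g])
    then show "sup_le (Z * G * lam j powr (- b)) (weighted (low P j) g)"
    proof (rule sup_le_mono)
      have "(\<Sum>i\<in>{-1..j - 2}. lam i powr (- b)) = (\<Sum>i\<in>{-1..j - 2}. lam j powr (- b) * lam (j - i) powr (- (- b)))"
        by (rule sum.cong) (simp_all add: lam_def powr_powr powr_add[symmetric] algebra_simps)
      also have "\<dots> = lam j powr (- b) * (\<Sum>i\<in>{-1..j - 2}. lam (j - i) powr (- (- b)))"
        by (simp add: sum_distrib_left)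
      also have "(\<Sum>i\<in>{-1..j - 2}. lam (j - i) powr (- (- b))) = (\<Sum>m\<in>{2..j + 1}. lam m powr (- (- b)))"
        by (rule sum.reindex_bij_witness[where i = "\<lambda>m. j - m" and j = "\<lambda>i. j - i"]) auto
      also have "\<dots> \<le> Z" unfolding Z_def using s by (intro finite_sum_le_infsum) auto
      finally have "(\<Sum>i\<in>{-1..j - 2}. lam i powr (- b)) \<le> lam j powr (- b) * Z" by (simp add: mult_left_mono)
      then have "G * (\<Sum>i\<in>{-1..j - 2}. lam i powr (- b)) \<le> G * (lam j powr (- b) * Z)"
        using G by (rule mult_left_mono)
      then show "(\<Sum>i\<in>{-1..j - 2}. G * lam i powr (- b)) \<le> Z * G * lam j powr (- b)"
        by (simp add: sum_distrib_left mult_ac)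
    qed
  qed
qed

text \<open>The exponent is arranged so that a margin a + b - t > 0 becomes the decay rate of the
  block series. For j \<le> 0 the low cut-off is an empty sum and the block is zero.\<close>

lemma low_high_paraproduct_blocks:
  assumes "-2 < t" "a \<le> 0"
  obtains D where "0 \<le> D" "\<And>j u g c G. -1 \<le> j \<Longrightarrow> sob_le a c u \<Longrightarrow> hold_le b G g \<Longrightarrow>
    sob_le t (D * G * c * lam j powr (- (a + b - t))) (mult (weighted (low P j) u) (lp_block P j g))"
proof -
  obtain D where D: "0 \<le> D" "\<And>j u g c G. 1 \<le> j \<Longrightarrow> sob_le a c u \<Longrightarrow> sup_le G (lp_block P j g) \<Longrightarrow>
    sob_le t (D * lam j powr (t - a) * G * c) (mult (weighted (low P j) u) (lp_block P j g))"
    by (rule low_high_block[OF assms]) (rule that; blast)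
  show thesis
  proof (rule that[OF D(1)])
    fix j :: int and u g :: torus_dist and c G :: real assume j: "-1 \<le> j" and u: "sob_le a c u" and g: "hold_le b G g"
    show "sob_le t (D * G * c * lam j powr (- (a + b - t))) (mult (weighted (low P j) u) (lp_block P j g))"
    proof (cases "1 \<le> j")
      case True
      have "lam j powr (- (a + b - t)) = lam j powr (t - a) * lam j powr (- b)"
        by (simp flip: powr_add add: algebra_simps)
      then show ?thesis using D(2)[OF True u hold_leD[OF g j]] by (simp only: mult_ac)
    next
      case False
      then have "mult (weighted (low P j) u) (lp_block P j g) = (\<lambda>n. 0)"
        by (simp add: weighted_def low_zero mult_def fun_eq_iff)
      then show ?thesis
        using D(1) sob_le_nonneg[OF u] hold_le_nonneg[OF g] by (simp add: sob_le_zero)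
    qed
  qed
qed

lemma high_low_paraproduct_blocks:
  assumes "-2 < t" "b < 0"
  obtains D where "0 \<le> D" "\<And>j u g c G. -1 \<le> j \<Longrightarrow> sob_le a c u \<Longrightarrow> hold_le b G g \<Longrightarrow>
    sob_le t (D * G * c * lam j powr (- (a + b - t))) (mult (weighted (low P j) g) (lp_block P j u))"
proof -
  obtain D where D: "0 \<le> D" "\<And>j u g c G. 1 \<le> j \<Longrightarrow> sob_le a c u \<Longrightarrow> sup_le G (weighted (low P j) g) \<Longrightarrow>
    sob_le t (D * lam j powr (t - a) * G * c) (mult (lp_block P j u) (weighted (low P j) g))"
    by (rule high_low_block[OF assms(1)]) (rule that; blast)
  obtain E where E: "0 \<le> E" "\<And>j g G. hold_le b G g \<Longrightarrow> sup_le (E * G * lam j powr (- b)) (weighted (low P j) g)"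
    by (rule low_sup[OF assms(2)]) (rule that; blast)
  show thesis
  proof (rule that[of "D * E"])
    show "0 \<le> D * E" using D(1) E(1) by simp
    fix j :: int and u g :: torus_dist and c G :: real assume j: "-1 \<le> j" and u: "sob_le a c u" and g: "hold_le b G g"
    show "sob_le t (D * E * G * c * lam j powr (- (a + b - t))) (mult (weighted (low P j) g) (lp_block P j u))"
    proof (cases "1 \<le> j")
      case True
      have "lam j powr (- (a + b - t)) = lam j powr (t - a) * lam j powr (- b)"
        by (simp flip: powr_add add: algebra_simps)
      then show ?thesis using D(2)[OF True u E(2)[OF g]] mult_commute[of "weighted (low P j) g"] by (simp only: mult_ac)
    next
      case False
      then have "mult (weighted (low P j) g) (lp_block P j u) = (\<lambda>n. 0)"
        by (simp add: weighted_def low_zero mult_def fun_eq_iff)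
      then show ?thesis
        using D(1) E(1) sob_le_nonneg[OF u] hold_le_nonneg[OF g] by (simp add: sob_le_zero)
    qed
  qed
qed

lemma block_series:
  assumes e: "0 < e" and F: "\<And>j. -1 \<le> j \<Longrightarrow> sob_le t (D * lam j powr (- e)) (F j)"
  shows "sob_le t (D * infsum (\<lambda>j. lam j powr (- e)) {-1..}) (\<lambda>n. \<Sum>\<^sub>\<infinity>j\<in>{-1..}. F j n)"
    "(\<lambda>j. F j n) summable_on {-1..}"
proof -
  have s: "(\<lambda>j. D * lam j powr (- e)) summable_on {-1..}"
    by (intro summable_on_cmult_right lam_series e)
  have "sob_le t (infsum (\<lambda>j. D * lam j powr (- e)) {-1..}) (\<lambda>n. \<Sum>\<^sub>\<infinity>j\<in>{-1..}. F j n)"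
    by (rule sob_le_infsum[OF F s]) simp
  then show "sob_le t (D * infsum (\<lambda>j. lam j powr (- e)) {-1..}) (\<lambda>n. \<Sum>\<^sub>\<infinity>j\<in>{-1..}. F j n)"
    by (simp only: infsum_cmult_right')
  show "(\<lambda>j. F j n) summable_on {-1..}"
    by (rule sob_le_infsum_pointwise(2)[OF F s]) simp
qed

lemma series_nonneg: "0 \<le> infsum (\<lambda>j. lam j powr (- e)) {-1..}"
  by (rule infsum_nonneg) simp

text \<open>Coefficientwise summability is exported as well: \<open>infsum\<close> is split only for
  summable series, and both the product rule and the additivity of the operators rely on such a
  splitting.\<close>

lemma low_high_paraproduct:
  assumes "-2 < t" "a \<le> 0" "t < a + b"
  obtains D where "0 \<le> D" "\<And>u g c G. sob_le a c u \<Longrightarrow> hold_le b G g \<Longrightarrow> sob_le t (D * G * c) (paraproduct P u g)"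
    "\<And>u g c G n. sob_le a c u \<Longrightarrow> hold_le b G g \<Longrightarrow>
      (\<lambda>j. mult (weighted (low P j) u) (lp_block P j g) n) summable_on {-1..}"
proof -
  obtain D where D: "0 \<le> D" "\<And>j u g c G. -1 \<le> j \<Longrightarrow> sob_le a c u \<Longrightarrow> hold_le b G g \<Longrightarrow>
    sob_le t (D * G * c * lam j powr (- (a + b - t))) (mult (weighted (low P j) u) (lp_block P j g))"
    by (rule low_high_paraproduct_blocks[OF assms(1,2)]) (rule that; blast)
  have e: "0 < a + b - t" using assms by simp
  show thesis
  proof (rule that[of "D * infsum (\<lambda>j. lam j powr (- (a + b - t))) {-1..}"])
    fix u g c G n assume u: "sob_le a c u" and g: "hold_le b G g"
    note * = block_series[OF e D(2)[OF _ u g]]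
    show "sob_le t (D * infsum (\<lambda>j. lam j powr (- (a + b - t))) {-1..} * G * c) (paraproduct P u g)"
      using *(1) unfolding paraproduct_eq by (simp only: mult_ac)
    show "(\<lambda>j. mult (weighted (low P j) u) (lp_block P j g) n) summable_on {-1..}" by (rule *(2))
  qed (intro mult_nonneg_nonneg D(1) series_nonneg)
qed

lemma high_low_paraproduct:
  assumes "-2 < t" "b < 0" "t < a + b"
  obtains D where "0 \<le> D" "\<And>u g c G. sob_le a c u \<Longrightarrow> hold_le b G g \<Longrightarrow> sob_le t (D * G * c) (paraproduct P g u)"
    "\<And>u g c G n. sob_le a c u \<Longrightarrow> hold_le b G g \<Longrightarrow>
      (\<lambda>j. mult (weighted (low P j) g) (lp_block P j u) n) summable_on {-1..}"
proof -
  obtain D where D: "0 \<le> D" "\<And>j u g c G. -1 \<le> j \<Longrightarrow> sob_le a c u \<Longrightarrow> hold_le b G g \<Longrightarrow>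
    sob_le t (D * G * c * lam j powr (- (a + b - t))) (mult (weighted (low P j) g) (lp_block P j u))"
    by (rule high_low_paraproduct_blocks[OF assms(1,2)]) (rule that; blast)
  have e: "0 < a + b - t" using assms by simp
  show thesis
  proof (rule that[of "D * infsum (\<lambda>j. lam j powr (- (a + b - t))) {-1..}"])
    fix u g c G n assume u: "sob_le a c u" and g: "hold_le b G g"
    note * = block_series[OF e D(2)[OF _ u g]]
    show "sob_le t (D * infsum (\<lambda>j. lam j powr (- (a + b - t))) {-1..} * G * c) (paraproduct P g u)"
      using *(1) unfolding paraproduct_eq by (simp only: mult_ac)
    show "(\<lambda>j. mult (weighted (low P j) g) (lp_block P j u) n) summable_on {-1..}" by (rule *(2))
  qed (intro mult_nonneg_nonneg D(1) series_nonneg)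
qed

lemma resonant_blocks:
  obtains D where "0 \<le> D" "\<And>j u g c G. -1 \<le> j \<Longrightarrow> sob_le a c u \<Longrightarrow> hold_le b G g \<Longrightarrow>
    sob_le 0 (D * G * c * lam j powr (- (a + b))) (mult (weighted (mid P j) u) (lp_block P j g))"
proof -
  obtain D where D: "0 \<le> D" "\<And>j u g c G. -1 \<le> j \<Longrightarrow> sob_le a c u \<Longrightarrow> sup_le G (lp_block P j g) \<Longrightarrow>
    sob_le 0 (D * lam j powr (- a) * G * c) (mult (weighted (mid P j) u) (lp_block P j g))"
    by (rule resonant_block[where a = a]) (rule that; blast)
  show thesis
  proof (rule that[OF D(1)])
    fix j :: int and u g :: torus_dist and c G :: real assume j: "-1 \<le> j" and u: "sob_le a c u" and g: "hold_le b G g"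
    have "lam j powr (- (a + b)) = lam j powr (- a) * lam j powr (- b)" by (simp flip: powr_add)
    then show "sob_le 0 (D * G * c * lam j powr (- (a + b))) (mult (weighted (mid P j) u) (lp_block P j g))"
      using D(2)[OF j u hold_leD[OF g j]] by (simp only: mult_ac)
  qed
qed

lemma resonant_product:
  assumes "0 < a + b"
  obtains D where "0 \<le> D" "\<And>u g c G. sob_le a c u \<Longrightarrow> hold_le b G g \<Longrightarrow> sob_le 0 (D * G * c) (resonant P u g)"
proof -
  obtain D where D: "0 \<le> D" "\<And>j u g c G. -1 \<le> j \<Longrightarrow> sob_le a c u \<Longrightarrow> hold_le b G g \<Longrightarrow>
    sob_le 0 (D * G * c * lam j powr (- (a + b))) (mult (weighted (mid P j) u) (lp_block P j g))"
    by (rule resonant_blocks[where a = a and b = b]) (rule that; blast)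
  show thesis
  proof (rule that[of "D * infsum (\<lambda>j. lam j powr (- (a + b))) {-1..}"])
    fix u g c G assume u: "sob_le a c u" and g: "hold_le b G g"
    show "sob_le 0 (D * infsum (\<lambda>j. lam j powr (- (a + b))) {-1..} * G * c) (resonant P u g)"
      using block_series(1)[OF assms D(2)[OF _ u g]] unfolding resonant_eq by (simp only: mult_ac)
  qed (intro mult_nonneg_nonneg D(1) series_nonneg)
qed

lemma lp_block_series: "(\<Sum>\<^sub>\<infinity>j\<in>{-1..}. lp_block P j g k) = g k"
  "(\<lambda>j. lp_block P j g k) abs_summable_on {-1..}" "(\<Sum>\<^sub>\<infinity>j\<in>{-1..}. cmod (lp_block P j g k)) = cmod (g k)"
proof -
  obtain J where J: "-1 \<le> J" "\<And>j. J < j \<Longrightarrow> phi P j k = 0" "\<And>J'. J \<le> J' \<Longrightarrow> (\<Sum>j\<in>{-1..J'}. phi P j k) = 1"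
    by (rule phi_sum_eq1[of k]) (rule that; blast)
  have z: "lp_block P j g k = 0" if "J < j" for j using J(2)[OF that] by (simp add: lp_block_phi)
  have one: "(\<Sum>j\<in>{-1..J}. phi P j k) = 1" using J(3)[of J] by simp
  have "(\<Sum>\<^sub>\<infinity>j\<in>{-1..}. lp_block P j g k) = (\<Sum>\<^sub>\<infinity>j\<in>{-1..J}. lp_block P j g k)"
    by (rule infsum_cong_neutral) (use z in auto)
  also have "\<dots> = of_real (\<Sum>j\<in>{-1..J}. phi P j k) * g k" by (simp add: lp_block_phi sum_distrib_right)
  finally show "(\<Sum>\<^sub>\<infinity>j\<in>{-1..}. lp_block P j g k) = g k" by (simp add: one)
  have "(\<Sum>\<^sub>\<infinity>j\<in>{-1..}. cmod (lp_block P j g k)) = (\<Sum>\<^sub>\<infinity>j\<in>{-1..J}. cmod (lp_block P j g k))"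
    by (rule infsum_cong_neutral) (use z in auto)
  also have "\<dots> = (\<Sum>j\<in>{-1..J}. phi P j k) * cmod (g k)"
    by (simp add: lp_block_phi sum_distrib_right norm_mult phi_nonneg)
  finally show "(\<Sum>\<^sub>\<infinity>j\<in>{-1..}. cmod (lp_block P j g k)) = cmod (g k)" by (simp add: one)
  have "(\<lambda>j. cmod (lp_block P j g k)) summable_on {-1..J}" by simp
  then show "(\<lambda>j. lp_block P j g k) abs_summable_on {-1..}"
    by (rule summable_on_cong_neutral[THEN iffD1, rotated -1]) (use z in auto)
qed

text \<open>The L^2 norm of a trigonometric polynomial is at most its sup norm, so block j lies in
  H^(-a) with a bound of order 2^(-j (a + b)).\<close>

lemma holder_sobolev:
  assumes "0 < a + b"
  obtains D where "0 \<le> D" "\<And>g G. hold_le b G g \<Longrightarrow> sob_le (- a) (D * G) g"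
proof -
  obtain r R where rR: "0 < r" "1 \<le> R"
    "\<And>j k. -1 \<le> j \<Longrightarrow> phi P j k \<noteq> 0 \<Longrightarrow> r * (lam j)\<^sup>2 \<le> bracket k \<and> bracket k \<le> R * (lam j)\<^sup>2"
    by (rule symbol_supports) (rule that; blast)
  define E where "E = max (r powr (- a / 2)) (R powr (- a / 2))"
  have E: "0 \<le> E" by (simp add: E_def le_max_iff_disj)
  have block: "sob_le (- a) (E * G * lam j powr (- (a + b))) (lp_block P j g)" if j: "-1 \<le> j" and g: "hold_le b G g" for j g G
  proof -
    have "sob_le (- a) (E * lam j powr (- a) * (G * lam j powr (- b))) (lp_block P j g)"
    proof (rule sob_le_localized[OF sup_le_sobolev[OF hold_leD[OF g j]]])
      fix k assume "lp_block P j g k \<noteq> 0"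
      then have k: "r * (lam j)\<^sup>2 \<le> bracket k" "bracket k \<le> R * (lam j)\<^sup>2" using rR(3)[OF j, of k] by (auto simp: lp_block_phi)
      have rp: "0 < r * (lam j)\<^sup>2" using rR(1) lam_pos[of j] by simp
      have sc: "(x * (lam j)\<^sup>2) powr (- a / 2) = x powr (- a / 2) * lam j powr (- a)" if "0 < x" for x
        using powr_scale[OF that lam_pos[of j], of "- a / 2"] by simp
      show "bracket k powr ((- a - 0) / 2) \<le> E * lam j powr (- a)"
      proof (cases "0 \<le> a")
        case True
        have "bracket k powr (- a / 2) \<le> (r * (lam j)\<^sup>2) powr (- a / 2)"
          using k rp True by (intro powr_mono2') auto
        also have "\<dots> \<le> E * lam j powr (- a)" unfolding sc[OF rR(1)] by (intro mult_right_mono) (auto simp: E_def)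
        finally show ?thesis by simp
      next
        case False
        have "bracket k powr (- a / 2) \<le> (R * (lam j)\<^sup>2) powr (- a / 2)"
          using k bracket_pos[of k] False by (intro powr_mono2) auto
        also have "\<dots> \<le> E * lam j powr (- a)" using rR(2) by (subst sc) (auto simp: E_def intro!: mult_right_mono)
        finally show ?thesis by simp
      qed
    qed (use E in simp)
    moreover have "lam j powr (- (a + b)) = lam j powr (- a) * lam j powr (- b)" by (simp flip: powr_add)
    ultimately show ?thesis by (simp only: mult_ac)
  qed
  show thesis
  proof (rule that[of "E * infsum (\<lambda>j. lam j powr (- (a + b))) {-1..}"])
    fix g G assume g: "hold_le b G g"
    show "sob_le (- a) (E * infsum (\<lambda>j. lam j powr (- (a + b))) {-1..} * G) g"
      using block_series(1)[OF assms block[OF _ g]] unfolding lp_block_series by (simp only: mult_ac)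
  qed (intro mult_nonneg_nonneg E series_nonneg)
qed

end

text \<open>A Peetre inequality: \<open>bracket (n - k)\<close> is at most 4 *
  \<open>bracket n\<close> * \<open>bracket k\<close>. By duality it makes the convolution sum in
  \<open>mult\<close> absolutely convergent.\<close>

lemma sob_le_reflect_shift:
  assumes a: "0 \<le> a" and g: "sob_le (- a) d g"
  shows "sob_le (- a) ((4 * bracket n) powr (a / 2) * d) (\<lambda>k. g (n - k))"
  unfolding sob_le_def
proof safe
  fix F :: "freq set" assume F: "finite F"
  have "L2_set (\<lambda>k. bracket k powr (- a / 2) * cmod (g (n - k))) F
      \<le> L2_set (\<lambda>k. (4 * bracket n) powr (a / 2) * (bracket (n - k) powr (- a / 2) * cmod (g (n - k)))) F"
  proof (rule L2_set_mono)
    fix k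
    have "bracket (n - k) \<le> 2 * (bracket n + bracket k)" using bracket_add[of n "- k"] by (simp add: bracket_uminus)
    also have "\<dots> \<le> 4 * bracket n * bracket k"
    proof -
      have "0 \<le> (bracket n - 1) * bracket k" "0 \<le> (bracket k - 1) * bracket n"
        using bracket_ge1[of n] bracket_ge1[of k] by simp_all
      then show ?thesis by (simp add: algebra_simps)
    qed
    finally have "bracket (n - k) powr (a / 2) \<le> (4 * bracket n * bracket k) powr (a / 2)"
      using a bracket_pos[of "n - k"] by (intro powr_mono2) auto
    also have "\<dots> = (4 * bracket n) powr (a / 2) * bracket k powr (a / 2)"
      using bracket_pos[of n] bracket_pos[of k] by (simp add: powr_mult)
    finally have "bracket k powr (- a / 2) \<le> (4 * bracket n) powr (a / 2) * bracket (n - k) powr (- a / 2)"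
      using bracket_pos[of k] bracket_pos[of "n - k"] by (simp add: powr_minus field_simps)
    then show "bracket k powr (- a / 2) * cmod (g (n - k))
        \<le> (4 * bracket n) powr (a / 2) * (bracket (n - k) powr (- a / 2) * cmod (g (n - k)))"
      by (simp add: mult_right_mono flip: mult.assoc)
  qed simp
  also have "\<dots> = (4 * bracket n) powr (a / 2) * L2_set (\<lambda>k. bracket (n - k) powr (- a / 2) * cmod (g (n - k))) F"
    by (simp add: L2_set_right_distrib)
  also have "L2_set (\<lambda>k. bracket (n - k) powr (- a / 2) * cmod (g (n - k))) F
      = L2_set (\<lambda>l. bracket l powr (- a / 2) * cmod (g l)) ((\<lambda>k. n - k) ` F)"
    unfolding L2_set_def by (subst sum.reindex) (auto simp: inj_on_def)
  also have "(4 * bracket n) powr (a / 2) * \<dots> \<le> (4 * bracket n) powr (a / 2) * d"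
    using sob_leD[OF g] F by (intro mult_left_mono) auto
  finally show "L2_set (\<lambda>k. bracket k powr (- a / 2) * cmod (g (n - k))) F \<le> (4 * bracket n) powr (a / 2) * d" .
qed

context dyadic_blocks
begin

text \<open>What remains of the product is a single series of (1 - \<open>low P j\<close>) u times
  block j of g. Its first factor has only high frequencies, so the regularity a of u compensates b
  block by block.\<close>

lemma mult_minus_paraproduct:
  assumes a: "0 \<le> a" and ab: "0 < a + b" and b: "-2 < b"
  obtains D where "0 \<le> D" "\<And>u g c G. sob_le a c u \<Longrightarrow> hold_le b G g \<Longrightarrow>
    sob_le 0 (D * G * c) (mult u g - paraproduct P u g)"
proof -
  obtain D where D: "0 \<le> D"
    "\<And>j u g c G. -1 \<le> j \<Longrightarrow> sob_le a c u \<Longrightarrow> sup_le G (lp_block P j g) \<Longrightarrow>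
      sob_le 0 (D * lam j powr (- a) * G * c) (mult (weighted (\<lambda>k. 1 - low P j k) u) (lp_block P j g))"
    by (rule complement_block[OF a]) (rule that; blast)
  obtain E where E: "\<And>g G. hold_le b G g \<Longrightarrow> sob_le (- a) (E * G) g"
    by (rule holder_sobolev[OF ab]) (rule that; blast)
  \<comment> \<open>The midpoint of -2 and b; only coefficientwise summability of the paraproduct
    series is extracted from it.\<close>
  have "-2 < (b - 2) / 2" "(b - 2) / 2 < 0 + b" using b by simp_all
  then have pp: "(\<lambda>j. mult (weighted (low P j) u) (lp_block P j g) n) summable_on {-1..}"
    if "sob_le 0 c u" "hold_le b G g" for u g c G n
    by (rule low_high_paraproduct[OF _ order_refl]) (use that in blast)
  show thesis
  proof (rule that[of "D * infsum (\<lambda>j. lam j powr (- (a + b))) {-1..}"])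
    fix u g c G assume u: "sob_le a c u" and g: "hold_le b G g"
    have block: "sob_le 0 (D * G * c * lam j powr (- (a + b))) (mult (weighted (\<lambda>k. 1 - low P j k) u) (lp_block P j g))"
      if j: "-1 \<le> j" for j
    proof -
      have "lam j powr (- (a + b)) = lam j powr (- a) * lam j powr (- b)" by (simp flip: powr_add)
      then show ?thesis using D(2)[OF j u hold_leD[OF g j]] by (simp only: mult_ac)
    qed
    have "(mult u g - paraproduct P u g) n
        = (\<Sum>\<^sub>\<infinity>j\<in>{-1..}. mult (weighted (\<lambda>k. 1 - low P j k) u) (lp_block P j g) n)" for n
    proof -
      \<comment> \<open>The block decomposition of g is exchanged with the convolution sum. The
        block symbols are nonnegative and sum to 1, so the double series of absolute values is the
        convolution of |u| with |g|.\<close>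
      let ?h = "\<lambda>k j. u k * lp_block P j g (n - k)"
      have ug: "(\<lambda>k. u k * g (n - k)) abs_summable_on UNIV"
        by (rule sob_le_pairing(1)[OF u sob_le_reflect_shift[OF a E[OF g]]])
      have "(\<lambda>(k, j). ?h k j) abs_summable_on (SIGMA k:UNIV. {-1..})"
        unfolding Infinite_Sum.abs_summable_on_Sigma_iff
      proof (intro conjI ballI)
        fix k
        show "(\<lambda>j. case (k, j) of (k, j) \<Rightarrow> ?h k j) abs_summable_on {-1..}"
          using lp_block_series(2)[of g "n - k"] by (simp add: norm_mult summable_on_cmult_right)
      next
        have "(\<Sum>\<^sub>\<infinity>j\<in>{-1..}. cmod (?h k j)) = cmod (u k * g (n - k))" for k
          unfolding norm_mult infsum_cmult_right' lp_block_series(3) ..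
        then show "(\<lambda>k. \<Sum>\<^sub>\<infinity>j\<in>{-1..}. cmod (case (k, j) of (k, j) \<Rightarrow> ?h k j)) abs_summable_on UNIV"
          using ug by simp
      qed
      then have "(\<lambda>(k, j). ?h k j) summable_on (UNIV \<times> {-1..})" by (rule abs_summable_summable)
      from infsum_swap_banach[OF this]
      have "(\<Sum>\<^sub>\<infinity>k. \<Sum>\<^sub>\<infinity>j\<in>{-1..}. ?h k j) = (\<Sum>\<^sub>\<infinity>j\<in>{-1..}. mult u (lp_block P j g) n)"
        by (simp only: mult_def)
      moreover have "(\<Sum>\<^sub>\<infinity>k. \<Sum>\<^sub>\<infinity>j\<in>{-1..}. ?h k j) = mult u g n"
        unfolding infsum_cmult_right' lp_block_series(1) mult_def ..
      moreover have "mult u (lp_block P j g) n = mult (weighted (low P j) u) (lp_block P j g) n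
          + mult (weighted (\<lambda>k. 1 - low P j k) u) (lp_block P j g) n" for j
      proof -
        have "u = (\<lambda>k. weighted (low P j) u k + weighted (\<lambda>k. 1 - low P j k) u k)"
          by (simp add: weighted_def fun_eq_iff algebra_simps)
        then show ?thesis using mult_add_left[OF finite_lp_block] by metis
      qed
      ultimately have "mult u g n = (\<Sum>\<^sub>\<infinity>j\<in>{-1..}. mult (weighted (low P j) u) (lp_block P j g) n
          + mult (weighted (\<lambda>k. 1 - low P j k) u) (lp_block P j g) n)" by simp
      also have "\<dots> = paraproduct P u g n + (\<Sum>\<^sub>\<infinity>j\<in>{-1..}. mult (weighted (\<lambda>k. 1 - low P j k) u) (lp_block P j g) n)"
        unfolding paraproduct_eq
        by (rule infsum_add[OF pp[OF sob_le_weaken[OF u a] g] block_series(2)[OF ab block]])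
      finally show ?thesis by simp
    qed
    then have "mult u g - paraproduct P u g
        = (\<lambda>n. \<Sum>\<^sub>\<infinity>j\<in>{-1..}. mult (weighted (\<lambda>k. 1 - low P j k) u) (lp_block P j g) n)" by blast
    then show "sob_le 0 (D * infsum (\<lambda>j. lam j powr (- (a + b))) {-1..} * G * c) (mult u g - paraproduct P u g)"
      using block_series(1)[OF ab block] by (simp only: mult_ac)
  qed (intro mult_nonneg_nonneg D(1) series_nonneg)
qed

end

section \<open>Resolvent and derivatives of distributions of given regularity\<close>

lemma sup_le_scale:
  assumes "sup_le G g"
  shows "sup_le (cmod z * G) (\<lambda>k. z * g k)"
proof -
  have "finite {k. z * g k \<noteq> 0}"
    by (rule finite_subset[of _ "{k. g k \<noteq> 0}"]) (use assms in \<open>auto simp: sup_le_def\<close>)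
  moreover have "eval_at (\<lambda>k. z * g k) x = z * eval_at g x" for x
    unfolding eval_at_def by (simp add: infsum_cmult_right' mult.assoc)
  moreover have "cmod (eval_at g x) \<le> G" for x using assms unfolding sup_le_def by blast
  ultimately show ?thesis by (simp add: sup_le_def norm_mult mult_left_mono)
qed

lemma sup_le_diff:
  assumes "sup_le F f" "sup_le G g"
  shows "sup_le (F + G) (\<lambda>k. f k - g k)"
  using sup_le_add[OF assms(1) sup_le_scale[OF assms(2), of "- 1"]] by simp

text \<open>The least bound in \<open>sup_le\<close> for finite support; it is needed where an
  inequality bounding this norm by itself is absorbed.\<close>

definition sup_val :: "torus_dist \<Rightarrow> real" where
  "sup_val g = (SUP x. cmod (eval_at g x))"

lemma sup_val:
  assumes "finite {k. g k \<noteq> 0}"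
  shows "sup_le (sup_val g) g" "sup_le G g \<Longrightarrow> sup_val g \<le> G"
proof -
  have b: "cmod (eval_at g x) \<le> (\<Sum>k\<in>{k. g k \<noteq> 0}. cmod (g k))" for x
    using sup_le_finite_support[OF assms] unfolding sup_le_def by blast
  then have "cmod (eval_at g x) \<le> sup_val g" for x
    unfolding sup_val_def by (intro cSUP_upper bdd_aboveI2) auto
  then show "sup_le (sup_val g) g" using assms unfolding sup_le_def by blast
  show "sup_val g \<le> G" if "sup_le G g"
    using that unfolding sup_val_def sup_le_def by (intro cSUP_least) auto
qed

lemma sob_le_partial:
  assumes "sob_le s c u"
  shows "sob_le (s - 1) c (partial1 u)" "sob_le (s - 1) c (partial2 u)"
proof -
  have sq: "bracket k powr ((s - 1) / 2) * (2 * pi * \<bar>x\<bar> * z) \<le> 1 * (bracket k powr (s / 2) * z)"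
    if "x\<^sup>2 \<le> (norm (vec_of k))\<^sup>2" "0 \<le> z" for k x z
  proof -
    have "(2 * pi * \<bar>x\<bar>)\<^sup>2 \<le> bracket k"
    proof -
      have "4 * pi\<^sup>2 * x\<^sup>2 \<le> 4 * pi\<^sup>2 * (norm (vec_of k))\<^sup>2" by (rule mult_left_mono[OF that(1)]) simp
      moreover have "(2 * pi * \<bar>x\<bar>)\<^sup>2 = 4 * pi\<^sup>2 * x\<^sup>2" by (simp add: power_mult_distrib)
      ultimately show ?thesis unfolding bracket_def by linarith
    qed
    then have "2 * pi * \<bar>x\<bar> \<le> bracket k powr (1 / 2)"
      using bracket_pos[of k] by (simp add: powr_half_sqrt real_le_rsqrt)
    then have "bracket k powr ((s - 1) / 2) * (2 * pi * \<bar>x\<bar>) \<le> bracket k powr ((s - 1) / 2) * bracket k powr (1 / 2)"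
      by (intro mult_left_mono) auto
    also have "\<dots> = bracket k powr (s / 2)" by (simp add: powr_add[symmetric] add_divide_distrib[symmetric])
    finally have "bracket k powr ((s - 1) / 2) * (2 * pi * \<bar>x\<bar>) * z \<le> bracket k powr (s / 2) * z"
      using that(2) by (rule mult_right_mono)
    then show ?thesis by (simp only: mult.assoc mult_1_left)
  qed
  have c: "(real_of_int (fst k))\<^sup>2 \<le> (norm (vec_of k))\<^sup>2" "(real_of_int (snd k))\<^sup>2 \<le> (norm (vec_of k))\<^sup>2" for k
    unfolding norm_vec_of_sq by simp_all
  have n: "cmod (partial1 u k) = 2 * pi * \<bar>real_of_int (fst k)\<bar> * cmod (u k)"
    "cmod (partial2 u k) = 2 * pi * \<bar>real_of_int (snd k)\<bar> * cmod (u k)" for k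
    by (simp_all add: partial1_def partial2_def norm_mult)
  have "bracket k powr ((s - 1) / 2) * cmod (partial1 u k) \<le> 1 * (bracket k powr (s / 2) * cmod (u k))"
    "bracket k powr ((s - 1) / 2) * cmod (partial2 u k) \<le> 1 * (bracket k powr (s / 2) * cmod (u k))" for k
    unfolding n by (rule sq[OF c(1) norm_ge_zero] sq[OF c(2) norm_ge_zero])+
  from sob_le_dominated[OF assms zero_le_one this(1)] sob_le_dominated[OF assms zero_le_one this(2)]
  show "sob_le (s - 1) c (partial1 u)" "sob_le (s - 1) c (partial2 u)" by (simp_all only: mult_1_left)
qed

lemma bracket_half: "bracket k powr (s / 2) * bracket k = bracket k powr ((s + 2) / 2)"
proof -
  have "bracket k powr ((s + 2) / 2) = bracket k powr (s / 2 + 1)" by (simp add: add_divide_distrib)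
  then show ?thesis using bracket_pos[of k] by (simp add: powr_add)
qed

lemma sob_le_laplacian:
  assumes "sob_le s c u"
  shows "sob_le (s - 2) c (laplacian u)"
proof -
  have "bracket k powr ((s - 2) / 2) * cmod (laplacian u k) \<le> 1 * (bracket k powr (s / 2) * cmod (u k))" for k
  proof -
    have "cmod (laplacian u k) \<le> bracket k * cmod (u k)"
    proof -
      have "cmod (laplacian u k) = 4 * pi\<^sup>2 * (norm (vec_of k))\<^sup>2 * cmod (u k)"
        unfolding laplacian_def norm_mult norm_minus_cancel norm_of_real by (simp add: abs_mult)
      also have "\<dots> \<le> bracket k * cmod (u k)" by (intro mult_right_mono) (auto simp: bracket_def)
      finally show ?thesis .
    qed
    then have "bracket k powr ((s - 2) / 2) * cmod (laplacian u k) \<le> bracket k powr ((s - 2) / 2) * (bracket k * cmod (u k))"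
      by (intro mult_left_mono) auto
    also have "\<dots> = bracket k powr (s / 2) * cmod (u k)" using bracket_half[of k "s - 2"] by (simp add: mult.assoc[symmetric])
    finally show ?thesis by simp
  qed
  then show ?thesis using sob_le_dominated[OF assms zero_le_one, of "s - 2" "laplacian u"] by simp
qed

lemma sob_le_resolvent:
  assumes "sob_le s c f"
  shows "sob_le (s + 2) c (resolvent f)"
proof -
  have "bracket k powr ((s + 2) / 2) * cmod (resolvent f k) = bracket k powr (s / 2) * cmod (f k)" for k
    unfolding bracket_half[symmetric] using bracket_pos[of k] by (simp add: resolvent_def norm_divide)
  then show ?thesis using sob_le_dominated[OF assms zero_le_one, of "s + 2" "resolvent f"] by simp
qed

context dyadic_blocks
begin

text \<open>Every single block is a trigonometric polynomial and has a finite sup norm; finitely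
  many blocks only enlarge the constant, so it suffices to treat large j.\<close>

lemma hold_le_eventually:
  assumes "\<And>j. j0 \<le> j \<Longrightarrow> -1 \<le> j \<Longrightarrow> sup_le (G * lam j powr (- b)) (lp_block P j g)"
  shows "\<exists>G'. hold_le b G' g"
proof -
  define H where "H j = sup_val (lp_block P j g) / lam j powr (- b)" for j
  define G' where "G' = \<bar>G\<bar> + (\<Sum>j\<in>{-1..<j0}. \<bar>H j\<bar>)"
  have "sup_le (G' * lam j powr (- b)) (lp_block P j g)" if j: "-1 \<le> j" for j
  proof (cases "j0 \<le> j")
    case True
    have "G \<le> G'" unfolding G'_def by (simp add: add_increasing2 sum_nonneg)
    then show ?thesis by (intro sup_le_mono[OF assms[OF True j]] mult_right_mono) auto
  next
    case False
    then have "\<bar>H j\<bar> \<le> (\<Sum>j\<in>{-1..<j0}. \<bar>H j\<bar>)" using j by (intro member_le_sum) auto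
    then have "H j \<le> G'" unfolding G'_def by linarith
    then have "H j * lam j powr (- b) \<le> G' * lam j powr (- b)" by (intro mult_right_mono) auto
    moreover have "H j * lam j powr (- b) = sup_val (lp_block P j g)" using lam_pos[of j] by (simp add: H_def)
    ultimately show ?thesis using sup_val(1)[OF finite_lp_block] by (auto intro: sup_le_mono)
  qed
  then show ?thesis unfolding hold_le_def by blast
qed

lemma mid_profile_support:
  obtains r R where "0 < r" "0 \<le> R" "\<And>x. norm x < r \<Longrightarrow> mid_profile P x = 0"
    "\<And>x. R < norm x \<Longrightarrow> mid_profile P x = 0"
proof -
  obtain r R where r: "0 < r" "1 \<le> R" "\<And>x. chi x \<noteq> 0 \<Longrightarrow> norm x \<le> R" "\<And>x. rho x \<noteq> 0 \<Longrightarrow> r \<le> norm x"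
    "\<And>x. rho x \<noteq> 0 \<Longrightarrow> norm x \<le> R" by (rule support_bounds) (rule that; blast)
  have z: "rho x = 0" if "norm x < r \<or> R < norm x" for x using r(4,5)[of x] that by fastforce
  show thesis
  proof (rule that[of "r / 2" "2 * R"])
    show "mid_profile P x = 0" if "norm x < r / 2" for x
      using that r(1) by (simp add: mid_profile_def z)
    show "mid_profile P x = 0" if "2 * R < norm x" for x
      using that r(2) by (simp add: mid_profile_def z)
  qed (use r in auto)
qed

text \<open>On the spectrum of block j the symbol of a derivative is 2 pi i lam j times the fixed
  profile p * \<open>mid_profile P\<close> at scale lam j, because \<open>mid_profile P\<close> is 1
  there.\<close>

lemma partial_block_bound:
  obtains D where "0 \<le> D"
    "\<And>j g G. 1 \<le> j \<Longrightarrow> sup_le G (lp_block P j g) \<Longrightarrow> sup_le (D * lam j * G) (lp_block P j (partial1 g))"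
    "\<And>j g G. 1 \<le> j \<Longrightarrow> sup_le G (lp_block P j g) \<Longrightarrow> sup_le (D * lam j * G) (lp_block P j (partial2 g))"
proof -
  obtain r R where R: "0 < r" "0 \<le> R" "\<And>x. norm x < r \<Longrightarrow> mid_profile P x = 0"
    "\<And>x. R < norm x \<Longrightarrow> mid_profile P x = 0" by (rule mid_profile_support) (rule that; blast)
  obtain B where B: "smooth_bound B (mid_profile P)" "0 \<le> B" by (rule mid_profile_smooth)
  have main: "\<exists>D\<ge>0. \<forall>j g G. 1 \<le> j \<longrightarrow> sup_le G (lp_block P j g) \<longrightarrow>
      sup_le (D * lam j * G) (\<lambda>k. of_real (2 * pi) * \<i> * of_real (p (vec_of k)) * lp_block P j g k)"
    if p: "linear p" "\<And>x. \<bar>p x\<bar> \<le> norm x" for p :: "plane \<Rightarrow> real"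
  proof -
    obtain B' where B': "0 \<le> B'" "\<And>x. \<bar>p x * mid_profile P x\<bar> \<le> B'"
      "\<And>x h. \<bar>p (x + h) * mid_profile P (x + h) + p (x - h) * mid_profile P (x - h) - 2 * (p x * mid_profile P x)\<bar> \<le> B' * (norm h)\<^sup>2"
      using second_difference_mult_linear[OF B(1) R(4,2) p] by blast
    define E where "E = 18 * B' * (2 * R + 5)"
    have "sup_le (2 * pi * E * lam j * G) (\<lambda>k. of_real (2 * pi) * \<i> * of_real (p (vec_of k)) * lp_block P j g k)"
      if j: "1 \<le> j" and g: "sup_le G (lp_block P j g)" for j g G
    proof -
      have lam1: "1 \<le> lam j" using lam_ge1[of j] j by simp
      let ?\<Psi> = "\<lambda>x. p x * mid_profile P x"
      have "sup_le (E * G) (\<lambda>k. of_real (?\<Psi> (vec_of k /\<^sub>R lam j)) * lp_block P j g k)"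
        unfolding E_def by (rule rescaled_multiplier_sup_bound[OF _ B'(2,3) R(2) lam1 g]) (simp add: R(4))
      from sup_le_scale[OF this, of "of_real (2 * pi * lam j) * \<i>"]
      have "sup_le (2 * pi * lam j * (E * G))
          (\<lambda>k. of_real (2 * pi * lam j) * \<i> * (of_real (?\<Psi> (vec_of k /\<^sub>R lam j)) * lp_block P j g k))"
        using lam1 by (simp add: norm_mult)
      moreover have "of_real (2 * pi * lam j) * \<i> * (of_real (?\<Psi> (vec_of k /\<^sub>R lam j)) * lp_block P j g k)
          = of_real (2 * pi) * \<i> * of_real (p (vec_of k)) * lp_block P j g k" for k
      proof (cases "phi P j k = 0")
        case False
        then have "mid_profile P (vec_of k /\<^sub>R lam j) = 1" using mid_eq1[of j k] mid_mid_profile[OF j] j by simp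
        moreover have "lam j * p (vec_of k /\<^sub>R lam j) = p (vec_of k)"
          using lam1 by (simp add: linear_cmul[OF p(1)])
        ultimately have "lam j * ?\<Psi> (vec_of k /\<^sub>R lam j) = p (vec_of k)" by simp
        then have c: "of_real (p (vec_of k)) = (of_real (lam j) * of_real (?\<Psi> (vec_of k /\<^sub>R lam j)) :: complex)"
          by (simp only: of_real_mult[symmetric])
        show ?thesis unfolding c by (simp only: of_real_mult mult_ac)
      qed (simp add: lp_block_phi)
      ultimately show ?thesis by (simp only: mult_ac)
    qed
    moreover have "0 \<le> 2 * pi * E" using B'(1) R(2) by (simp add: E_def)
    ultimately show ?thesis by blast
  qed
  have lin: "linear (fst :: plane \<Rightarrow> real)" "linear (snd :: plane \<Rightarrow> real)"
    by (auto intro!: linearI)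
  obtain D1 where D1: "0 \<le> D1" "\<And>j g G. 1 \<le> j \<Longrightarrow> sup_le G (lp_block P j g) \<Longrightarrow>
      sup_le (D1 * lam j * G) (\<lambda>k. of_real (2 * pi) * \<i> * of_real (fst (vec_of k)) * lp_block P j g k)"
    using main[OF lin(1) coord_le_norm(1)] by blast
  obtain D2 where D2: "0 \<le> D2" "\<And>j g G. 1 \<le> j \<Longrightarrow> sup_le G (lp_block P j g) \<Longrightarrow>
      sup_le (D2 * lam j * G) (\<lambda>k. of_real (2 * pi) * \<i> * of_real (snd (vec_of k)) * lp_block P j g k)"
    using main[OF lin(2) coord_le_norm(2)] by blast
  show thesis
  proof (rule that[of "max D1 D2"])
    fix j :: int and g :: torus_dist and G :: real assume j: "1 \<le> j" and g: "sup_le G (lp_block P j g)"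
    have le: "D1 * lam j * G \<le> max D1 D2 * lam j * G" "D2 * lam j * G \<le> max D1 D2 * lam j * G"
      using lam_pos[of j] sup_le_nonneg[OF g] by (auto intro!: mult_right_mono)
    have e1: "(\<lambda>k. of_real (2 * pi) * \<i> * of_real (fst (vec_of k)) * lp_block P j g k) = lp_block P j (partial1 g)"
      by (simp add: lp_block_phi partial1_def vec_of_def fun_eq_iff)
    have e2: "(\<lambda>k. of_real (2 * pi) * \<i> * of_real (snd (vec_of k)) * lp_block P j g k) = lp_block P j (partial2 g)"
      by (simp add: lp_block_phi partial2_def vec_of_def fun_eq_iff)
    show "sup_le (max D1 D2 * lam j * G) (lp_block P j (partial1 g))"
      using sup_le_mono[OF D1(2)[OF j g] le(1)] by (simp only: e1)
    show "sup_le (max D1 D2 * lam j * G) (lp_block P j (partial2 g))"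
      using sup_le_mono[OF D2(2)[OF j g] le(2)] by (simp only: e2)
  qed (use D1 in \<open>simp add: le_max_iff_disj\<close>)
qed

text \<open>
  On an annulus, \<open>(1 - \<Delta>)\<inverse>\<close> is the fixed multiplier \<open>1 / (4 \<pi>\<^sup>2 \<bar>x\<bar>\<^sup>2)\<close> at scale \<open>lam j\<close> applied to
  \<open>\<xi>\<^sub>j - X\<^sub>j\<close>; for large \<open>j\<close> the term \<open>X\<^sub>j\<close> is absorbed.
\<close>

lemma resolvent_block_bound:
  obtains D j0 where "0 \<le> D" "1 \<le> j0"
    "\<And>j g G. j0 \<le> j \<Longrightarrow> sup_le G (lp_block P j g) \<Longrightarrow> sup_le (D * lam j powr (- 2) * G) (lp_block P j (resolvent g))"
proof -
  obtain r R where R: "0 < r" "0 \<le> R" "\<And>x. norm x < r \<Longrightarrow> mid_profile P x = 0"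
    "\<And>x. R < norm x \<Longrightarrow> mid_profile P x = 0" by (rule mid_profile_support) (rule that; blast)
  obtain B where B: "smooth_bound B (mid_profile P)" "0 \<le> B" by (rule mid_profile_smooth)
  let ?\<Psi> = "\<lambda>x. mid_profile P x / (norm x)\<^sup>2"
  obtain B' where B': "0 \<le> B'" "\<And>x. \<bar>?\<Psi> x\<bar> \<le> B'"
    "\<And>x h. \<bar>?\<Psi> (x + h) + ?\<Psi> (x - h) - 2 * ?\<Psi> x\<bar> \<le> B' * (norm h)\<^sup>2"
    using second_difference_div_square[OF B(1) R(3,1)] by blast
  define E where "E = 18 * B' * (2 * R + 5)"
  have E: "0 \<le> E" using B'(1) R(2) by (simp add: E_def)
  \<comment> \<open>From this scale on (lam j)^2 \<ge> 2 * E, so that E * y is absorbed by half of y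
    * (lam j)^2.\<close>
  obtain m :: nat where m: "2 * E < 2 ^ m" using real_arch_pow[of 2 "2 * E"] by auto
  show thesis
  proof (rule that[of "2 * E" "int m + 1"])
    fix j :: int and g :: torus_dist and G :: real
    assume j: "int m + 1 \<le> j" and g: "sup_le G (lp_block P j g)"
    have j1: "1 \<le> j" using j by simp
    have lam1: "1 \<le> lam j" using lam_ge1[of j] j1 by simp
    have "2 ^ m = lam (int m)" by (simp add: lam_def powr_realpow)
    also have "\<dots> \<le> lam j" using j by (intro lam_mono) simp
    also have "\<dots> \<le> (lam j)\<^sup>2" using lam1 by (simp add: power2_eq_square)
    finally have big: "2 * E \<le> (lam j)\<^sup>2" using m by simp
    let ?Y = "lp_block P j (resolvent g)" and ?g = "lp_block P j g"
    define y where "y = sup_val ?Y"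
    have y: "sup_le y ?Y" unfolding y_def by (rule sup_val(1)[OF finite_lp_block])
    have "sup_le (E * (G + y)) (\<lambda>k. of_real (?\<Psi> (vec_of k /\<^sub>R lam j)) * (?g k - ?Y k))"
      unfolding E_def
      by (rule rescaled_multiplier_sup_bound[OF _ B'(2,3) R(2) lam1 sup_le_diff[OF g y]]) (simp add: R(4))
    from sup_le_scale[OF this, of "of_real (1 / (4 * pi\<^sup>2 * (lam j)\<^sup>2))"]
    have s: "sup_le (1 / (4 * pi\<^sup>2 * (lam j)\<^sup>2) * (E * (G + y)))
        (\<lambda>k. of_real (1 / (4 * pi\<^sup>2 * (lam j)\<^sup>2)) * (of_real (?\<Psi> (vec_of k /\<^sub>R lam j)) * (?g k - ?Y k)))"
      using lam1 by (simp add: norm_divide norm_mult norm_power)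
    have eq: "of_real (1 / (4 * pi\<^sup>2 * (lam j)\<^sup>2)) * (of_real (?\<Psi> (vec_of k /\<^sub>R lam j)) * (?g k - ?Y k)) = ?Y k" for k
    proof (cases "phi P j k = 0")
      case False
      then have mp: "mid_profile P (vec_of k /\<^sub>R lam j) = 1" using mid_eq1[of j k] mid_mid_profile[OF j1] j1 by simp
      then have "vec_of k /\<^sub>R lam j \<noteq> 0" using R(3)[of 0] R(1) by auto
      then have n0: "norm (vec_of k) \<noteq> 0" by simp
      have "?\<Psi> (vec_of k /\<^sub>R lam j) = (lam j)\<^sup>2 / (norm (vec_of k))\<^sup>2"
        using lam1 n0 by (simp only: mp norm_scaleR power_mult_distrib) (simp add: field_simps)
      then have "1 / (4 * pi\<^sup>2 * (lam j)\<^sup>2) * ?\<Psi> (vec_of k /\<^sub>R lam j) = 1 / (4 * pi\<^sup>2 * (norm (vec_of k))\<^sup>2)"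
        using lam1 by simp
      then have c: "complex_of_real (1 / (4 * pi\<^sup>2 * (lam j)\<^sup>2)) * of_real (?\<Psi> (vec_of k /\<^sub>R lam j))
          = of_real (1 / (4 * pi\<^sup>2 * (norm (vec_of k))\<^sup>2))"
        by (simp only: of_real_mult[symmetric])
      have gk: "?g k = of_real (bracket k) * ?Y k"
        using bracket_pos[of k] by (simp add: lp_block_phi resolvent_def)
      have "?g k - ?Y k = of_real (4 * pi\<^sup>2 * (norm (vec_of k))\<^sup>2) * ?Y k"
        unfolding gk by (simp add: bracket_def algebra_simps)
      then have "of_real (1 / (4 * pi\<^sup>2 * (lam j)\<^sup>2)) * of_real (?\<Psi> (vec_of k /\<^sub>R lam j)) * (?g k - ?Y k)
          = of_real (1 / (4 * pi\<^sup>2 * (norm (vec_of k))\<^sup>2) * (4 * pi\<^sup>2 * (norm (vec_of k))\<^sup>2)) * ?Y k"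
        unfolding c by (simp only: of_real_mult mult.assoc)
      also have "\<dots> = ?Y k" using n0 by simp
      finally show ?thesis by (simp only: mult.assoc)
    qed (simp add: lp_block_phi)
    have "sup_le (1 / (4 * pi\<^sup>2 * (lam j)\<^sup>2) * (E * (G + y))) ?Y" using s unfolding eq .
    from sup_val(2)[OF finite_lp_block this]
    have "y \<le> 1 / (4 * pi\<^sup>2 * (lam j)\<^sup>2) * (E * (G + y))" unfolding y_def .
    also have "\<dots> \<le> 1 / (lam j)\<^sup>2 * (E * (G + y))"
    proof (rule mult_right_mono)
      have "1 \<le> pi\<^sup>2" using pi_ge_two by (intro one_le_power) linarith
      then have "1 * (lam j)\<^sup>2 \<le> (4 * pi\<^sup>2) * (lam j)\<^sup>2" by (intro mult_right_mono) auto
      then show "1 / (4 * pi\<^sup>2 * (lam j)\<^sup>2) \<le> 1 / (lam j)\<^sup>2" using lam1 by (intro divide_left_mono) auto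
      show "0 \<le> E * (G + y)" using E sup_le_nonneg[OF g] sup_le_nonneg[OF y] by simp
    qed
    finally have "y * (lam j)\<^sup>2 \<le> E * G + E * y" using lam1 by (simp add: field_simps)
    moreover have "2 * E * y \<le> (lam j)\<^sup>2 * y" using big sup_le_nonneg[OF y] by (rule mult_right_mono)
    then have "2 * (E * y) \<le> y * (lam j)\<^sup>2" by (simp only: mult.assoc mult.commute[of y])
    ultimately have "y * (lam j)\<^sup>2 \<le> 2 * (E * G)" by linarith
    then have "y \<le> 2 * E * lam j powr (- 2) * G"
      using lam1 by (simp add: powr_minus field_simps)
    then show "sup_le (2 * E * lam j powr (- 2) * G) ?Y" using y by (rule sup_le_mono[rotated])
  qed (use E in auto)
qed

lemma hold_le_resolvent:
  assumes "hold_le b G g"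
  shows "\<exists>G'. hold_le (b + 2) G' (resolvent g)"
proof -
  obtain D j0 where D: "0 \<le> D" "1 \<le> j0"
    "\<And>j g G. j0 \<le> j \<Longrightarrow> sup_le G (lp_block P j g) \<Longrightarrow> sup_le (D * lam j powr (- 2) * G) (lp_block P j (resolvent g))"
    by (rule resolvent_block_bound) (rule that; blast)
  show ?thesis
  proof (rule hold_le_eventually)
    fix j assume j: "j0 \<le> j" "-1 \<le> j"
    have "- (b + 2) = - 2 + - b" by simp
    then have "lam j powr (- (b + 2)) = lam j powr (- 2) * lam j powr (- b)" by (simp only: powr_add)
    then show "sup_le (D * G * lam j powr (- (b + 2))) (lp_block P j (resolvent g))"
      using D(3)[OF j(1) hold_leD[OF assms j(2)]] by (simp only: mult_ac)
  qed
qed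

lemma hold_le_partial:
  assumes "hold_le b G g"
  shows "\<exists>G'. hold_le (b - 1) G' (partial1 g)" "\<exists>G'. hold_le (b - 1) G' (partial2 g)"
proof -
  obtain D where D: "0 \<le> D"
    "\<And>j g G. 1 \<le> j \<Longrightarrow> sup_le G (lp_block P j g) \<Longrightarrow> sup_le (D * lam j * G) (lp_block P j (partial1 g))"
    "\<And>j g G. 1 \<le> j \<Longrightarrow> sup_le G (lp_block P j g) \<Longrightarrow> sup_le (D * lam j * G) (lp_block P j (partial2 g))"
    by (rule partial_block_bound) (rule that; blast)
  have e: "lam j powr (- (b - 1)) = lam j * lam j powr (- b)" for j
    using powr_add[of "lam j" 1 "- b"] lam_pos[of j] by simp
  show "\<exists>G'. hold_le (b - 1) G' (partial1 g)"
  proof (rule hold_le_eventually)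
    fix j :: int assume j: "1 \<le> j" "-1 \<le> j"
    show "sup_le (D * G * lam j powr (- (b - 1))) (lp_block P j (partial1 g))"
      using D(2)[OF j(1) hold_leD[OF assms j(2)]] unfolding e by (simp only: mult_ac)
  qed
  show "\<exists>G'. hold_le (b - 1) G' (partial2 g)"
  proof (rule hold_le_eventually)
    fix j :: int assume j: "1 \<le> j" "-1 \<le> j"
    show "sup_le (D * G * lam j powr (- (b - 1))) (lp_block P j (partial2 g))"
      using D(3)[OF j(1) hold_leD[OF assms j(2)]] unfolding e by (simp only: mult_ac)
  qed
qed

end

section \<open>The operators at the level of Sobolev spaces\<close>

text \<open>The product rule for 1 - \<Delta> on characters: the mixed term is -2 times the product
  of the two gradient symbols.\<close>

lemma bracket_sum_symbol:
  "bracket (k + l) = bracket l + 4 * pi\<^sup>2 * (norm (vec_of k))\<^sup>2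
    + 8 * pi\<^sup>2 * (real_of_int (fst k) * real_of_int (fst l) + real_of_int (snd k) * real_of_int (snd l))"
  unfolding bracket_def norm_vec_of_sq by (simp add: power2_eq_square algebra_simps)

text \<open>
  The noise has regularity \<open>- 1 - \<kappa>\<close> for every \<open>\<kappa> > 0\<close>; with \<open>\<gamma> = 1 - 4 \<kappa>\<close> all the exponents
  below are satisfied with a margin.
\<close>

locale noise = dyadic_blocks +
  fixes \<Xi> :: enhanced and \<kappa> \<gamma> :: real
  assumes gamma: "2 / 3 < \<gamma>" "\<gamma> < 1" and kappa_def: "\<kappa> = (1 - \<gamma>) / 4"
    and hold_xi: "\<exists>G. hold_le (- 1 - \<kappa>) G (fst \<Xi>)"
    and hold_Xi2: "\<exists>G. hold_le (- 2 * \<kappa>) G (snd \<Xi>)"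
    and real_xi: "fst \<Xi> (- k) = cnj (fst \<Xi> k)"
begin

abbreviation xi :: torus_dist where "xi \<equiv> fst \<Xi>"
abbreviation Xi2 :: torus_dist where "Xi2 \<equiv> snd \<Xi>"
abbreviation X :: torus_dist where "X \<equiv> X_of \<Xi>"

lemma kappa: "0 < \<kappa>" "\<kappa> < 1 / 12" "\<gamma> = 1 - 4 * \<kappa>"
  using gamma by (simp_all add: kappa_def field_simps)

lemma hold_X: "\<exists>G. hold_le (1 - \<kappa>) G X"
proof -
  obtain G where "hold_le (- 1 - \<kappa>) G xi" using hold_xi by blast
  from hold_le_resolvent[OF this] show ?thesis by (simp add: X_of_def)
qed

lemma hold_partial_X: "\<exists>G. hold_le (- \<kappa>) G (partial1 X)" "\<exists>G. hold_le (- \<kappa>) G (partial2 X)"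
proof -
  obtain G where G: "hold_le (1 - \<kappa>) G X" using hold_X by blast
  show "\<exists>G. hold_le (- \<kappa>) G (partial1 X)" "\<exists>G. hold_le (- \<kappa>) G (partial2 X)"
    using hold_le_partial[OF G] by simp_all
qed

text \<open>A bound without linearity, so that the commutator term is treated like the explicit
  ones; additivity is proved separately for \<open>T\<close>.\<close>

definition bounded_op :: "real \<Rightarrow> real \<Rightarrow> (torus_dist \<Rightarrow> torus_dist) \<Rightarrow> bool" where
  "bounded_op a t F \<longleftrightarrow> (\<exists>C\<ge>0. \<forall>c u. sob_le a c u \<longrightarrow> sob_le t (C * c) (F u))"

lemma bounded_opE:
  assumes "bounded_op a t F"
  obtains C where "0 \<le> C" "\<And>c u. sob_le a c u \<Longrightarrow> sob_le t (C * c) (F u)"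
  using assms unfolding bounded_op_def by blast

lemma bounded_opI: "0 \<le> C \<Longrightarrow> (\<And>c u. sob_le a c u \<Longrightarrow> sob_le t (C * c) (F u)) \<Longrightarrow> bounded_op a t F"
  unfolding bounded_op_def by blast

lemma bounded_op_add:
  assumes "bounded_op a t F" "bounded_op a t G"
  shows "bounded_op a t (\<lambda>u. F u + G u)"
proof -
  obtain C where C: "0 \<le> C" "\<And>c u. sob_le a c u \<Longrightarrow> sob_le t (C * c) (F u)" by (rule bounded_opE[OF assms(1)]) (rule that; blast)
  obtain D where D: "0 \<le> D" "\<And>c u. sob_le a c u \<Longrightarrow> sob_le t (D * c) (G u)" by (rule bounded_opE[OF assms(2)]) (rule that; blast)
  show ?thesis
  proof (rule bounded_opI[of "C + D"])
    show "sob_le t ((C + D) * c) (F u + G u)" if "sob_le a c u" for c u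
      using sob_le_add[OF C(2)[OF that] D(2)[OF that]] by (simp add: distrib_right)
  qed (use C(1) D(1) in simp)
qed

lemma bounded_op_weaken:
  assumes "bounded_op a t F" "a \<le> a'" "t' \<le> t"
  shows "bounded_op a' t' F"
  using assms unfolding bounded_op_def by (meson sob_le_weaken)

lemma bounded_op_compose:
  assumes "bounded_op a b F" "bounded_op b t G"
  shows "bounded_op a t (\<lambda>u. G (F u))"
proof -
  obtain C where C: "0 \<le> C" "\<And>c u. sob_le a c u \<Longrightarrow> sob_le b (C * c) (F u)" by (rule bounded_opE[OF assms(1)]) (rule that; blast)
  obtain D where D: "0 \<le> D" "\<And>c u. sob_le b c u \<Longrightarrow> sob_le t (D * c) (G u)" by (rule bounded_opE[OF assms(2)]) (rule that; blast)
  show ?thesis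
  proof (rule bounded_opI[of "D * C"])
    show "sob_le t (D * C * c) (G (F u))" if "sob_le a c u" for c u
      using D(2)[OF C(2)[OF that]] by (simp add: mult.assoc)
  qed (use C(1) D(1) in simp)
qed

lemma bounded_op_scale:
  assumes "bounded_op a t F"
  shows "bounded_op a t (\<lambda>u. scale z (F u))"
proof -
  obtain C where C: "0 \<le> C" "\<And>c u. sob_le a c u \<Longrightarrow> sob_le t (C * c) (F u)" by (rule bounded_opE[OF assms]) (rule that; blast)
  show ?thesis
  proof (rule bounded_opI[of "cmod z * C"])
    show "sob_le t (cmod z * C * c) (scale z (F u))" if "sob_le a c u" for c u
      using sob_le_scale[OF C(2)[OF that], of z] by (simp add: mult.assoc)
  qed (use C(1) in simp)
qed

lemma bounded_op_partial:
  "bounded_op a (a - 1) partial1" "bounded_op a (a - 1) partial2"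
  "bounded_op a (a - 2) laplacian" "bounded_op a (a + 2) resolvent"
  using sob_le_partial sob_le_laplacian sob_le_resolvent
  by (auto intro!: bounded_opI[of 1])

lemma bounded_low_high:
  assumes "-2 < t" "a \<le> 0" "t < a + b" "\<exists>G. hold_le b G g"
  shows "bounded_op a t (\<lambda>u. paraproduct P u g)"
proof -
  obtain G where G: "hold_le b G g" using assms(4) by blast
  obtain D where D: "0 \<le> D" "\<And>u g c G. sob_le a c u \<Longrightarrow> hold_le b G g \<Longrightarrow> sob_le t (D * G * c) (paraproduct P u g)"
    by (rule low_high_paraproduct[OF assms(1,2,3)]) (rule that; blast)
  show ?thesis by (rule bounded_opI[of "D * G"]) (use D hold_le_nonneg[OF G] G in auto)
qed

lemma bounded_high_low:
  assumes "-2 < t" "b < 0" "t < a + b" "\<exists>G. hold_le b G g"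
  shows "bounded_op a t (\<lambda>u. paraproduct P g u)"
proof -
  obtain G where G: "hold_le b G g" using assms(4) by blast
  obtain D where D: "0 \<le> D" "\<And>u g c G. sob_le a c u \<Longrightarrow> hold_le b G g \<Longrightarrow> sob_le t (D * G * c) (paraproduct P g u)"
    by (rule high_low_paraproduct[OF assms(1,2,3)]) (rule that; blast)
  show ?thesis by (rule bounded_opI[of "D * G"]) (use D hold_le_nonneg[OF G] G in auto)
qed

lemma bounded_resonant:
  assumes "0 < a + b" "\<exists>G. hold_le b G g"
  shows "bounded_op a 0 (\<lambda>u. resonant P u g)"
proof -
  obtain G where G: "hold_le b G g" using assms(2) by blast
  obtain D where D: "0 \<le> D" "\<And>u g c G. sob_le a c u \<Longrightarrow> hold_le b G g \<Longrightarrow> sob_le 0 (D * G * c) (resonant P u g)"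
    by (rule resonant_product[OF assms(1)]) (rule that; blast)
  show ?thesis by (rule bounded_opI[of "D * G"]) (use D hold_le_nonneg[OF G] G in auto)
qed

lemma bounded_grad_paraproduct:
  assumes "-2 < t" "a \<le> 1" "t < a - 1 - \<kappa>"
  shows "bounded_op a t (\<lambda>u. grad_paraproduct P u X)"
proof -
  have "bounded_op (a - 1) t (\<lambda>u. paraproduct P u (partial1 X))" "bounded_op (a - 1) t (\<lambda>u. paraproduct P u (partial2 X))"
    using assms hold_partial_X by (auto intro!: bounded_low_high[where b = "- \<kappa>"])
  from bounded_op_compose[OF bounded_op_partial(1) this(1)] bounded_op_compose[OF bounded_op_partial(2) this(2)]
  show ?thesis unfolding grad_paraproduct_def by (rule bounded_op_add)
qed

lemma bounded_B_source:
  assumes "-2 < t" "0 \<le> a" "a \<le> 1" "t < a - 1 - \<kappa>" "t < - 2 * \<kappa>"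
  shows "bounded_op a t (\<lambda>u. paraproduct P (laplacian u) X + scale 2 (grad_paraproduct P u X)
    + paraproduct P xi u + paraproduct P u Xi2)"
proof (intro bounded_op_add bounded_op_scale)
  have "bounded_op (a - 2) t (\<lambda>u. paraproduct P u X)"
    using assms hold_X by (intro bounded_low_high[where b = "1 - \<kappa>"]) auto
  from bounded_op_compose[OF bounded_op_partial(3) this]
  show "bounded_op a t (\<lambda>u. paraproduct P (laplacian u) X)" .
  show "bounded_op a t (\<lambda>u. grad_paraproduct P u X)" using assms by (intro bounded_grad_paraproduct)
  show "bounded_op a t (\<lambda>u. paraproduct P xi u)"
    using assms kappa hold_xi by (intro bounded_high_low[where b = "- 1 - \<kappa>"]) auto
  have "bounded_op 0 t (\<lambda>u. paraproduct P u Xi2)"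
    using assms hold_Xi2 by (intro bounded_low_high[where b = "- 2 * \<kappa>"]) auto
  then show "bounded_op a t (\<lambda>u. paraproduct P u Xi2)" by (rule bounded_op_weaken) (use assms in auto)
qed

text \<open>The worst source terms have order \<gamma> - 1 - \<kappa>, one more \<kappa> pays for
  summing the blocks, and the resolvent adds 2. The result 2 - 6 * \<kappa> exceeds 1 + \<kappa>, so
  the resonant product with the noise converges.\<close>

lemma bounded_B: "bounded_op \<gamma> (\<gamma> + 1 - 2 * \<kappa>) (B_op P \<Xi>)"
proof -
  have "bounded_op \<gamma> (\<gamma> - 1 - 2 * \<kappa>) (\<lambda>u. paraproduct P (laplacian u) X + scale 2 (grad_paraproduct P u X)
    + paraproduct P xi u + paraproduct P u Xi2)"
    using gamma kappa by (intro bounded_B_source) auto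
  from bounded_op_compose[OF this bounded_op_partial(4)]
  have "bounded_op \<gamma> (\<gamma> - 1 - 2 * \<kappa> + 2) (B_op P \<Xi>)" by (simp only: B_op_def[abs_def])
  moreover have "\<gamma> - 1 - 2 * \<kappa> + 2 = \<gamma> + 1 - 2 * \<kappa>" by simp
  ultimately show ?thesis by (simp only:)
qed

section \<open>The smoothing operator T\<close>

definition T :: "torus_dist \<Rightarrow> torus_dist" where
  "T u = paraproduct P u X + B_op P \<Xi> u"

definition drift :: "torus_dist \<Rightarrow> torus_dist" where
  "drift u = paraproduct P u xi + paraproduct P xi u + paraproduct P u Xi2"

lemma remainder_T: "remainder P \<Xi> u = u - T u"
  by (simp add: remainder_def T_def)

text \<open>The block-wise form of \<open>(1 - \<Delta>)(u \<prec> X) = u \<prec> \<xi> - \<Delta>u \<prec> X - 2 \<nabla>u \<prec> \<nabla>X\<close>.\<close>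

lemma product_rule_block:
  "of_real (bracket n) * mult (weighted (low P j) u) (lp_block P j X) n
    + mult (weighted (low P j) (laplacian u)) (lp_block P j X) n
    + 2 * (mult (weighted (low P j) (partial1 u)) (lp_block P j (partial1 X)) n
      + mult (weighted (low P j) (partial2 u)) (lp_block P j (partial2 X)) n)
    = mult (weighted (low P j) u) (lp_block P j xi) n"
proof -
  let ?S = "{l. phi P j l \<noteq> 0}"
  have e: "mult f (lp_block P j g) n = (\<Sum>l\<in>?S. f (n - l) * lp_block P j g l)" for f g
    by (rule mult_finite_right[OF finite_phi]) (simp add: lp_block_phi)
  have "of_real (bracket n) * (weighted (low P j) u (n - l) * lp_block P j X l)
      + weighted (low P j) (laplacian u) (n - l) * lp_block P j X l
      + 2 * (weighted (low P j) (partial1 u) (n - l) * lp_block P j (partial1 X) l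
        + weighted (low P j) (partial2 u) (n - l) * lp_block P j (partial2 X) l)
      = weighted (low P j) u (n - l) * lp_block P j xi l" for l
  proof -
    let ?k = "n - l"
    let ?w = "of_real (low P j ?k) * u ?k * (of_real (phi P j l) * X l)"
    have x: "xi l = of_real (bracket l) * X l" using bracket_pos[of l] by (simp add: X_of_def resolvent_def)
    have b: "bracket n = bracket l + 4 * pi\<^sup>2 * (norm (vec_of ?k))\<^sup>2
      + 8 * pi\<^sup>2 * (real_of_int (fst ?k) * real_of_int (fst l) + real_of_int (snd ?k) * real_of_int (snd l))"
      using bracket_sum_symbol[of ?k l] by simp
    have "of_real (bracket n) * (weighted (low P j) u ?k * lp_block P j X l)
      + weighted (low P j) (laplacian u) ?k * lp_block P j X l
      + 2 * (weighted (low P j) (partial1 u) ?k * lp_block P j (partial1 X) l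
        + weighted (low P j) (partial2 u) ?k * lp_block P j (partial2 X) l)
      = (of_real (bracket n) - of_real (4 * pi\<^sup>2 * (norm (vec_of ?k))\<^sup>2)
        - of_real (8 * pi\<^sup>2 * (real_of_int (fst ?k) * real_of_int (fst l) + real_of_int (snd ?k) * real_of_int (snd l)))) * ?w"
      by (simp add: weighted_def lp_block_phi laplacian_def partial1_def partial2_def power2_eq_square algebra_simps)
    also have "\<dots> = of_real (bracket l) * ?w" unfolding b by simp
    also have "\<dots> = weighted (low P j) u ?k * lp_block P j xi l"
      by (simp add: weighted_def lp_block_phi x)
    finally show ?thesis .
  qed
  then show ?thesis
    unfolding e sum_distrib_left sum.distrib[symmetric] by (intro sum.cong refl)
qed

lemma summable_low_high:
  assumes "-2 < t" "a \<le> 0" "t < a + b" "\<exists>G. hold_le b G g" "\<exists>c. sob_le a c u"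
  shows "(\<lambda>j. mult (weighted (low P j) u) (lp_block P j g) n) summable_on {-1..}"
  by (rule low_high_paraproduct[OF assms(1,2,3)]) (use assms(4,5) in blast)

lemma T_eq:
  assumes u: "sob_le 0 c u"
  shows "T u = resolvent (drift u)"
proof
  fix n
  let ?A = "\<lambda>j. mult (weighted (low P j) u) (lp_block P j X) n"
  let ?L = "\<lambda>j. mult (weighted (low P j) (laplacian u)) (lp_block P j X) n"
  let ?G1 = "\<lambda>j. mult (weighted (low P j) (partial1 u)) (lp_block P j (partial1 X)) n"
  let ?G2 = "\<lambda>j. mult (weighted (low P j) (partial2 u)) (lp_block P j (partial2 X)) n"
  \<comment> \<open>Any exponent strictly between -2 and -1 - \<kappa> would do, the latter being
    the smallest a + b among the four series, each of which must be summable on its own.\<close>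
  have t: "-2 < (- 3 / 2 :: real)" by simp
  have A: "?A summable_on {-1..}"
    by (rule summable_low_high[OF t, where a = 0 and b = "1 - \<kappa>"]) (use kappa hold_X u in auto)
  have L: "?L summable_on {-1..}"
    by (rule summable_low_high[OF t, where a = "-2" and b = "1 - \<kappa>"])
       (use kappa hold_X sob_le_laplacian[OF u] in auto)
  have G1: "?G1 summable_on {-1..}"
    by (rule summable_low_high[OF t, where a = "-1" and b = "- \<kappa>"])
       (use kappa hold_partial_X sob_le_partial[OF u] in auto)
  have G2: "?G2 summable_on {-1..}"
    by (rule summable_low_high[OF t, where a = "-1" and b = "- \<kappa>"])
       (use kappa hold_partial_X sob_le_partial[OF u] in auto)
  have "paraproduct P u xi n = (\<Sum>\<^sub>\<infinity>j\<in>{-1..}. of_real (bracket n) * ?A j + ?L j + 2 * (?G1 j + ?G2 j))"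
    unfolding paraproduct_eq product_rule_block ..
  also have "\<dots> = of_real (bracket n) * paraproduct P u X n + paraproduct P (laplacian u) X n
      + 2 * grad_paraproduct P u X n"
    unfolding grad_paraproduct_def plus_fun_apply paraproduct_eq
    by (subst infsum_add, (intro summable_on_add summable_on_cmult_right A L G1 G2)+)+
       (simp only: infsum_cmult_right' infsum_add[OF G1 G2])
  finally have "paraproduct P u X n = (paraproduct P u xi n - paraproduct P (laplacian u) X n
      - 2 * grad_paraproduct P u X n) / of_real (bracket n)"
    using bracket_pos[of n] by (simp add: field_simps)
  then show "T u n = resolvent (drift u) n"
    by (simp add: T_def B_op_def resolvent_def drift_def scale_def add_divide_distrib[symmetric])
qed

text \<open>The order \<gamma> - 2 = -1 - 4 * \<kappa> lies strictly below the order -1 - \<kappa>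
  of the noise, which is the room the paraproducts need.\<close>

lemma bounded_drift: "bounded_op 0 (\<gamma> - 2) drift"
  unfolding drift_def[abs_def]
proof (intro bounded_op_add)
  show "bounded_op 0 (\<gamma> - 2) (\<lambda>u. paraproduct P u xi)"
    using gamma kappa hold_xi by (intro bounded_low_high[where b = "- 1 - \<kappa>"]) auto
  show "bounded_op 0 (\<gamma> - 2) (paraproduct P xi)"
    using gamma kappa hold_xi by (intro bounded_high_low[where b = "- 1 - \<kappa>"]) auto
  show "bounded_op 0 (\<gamma> - 2) (\<lambda>u. paraproduct P u Xi2)"
    using gamma kappa hold_Xi2 by (intro bounded_low_high[where b = "- 2 * \<kappa>"]) auto
qed

lemma bounded_T: "bounded_op 0 \<gamma> T"
proof -
  obtain C where C: "0 \<le> C" "\<And>c u. sob_le 0 c u \<Longrightarrow> sob_le (\<gamma> - 2) (C * c) (drift u)" by (rule bounded_opE[OF bounded_drift]) (rule that; blast)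
  show ?thesis
  proof (rule bounded_opI[OF C(1)])
    fix c u assume u: "sob_le 0 c u"
    show "sob_le \<gamma> (C * c) (T u)" using sob_le_resolvent[OF C(2)[OF u]] by (simp add: T_eq[OF u])
  qed
qed

lemma weighted_add: "weighted a (f + g) = (\<lambda>k. weighted a f k + weighted a g k)"
  by (simp add: weighted_def fun_eq_iff distrib_left)

lemma lp_block_add: "lp_block P j (f + g) = (\<lambda>k. lp_block P j f k + lp_block P j g k)"
  by (simp add: lp_block_phi fun_eq_iff distrib_left)

lemma finite_weighted_low: "finite {k. weighted (low P j) f k \<noteq> 0}"
proof -
  have "{k. weighted (low P j) f k \<noteq> 0} \<subseteq> (\<Union>i\<in>{-1..j - 2}. {k. lp_block P i f k \<noteq> 0})"
    unfolding weighted_low_sum using sum.not_neutral_contains_not_neutral by fastforce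
  then show ?thesis by (rule finite_subset) (simp add: finite_lp_block)
qed

text \<open>Needed to apply the contraction property to differences of L^2 functions; the series may
  be added once summability is known for both summands.\<close>

lemma drift_add:
  assumes u: "sob_le 0 c u" and v: "sob_le 0 d v"
  shows "drift (u + v) = drift u + drift v"
proof -
  have t: "-2 < (- 3 / 2 :: real)" by simp
  have lh: "paraproduct P (u + v) g = paraproduct P u g + paraproduct P v g"
    if g: "\<exists>G. hold_le b G g" "- 3 / 2 < 0 + b" for g b
  proof
    fix n
    have s: "(\<lambda>j. mult (weighted (low P j) w) (lp_block P j g) n) summable_on {-1..}" if "sob_le 0 e w" for w e
      by (rule summable_low_high[OF t order_refl g(2,1)]) (use that in blast)
    show "paraproduct P (u + v) g n = (paraproduct P u g + paraproduct P v g) n"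
      unfolding plus_fun_apply paraproduct_eq weighted_add mult_add_left[OF finite_lp_block]
      by (rule infsum_add[OF s[OF u] s[OF v]])
  qed
  have hl: "paraproduct P xi (u + v) = paraproduct P xi u + paraproduct P xi v"
  proof
    fix n
    obtain G where G: "hold_le (- 1 - \<kappa>) G xi" using hold_xi by blast
    have b: "- 1 - \<kappa> < 0" "- 3 / 2 < 0 + (- 1 - \<kappa>)" using kappa by simp_all
    have s: "(\<lambda>j. mult (weighted (low P j) xi) (lp_block P j w) n) summable_on {-1..}" if "sob_le 0 e w" for w e
      by (rule high_low_paraproduct[OF t b]) (use that G in blast)
    have m: "mult (weighted (low P j) xi) (lp_block P j (u + v)) n
        = mult (weighted (low P j) xi) (lp_block P j u) n + mult (weighted (low P j) xi) (lp_block P j v) n" for j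
      unfolding mult_commute[of "weighted (low P j) xi"] lp_block_add by (rule mult_add_left[OF finite_weighted_low])
    show "paraproduct P xi (u + v) n = (paraproduct P xi u + paraproduct P xi v) n"
      unfolding plus_fun_apply paraproduct_eq m by (rule infsum_add[OF s[OF u] s[OF v]])
  qed
  show ?thesis
    unfolding drift_def hl lh[OF hold_xi, of] lh[OF hold_Xi2]
    by (subst lh[OF hold_xi], use kappa in simp, subst lh[OF hold_Xi2], use kappa in simp, simp)
qed

lemma T_add:
  assumes u: "sob_le 0 c u" and v: "sob_le 0 d v"
  shows "T (u + v) = T u + T v"
  unfolding T_eq[OF u] T_eq[OF v] T_eq[OF sob_le_add[OF u v]] drift_add[OF u v]
  by (simp add: resolvent_def fun_eq_iff add_divide_distrib)

lemma T_diff: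
  assumes u: "sob_le 0 c u" and v: "sob_le 0 d v"
  shows "T (u - v) = T u - T v"
  using T_add[OF sob_le_diff[OF u v] v] by (simp add: algebra_simps)

lemma bounded_mult_Xi2: "bounded_op \<gamma> 0 (\<lambda>u. mult u Xi2 - paraproduct P u Xi2)"
proof -
  obtain G where G: "hold_le (- 2 * \<kappa>) G Xi2" using hold_Xi2 by blast
  have a: "0 \<le> \<gamma>" "0 < \<gamma> + (- 2 * \<kappa>)" "-2 < - 2 * \<kappa>" using gamma kappa by simp_all
  obtain D where D: "0 \<le> D" "\<And>u g c G. sob_le \<gamma> c u \<Longrightarrow> hold_le (- 2 * \<kappa>) G g \<Longrightarrow>
    sob_le 0 (D * G * c) (mult u g - paraproduct P u g)"
    by (rule mult_minus_paraproduct[OF a]) (rule that; blast)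
  show ?thesis by (rule bounded_opI[of "D * G"]) (use D hold_le_nonneg[OF G] G in auto)
qed

lemma holder_of_hold_le:
  assumes "hold_le b G g"
  shows "holder_norm P b g \<le> ennreal G"
  unfolding holder_norm_def
proof (rule SUP_least)
  fix j :: int assume "j \<in> {-1..}"
  then have s: "sup_le (G * lam j powr (- b)) (lp_block P j g)" using hold_leD[OF assms] by simp
  have "linf_norm (lp_block P j g) \<le> ennreal (G * lam j powr (- b))"
    unfolding linf_norm_def
  proof (rule SUP_least)
    fix x
    have "cmod (eval_at (lp_block P j g) x) \<le> G * lam j powr (- b)" using s unfolding sup_le_def by blast
    then show "ennreal (cmod (eval_at (lp_block P j g) x)) \<le> ennreal (G * lam j powr (- b))" by (rule ennreal_leI)
  qed
  then have "ennreal (2 powr (of_int j * b)) * linf_norm (lp_block P j g)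
      \<le> ennreal (2 powr (of_int j * b)) * ennreal (G * lam j powr (- b))" by (intro mult_left_mono) auto
  also have "\<dots> = ennreal (2 powr (of_int j * b) * (G * lam j powr (- b)))"
    using hold_le_nonneg[OF assms] by (simp add: ennreal_mult)
  also have "2 powr (of_int j * b) * (G * lam j powr (- b)) = G"
    by (simp add: lam_def powr_powr mult.left_commute flip: powr_add)
  finally show "ennreal (2 powr (of_int j * b)) * linf_norm (lp_block P j g) \<le> ennreal G" .
qed

text \<open>The orders are \<gamma>, 1 - \<kappa> and -1 - \<kappa>: the last two sum to -2 *
  \<kappa> < 0 and all three to \<gamma> - 2 * \<kappa> > 0, as the commutator estimate
  demands.\<close>

lemma bounded_commutator:
  assumes C: "commutator_operator P C"
  shows "bounded_op \<gamma> 0 (\<lambda>u. C u X xi)"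
proof -
  obtain G1 where G1: "hold_le (1 - \<kappa>) G1 X" using hold_X by blast
  obtain G2 where G2: "hold_le (- 1 - \<kappa>) G2 xi" using hold_xi by blast
  have cond: "0 < \<gamma> \<and> \<gamma> < 1 \<and> (1 - \<kappa>) + (- 1 - \<kappa>) < 0 \<and> \<gamma> + (1 - \<kappa>) + (- 1 - \<kappa>) > 0" using gamma kappa by simp
  from C[unfolded commutator_operator_def, THEN conjunct1, THEN spec, THEN spec, THEN spec, THEN mp, OF cond, THEN conjunct1]
  obtain M :: real where M: "\<And>f g h. f \<in> sobolev \<gamma> \<Longrightarrow> g \<in> holder P (1 - \<kappa>) \<Longrightarrow> h \<in> holder P (- 1 - \<kappa>) \<Longrightarrow>
      sobolev_norm (\<gamma> + (1 - \<kappa>) + (- 1 - \<kappa>)) (C f g h)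
        \<le> ennreal M * sobolev_norm \<gamma> f * holder_norm P (1 - \<kappa>) g * holder_norm P (- 1 - \<kappa>) h"
    by blast
  have hX: "holder_norm P (1 - \<kappa>) X \<le> ennreal G1" and hxi: "holder_norm P (- 1 - \<kappa>) xi \<le> ennreal G2"
    by (rule holder_of_hold_le[OF G1] holder_of_hold_le[OF G2])+
  have h: "X \<in> holder P (1 - \<kappa>)" "xi \<in> holder P (- 1 - \<kappa>)"
    using hX hxi by (auto simp: holder_def intro: le_less_trans)
  have G: "0 \<le> G1" "0 \<le> G2" using hold_le_nonneg G1 G2 by blast+
  show ?thesis
  proof (rule bounded_opI[of "max M 0 * G1 * G2"])
    fix c u assume u: "sob_le \<gamma> c u"
    have c: "0 \<le> c" using u by (rule sob_le_nonneg)
    have "u \<in> sobolev \<gamma>" using u sobolev_iff by blast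
    from M[OF this h]
    have "sobolev_norm (\<gamma> + (1 - \<kappa>) + (- 1 - \<kappa>)) (C u X xi)
        \<le> ennreal M * sobolev_norm \<gamma> u * holder_norm P (1 - \<kappa>) X * holder_norm P (- 1 - \<kappa>) xi" .
    also have "\<dots> \<le> ennreal (max M 0) * ennreal c * ennreal G1 * ennreal G2"
      using u sobolev_norm_le_iff[OF c] hX hxi by (intro mult_mono) (auto intro: ennreal_leI)
    also have "\<dots> = ennreal (max M 0 * c * G1 * G2)" using c G by (simp add: ennreal_mult)
    finally have "sob_le (\<gamma> + (1 - \<kappa>) + (- 1 - \<kappa>)) (max M 0 * c * G1 * G2) (C u X xi)"
      using c G by (subst (asm) sobolev_norm_le_iff) auto
    then have "sob_le 0 (max M 0 * c * G1 * G2) (C u X xi)"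
      by (rule sob_le_weaken) (use gamma kappa in simp)
    then show "sob_le 0 (max M 0 * G1 * G2 * c) (C u X xi)" by (simp only: mult_ac)
  qed (use G in simp)
qed

lemma bounded_B_resonant: "bounded_op \<gamma> 0 (\<lambda>u. resonant P (B_op P \<Xi> u) xi)"
proof -
  have "bounded_op (\<gamma> + 1 - 2 * \<kappa>) 0 (\<lambda>u. resonant P u xi)"
    using gamma kappa hold_xi by (intro bounded_resonant[where b = "- 1 - \<kappa>"]) auto
  then show ?thesis by (rule bounded_op_compose[OF bounded_B])
qed

text \<open>The order 3 / 2 exceeds 1 + \<kappa> yet stays below 2, which leaves room to interpolate
  against the H^2 norm of R u.\<close>

lemma bounded_R_resonant: "bounded_op (3 / 2) 0 (\<lambda>u. resonant P u xi)"
  using kappa hold_xi by (intro bounded_resonant[where b = "- 1 - \<kappa>"]) auto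

text \<open>In the form these terms are paired with R u in H^(1/2), an order below 1 and so open to
  interpolation; it works because \<gamma> - 1 - \<kappa> = -5 * \<kappa> > -1 / 2.\<close>

lemma bounded_half: "bounded_op \<gamma> (- (1 / 2)) (\<lambda>u. paraproduct P xi u)" "bounded_op \<gamma> (- (1 / 2)) (\<lambda>u. paraproduct P u Xi2)"
proof -
  show "bounded_op \<gamma> (- (1 / 2)) (\<lambda>u. paraproduct P xi u)"
    using gamma kappa hold_xi by (intro bounded_high_low[where b = "- 1 - \<kappa>"]) auto
  have "bounded_op 0 (- (1 / 2)) (\<lambda>u. paraproduct P u Xi2)"
    using gamma kappa hold_Xi2 by (intro bounded_low_high[where b = "- 2 * \<kappa>"]) auto
  then show "bounded_op \<gamma> (- (1 / 2)) (\<lambda>u. paraproduct P u Xi2)" by (rule bounded_op_weaken) (use gamma in auto)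
qed

end

section \<open>The quadratic form\<close>

lemma sob_le_0_shift:
  assumes "sob_le 0 d g"
  shows "sob_le 0 d (\<lambda>n. g (n - l))"
  unfolding sob_le_def
proof safe
  fix F :: "freq set" assume F: "finite F"
  have "L2_set (\<lambda>n. bracket n powr (0 / 2) * cmod (g (n - l))) F
      = L2_set (\<lambda>n. bracket n powr (0 / 2) * cmod (g n)) ((\<lambda>n. n - l) ` F)"
    unfolding L2_set_def using bracket_pos by (subst sum.reindex) (auto simp: inj_on_def less_le)
  also have "\<dots> \<le> d" using sob_leD[OF assms] F by simp
  finally show "L2_set (\<lambda>n. bracket n powr (0 / 2) * cmod (g (n - l))) F \<le> d" .
qed

lemma infsum_finite_sum:
  fixes F :: "'a \<Rightarrow> 'b \<Rightarrow> complex"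
  assumes "\<And>l. (\<lambda>n. F l n) summable_on A"
  shows "(\<Sum>\<^sub>\<infinity>n\<in>A. \<Sum>l\<in>S. F l n) = (\<Sum>l\<in>S. \<Sum>\<^sub>\<infinity>n\<in>A. F l n)"
proof -
  have "(\<lambda>n. \<Sum>l\<in>S. F l n) summable_on A \<and>
      (\<Sum>\<^sub>\<infinity>n\<in>A. \<Sum>l\<in>S. F l n) = (\<Sum>l\<in>S. \<Sum>\<^sub>\<infinity>n\<in>A. F l n)"
  proof (induction S rule: infinite_finite_induct)
    case (insert l S)
    then show ?case using assms by (simp add: infsum_add summable_on_add)
  qed simp_all
  then show ?thesis ..
qed

text \<open>Multiplication by a real function is self-adjoint; reality exchanges the frequencies l
  and -l after the summation index has been shifted.\<close>

lemma L2_inner_mult_adjoint: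
  assumes f: "sob_le 0 c f" and g: "sob_le 0 d g" and S: "finite {l. h l \<noteq> 0}"
    and real: "\<And>l. h (- l) = cnj (h l)"
  shows "L2_inner f (mult g h) = L2_inner (mult f h) g"
proof -
  let ?S = "{l. h l \<noteq> 0}"
  have sym: "(\<lambda>l. - l) ` ?S = ?S"
  proof -
    have "l \<in> (\<lambda>l. - l) ` ?S" if "l \<in> ?S" for l
      using that real[of l] by (intro image_eqI[of _ _ "- l"]) auto
    moreover have "- l \<in> ?S" if "l \<in> ?S" for l using that real[of l] by simp
    ultimately show ?thesis by blast
  qed
  have e: "mult v h n = (\<Sum>l\<in>?S. v (n - l) * h l)" for v n by (rule mult_finite_right[OF S]) auto
  have sm: "(\<lambda>n. f n * cnj (g (n - l)) * z) summable_on UNIV" for l z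
  proof -
    have "sob_le (- 0) d (\<lambda>n. g (n - l))" using sob_le_0_shift[OF g] by simp
    from L2_inner_summable[OF f this] show ?thesis by (rule summable_on_cmult_left)
  qed
  have "L2_inner f (mult g h) = (\<Sum>\<^sub>\<infinity>n. \<Sum>l\<in>?S. f n * cnj (g (n - l)) * cnj (h l))"
    unfolding L2_inner_def e by (intro infsum_cong) (simp add: sum_distrib_left mult_ac)
  also have "\<dots> = (\<Sum>l\<in>?S. \<Sum>\<^sub>\<infinity>n. f n * cnj (g (n - l)) * cnj (h l))"
    by (rule infsum_finite_sum[OF sm])
  also have "\<dots> = (\<Sum>l\<in>?S. \<Sum>\<^sub>\<infinity>m. f (m + l) * cnj (g m) * h (- l))"
  proof (rule sum.cong[OF refl])
    fix l
    have "(\<Sum>\<^sub>\<infinity>n. f n * cnj (g (n - l)) * cnj (h l)) = (\<Sum>\<^sub>\<infinity>n\<in>range (\<lambda>m. m + l). f n * cnj (g (n - l)) * cnj (h l))"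
      by (rule arg_cong[where f = "infsum _"]) (metis surj_def diff_add_cancel)
    also have "\<dots> = (\<Sum>\<^sub>\<infinity>m. f (m + l) * cnj (g m) * cnj (h l))"
      by (subst infsum_reindex) (auto simp: inj_on_def o_def)
    finally show "(\<Sum>\<^sub>\<infinity>n. f n * cnj (g (n - l)) * cnj (h l)) = (\<Sum>\<^sub>\<infinity>m. f (m + l) * cnj (g m) * h (- l))"
      by (simp only: real)
  qed
  also have "\<dots> = (\<Sum>l\<in>?S. \<Sum>\<^sub>\<infinity>m. f (m - l) * cnj (g m) * h l)"
    by (subst (2) sym[symmetric], subst sum.reindex) (auto simp: inj_on_def)
  also have "\<dots> = (\<Sum>\<^sub>\<infinity>m. \<Sum>l\<in>?S. f (m - l) * cnj (g m) * h l)"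
  proof (rule infsum_finite_sum[symmetric])
    fix l
    have "sob_le (- 0) d g" using g by simp
    from L2_inner_summable[OF sob_le_0_shift[OF f] this]
    show "(\<lambda>m. f (m - l) * cnj (g m) * h l) summable_on UNIV" by (rule summable_on_cmult_left)
  qed
  also have "\<dots> = L2_inner (mult f h) g"
    unfolding L2_inner_def e by (intro infsum_cong) (simp add: sum_distrib_left sum_distrib_right mult_ac)
  finally show ?thesis .
qed

context noise
begin

lemma lp_block_xi_real: "lp_block P j xi (- l) = cnj (lp_block P j xi l)"
proof -
  have "phi P j (- l) = phi P j l"
    using chi_radial[of "vec_of (- l)" "vec_of l"] rho_radial[of "vec_of (- l) /\<^sub>R lam j" "vec_of l /\<^sub>R lam j"]
    by (simp add: phi_def vec_of_uminus)
  then show ?thesis by (simp add: lp_block_phi real_xi)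
qed

text \<open>Split u = u1 + u2 at frequency 2^j. On u1 the low cut-off is 1, so u1 meets only the
  small low-frequency part of (1 - \<open>mid P j\<close>) R times the block. Each term with u2
  gains 2^(-j \<gamma>) from u2 and 2^(-j / 2) from R or from the negative order of the
  product.\<close>

lemma form_commutator_block:
  obtains D where "0 \<le> D" "\<And>j c d u R G. -1 \<le> j \<Longrightarrow> sob_le \<gamma> c u \<Longrightarrow> sob_le (1 / 2) d R \<Longrightarrow>
    sup_le G (lp_block P j xi) \<Longrightarrow>
    cmod (L2_inner (mult (weighted (low P j) u) (lp_block P j xi)) R
      - L2_inner u (mult (weighted (mid P j) R) (lp_block P j xi))) \<le> D * lam j powr (- \<gamma> - 1 / 2) * G * c * d"
proof -
  have g0: "0 \<le> \<gamma>" "-2 < - \<gamma>" using gamma by simp_all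
  have h0: "(0::real) \<le> 1 / 2" "-2 < (- (1 / 2) :: real)" by simp_all
  obtain r D1 where r: "0 < r" and D1: "0 \<le> D1"
    and low1: "\<And>j k. 1 \<le> j \<Longrightarrow> bracket k \<le> r * (lam j)\<^sup>2 \<Longrightarrow> low P j k = 1"
    and b1: "\<And>j u g c G. 1 \<le> j \<Longrightarrow> sob_le (1 / 2) c u \<Longrightarrow> sup_le G (lp_block P j g) \<Longrightarrow>
    sob_le (- \<gamma>) (D1 * lam j powr (- \<gamma> - 1 / 2) * G * c)
      (\<lambda>n. if bracket n \<le> r * (lam j)\<^sup>2 then mult (weighted (\<lambda>k. 1 - mid P j k) u) (lp_block P j g) n else 0)"
    by (rule mid_complement_block[OF g0(2) h0(1)]) (rule that; blast)
  obtain D2 where D2: "0 \<le> D2" and b2: "\<And>j u g c G. 1 \<le> j \<Longrightarrow> sob_le 0 c u \<Longrightarrow> sup_le G (lp_block P j g) \<Longrightarrow>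
    sob_le (- (1 / 2)) (D2 * lam j powr (- (1 / 2) - 0) * G * c) (mult (weighted (low P j) u) (lp_block P j g))"
    by (rule low_high_block[OF h0(2) order_refl]) (rule that; blast)
  obtain D3 where D3: "0 \<le> D3" and b3: "\<And>j u g c G. -1 \<le> j \<Longrightarrow> sob_le (1 / 2) c u \<Longrightarrow> sup_le G (lp_block P j g) \<Longrightarrow>
    sob_le 0 (D3 * lam j powr (- (1 / 2)) * G * c) (mult (weighted (mid P j) u) (lp_block P j g))"
    by (rule resonant_block[where a = "1 / 2"]) (rule that; blast)
  define E where "E = r powr (- \<gamma> / 2)"
  have E: "0 \<le> E" by (simp add: E_def)
  define D where "D = D1 + D2 * E + D3 * E + D3"
  have D: "0 \<le> D" using D1 D2 D3 E by (simp add: D_def)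
  show thesis
  proof (rule that[OF D])
    fix j :: int and c d :: real and u R :: torus_dist and G :: real
    assume j: "-1 \<le> j" and u: "sob_le \<gamma> c u" and R: "sob_le (1 / 2) d R" and G: "sup_le G (lp_block P j xi)"
    let ?h = "lp_block P j xi" and ?lu = "weighted (low P j)"
    have c: "0 \<le> c" and d: "0 \<le> d" and G0: "0 \<le> G"
      using u R G by (auto intro: sob_le_nonneg sup_le_nonneg)
    have u0: "sob_le 0 c u" and R0: "sob_le 0 d R" using u R gamma by (auto intro: sob_le_weaken)
    have Q: "sob_le 0 (D3 * lam j powr (- (1 / 2)) * G * d) (mult (weighted (mid P j) R) ?h)" by (rule b3[OF j R G])
    show "cmod (L2_inner (mult (?lu u) ?h) R - L2_inner u (mult (weighted (mid P j) R) ?h))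
        \<le> D * lam j powr (- \<gamma> - 1 / 2) * G * c * d"
    proof (cases "1 \<le> j")
      \<comment> \<open>Here the low cut-off vanishes and lam j \<le> 1, so the factor lam j powr (-
        \<gamma>) missing from the estimate is at least 1.\<close>
      case False
      then have "mult (?lu u) ?h = (\<lambda>n. 0)" by (simp add: weighted_def low_zero mult_def fun_eq_iff)
      then have z: "L2_inner (mult (?lu u) ?h) R = 0" by (simp add: L2_inner_def)
      have "cmod (L2_inner u (mult (weighted (mid P j) R) ?h)) \<le> c * (D3 * lam j powr (- (1 / 2)) * G * d)"
        by (rule L2_inner_bound[where s = 0]) (use u0 Q in auto)
      also have "\<dots> = lam j powr (- (1 / 2)) * (D3 * G * c * d)" by (simp only: mult_ac)
      also have "\<dots> \<le> lam j powr (- \<gamma> - 1 / 2) * (D3 * G * c * d)"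
      proof (rule mult_right_mono)
        have "lam j \<le> 1" using lam_mono[of j 0] False by simp
        then show "lam j powr (- (1 / 2)) \<le> lam j powr (- \<gamma> - 1 / 2)"
          using lam_pos[of j] gamma by (intro powr_mono') auto
      qed (use D3 c d G0 in simp)
      also have "\<dots> \<le> lam j powr (- \<gamma> - 1 / 2) * (D * G * c * d)"
        using D1 D2 D3 E c d G0 by (intro mult_left_mono mult_right_mono) (auto simp: D_def)
      finally show ?thesis using z by (simp add: mult_ac)
    next
      case True
      define u1 where "u1 = weighted (\<lambda>k. if bracket k \<le> r * (lam j)\<^sup>2 then 1 else 0) u"
      define u2 where "u2 = weighted (\<lambda>k. if bracket k \<le> r * (lam j)\<^sup>2 then 0 else 1) u"
      have split: "u = u1 + u2" by (auto simp: u1_def u2_def weighted_def fun_eq_iff)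
      have su1: "sob_le \<gamma> c u1" unfolding u1_def by (rule weighted_le1[OF u]) simp
      have su10: "sob_le 0 c u1" using su1 g0(1) by (rule sob_le_weaken)
      have su2: "sob_le 0 (E * lam j powr (- \<gamma>) * c) u2"
        unfolding u2_def E_def by (rule weighted_localized_above[OF u g0(1) r lam_pos]) (auto split: if_splits)
      have lu1: "?lu u1 = u1" using low1[OF True] by (auto simp: u1_def weighted_def fun_eq_iff)
      have slu2: "sob_le 0 (E * lam j powr (- \<gamma>) * c) (?lu u2)"
        by (rule weighted_le1[OF su2]) (use low_bounds in auto)
      have Rh: "sob_le 0 (G * d) (mult R ?h)" by (rule mult_sup_bound[OF G R0])
      define V where "V = mult (weighted (\<lambda>k. 1 - mid P j k) R) ?h"
      have V: "mult R ?h - mult (weighted (mid P j) R) ?h = V"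
      proof
        fix n
        have "weighted (\<lambda>k. 1 - mid P j k) R = (\<lambda>k. R k - weighted (mid P j) R k)"
          by (simp add: weighted_def fun_eq_iff algebra_simps)
        then show "(mult R ?h - mult (weighted (mid P j) R) ?h) n = V n"
          by (simp add: V_def mult_diff_left[OF finite_lp_block])
      qed
      have s0: "sob_le (- 0) x f" if "sob_le 0 x f" for x f using that by simp
      have "L2_inner (mult (?lu u) ?h) R = L2_inner (?lu u) (mult R ?h)"
        by (rule L2_inner_mult_adjoint[symmetric, OF _ R0 finite_lp_block lp_block_xi_real])
           (rule weighted_le1[OF u0], use low_bounds in auto)
      also have "\<dots> = L2_inner (u1 + ?lu u2) (mult R ?h)"
      proof -
        have "?lu u = u1 + ?lu u2" unfolding split weighted_add lu1 by (simp add: fun_eq_iff)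
        then show ?thesis by (simp only:)
      qed
      also have "L2_inner (u1 + ?lu u2) (mult R ?h) = L2_inner u1 (mult R ?h) + L2_inner (?lu u2) (mult R ?h)"
        by (rule L2_inner_add_left[OF su10 slu2 s0[OF Rh]])
      also have "L2_inner (?lu u2) (mult R ?h) = L2_inner (mult (?lu u2) ?h) R"
        by (rule L2_inner_mult_adjoint[OF slu2 R0 finite_lp_block lp_block_xi_real])
      finally have A: "L2_inner (mult (?lu u) ?h) R = L2_inner u1 (mult R ?h) + L2_inner (mult (?lu u2) ?h) R" .
      have B: "L2_inner u (mult (weighted (mid P j) R) ?h)
          = L2_inner u1 (mult (weighted (mid P j) R) ?h) + L2_inner u2 (mult (weighted (mid P j) R) ?h)"
        by (subst split, rule L2_inner_add_left[OF su10 su2 s0[OF Q]])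
      have "L2_inner u1 (mult R ?h) - L2_inner u1 (mult (weighted (mid P j) R) ?h) = L2_inner u1 V"
        unfolding V[symmetric] by (rule L2_inner_diff_right[symmetric, OF su10 s0[OF Rh] s0[OF Q]])
      \<comment> \<open>\<open>u1\<close> vanishes outside the low region, so V may be cut off
        there, as \<open>mid_complement_block\<close> requires.\<close>
      also have "L2_inner u1 V = L2_inner u1 (\<lambda>n. if bracket n \<le> r * (lam j)\<^sup>2 then V n else 0)"
        unfolding L2_inner_def by (rule infsum_cong) (auto simp: u1_def weighted_def)
      finally have eq: "L2_inner (mult (?lu u) ?h) R - L2_inner u (mult (weighted (mid P j) R) ?h)
          = L2_inner u1 (\<lambda>n. if bracket n \<le> r * (lam j)\<^sup>2 then V n else 0)
            + L2_inner (mult (?lu u2) ?h) R - L2_inner u2 (mult (weighted (mid P j) R) ?h)"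
        unfolding A B by simp
      have 1: "cmod (L2_inner u1 (\<lambda>n. if bracket n \<le> r * (lam j)\<^sup>2 then V n else 0))
          \<le> c * (D1 * lam j powr (- \<gamma> - 1 / 2) * G * d)"
        unfolding V_def by (rule L2_inner_bound[OF su1 b1[OF True R G]])
      have 2: "cmod (L2_inner (mult (?lu u2) ?h) R) \<le> (D2 * lam j powr (- (1 / 2) - 0) * G * (E * lam j powr (- \<gamma>) * c)) * d"
        by (rule L2_inner_bound[OF b2[OF True su2 G]]) (use R in simp)
      have 3: "cmod (L2_inner u2 (mult (weighted (mid P j) R) ?h)) \<le> (E * lam j powr (- \<gamma>) * c) * (D3 * lam j powr (- (1 / 2)) * G * d)"
        by (rule L2_inner_bound[OF su2 s0[OF Q]])
      have p: "lam j powr (- \<gamma> - 1 / 2) = lam j powr (- \<gamma>) * lam j powr (- (1 / 2))"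
        by (simp flip: powr_add)
      have "cmod (L2_inner (mult (?lu u) ?h) R - L2_inner u (mult (weighted (mid P j) R) ?h))
          \<le> c * (D1 * lam j powr (- \<gamma> - 1 / 2) * G * d)
            + (D2 * lam j powr (- (1 / 2) - 0) * G * (E * lam j powr (- \<gamma>) * c)) * d
            + (E * lam j powr (- \<gamma>) * c) * (D3 * lam j powr (- (1 / 2)) * G * d)"
        unfolding eq by (intro order_trans[OF norm_triangle_ineq4] add_mono order_trans[OF norm_triangle_ineq] 1 2 3)
      also have "\<dots> = (D1 + D2 * E + D3 * E) * (lam j powr (- \<gamma> - 1 / 2) * (G * (c * d)))"
        unfolding p by (simp add: algebra_simps)
      also have "\<dots> \<le> D * (lam j powr (- \<gamma> - 1 / 2) * (G * (c * d)))"
        using D3 c d G0 by (intro mult_right_mono) (auto simp: D_def)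
      finally show ?thesis by (simp only: mult_ac)
    qed
  qed
qed

text \<open>The H^2 bound e makes the two block series converge separately, while the final estimate
  involves only the H^(1/2) bound d. The decay rate \<open>e0\<close> is the gain \<gamma> + 1 / 2
  minus the loss 1 + \<kappa> from the noise.\<close>

lemma form_commutator:
  obtains D where "0 \<le> D" "\<And>c d e u R. sob_le \<gamma> c u \<Longrightarrow> sob_le (1 / 2) d R \<Longrightarrow> sob_le 2 e R \<Longrightarrow>
    cmod (L2_inner (paraproduct P u xi) R - L2_inner u (resonant P R xi)) \<le> D * c * d"
proof -
  obtain G where G: "hold_le (- 1 - \<kappa>) G xi" using hold_xi by blast
  have G0: "0 \<le> G" using G by (rule hold_le_nonneg)
  obtain D where D: "0 \<le> D" and blk: "\<And>j c d u R G. -1 \<le> j \<Longrightarrow> sob_le \<gamma> c u \<Longrightarrow> sob_le (1 / 2) d R \<Longrightarrow>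
    sup_le G (lp_block P j xi) \<Longrightarrow>
    cmod (L2_inner (mult (weighted (low P j) u) (lp_block P j xi)) R
      - L2_inner u (mult (weighted (mid P j) R) (lp_block P j xi))) \<le> D * lam j powr (- \<gamma> - 1 / 2) * G * c * d"
    by (rule form_commutator_block) (rule that; blast)
  define e0 where "e0 = \<gamma> - 1 / 2 - \<kappa>"
  have e0: "0 < e0" using gamma kappa by (simp add: e0_def)
  define Z where "Z = infsum (\<lambda>j. lam j powr (- e0)) {-1..}"
  have Z: "0 \<le> Z" unfolding Z_def by (rule series_nonneg)
  obtain D1 where D1: "\<And>j u g c G. -1 \<le> j \<Longrightarrow> sob_le 0 c u \<Longrightarrow> hold_le (- 1 - \<kappa>) G g \<Longrightarrow>
    sob_le (- (3 / 2)) (D1 * G * c * lam j powr (- (0 + (- 1 - \<kappa>) - - (3 / 2)))) (mult (weighted (low P j) u) (lp_block P j g))"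
    by (rule low_high_paraproduct_blocks[of "- (3 / 2)" 0 "- 1 - \<kappa>"]) (simp, simp, rule that, blast)
  obtain D2 where D2: "\<And>j u g c G. -1 \<le> j \<Longrightarrow> sob_le (3 / 2) c u \<Longrightarrow> hold_le (- 1 - \<kappa>) G g \<Longrightarrow>
    sob_le 0 (D2 * G * c * lam j powr (- (3 / 2 + (- 1 - \<kappa>)))) (mult (weighted (mid P j) u) (lp_block P j g))"
    by (rule resonant_blocks[of "3 / 2" "- 1 - \<kappa>"]) (rule that, blast)
  show thesis
  proof (rule that[of "D * G * Z"])
    show "0 \<le> D * G * Z" using D G0 Z by simp
    fix c d e u R assume u: "sob_le \<gamma> c u" and R: "sob_le (1 / 2) d R" and R2: "sob_le 2 e R"
    have u0: "sob_le 0 c u" using u by (rule sob_le_weaken) (use gamma in simp)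
    have R32: "sob_le (3 / 2) e R" using R2 by (rule sob_le_weaken) simp
    let ?a = "\<lambda>j. L2_inner R (mult (weighted (low P j) u) (lp_block P j xi))"
    let ?b = "\<lambda>j. L2_inner u (mult (weighted (mid P j) R) (lp_block P j xi))"
    have "0 < 0 + (- 1 - \<kappa>) - - (3 / 2)" using kappa by simp
    from lam_series[OF this]
    have s1: "(\<lambda>j. D1 * G * c * lam j powr (- (0 + (- 1 - \<kappa>) - - (3 / 2)))) summable_on {-1..}"
      by (rule summable_on_cmult_right)
    have "0 < 3 / 2 + (- 1 - \<kappa>)" using kappa by simp
    from lam_series[OF this]
    have s2: "(\<lambda>j. D2 * G * e * lam j powr (- (3 / 2 + (- 1 - \<kappa>)))) summable_on {-1..}"
      by (rule summable_on_cmult_right)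
    have a: "?a summable_on {-1..}" "L2_inner R (paraproduct P u xi) = (\<Sum>\<^sub>\<infinity>j\<in>{-1..}. ?a j)"
      unfolding paraproduct_eq by (rule L2_inner_infsum_right[OF R32 _ s1], rule D1[OF _ u0 G], simp)+
    have b: "?b summable_on {-1..}" "L2_inner u (resonant P R xi) = (\<Sum>\<^sub>\<infinity>j\<in>{-1..}. ?b j)"
      unfolding resonant_eq
      by (rule L2_inner_infsum_right[OF u0 _ s2], simp only: minus_zero, rule D2[OF _ R32 G], simp)+
    have ca: "(\<lambda>j. cnj (?a j)) summable_on {-1..}" by (subst summable_on_cnj_iff) (rule a(1))
    have mb: "(\<lambda>j. - ?b j) summable_on {-1..}" by (rule summable_on_uminus[THEN iffD2, OF b(1)])
    have "L2_inner (paraproduct P u xi) R = (\<Sum>\<^sub>\<infinity>j\<in>{-1..}. cnj (?a j))"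
      unfolding L2_inner_cnj[of "paraproduct P u xi"] a(2) infsum_cnj ..
    then have "L2_inner (paraproduct P u xi) R - L2_inner u (resonant P R xi)
        = (\<Sum>\<^sub>\<infinity>j\<in>{-1..}. cnj (?a j)) + (\<Sum>\<^sub>\<infinity>j\<in>{-1..}. - ?b j)"
      by (simp add: b(2) infsum_uminus)
    also have "\<dots> = (\<Sum>\<^sub>\<infinity>j\<in>{-1..}. cnj (?a j) + - ?b j)" by (rule infsum_add[OF ca mb, symmetric])
    finally have eq: "L2_inner (paraproduct P u xi) R - L2_inner u (resonant P R xi)
        = (\<Sum>\<^sub>\<infinity>j\<in>{-1..}. cnj (?a j) + - ?b j)" .
    have trm: "cmod (cnj (?a j) + - ?b j) \<le> D * G * c * d * lam j powr (- e0)" if j: "-1 \<le> j" for j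
    proof -
      have "cmod (cnj (?a j) + - ?b j) \<le> D * lam j powr (- \<gamma> - 1 / 2) * (G * lam j powr (- (- 1 - \<kappa>))) * c * d"
        using blk[OF j u R hold_leD[OF G j]] by (simp add: L2_inner_cnj[symmetric])
      also have "\<dots> = D * G * c * d * (lam j powr (- \<gamma> - 1 / 2) * lam j powr (- (- 1 - \<kappa>)))" by (simp only: mult_ac)
      also have "lam j powr (- \<gamma> - 1 / 2) * lam j powr (- (- 1 - \<kappa>)) = lam j powr (- e0)"
        by (simp add: e0_def algebra_simps flip: powr_add)
      finally show ?thesis .
    qed
    have sb: "(\<lambda>j. D * G * c * d * lam j powr (- e0)) summable_on {-1..}"
      by (intro summable_on_cmult_right lam_series e0)
    have abs: "(\<lambda>j. cnj (?a j) + - ?b j) abs_summable_on {-1..}"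
      by (rule Infinite_Sum.abs_summable_on_comparison_test'[OF sb]) (use trm in simp)
    have "cmod (\<Sum>\<^sub>\<infinity>j\<in>{-1..}. cnj (?a j) + - ?b j) \<le> (\<Sum>\<^sub>\<infinity>j\<in>{-1..}. cmod (cnj (?a j) + - ?b j))"
      by (rule norm_infsum_bound[OF abs])
    also have "\<dots> \<le> (\<Sum>\<^sub>\<infinity>j\<in>{-1..}. D * G * c * d * lam j powr (- e0))"
      by (rule infsum_mono[OF abs sb]) (use trm in simp)
    also have "\<dots> = D * G * c * d * Z" unfolding Z_def by (rule infsum_cmult_right')
    finally show "cmod (L2_inner (paraproduct P u xi) R - L2_inner u (resonant P R xi)) \<le> D * G * Z * c * d"
      unfolding eq by (simp only: mult_ac)
  qed
qed

end

section \<open>The Anderson Hamiltonian in terms of the remainder\<close>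

lemmas L2_inner_add_right0 = L2_inner_add_right[where s = 0, simplified]
lemmas L2_inner_diff_right0 = L2_inner_diff_right[where s = 0, simplified]
lemmas L2_inner_add_left0 = L2_inner_add_left[where s = 0, simplified]
lemmas L2_inner_bound0 = L2_inner_bound[where s = 0, simplified]

definition bessel :: "torus_dist \<Rightarrow> torus_dist" where
  "bessel f = (\<lambda>k. of_real (bracket k) * f k)"

lemma bessel_eq: "bessel f = f - laplacian f"
  by (simp add: bessel_def laplacian_def bracket_def fun_eq_iff algebra_simps)

lemma sob_le_bessel: "sob_le (s + 2) c f \<longleftrightarrow> sob_le s c (bessel f)"
proof -
  have "bracket k powr (s / 2) * cmod (bessel f k) = bracket k powr ((s + 2) / 2) * cmod (f k)" for k
    unfolding bracket_half[symmetric] using bracket_pos[of k] by (simp add: bessel_def norm_mult)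
  then show ?thesis by (simp add: sob_le_def)
qed

lemma sob_le_2_bessel: "sob_le 2 c f \<longleftrightarrow> sob_le 0 c (bessel f)"
  using sob_le_bessel[of 0 c f] by simp

locale anderson = noise +
  fixes C :: "torus_dist \<Rightarrow> torus_dist \<Rightarrow> torus_dist \<Rightarrow> torus_dist"
  assumes comm: "commutator_operator P C"
begin

abbreviation R :: "torus_dist \<Rightarrow> torus_dist" where "R \<equiv> remainder P \<Xi>"
abbreviation dom :: "torus_dist set" where "dom \<equiv> domain_H P \<Xi> \<gamma>"
abbreviation H :: "real \<Rightarrow> torus_dist \<Rightarrow> torus_dist" where "H \<equiv> H_op P C \<Xi>"

text \<open>The terms of A u that are bounded from H^\<gamma> to L^2. \<open>T u\<close> appears
  because the Laplacian of \<open>T u\<close> is \<open>T u\<close> - \<open>drift u\<close>, and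
  \<open>paraproduct P u Xi2\<close> is subtracted because \<open>drift u\<close> contains
  it.\<close>

definition lower :: "torus_dist \<Rightarrow> torus_dist" where
  "lower u = T u + (mult u Xi2 - paraproduct P u Xi2) + C u X xi + resonant P (B_op P \<Xi> u) xi"

lemma bounded_lower: "bounded_op \<gamma> 0 lower"
  unfolding lower_def[abs_def]
  by (intro bounded_op_add bounded_mult_Xi2 bounded_commutator[OF comm] bounded_B_resonant
      bounded_op_weaken[OF bounded_T]) (use gamma in auto)

text \<open>Write u = R u + T u. The \<open>drift u\<close> produced by the Laplacian of T u cancels
  the two paraproducts with the noise, and its last term removes u \<prec> Xi2 from the product of u
  with Xi2.\<close>

lemma A_eq:
  assumes u: "sob_le 0 c u"
  shows "A_op P C \<Xi> u = laplacian (R u) + lower u + resonant P (R u) xi"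
proof
  fix n
  have T: "of_real (bracket n) * T u n = drift u n"
    using bracket_pos[of n] by (simp add: T_eq[OF u] resolvent_def)
  have "laplacian u n - laplacian (R u) n = - of_real (4 * pi\<^sup>2 * (norm (vec_of n))\<^sup>2) * T u n"
    by (simp add: remainder_T laplacian_def algebra_simps)
  also have "\<dots> = T u n - of_real (bracket n) * T u n" by (simp add: bracket_def algebra_simps)
  finally have "laplacian u n = laplacian (R u) n + T u n - drift u n" unfolding T by (simp add: algebra_simps)
  then show "A_op P C \<Xi> u n = (laplacian (R u) + lower u + resonant P (R u) xi) n"
    by (simp add: A_op_def resonant_noise_def lower_def drift_def algebra_simps)
qed

lemma domD:
  assumes "u \<in> dom"
  obtains c e where "sob_le \<gamma> c u" "sob_le 2 e (R u)"
  using assms unfolding domain_H_def sobolev_iff by blast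

lemma dom_L2:
  assumes "u \<in> dom"
  shows "\<exists>c. sob_le 0 c u"
proof -
  obtain c e where "sob_le \<gamma> c u" "sob_le 2 e (R u)" by (rule domD[OF assms]) (rule that; blast)
  from this(1) have "sob_le 0 c u" by (rule sob_le_weaken) (use gamma in simp)
  then show ?thesis ..
qed

lemma H_eq:
  assumes "u \<in> dom"
  shows "H K u = laplacian (R u) + lower u + resonant P (R u) xi - scale (of_real K) u"
  using dom_L2[OF assms] A_eq by (auto simp: H_op_def)

text \<open>Since T gains \<gamma> derivatives from L^2, the H^\<gamma> norm of u = T u + R u is
  controlled by the L^2 norm of u and the H^\<gamma> norm of R u.\<close>

lemma u_bounds:
  obtains C1 where "0 \<le> C1" "\<And>n u. sob_le 0 n u \<Longrightarrow> sob_le 0 (C1 * n) (T u)"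
    "\<And>n d u. sob_le 0 n u \<Longrightarrow> sob_le \<gamma> d (R u) \<Longrightarrow> sob_le \<gamma> (C1 * n + d) u"
    "\<And>n u. sob_le 0 n u \<Longrightarrow> sob_le 0 ((1 + C1) * n) (R u)"
proof -
  obtain C1 where C1: "0 \<le> C1" "\<And>n u. sob_le 0 n u \<Longrightarrow> sob_le \<gamma> (C1 * n) (T u)"
    by (rule bounded_opE[OF bounded_T]) (rule that; blast)
  have T0: "sob_le 0 (C1 * n) (T u)" if "sob_le 0 n u" for n u
    using C1(2)[OF that] by (rule sob_le_weaken) (use gamma in simp)
  show thesis
  proof (rule that[OF C1(1) T0])
    fix n d u assume u: "sob_le 0 n u" and d: "sob_le \<gamma> d (R u)"
    have "T u + R u = u" by (simp add: remainder_T)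
    then show "sob_le \<gamma> (C1 * n + d) u" using sob_le_add[OF C1(2)[OF u] d] by simp
  next
    fix n u assume u: "sob_le 0 n u"
    show "sob_le 0 ((1 + C1) * n) (R u)"
      unfolding remainder_T using sob_le_diff[OF u T0[OF u]] by (simp add: algebra_simps)
  qed
qed

lemma H_upper:
  obtains D where "0 \<le> D" "\<And>u n e K. u \<in> dom \<Longrightarrow> sob_le 0 n u \<Longrightarrow> sob_le 2 e (R u) \<Longrightarrow>
    sob_le 0 (D * (e + n) + \<bar>K\<bar> * n) (H K u)"
proof -
  obtain C1 where C1: "0 \<le> C1" "\<And>n d u. sob_le 0 n u \<Longrightarrow> sob_le \<gamma> d (R u) \<Longrightarrow> sob_le \<gamma> (C1 * n + d) u"
    by (rule u_bounds) (rule that; blast)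
  obtain C2 where C2: "0 \<le> C2" "\<And>c u. sob_le \<gamma> c u \<Longrightarrow> sob_le 0 (C2 * c) (lower u)"
    by (rule bounded_opE[OF bounded_lower]) (rule that; blast)
  obtain C3 where C3: "0 \<le> C3" "\<And>c u. sob_le (3 / 2) c u \<Longrightarrow> sob_le 0 (C3 * c) (resonant P u xi)"
    by (rule bounded_opE[OF bounded_R_resonant]) (rule that; blast)
  define D where "D = 1 + C2 * (C1 + 1) + C3"
  have D: "0 \<le> D" using C1 C2 C3 by (simp add: D_def)
  show thesis
  proof (rule that[OF D])
    fix u n e K assume u: "u \<in> dom" and n: "sob_le 0 n u" and e: "sob_le 2 e (R u)"
    have n0: "0 \<le> n" and e0: "0 \<le> e" using n e by (auto intro: sob_le_nonneg)
    have eg: "sob_le \<gamma> e (R u)" "sob_le (3 / 2) e (R u)" using e gamma by (auto intro: sob_le_weaken)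
    have l: "sob_le 0 e (laplacian (R u))" using sob_le_laplacian[OF e] by simp
    have "sob_le 0 (e + C2 * (C1 * n + e) + C3 * e + cmod (of_real K) * n) (H K u)"
      unfolding H_eq[OF u]
      by (intro sob_le_diff sob_le_add l C2(2) C1(2) C3(2) sob_le_scale n eg)
    then show "sob_le 0 (D * (e + n) + \<bar>K\<bar> * n) (H K u)"
    proof (rule sob_le_mono)
      have "D * (e + n) - (e + C2 * (C1 * n + e) + C3 * e) = n + C2 * (C1 * e) + C2 * n + C3 * n"
        by (simp add: D_def algebra_simps)
      moreover have "0 \<le> n + C2 * (C1 * e) + C2 * n + C3 * n" using n0 e0 C1(1) C2(1) C3(1) by simp
      ultimately show "e + C2 * (C1 * n + e) + C3 * e + cmod (of_real K) * n \<le> D * (e + n) + \<bar>K\<bar> * n" by simp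
    qed
  qed
qed

text \<open>Elliptic regularity: solve the formula for H u for (1 - \<Delta>) R u, interpolate the
  lower order terms between H^2 and L^2, and absorb half of the H^2 norm, which is finite because u
  lies in the domain.\<close>

lemma H_lower:
  obtains D where "0 \<le> D" "\<And>u n h K. u \<in> dom \<Longrightarrow> sob_le 0 n u \<Longrightarrow> sob_le 0 h (H K u) \<Longrightarrow>
    sob_le 2 (D * (h + n + \<bar>K\<bar> * n)) (R u)"
proof -
  obtain C1 where C1: "0 \<le> C1" "\<And>n d u. sob_le 0 n u \<Longrightarrow> sob_le \<gamma> d (R u) \<Longrightarrow> sob_le \<gamma> (C1 * n + d) u"
    "\<And>n u. sob_le 0 n u \<Longrightarrow> sob_le 0 ((1 + C1) * n) (R u)"
    by (rule u_bounds) (rule that; blast)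
  obtain C2 where C2: "0 \<le> C2" "\<And>c u. sob_le \<gamma> c u \<Longrightarrow> sob_le 0 (C2 * c) (lower u)"
    by (rule bounded_opE[OF bounded_lower]) (rule that; blast)
  obtain C3 where C3: "0 \<le> C3" "\<And>c u. sob_le (3 / 2) c u \<Longrightarrow> sob_le 0 (C3 * c) (resonant P u xi)"
    by (rule bounded_opE[OF bounded_R_resonant]) (rule that; blast)
  \<comment> \<open>The two interpolated terms then contribute at most half of e.\<close>
  define \<delta> where "\<delta> = 1 / (2 * (C2 + C3 + 1))"
  have \<delta>: "0 < \<delta>" "(C2 + C3) * \<delta> \<le> 1 / 2" using C2(1) C3(1) by (simp_all add: \<delta>_def field_simps)
  have i: "\<gamma> < 2" "3 / 2 < (2 :: real)" using gamma by simp_all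
  obtain D1 where D1: "0 \<le> D1" "\<And>f c d. sob_le 2 c f \<Longrightarrow> sob_le 0 d f \<Longrightarrow> sob_le \<gamma> (\<delta> * c + D1 * d) f"
    by (rule sob_le_interpolation[OF i(1) \<delta>(1)]) (rule that; blast)
  obtain D2 where D2: "0 \<le> D2" "\<And>f c d. sob_le 2 c f \<Longrightarrow> sob_le 0 d f \<Longrightarrow> sob_le (3 / 2) (\<delta> * c + D2 * d) f"
    by (rule sob_le_interpolation[OF i(2) \<delta>(1)]) (rule that; blast)
  define M where "M = (1 + C1) + C2 * (C1 + D1 * (1 + C1)) + C3 * (D2 * (1 + C1))"
  have M: "1 \<le> M" using C1(1) C2(1) C3(1) D1(1) D2(1) by (simp add: M_def add_nonneg_nonneg)
  show thesis
  proof (rule that[of "2 * M"])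
    show "0 \<le> 2 * M" using M by simp
    fix u n h K assume u: "u \<in> dom" and n: "sob_le 0 n u" and h: "sob_le 0 h (H K u)"
    have n0: "0 \<le> n" and h0: "0 \<le> h" using n h by (auto intro: sob_le_nonneg)
    obtain c e' where "sob_le 2 e' (R u)" using domD[OF u] by metis
    then have "R u \<in> sobolev 2" using sobolev_iff by blast
    define e where "e = sob_val 2 (R u)"
    have e: "sob_le 2 e (R u)" unfolding e_def by (rule sobolev_norm_eq(2)) fact
    have r0: "sob_le 0 ((1 + C1) * n) (R u)" by (rule C1(3)[OF n])
    have "bessel (R u) = R u - (H K u + scale (of_real K) u - lower u - resonant P (R u) xi)"
      unfolding bessel_eq H_eq[OF u] by simp
    moreover have "sob_le 0 ((1 + C1) * n + (h + cmod (of_real K) * n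
        + C2 * (C1 * n + (\<delta> * e + D1 * ((1 + C1) * n))) + C3 * (\<delta> * e + D2 * ((1 + C1) * n))))
      (R u - (H K u + scale (of_real K) u - lower u - resonant P (R u) xi))"
      by (intro sob_le_diff sob_le_add r0 h sob_le_scale n C2(2) C1(2) C3(2) D1(2) D2(2) e)
    ultimately have "sob_le 2 ((1 + C1) * n + (h + \<bar>K\<bar> * n
        + C2 * (C1 * n + (\<delta> * e + D1 * ((1 + C1) * n))) + C3 * (\<delta> * e + D2 * ((1 + C1) * n)))) (R u)"
      unfolding sob_le_2_bessel by simp
    from sob_val_le[OF this]
    have "e \<le> (1 + C1) * n + (h + \<bar>K\<bar> * n
        + C2 * (C1 * n + (\<delta> * e + D1 * ((1 + C1) * n))) + C3 * (\<delta> * e + D2 * ((1 + C1) * n)))"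
      unfolding e_def .
    also have "\<dots> = M * n + h + \<bar>K\<bar> * n + (C2 + C3) * \<delta> * e" by (simp add: M_def algebra_simps)
    also have "(C2 + C3) * \<delta> * e \<le> 1 / 2 * e"
      using \<delta>(2) sob_val_nonneg by (intro mult_right_mono) (auto simp: e_def)
    finally have "e \<le> 2 * (M * n + h + \<bar>K\<bar> * n)" by simp
    also have "\<dots> \<le> 2 * (M * n + M * h + M * (\<bar>K\<bar> * n))"
    proof -
      have "1 * h \<le> M * h" "1 * (\<bar>K\<bar> * n) \<le> M * (\<bar>K\<bar> * n)" using M h0 n0 by (intro mult_right_mono; simp)+
      then show ?thesis by simp
    qed
    finally have "e \<le> 2 * M * (h + n + \<bar>K\<bar> * n)" by (simp add: algebra_simps)
    with e show "sob_le 2 (2 * M * (h + n + \<bar>K\<bar> * n)) (R u)" by (rule sob_le_mono)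
  qed
qed

text \<open>Insert u = R u + T u into the pairing with (1 - \<Delta>) R u and move 1 - \<Delta> onto
  T u, which becomes \<open>drift u\<close>. Its term u \<prec> xi meets the resonant term of H u,
  and together they form the commutator.\<close>

lemma form_identity:
  assumes u: "u \<in> dom"
  shows "L2_inner u (- H K u) = of_real ((sob_val 1 (R u))\<^sup>2) + of_real (K * (sob_val 0 u)\<^sup>2)
    - L2_inner (R u) (R u) - L2_inner (T u) (R u)
    + (L2_inner (paraproduct P u xi) (R u) - L2_inner u (resonant P (R u) xi))
    + L2_inner (paraproduct P xi u) (R u) + L2_inner (paraproduct P u Xi2) (R u) - L2_inner u (lower u)"
proof -
  obtain c e where c: "sob_le \<gamma> c u" and e: "sob_le 2 e (R u)" by (rule domD[OF u]) (rule that; blast)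
  have u0: "sob_le 0 c u" using c by (rule sob_le_weaken) (use gamma in simp)
  have R0: "sob_le 0 e (R u)" using e by (rule sob_le_weaken) simp
  have bR: "sob_le 0 e (bessel (R u))" using e by (simp add: sob_le_2_bessel)
  obtain cT where T0: "sob_le 0 cT (T u)" using u_bounds u0 by metis
  obtain cl where l0: "sob_le 0 cl (lower u)" using bounded_lower c unfolding bounded_op_def by blast
  have "sob_le (3 / 2) e (R u)" using e by (rule sob_le_weaken) simp
  then obtain cw where w0: "sob_le 0 cw (resonant P (R u) xi)" using bounded_R_resonant unfolding bounded_op_def by blast
  have k0: "sob_le 0 (cmod (of_real K) * c) (scale (of_real K) u)" by (rule sob_le_scale[OF u0])
  let ?w = "resonant P (R u) xi"
  have split: "u = R u + T u" by (simp add: remainder_T)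
  have "- H K u = bessel (R u) - R u - lower u - ?w + scale (of_real K) u"
    unfolding H_eq[OF u] bessel_eq by simp
  then have "L2_inner u (- H K u) = L2_inner u (bessel (R u) - R u - lower u - ?w + scale (of_real K) u)" by simp
  also have "\<dots> = L2_inner u (bessel (R u)) - L2_inner u (R u) - L2_inner u (lower u) - L2_inner u ?w
      + L2_inner u (scale (of_real K) u)"
    by (simp only: L2_inner_add_right0[OF u0 sob_le_diff[OF sob_le_diff[OF sob_le_diff[OF bR R0] l0] w0] k0]
        L2_inner_diff_right0[OF u0 sob_le_diff[OF sob_le_diff[OF bR R0] l0] w0]
        L2_inner_diff_right0[OF u0 sob_le_diff[OF bR R0] l0] L2_inner_diff_right0[OF u0 bR R0])
  also have "L2_inner u (scale (of_real K) u) = of_real (K * (sob_val 0 u)\<^sup>2)"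
  proof -
    have "u \<in> sobolev 0" using u0 sobolev_iff by blast
    from L2_inner_self[OF this] have "L2_inner u u = of_real ((sob_val 0 u)\<^sup>2)"
      using bracket_pos by (simp add: less_imp_neq[symmetric])
    moreover have "L2_inner u (scale (of_real K) u) = of_real K * L2_inner u u"
      unfolding L2_inner_def infsum_cmult_right'[symmetric] by (simp add: scale_def mult_ac)
    ultimately show ?thesis by simp
  qed
  also have "L2_inner u (bessel (R u)) = L2_inner (R u) (bessel (R u)) + L2_inner (T u) (bessel (R u))"
    by (subst (1) split, rule L2_inner_add_left0[OF R0 T0 bR])
  also have "L2_inner u (R u) = L2_inner (R u) (R u) + L2_inner (T u) (R u)"
    by (subst (1) split, rule L2_inner_add_left0[OF R0 T0 R0])
  also have "L2_inner (R u) (bessel (R u)) = of_real ((sob_val 1 (R u))\<^sup>2)"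
  proof -
    have "sob_le 1 e (R u)" using e by (rule sob_le_weaken) simp
    then have "R u \<in> sobolev 1" using sobolev_iff by blast
    from L2_inner_self[OF this] show ?thesis
      using bracket_pos by (simp add: bessel_def less_imp_le)
  qed
  also have "L2_inner (T u) (bessel (R u)) = L2_inner (drift u) (R u)"
    unfolding L2_inner_def
  proof (rule infsum_cong)
    fix k
    have "drift u k = of_real (bracket k) * T u k"
      using bracket_pos[of k] by (simp add: T_eq[OF u0] resolvent_def)
    then show "T u k * cnj (bessel (R u) k) = drift u k * cnj (R u k)" by (simp add: bessel_def)
  qed
  also have "L2_inner (drift u) (R u)
      = L2_inner (paraproduct P u xi) (R u) + L2_inner (paraproduct P xi u) (R u) + L2_inner (paraproduct P u Xi2) (R u)"
  proof -
    have g: "- 2 < \<gamma> - 2" "\<gamma> - 2 < 0 + (- 1 - \<kappa>)" "\<gamma> - 2 < 0 + (- 2 * \<kappa>)" "- 1 - \<kappa> < 0"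
      using gamma kappa by simp_all
    obtain a1 where a1: "sob_le (\<gamma> - 2) a1 (paraproduct P u xi)"
      using bounded_low_high[OF g(1) order_refl g(2) hold_xi] u0 unfolding bounded_op_def by blast
    obtain a2 where a2: "sob_le (\<gamma> - 2) a2 (paraproduct P xi u)"
      using bounded_high_low[OF g(1) g(4) g(2) hold_xi] u0 unfolding bounded_op_def by blast
    obtain a3 where a3: "sob_le (\<gamma> - 2) a3 (paraproduct P u Xi2)"
      using bounded_low_high[OF g(1) order_refl g(3) hold_Xi2] u0 unfolding bounded_op_def by blast
    \<comment> \<open>\<open>drift u\<close> has order \<gamma> - 2 only, so it is paired with R u
      in H^(2 - \<gamma>), available on the domain.\<close>
    have r: "sob_le (- (\<gamma> - 2)) e (R u)" using e by (rule sob_le_weaken) (use gamma in simp)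
    show ?thesis
      unfolding drift_def
      by (simp only: L2_inner_add_left[OF sob_le_add[OF a1 a2] a3 r] L2_inner_add_left[OF a1 a2 r])
  qed
  finally show ?thesis by (simp only: diff_conv_add_uminus minus_add_distrib add_ac)
qed

text \<open>Every error term is bounded by a constant times a product of two of the quantities c
  (for u in H^\<gamma>) and d (for R u in H^(1/2)), both obtained by interpolation. K enters the
  identity only through its exact term, so K1 is independent of it.\<close>

lemma form_estimate:
  obtains K1 where "0 \<le> K1" "\<And>u K. u \<in> dom \<Longrightarrow>
    \<bar>Re (L2_inner u (- H K u)) - (sob_val 1 (R u))\<^sup>2 - K * (sob_val 0 u)\<^sup>2\<bar>
      \<le> (sob_val 1 (R u))\<^sup>2 / 2 + K1 * (sob_val 0 u)\<^sup>2"
proof -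
  obtain C1 where C1: "0 \<le> C1" "\<And>n u. sob_le 0 n u \<Longrightarrow> sob_le 0 (C1 * n) (T u)"
    "\<And>n d u. sob_le 0 n u \<Longrightarrow> sob_le \<gamma> d (R u) \<Longrightarrow> sob_le \<gamma> (C1 * n + d) u"
    "\<And>n u. sob_le 0 n u \<Longrightarrow> sob_le 0 ((1 + C1) * n) (R u)"
    by (rule u_bounds) (rule that; blast)
  obtain C2 where C2: "0 \<le> C2" "\<And>c u. sob_le \<gamma> c u \<Longrightarrow> sob_le 0 (C2 * c) (lower u)"
    by (rule bounded_opE[OF bounded_lower]) (rule that; blast)
  obtain C3 where C3: "0 \<le> C3" "\<And>c u. sob_le \<gamma> c u \<Longrightarrow> sob_le (- (1 / 2)) (C3 * c) (paraproduct P xi u)"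
    by (rule bounded_opE[OF bounded_half(1)]) (rule that; blast)
  obtain C4 where C4: "0 \<le> C4" "\<And>c u. sob_le \<gamma> c u \<Longrightarrow> sob_le (- (1 / 2)) (C4 * c) (paraproduct P u Xi2)"
    by (rule bounded_opE[OF bounded_half(2)]) (rule that; blast)
  obtain C5 where C5: "0 \<le> C5" "\<And>c d e u R. sob_le \<gamma> c u \<Longrightarrow> sob_le (1 / 2) d R \<Longrightarrow> sob_le 2 e R \<Longrightarrow>
    cmod (L2_inner (paraproduct P u xi) R - L2_inner u (resonant P R xi)) \<le> C5 * c * d"
    by (rule form_commutator) (rule that; blast)
  define L where "L = 1 + C1 + C2 + C3 + C4 + C5"
  have L: "1 \<le> L" using C1(1) C2(1) C3(1) C4(1) C5(1) by (simp add: L_def)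
  \<comment> \<open>Since c + d = 2 * \<delta> * e + M * n, the coefficient of e^2 becomes 8 * L *
    \<delta>^2 = 1 / (2 * L), at most 1 / 2.\<close>
  define \<delta> where "\<delta> = 1 / (4 * L)"
  have \<delta>: "0 < \<delta>" using L by (simp add: \<delta>_def)
  have i: "\<gamma> < 1" "1 / 2 < (1 :: real)" using gamma by simp_all
  obtain D1 where D1: "0 \<le> D1" "\<And>f c d. sob_le 1 c f \<Longrightarrow> sob_le 0 d f \<Longrightarrow> sob_le \<gamma> (\<delta> * c + D1 * d) f"
    by (rule sob_le_interpolation[OF i(1) \<delta>]) (rule that; blast)
  obtain D2 where D2: "0 \<le> D2" "\<And>f c d. sob_le 1 c f \<Longrightarrow> sob_le 0 d f \<Longrightarrow> sob_le (1 / 2) (\<delta> * c + D2 * d) f"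
    by (rule sob_le_interpolation[OF i(2) \<delta>]) (rule that; blast)
  define M where "M = C1 + (D1 + D2) * (1 + C1)"
  have M: "0 \<le> M" using C1(1) D1(1) D2(1) by (simp add: M_def)
  show thesis
  proof (rule that[of "2 * L * M\<^sup>2"])
    show "0 \<le> 2 * L * M\<^sup>2" using L by simp
    fix u K assume u: "u \<in> dom"
    obtain c0 e0 where c0: "sob_le \<gamma> c0 u" and e0: "sob_le 2 e0 (R u)" by (rule domD[OF u]) (rule that; blast)
    have "sob_le 0 c0 u" using c0 by (rule sob_le_weaken) (use gamma in simp)
    then have "u \<in> sobolev 0" using sobolev_iff by blast
    have "sob_le 1 e0 (R u)" using e0 by (rule sob_le_weaken) simp
    then have "R u \<in> sobolev 1" using sobolev_iff by blast
    define n where "n = sob_val 0 u"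
    define e where "e = sob_val 1 (R u)"
    have n: "sob_le 0 n u" unfolding n_def by (rule sobolev_norm_eq(2)) fact
    have e: "sob_le 1 e (R u)" unfolding e_def by (rule sobolev_norm_eq(2)) fact
    have r0: "sob_le 0 ((1 + C1) * n) (R u)" by (rule C1(4)[OF n])
    define c where "c = C1 * n + (\<delta> * e + D1 * ((1 + C1) * n))"
    define d where "d = \<delta> * e + D2 * ((1 + C1) * n)"
    have c: "sob_le \<gamma> c u" unfolding c_def by (intro C1(3) n D1(2) e r0)
    have d: "sob_le (1 / 2) d (R u)" unfolding d_def by (intro D2(2) e r0)
    have c00: "sob_le 0 c u" using c by (rule sob_le_weaken) (use gamma in simp)
    have d0: "sob_le 0 d (R u)" using d by (rule sob_le_weaken) simp
    have cn: "0 \<le> c" and dn: "0 \<le> d" using c d by (auto intro: sob_le_nonneg)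
    define err where "err = - L2_inner (R u) (R u) - L2_inner (T u) (R u)
      + (L2_inner (paraproduct P u xi) (R u) - L2_inner u (resonant P (R u) xi))
      + L2_inner (paraproduct P xi u) (R u) + L2_inner (paraproduct P u Xi2) (R u) - L2_inner u (lower u)"
    have id: "L2_inner u (- H K u) = of_real (e\<^sup>2 + K * n\<^sup>2) + err"
      unfolding form_identity[OF u] err_def e_def n_def by simp
    have d': "sob_le (- (- (1 / 2))) d (R u)" using d by simp
    have "cmod err \<le> d * d + C1 * c * d + C5 * c * d + C3 * c * d + C4 * c * d + c * (C2 * c)"
    proof -
      have b: "cmod (L2_inner (R u) (R u)) \<le> d * d" "cmod (L2_inner (T u) (R u)) \<le> C1 * c * d"
        "cmod (L2_inner (paraproduct P u xi) (R u) - L2_inner u (resonant P (R u) xi)) \<le> C5 * c * d"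
        "cmod (L2_inner (paraproduct P xi u) (R u)) \<le> C3 * c * d"
        "cmod (L2_inner (paraproduct P u Xi2) (R u)) \<le> C4 * c * d"
        "cmod (L2_inner u (lower u)) \<le> c * (C2 * c)"
        by (rule L2_inner_bound0[OF d0 d0] L2_inner_bound0[OF C1(2)[OF c00] d0] C5(2)[OF c d e0]
            L2_inner_bound[OF C3(2)[OF c] d'] L2_inner_bound[OF C4(2)[OF c] d'] L2_inner_bound0[OF c00 C2(2)[OF c]])+
      show ?thesis
        unfolding err_def
        by (intro order_trans[OF norm_triangle_ineq4] order_trans[OF norm_triangle_ineq] add_mono b) (simp add: b)
    qed
    also have "\<dots> \<le> L * (c + d)\<^sup>2"
    proof -
      have "L * (c + d)\<^sup>2 - (d * d + C1 * c * d + C5 * c * d + C3 * c * d + C4 * c * d + c * (C2 * c))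
        = c * c + 2 * (c * d) + (C1 + C2 + C3 + C4 + C5) * (d * d) + (C1 + C3 + C4 + C5) * (c * c)
          + (C1 + C3 + C4 + C5) * (c * d) + 2 * C2 * (c * d)"
        by (simp add: L_def power2_eq_square algebra_simps)
      moreover have "0 \<le> \<dots>" using cn dn C1(1) C2(1) C3(1) C4(1) C5(1) by simp
      ultimately show ?thesis by linarith
    qed
    also have "c + d = 2 * \<delta> * e + M * n" by (simp add: c_def d_def M_def algebra_simps)
    also have "L * (2 * \<delta> * e + M * n)\<^sup>2 \<le> L * (2 * (2 * \<delta> * e)\<^sup>2 + 2 * (M * n)\<^sup>2)"
    proof (rule mult_left_mono)
      show "(2 * \<delta> * e + M * n)\<^sup>2 \<le> 2 * (2 * \<delta> * e)\<^sup>2 + 2 * (M * n)\<^sup>2"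
        using zero_le_power2[of "2 * \<delta> * e - M * n"] by (simp add: power2_sum power2_diff)
    qed (use L in simp)
    also have "\<dots> = 1 / (2 * L) * e\<^sup>2 + 2 * L * M\<^sup>2 * n\<^sup>2"
      using L by (simp add: \<delta>_def power_mult_distrib power_divide distrib_left power2_eq_square)
    also have "\<dots> \<le> 1 / 2 * e\<^sup>2 + 2 * L * M\<^sup>2 * n\<^sup>2"
      using L by (intro add_mono mult_right_mono) (auto simp: field_simps)
    finally have ce: "cmod err \<le> e\<^sup>2 / 2 + 2 * L * M\<^sup>2 * n\<^sup>2" by simp
    have "Re (L2_inner u (- H K u)) - e\<^sup>2 - K * n\<^sup>2 = Re err" unfolding id by simp
    then show "\<bar>Re (L2_inner u (- H K u)) - (sob_val 1 (R u))\<^sup>2 - K * (sob_val 0 u)\<^sup>2\<bar>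
      \<le> (sob_val 1 (R u))\<^sup>2 / 2 + 2 * L * M\<^sup>2 * (sob_val 0 u)\<^sup>2"
      using ce abs_Re_le_cmod[of err] unfolding e_def n_def by linarith
  qed
qed

end

section \<open>The map \<open>\<Gamma>\<close>\<close>

lemma L2_T_iff: "f \<in> L2_T \<longleftrightarrow> (\<exists>c. sob_le 0 c f)"
  by (rule sobolev_iff)

definition low_freq :: "nat \<Rightarrow> torus_dist \<Rightarrow> torus_dist" where
  "low_freq N f = f - high_freq N f"

lemma high_freq_diff: "high_freq N (f - g) = high_freq N f - high_freq N g"
  by (simp add: high_freq_def fun_eq_iff)

lemma sob_le_high_freq: "sob_le s c f \<Longrightarrow> sob_le s c (high_freq N f)"
  by (erule sob_le_smaller) (simp add: high_freq_def)

lemma sob_le_low_freq: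
  obtains D where "0 \<le> D" "\<And>c f. sob_le 0 c f \<Longrightarrow> sob_le 2 (D * c) (low_freq N f)"
proof -
  define B where "B = 1 + 4 * pi\<^sup>2 * (2 ^ N)\<^sup>2"
  have B: "0 \<le> B" by (simp add: B_def)
  show thesis
  proof (rule that[OF B])
    fix c f assume f: "sob_le 0 c f"
    have "sob_le 0 c (low_freq N f)" by (rule sob_le_smaller[OF f]) (simp add: low_freq_def high_freq_def)
    then show "sob_le 2 (B * c) (low_freq N f)"
    proof (rule sob_le_localized[OF _ B])
      fix k assume "low_freq N f k \<noteq> 0"
      then have "norm (vec_of k) \<le> 2 ^ N" by (simp add: low_freq_def high_freq_def split: if_splits)
      then have "(norm (vec_of k))\<^sup>2 \<le> (2 ^ N)\<^sup>2" by (intro power_mono) auto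
      then have "4 * pi\<^sup>2 * (norm (vec_of k))\<^sup>2 \<le> 4 * pi\<^sup>2 * (2 ^ N)\<^sup>2" by (intro mult_left_mono) auto
      then show "bracket k powr ((2 - 0) / 2) \<le> B" using bracket_pos[of k] by (simp add: B_def bracket_def)
    qed
  qed
qed

context anderson
begin

text \<open>Above frequency 2^N the gain of \<gamma> derivatives is worth a factor 2^(- \<gamma>
  N).\<close>

lemma high_freq_contraction:
  obtains N0 where "\<And>N c u. N0 \<le> N \<Longrightarrow> sob_le 0 c u \<Longrightarrow> sob_le 0 (c / 2) (high_freq N (T u))"
proof -
  obtain C1 where C1: "0 \<le> C1" "\<And>c u. sob_le 0 c u \<Longrightarrow> sob_le \<gamma> (C1 * c) (T u)"
    by (rule bounded_opE[OF bounded_T]) (rule that; blast)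
  have "1 < 2 powr \<gamma>" using gamma powr_less_mono[of 0 \<gamma> 2] by simp
  then obtain N0 where N0: "2 * C1 < (2 powr \<gamma>) ^ N0" using real_arch_pow by blast
  show thesis
  proof (rule that[of N0])
    fix N c u assume N: "N0 \<le> N" and u: "sob_le 0 c u"
    have c: "0 \<le> c" using u by (rule sob_le_nonneg)
    have "(2 powr \<gamma>) ^ N0 \<le> (2 powr \<gamma>) ^ N"
      using N \<open>1 < 2 powr \<gamma>\<close> by (intro power_increasing) auto
    also have "\<dots> = 2 powr (\<gamma> * real N)" by (simp add: powr_powr flip: powr_realpow)
    finally have big: "2 * C1 \<le> 2 powr (\<gamma> * real N)" using N0 by simp
    have "sob_le 0 (2 powr (- (\<gamma> * real N)) * (C1 * c)) (high_freq N (T u))"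
    proof (rule sob_le_localized[OF sob_le_high_freq[OF C1(2)[OF u]]])
      fix k assume "high_freq N (T u) k \<noteq> 0"
      then have "2 ^ N \<le> norm (vec_of k)" by (simp add: high_freq_def split: if_splits)
      then have "(2 ^ N)\<^sup>2 \<le> (norm (vec_of k))\<^sup>2" by (intro power_mono) auto
      then have "(2 ^ N)\<^sup>2 \<le> bracket k" using bracket_ge_norm[of k] by linarith
      then have "bracket k powr (- (\<gamma> / 2)) \<le> ((2 ^ N)\<^sup>2) powr (- (\<gamma> / 2))"
        using gamma by (intro powr_mono2') auto
      also have "((2 ^ N)\<^sup>2) powr (- (\<gamma> / 2)) = (2::real) powr (- (\<gamma> * real N))"
        using powr_scale[of 1 "2 ^ N" "- (\<gamma> / 2)"] by (simp add: powr_powr mult.commute flip: powr_realpow)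
      finally show "bracket k powr ((0 - \<gamma>) / 2) \<le> 2 powr (- (\<gamma> * real N))" by simp
    qed simp
    then show "sob_le 0 (c / 2) (high_freq N (T u))"
    proof (rule sob_le_mono)
      have "C1 * c * 2 \<le> c * 2 powr (\<gamma> * real N)"
        using mult_right_mono[OF big c] by (simp add: mult_ac)
      then show "2 powr (- (\<gamma> * real N)) * (C1 * c) \<le> c / 2"
        by (simp add: powr_minus field_simps)
    qed
  qed
qed

end

locale anderson_cutoff = anderson +
  fixes N :: nat
  assumes contraction: "sob_le 0 c u \<Longrightarrow> sob_le 0 (c / 2) (high_freq N (T u))"
begin

abbreviation hT :: "torus_dist \<Rightarrow> torus_dist" where "hT u \<equiv> high_freq N (T u)"
abbreviation \<Gamma> :: "torus_dist \<Rightarrow> torus_dist" where "\<Gamma> \<equiv> Gamma_map P \<Xi> N"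

lemma hT_diff: "sob_le 0 c u \<Longrightarrow> sob_le 0 d v \<Longrightarrow> hT (u - v) = hT u - hT v"
  by (simp add: T_diff high_freq_diff)

text \<open>The norm of g is at most half of itself plus c; being finite, it can be
  absorbed.\<close>

lemma fixed_point_bound:
  assumes g: "sob_le 0 d g" and f: "sob_le 0 c f" and eq: "g = hT g + f"
  shows "sob_le 0 (2 * c) g"
proof -
  have "g \<in> sobolev 0" using g sobolev_iff by blast
  then have n: "sob_le 0 (sob_val 0 g) g" by (rule sobolev_norm_eq(2))
  have "sob_le 0 (sob_val 0 g / 2 + c) g"
    using sob_le_add[OF contraction[OF n] f] by (simp only: eq[symmetric])
  from sob_val_le[OF this] have "sob_val 0 g \<le> 2 * c" by simp
  with n show ?thesis by (rule sob_le_mono)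
qed

lemma sob_le_0_zero:
  assumes "sob_le 0 0 g"
  shows "g = (\<lambda>k. 0)"
proof
  fix k show "g k = 0" using sob_le_0_point[OF assms, of k] by simp
qed

lemma fixed_point_unique:
  assumes g: "sob_le 0 d g" "g = hT g + f" and h: "sob_le 0 e h" "h = hT h + f"
  shows "g = h"
proof -
  have "g - h = hT g - hT h" using arg_cong2[OF g(2) h(2), of "(-)"] by (simp only: add_diff_cancel_right)
  then have "g - h = hT (g - h) + (\<lambda>k. 0)" unfolding hT_diff[OF g(1) h(1)] by (simp add: fun_eq_iff)
  from fixed_point_bound[OF sob_le_diff[OF g(1) h(1)] sob_le_zero[OF order_refl] this]
  have "g - h = (\<lambda>k. 0)" by (intro sob_le_0_zero) simp
  then show ?thesis by (simp add: fun_eq_iff)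
qed

text \<open>Picard iteration. The limit is taken coefficient by coefficient, and lower
  semicontinuity carries the geometric tail bound over to it.\<close>

lemma fixed_point_exists:
  assumes f: "sob_le 0 c f"
  shows "\<exists>g d. sob_le 0 d g \<and> g = hT g + f"
proof -
  have c: "0 \<le> c" using f by (rule sob_le_nonneg)
  define s where "s = rec_nat f (\<lambda>_ v. hT v + f)"
  have s0: "s 0 = f" and sS: "\<And>m. s (Suc m) = hT (s m) + f" by (simp_all add: s_def)
  have b: "sob_le 0 (2 * c) (s m)" for m
  proof (induction m)
    case 0
    show ?case using sob_le_mono[OF f] c by (simp add: s0)
  next
    case (Suc m)
    have "sob_le 0 (2 * c / 2 + c) (s (Suc m))" unfolding sS by (rule sob_le_add[OF contraction[OF Suc] f])
    then show ?case by simp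
  qed
  have diff: "sob_le 0 (c / 2 ^ m) (s (m + i) - s m)" for m i
  proof (induction m)
    case 0
    show ?case
    proof (cases i)
      case 0
      then show ?thesis using c sob_le_zero by (simp add: zero_fun_def)
    next
      case (Suc i')
      have "s (Suc i') - s 0 = hT (s i')" by (simp add: sS s0)
      then show ?thesis using Suc contraction[OF b[of i']] by simp
    qed
  next
    case (Suc m)
    have "hT (s (m + i) - s m) = s (Suc m + i) - s (Suc m)"
      unfolding hT_diff[OF b b] by (simp add: sS)
    moreover have "c / 2 ^ m / 2 = c / 2 ^ Suc m" by simp
    ultimately show ?case using contraction[OF Suc] by (simp only:)
  qed
  have tend: "(\<lambda>m. c / 2 ^ m) \<longlonglongrightarrow> 0"
    by (rule LIMSEQ_divide_realpow_zero) simp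
  have conv: "convergent (\<lambda>m. s m k)" for k
  proof (rule Cauchy_convergent, rule metric_CauchyI)
    fix e :: real assume e: "0 < e"
    then obtain M where M: "\<And>m. M \<le> m \<Longrightarrow> c / 2 ^ m < e / 2"
      using order_tendstoD(2)[OF tend, of "e / 2"] by (auto simp: eventually_sequentially)
    have "dist (s m k) (s M k) < e / 2" if "M \<le> m" for m
    proof -
      have "dist (s m k) (s M k) \<le> c / 2 ^ M"
        using sob_le_0_point[OF diff[of M "m - M"], of k] that by (simp add: dist_norm)
      then show ?thesis using M[OF order_refl] by (rule le_less_trans)
    qed
    then have "dist (s m k) (s n k) < e" if "M \<le> m" "M \<le> n" for m n
      using dist_triangle_half_l that by blast
    then show "\<exists>M. \<forall>m\<ge>M. \<forall>n\<ge>M. dist (s m k) (s n k) < e" by blast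
  qed
  define g where "g = (\<lambda>k. lim (\<lambda>m. s m k))"
  have lim: "(\<lambda>m. s m k) \<longlonglongrightarrow> g k" for k using conv[of k] by (simp add: g_def convergent_LIMSEQ_iff)
  have tail: "sob_le 0 (c / 2 ^ m) (g - s m)" for m
  proof (rule sob_le_limit[of sequentially])
    have "(\<lambda>i. s (m + i) k) \<longlonglongrightarrow> g k" for k
      using LIMSEQ_ignore_initial_segment[OF lim[of k], of m] by (simp only: add.commute)
    then show "(\<lambda>i. (s (m + i) - s m) k) \<longlonglongrightarrow> (g - s m) k" for k
      unfolding fun_diff_def by (intro tendsto_diff tendsto_const)
    show "\<forall>\<^sub>F i in sequentially. sob_le 0 (c / 2 ^ m) (s (m + i) - s m)"
      by (intro always_eventually allI diff)
  qed simp
  have g: "sob_le 0 (c / 2 ^ 0 + 2 * c) g" using sob_le_add[OF tail[of 0] b[of 0]] by simp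
  have "g = hT g + f"
  proof
    fix k
    \<comment> \<open>The residual is g - s (Suc m) minus \<open>hT\<close> of g - s m, and both
      parts are bounded by c / 2^(m + 1).\<close>
    have "cmod (g k - (hT g + f) k) \<le> c / 2 ^ m" for m
    proof -
      have "g - (hT g + f) = (g - s (Suc m)) - (hT g - hT (s m))" by (simp add: sS)
      also have "\<dots> = (g - s (Suc m)) - hT (g - s m)" by (simp only: hT_diff[OF g b])
      finally have "sob_le 0 (c / 2 ^ Suc m + c / 2 ^ m / 2) (g - (hT g + f))"
        using sob_le_diff[OF tail[of "Suc m"] contraction[OF tail[of m]]] by (simp only:)
      from sob_le_0_point[OF this, of k] show ?thesis by (simp add: field_simps)
    qed
    then have "cmod (g k - (hT g + f) k) \<le> 0" by (intro LIMSEQ_le_const[OF tend]) auto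
    then show "g k = (hT g + f) k" by simp
  qed
  with g show ?thesis by blast
qed

lemma Gamma_fixed_point:
  assumes "f \<in> L2_T"
  shows "\<Gamma> f \<in> L2_T" "\<Gamma> f = hT (\<Gamma> f) + f"
proof -
  obtain c where "sob_le 0 c f" using assms L2_T_iff by blast
  from fixed_point_exists[OF this] obtain g d where g: "sob_le 0 d g" "g = hT g + f" by blast
  have "\<Gamma> f = (THE g. g \<in> L2_T \<and> g = hT g + f)" by (simp only: Gamma_map_def T_def)
  also have "\<dots> = g"
  proof (rule the_equality)
    show "g \<in> L2_T \<and> g = hT g + f" using g L2_T_iff by blast
    show "h = g" if "h \<in> L2_T \<and> h = hT h + f" for h
      using that L2_T_iff fixed_point_unique[OF _ _ g] by blast
  qed
  finally show "\<Gamma> f \<in> L2_T" "\<Gamma> f = hT (\<Gamma> f) + f" using g L2_T_iff by auto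
qed

lemma Gamma_eqI:
  assumes "f \<in> L2_T" "g \<in> L2_T" "g = hT g + f"
  shows "\<Gamma> f = g"
  using fixed_point_unique[of _ "\<Gamma> f" f _ g] Gamma_fixed_point[OF assms(1)] assms L2_T_iff by blast

lemma Gamma_bound:
  assumes "sob_le 0 c f"
  shows "sob_le 0 (2 * c) (\<Gamma> f)"
proof -
  have "f \<in> L2_T" using assms L2_T_iff by blast
  from Gamma_fixed_point[OF this] show ?thesis using fixed_point_bound[OF _ assms] L2_T_iff by blast
qed

lemma L2_T_diff: "f \<in> L2_T \<Longrightarrow> g \<in> L2_T \<Longrightarrow> f - g \<in> L2_T"
  using sob_le_diff L2_T_iff by blast

lemma Gamma_diff:
  assumes f: "f \<in> L2_T" and g: "g \<in> L2_T"
  shows "\<Gamma> (f - g) = \<Gamma> f - \<Gamma> g"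
proof (rule Gamma_eqI)
  obtain c d where "sob_le 0 c (\<Gamma> f)" "sob_le 0 d (\<Gamma> g)"
    using Gamma_fixed_point(1)[OF f] Gamma_fixed_point(1)[OF g] L2_T_iff by blast
  then have "hT (\<Gamma> f - \<Gamma> g) = hT (\<Gamma> f) - hT (\<Gamma> g)" by (rule hT_diff)
  moreover have "\<Gamma> f - \<Gamma> g = (hT (\<Gamma> f) + f) - (hT (\<Gamma> g) + g)"
    by (rule arg_cong2[OF Gamma_fixed_point(2)[OF f] Gamma_fixed_point(2)[OF g]])
  ultimately show "\<Gamma> f - \<Gamma> g = hT (\<Gamma> f - \<Gamma> g) + (f - g)" by simp
qed (use L2_T_diff Gamma_fixed_point f g in auto)

lemma remainder_Gamma:
  assumes "f \<in> L2_T"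
  shows "R (\<Gamma> f) = f - low_freq N (T (\<Gamma> f))"
proof -
  have "R (\<Gamma> f) = (hT (\<Gamma> f) + f) - T (\<Gamma> f)"
    unfolding remainder_T by (rule arg_cong[OF Gamma_fixed_point(2)[OF assms]])
  then show ?thesis by (simp add: low_freq_def)
qed

lemma remainder_Gamma_bounds:
  obtains D where "0 \<le> D"
    "\<And>f n. f \<in> L2_T \<Longrightarrow> sob_le 0 n (\<Gamma> f) \<Longrightarrow> sob_le 2 (D * n) (f - R (\<Gamma> f))"
proof -
  obtain C1 where C1: "0 \<le> C1" "\<And>n u. sob_le 0 n u \<Longrightarrow> sob_le 0 (C1 * n) (T u)"
    by (rule u_bounds) (rule that; blast)
  obtain D where D: "0 \<le> D" "\<And>c f. sob_le 0 c f \<Longrightarrow> sob_le 2 (D * c) (low_freq N f)"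
    by (rule sob_le_low_freq) (rule that; blast)
  show thesis
  proof (rule that[of "D * C1"])
    show "0 \<le> D * C1" using C1(1) D(1) by simp
    show "sob_le 2 (D * C1 * n) (f - R (\<Gamma> f))" if "f \<in> L2_T" "sob_le 0 n (\<Gamma> f)" for f n
      unfolding remainder_Gamma[OF that(1)] using D(2)[OF C1(2)[OF that(2)]] by (simp add: mult.assoc)
  qed
qed

lemma Gamma_dom_iff:
  assumes f: "f \<in> L2_T"
  shows "\<Gamma> f \<in> dom \<longleftrightarrow> f \<in> sobolev 2"
proof -
  obtain n where n: "sob_le 0 n (\<Gamma> f)" using Gamma_fixed_point(1)[OF f] L2_T_iff by blast
  obtain d where d: "sob_le 2 d (f - R (\<Gamma> f))" using remainder_Gamma_bounds f n by metis
  show ?thesis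
  proof
    assume "\<Gamma> f \<in> dom"
    then obtain e where "sob_le 2 e (R (\<Gamma> f))" using domD by metis
    from sob_le_add[OF this d] show "f \<in> sobolev 2" unfolding sobolev_iff by auto
  next
    assume "f \<in> sobolev 2"
    then obtain e where e: "sob_le 2 e f" using sobolev_iff by blast
    have "sob_le 2 (e + d) (R (\<Gamma> f))" using sob_le_diff[OF e d] by simp
    moreover obtain C1 where "sob_le \<gamma> (C1 * n) (T (\<Gamma> f))" using bounded_T n unfolding bounded_op_def by blast
    then have "sob_le \<gamma> (C1 * n) (hT (\<Gamma> f))" by (rule sob_le_high_freq)
    moreover have "sob_le \<gamma> e f" using e by (rule sob_le_weaken) (use gamma in simp)
    ultimately have "sob_le \<gamma> (C1 * n + e) (\<Gamma> f)"
      using sob_le_add Gamma_fixed_point(2)[OF f] by metis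
    with \<open>sob_le 2 (e + d) (R (\<Gamma> f))\<close> show "\<Gamma> f \<in> dom" unfolding domain_H_def sobolev_iff by blast
  qed
qed

text \<open>The inverse of \<Gamma> on the domain, read off from the fixed point equation; it turns
  a sequence in the domain into a sequence of arguments of \<Gamma>.\<close>

lemma dom_Gamma:
  assumes "u \<in> dom"
  shows "u - hT u \<in> L2_T" "\<Gamma> (u - hT u) = u"
proof -
  obtain c where c: "sob_le 0 c u" using dom_L2[OF assms] by blast
  have u: "u \<in> L2_T" using c L2_T_iff by blast
  show f: "u - hT u \<in> L2_T" using sob_le_diff[OF c contraction[OF c]] L2_T_iff by blast
  show "\<Gamma> (u - hT u) = u" by (rule Gamma_eqI[OF f u]) simp
qed

end

section \<open>Regularity of the enhanced noise\<close>

context dyadic_blocks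
begin

lemma hold_le_of_holder:
  assumes "holder_norm P b g < \<infinity>"
  shows "\<exists>G. hold_le b G g"
proof -
  obtain G where G: "0 \<le> G" "holder_norm P b g = ennreal G"
    using assms by (cases "holder_norm P b g") auto
  have "sup_le (G * lam j powr (- b)) (lp_block P j g)" if j: "-1 \<le> j" for j
    unfolding sup_le_def
  proof (intro conjI allI)
    show "finite {k. lp_block P j g k \<noteq> 0}" by (rule finite_lp_block)
    fix x
    let ?v = "cmod (eval_at (lp_block P j g) x)"
    have "ennreal (2 powr (of_int j * b)) * ennreal ?v
        \<le> ennreal (2 powr (of_int j * b)) * linf_norm (lp_block P j g)"
      unfolding linf_norm_def by (intro mult_left_mono SUP_upper) auto
    also have "\<dots> \<le> holder_norm P b g"
      unfolding holder_norm_def using j by (intro SUP_upper) auto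
    finally have "2 powr (of_int j * b) * ?v \<le> G"
      using G by (simp add: ennreal_mult[symmetric])
    moreover have "lam j powr (- b) = inverse (2 powr (of_int j * b))"
      by (simp add: lam_def powr_powr powr_minus)
    ultimately show "?v \<le> G * lam j powr (- b)"
      by (simp add: inverse_eq_divide pos_le_divide_eq mult.commute)
  qed
  then show ?thesis unfolding hold_le_def by blast
qed

lemma hold_le_diff:
  assumes "hold_le b F f" "hold_le b G g"
  shows "hold_le b (F + G) (f - g)"
proof -
  have "lp_block P j (f - g) = (\<lambda>k. lp_block P j f k - lp_block P j g k)" for j
    by (simp add: lp_block_phi fun_eq_iff right_diff_distrib)
  then show ?thesis
    using sup_le_diff hold_leD[OF assms(1)] hold_leD[OF assms(2)] by (simp add: hold_le_def distrib_right)
qed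

lemma hold_le_finite_support:
  assumes fin: "finite {k. g k \<noteq> 0}"
  shows "\<exists>G. hold_le b G g"
proof -
  obtain r where r: "0 < r" "\<And>j k. -1 \<le> j \<Longrightarrow> phi P j k \<noteq> 0 \<Longrightarrow> r * (lam j)\<^sup>2 \<le> bracket k"
    by (rule symbol_supports) (rule that; blast)
  define B where "B = (\<Sum>k\<in>{k. g k \<noteq> 0}. bracket k)"
  have B: "bracket k \<le> B" if "g k \<noteq> 0" for k
    unfolding B_def using that fin bracket_pos by (intro member_le_sum) (auto intro: less_imp_le)
  obtain n :: nat where n: "B / r < 2 ^ n" using real_arch_pow[of 2 "B / r"] by auto
  have z: "lp_block P j g = (\<lambda>k. 0)" if "int n \<le> j" for j
  proof
    fix k
    have l: "2 ^ n \<le> lam j" using lam_mono[OF that] lam_nat[of "int n"] by simp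
    have "1 \<le> lam j" using that by (intro lam_ge1) linarith
    then have "lam j \<le> (lam j)\<^sup>2" by (rule self_le_power) simp
    with l n have "B / r < (lam j)\<^sup>2" by linarith
    then have "B < r * (lam j)\<^sup>2" using r(1) by (simp add: field_simps)
    then have "phi P j k = 0 \<or> g k = 0" using r(2)[of j k] B[of k] that by fastforce
    then show "lp_block P j g k = 0" by (auto simp: lp_block_phi)
  qed
  show ?thesis by (rule hold_le_eventually[of "int n" 0]) (simp add: z sup_le_zero)
qed

text \<open>The limit controls only differences, but at a single small \<epsilon> the regularization
  is a trigonometric polynomial and so has every Hoelder order.\<close>

lemma hold_le_regularization:
  assumes lim: "((\<lambda>\<epsilon>. holder_norm P b (f \<epsilon> - g)) \<longlongrightarrow> 0) (at_right (0::real))"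
    and fin: "\<And>\<epsilon>. 0 < \<epsilon> \<Longrightarrow> finite {k. f \<epsilon> k \<noteq> 0}"
  shows "\<exists>G. hold_le b G g"
proof -
  have "\<forall>\<^sub>F \<epsilon> in at_right 0. 0 < \<epsilon> \<and> holder_norm P b (f \<epsilon> - g) < 1"
    using eventually_at_right_less order_tendstoD(2)[OF lim, of 1] by (intro eventually_conj) auto
  then obtain \<epsilon> where e: "0 < \<epsilon>" "holder_norm P b (f \<epsilon> - g) < 1"
    using eventually_happens[of _ "at_right (0::real)"] trivial_limit_at_right_real by blast
  then have "holder_norm P b (f \<epsilon> - g) < \<infinity>" using less_trans[OF e(2), of \<infinity>] by simp
  from hold_le_of_holder[OF this] obtain G1 where G1: "hold_le b G1 (f \<epsilon> - g)" by blast
  obtain G2 where G2: "hold_le b G2 (f \<epsilon>)" using hold_le_finite_support[OF fin[OF e(1)]] by blast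
  have "f \<epsilon> - (f \<epsilon> - g) = g" by simp
  with hold_le_diff[OF G2 G1] show ?thesis by (simp only:) blast
qed

lemma finite_resonant:
  assumes "finite {k. f k \<noteq> 0}" "finite {k. g k \<noteq> 0}"
  shows "finite {n. resonant P f g n \<noteq> 0}"
proof -
  let ?S = "(\<lambda>(k, l). k + l) ` ({k. f k \<noteq> 0} \<times> {k. g k \<noteq> 0})"
  have "resonant P f g n = 0" if "n \<notin> ?S" for n
  proof -
    have "f k = 0 \<or> g (n - k) = 0" for k
    proof (rule ccontr)
      assume "\<not> ?thesis"
      then have "(k, n - k) \<in> {k. f k \<noteq> 0} \<times> {k. g k \<noteq> 0}" by blast
      moreover have "n = (case (k, n - k) of (k, l) \<Rightarrow> k + l)" by simp
      ultimately have "n \<in> ?S" by (rule rev_image_eqI)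
      with that show False by blast
    qed
    then have z: "lp_block P i f k * lp_block P j g (n - k) = 0" for i j k
      unfolding lp_block_phi by (metis mult_zero_right mult_zero_left)
    have "mult (lp_block P i f) (lp_block P j g) n = 0" for i j
      unfolding mult_def z by simp
    then show ?thesis by (simp add: resonant_def)
  qed
  then have "{n. resonant P f g n \<noteq> 0} \<subseteq> ?S" by blast
  then show ?thesis by (rule finite_subset) (use assms in blast)
qed

lemma finite_regularized:
  assumes "mollifier m" "0 < \<epsilon>"
  shows "finite {k. regularized m f \<epsilon> k \<noteq> 0}"
proof -
  obtain R where R: "\<And>x. m x \<noteq> 0 \<Longrightarrow> norm x \<le> R" using assms(1) unfolding mollifier_def by blast
  have "bracket k \<le> 1 + 4 * pi\<^sup>2 * (R / \<epsilon>)\<^sup>2" if "regularized m f \<epsilon> k \<noteq> 0" for k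
  proof -
    have "norm (\<epsilon> *\<^sub>R vec_of k) \<le> R" using that R[of "\<epsilon> *\<^sub>R vec_of k"] unfolding regularized_def by fastforce
    then have "norm (vec_of k) \<le> R / \<epsilon>" using assms(2) by (simp add: field_simps)
    then have "(norm (vec_of k))\<^sup>2 \<le> (R / \<epsilon>)\<^sup>2" by (intro power_mono) auto
    then show ?thesis by (simp add: bracket_def)
  qed
  then show ?thesis by (intro finite_subset[OF _ finite_bracket_le]) blast
qed

end

text \<open>The convergence is used at \<beta> = -1 - \<kappa>, where 2 * \<beta> + 2 = -2 *
  \<kappa>; reality of the coefficients is the symmetry of the white noise at the fixed sample
  w.\<close>

lemma noise_of_enhanced:
  assumes P: "dyadic_partition P" and W: "white_noise M W" and m: "mollifier m" and w: "w \<in> space M"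
    and fst: "fst \<Xi> = (\<lambda>k. W k w)" and enh: "enhanced_noise P m \<Xi>"
    and \<gamma>: "2 / 3 < \<gamma>" "\<gamma> < 1"
  shows "noise P \<Xi> ((1 - \<gamma>) / 4) \<gamma>"
proof -
  interpret dyadic_blocks P by unfold_locales (rule P)
  let ?\<kappa> = "(1 - \<gamma>) / 4"
  let ?\<xi> = "\<lambda>\<epsilon>. regularized m (fst \<Xi>) \<epsilon>"
  let ?p = "\<lambda>\<epsilon>. resonant P (?\<xi> \<epsilon>) (resolvent (?\<xi> \<epsilon>)) - const_dist (of_real (renorm_const m \<epsilon>))"
  have "- 1 - ?\<kappa> < - 1" using \<gamma> by simp
  then have lim: "((\<lambda>\<epsilon>. holder_norm P (- 1 - ?\<kappa>) (?\<xi> \<epsilon> - fst \<Xi>)) \<longlongrightarrow> 0) (at_right 0)"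
    "((\<lambda>\<epsilon>. holder_norm P (2 * (- 1 - ?\<kappa>) + 2) (?p \<epsilon> - snd \<Xi>)) \<longlongrightarrow> 0) (at_right 0)"
    using enh unfolding enhanced_noise_def case_prod_beta by blast+
  have fin: "finite {k. ?p \<epsilon> k \<noteq> 0}" if "0 < \<epsilon>" for \<epsilon>
  proof -
    have f1: "finite {k. ?\<xi> \<epsilon> k \<noteq> 0}" by (rule finite_regularized[OF m that])
    have "resolvent (?\<xi> \<epsilon>) k = 0" if "?\<xi> \<epsilon> k = 0" for k
      unfolding resolvent_def that by simp
    then have "{k. resolvent (?\<xi> \<epsilon>) k \<noteq> 0} \<subseteq> {k. ?\<xi> \<epsilon> k \<noteq> 0}" by blast
    then have "finite {k. resolvent (?\<xi> \<epsilon>) k \<noteq> 0}" by (rule finite_subset[OF _ f1])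
    from finite_resonant[OF f1 this]
    \<comment> \<open>The renormalization constant contributes the frequency 0.\<close>
    have "finite (insert 0 {k. resonant P (?\<xi> \<epsilon>) (resolvent (?\<xi> \<epsilon>)) k \<noteq> 0})" by simp
    moreover have "k \<in> insert 0 {k. resonant P (?\<xi> \<epsilon>) (resolvent (?\<xi> \<epsilon>)) k \<noteq> 0}" if "?p \<epsilon> k \<noteq> 0" for k
    proof (rule ccontr)
      assume "k \<notin> insert 0 {k. resonant P (?\<xi> \<epsilon>) (resolvent (?\<xi> \<epsilon>)) k \<noteq> 0}"
      then have "k \<noteq> 0" "resonant P (?\<xi> \<epsilon>) (resolvent (?\<xi> \<epsilon>)) k = 0" by blast+
      then have "?p \<epsilon> k = 0" by (simp only: fun_diff_def const_dist_def if_False diff_zero)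
      with that show False by contradiction
    qed
    then have "{k. ?p \<epsilon> k \<noteq> 0} \<subseteq> insert 0 {k. resonant P (?\<xi> \<epsilon>) (resolvent (?\<xi> \<epsilon>)) k \<noteq> 0}" by blast
    ultimately show ?thesis by (rule finite_subset[rotated])
  qed
  show ?thesis
  proof unfold_locales
    show "\<exists>G. hold_le (- 1 - ?\<kappa>) G (fst \<Xi>)"
      by (rule hold_le_regularization[OF lim(1) finite_regularized[OF m]])
    have "2 * (- 1 - ?\<kappa>) + 2 = - 2 * ?\<kappa>" by (simp add: field_simps)
    from hold_le_regularization[OF lim(2)[unfolded this] fin]
    show "\<exists>G. hold_le (- 2 * ?\<kappa>) G (snd \<Xi>)" .
    show "fst \<Xi> (- k) = cnj (fst \<Xi> k)" for k
      using W w unfolding fst white_noise_def by blast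
  qed (use \<gamma> in simp_all)
qed

section \<open>Closures and truncations\<close>

lemma ennreal_mult_less:
  assumes "0 < c" "0 < r" "p < ennreal (r / c)"
  shows "ennreal c * p < ennreal r"
proof -
  obtain a where a: "0 \<le> a" "p = ennreal a"
    using assms(3) by (cases p) auto
  then have "a < r / c" using assms(3) by (simp add: ennreal_less_iff)
  then have "c * a < r" using assms(1) by (simp add: field_simps)
  then show ?thesis using a assms(1) by (simp add: ennreal_mult[symmetric] ennreal_less_iff)
qed

lemma ennreal_ge_real:
  assumes "0 < (e :: ennreal)"
  obtains r where "0 < r" "ennreal r \<le> e"
  by (rule that[of "if e = \<infinity> then 1 else enn2real e"])
     (use assms in \<open>auto simp: enn2real_positive_iff less_top\<close>)

text \<open>Stability of D under differences lets the comparison of norms act on s n - s n' in the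
  Cauchy condition; the L^2 limit is common to both closures.\<close>

lemma norm_closure_mono:
  assumes c: "0 < c" and le: "\<And>f. f \<in> D \<Longrightarrow> q f \<le> ennreal c * p f"
    and diff: "\<And>f g. f \<in> D \<Longrightarrow> g \<in> D \<Longrightarrow> f - g \<in> D"
  shows "norm_closure p D \<subseteq> norm_closure q D"
proof
  fix u assume "u \<in> norm_closure p D"
  then obtain s where u: "u \<in> L2_T" and s: "\<And>n. s n \<in> D"
    and p: "\<And>e. 0 < e \<Longrightarrow> \<exists>n0. \<forall>n\<ge>n0. \<forall>n'\<ge>n0. p (s n - s n') < e"
    and l: "(\<lambda>n. L2_norm_T (s n - u)) \<longlonglongrightarrow> 0"
    unfolding norm_closure_def by blast
  have "\<exists>n0. \<forall>n\<ge>n0. \<forall>n'\<ge>n0. q (s n - s n') < e" if e: "0 < e" for e :: ennreal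
  proof -
    obtain r where r: "0 < r" "ennreal r \<le> e" using e by (rule ennreal_ge_real)
    have "0 < ennreal (r / c)" using r(1) c by simp
    from p[OF this] obtain n0 where n0: "\<And>n n'. n0 \<le> n \<Longrightarrow> n0 \<le> n' \<Longrightarrow> p (s n - s n') < ennreal (r / c)" by blast
    have "q (s n - s n') < e" if "n0 \<le> n" "n0 \<le> n'" for n n'
    proof -
      have "q (s n - s n') \<le> ennreal c * p (s n - s n')" by (intro le diff s)
      also have "\<dots> < ennreal r" by (rule ennreal_mult_less[OF c r(1) n0[OF that]])
      finally show ?thesis using r(2) by (rule less_le_trans)
    qed
    then show ?thesis by blast
  qed
  then show "u \<in> norm_closure q D" unfolding norm_closure_def using u s l by blast
qed

text \<open>A spectral truncation has finite support and hence every Sobolev order; it supplies H^2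
  approximations of H^1 functions.\<close>

definition truncate :: "nat \<Rightarrow> torus_dist \<Rightarrow> torus_dist" where
  "truncate m f = (\<lambda>k. if bracket k \<le> real m then f k else 0)"

lemma truncate_sobolev:
  assumes "f \<in> sobolev s"
  shows "truncate m f \<in> sobolev t"
proof -
  obtain c where c: "sob_le s c f" using assms sobolev_iff by blast
  have "sob_le s c (truncate m f)" by (rule sob_le_smaller[OF c]) (simp add: truncate_def)
  moreover have "bracket k powr ((t - s) / 2) \<le> real m powr \<bar>(t - s) / 2\<bar>" if "truncate m f k \<noteq> 0" for k
  proof -
    have k: "bracket k \<le> real m" using that by (auto simp: truncate_def split: if_splits)
    have "bracket k powr ((t - s) / 2) \<le> bracket k powr \<bar>(t - s) / 2\<bar>"
      by (rule powr_mono[OF abs_ge_self bracket_ge1])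
    also have "\<dots> \<le> real m powr \<bar>(t - s) / 2\<bar>" using k bracket_pos[of k] by (intro powr_mono2) auto
    finally show ?thesis .
  qed
  ultimately have "sob_le t (real m powr \<bar>(t - s) / 2\<bar> * c) (truncate m f)"
    by (intro sob_le_localized) auto
  then show ?thesis using sobolev_iff by blast
qed

lemma truncate_tendsto:
  assumes f: "f \<in> sobolev s" and e: "0 < e"
  shows "\<exists>m0. \<forall>m\<ge>m0. sob_le s e (f - truncate m f)"
proof -
  let ?a = "\<lambda>k. bracket k powr s * (cmod (f k))\<^sup>2"
  have a: "0 \<le> ?a k" for k by simp
  have sum: "?a summable_on UNIV" by (rule sobolev_norm_eq(3)[OF f])
  have "\<forall>\<^sub>F F in finite_subsets_at_top UNIV. infsum ?a UNIV - e\<^sup>2 < sum ?a F"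
    using order_tendstoD(1)[OF infsum_tendsto[OF sum]] e by simp
  then obtain X where X: "finite X" "infsum ?a UNIV - e\<^sup>2 < sum ?a X"
    unfolding eventually_finite_subsets_at_top by blast
  define m0 where "m0 = nat \<lceil>\<Sum>k\<in>X. bracket k\<rceil>"
  have m0: "bracket k \<le> real m0" if "k \<in> X" for k
  proof -
    have "bracket k \<le> (\<Sum>k\<in>X. bracket k)"
      using that X(1) bracket_pos by (intro member_le_sum) (auto intro: less_imp_le)
    then show ?thesis unfolding m0_def by linarith
  qed
  have "sob_le s e (f - truncate m f)" if m: "m0 \<le> m" for m
    unfolding sob_le_iff_sum[OF less_imp_le[OF e]]
  proof (intro allI impI)
    fix F :: "freq set" assume F: "finite F"
    have z: "f k - truncate m f k = 0" if "k \<in> X" for k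
      using m0[OF that] m by (simp add: truncate_def)
    have "(\<Sum>k\<in>F. bracket k powr s * (cmod ((f - truncate m f) k))\<^sup>2)
        = (\<Sum>k\<in>F - X. bracket k powr s * (cmod ((f - truncate m f) k))\<^sup>2)"
      using F z by (intro sum.mono_neutral_right) auto
    also have "\<dots> \<le> sum ?a (F - X)"
      by (intro sum_mono mult_left_mono power_mono) (auto simp: truncate_def)
    also have "\<dots> = sum ?a (X \<union> (F - X)) - sum ?a X"
      using F X(1) by (subst sum.union_disjoint) auto
    also have "\<dots> \<le> infsum ?a UNIV - sum ?a X"
      using F X(1) by (intro diff_right_mono finite_sum_le_infsum sum) auto
    also have "\<dots> \<le> e\<^sup>2" using X(2) by simp
    finally show "(\<Sum>k\<in>F. bracket k powr s * (cmod ((f - truncate m f) k))\<^sup>2) \<le> e\<^sup>2" .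
  qed
  then show ?thesis by blast
qed

section \<open>Norm equivalences\<close>

context anderson
begin

lemma form_bounds:
  obtains K0 where "0 < K0"
    "\<And>u K. u \<in> dom \<Longrightarrow> K0 \<le> K \<Longrightarrow> (sob_val 1 (R u))\<^sup>2 / 2 + (sob_val 0 u)\<^sup>2 \<le> Re (L2_inner u (- H K u))"
    "\<And>u K. u \<in> dom \<Longrightarrow> K0 \<le> K \<Longrightarrow> Re (L2_inner u (- H K u)) \<le> 2 * (sob_val 1 (R u))\<^sup>2 + 2 * K * (sob_val 0 u)\<^sup>2"
proof -
  obtain K1 where K1: "0 \<le> K1" "\<And>u K. u \<in> dom \<Longrightarrow>
    \<bar>Re (L2_inner u (- H K u)) - (sob_val 1 (R u))\<^sup>2 - K * (sob_val 0 u)\<^sup>2\<bar>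
      \<le> (sob_val 1 (R u))\<^sup>2 / 2 + K1 * (sob_val 0 u)\<^sup>2"
    by (rule form_estimate) (rule that; blast)
  show thesis
  \<comment> \<open>The extra 1 leaves a full squared L^2 norm of u in the lower bound, which is the
    coercivity used below.\<close>
  proof (rule that[of "K1 + 1"])
    fix u K assume u: "u \<in> dom" and K: "K1 + 1 \<le> K"
    have "(K1 + 1) * (sob_val 0 u)\<^sup>2 \<le> K * (sob_val 0 u)\<^sup>2" using K by (intro mult_right_mono) auto
    then have k: "K1 * (sob_val 0 u)\<^sup>2 + (sob_val 0 u)\<^sup>2 \<le> K * (sob_val 0 u)\<^sup>2" by (simp add: distrib_right)
    have n: "0 \<le> (sob_val 0 u)\<^sup>2" "0 \<le> (sob_val 1 (R u))\<^sup>2" by simp_all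
    show "(sob_val 1 (R u))\<^sup>2 / 2 + (sob_val 0 u)\<^sup>2 \<le> Re (L2_inner u (- H K u))"
      using K1(2)[OF u, of K] k unfolding abs_le_iff by linarith
    show "Re (L2_inner u (- H K u)) \<le> 2 * (sob_val 1 (R u))\<^sup>2 + 2 * K * (sob_val 0 u)\<^sup>2"
      using K1(2)[OF u, of K] k n unfolding abs_le_iff mult.assoc by linarith
  qed (use K1(1) in simp)
qed

end

locale anderson_shifted = anderson_cutoff +
  fixes K :: real
  assumes K: "0 \<le> K"
    and form_lower: "u \<in> dom \<Longrightarrow> (sob_val 1 (R u))\<^sup>2 / 2 + (sob_val 0 u)\<^sup>2 \<le> Re (L2_inner u (- H K u))"
    and form_upper: "u \<in> dom \<Longrightarrow> Re (L2_inner u (- H K u)) \<le> 2 * (sob_val 1 (R u))\<^sup>2 + 2 * K * (sob_val 0 u)\<^sup>2"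
begin

definition form :: "torus_dist \<Rightarrow> real" where
  "form f = sqrt (Re (L2_inner (\<Gamma> f) (- H K (\<Gamma> f))))"

lemma form_norm_Gamma: "form_norm P C \<Xi> K (\<Gamma> f) = ennreal (form f)"
  by (simp add: form_norm_def form_def)

lemma sobolev_mono: "f \<in> sobolev s \<Longrightarrow> t \<le> s \<Longrightarrow> f \<in> sobolev t"
  using sobolev_iff sob_le_weaken by blast

lemma sobolev_diff: "f \<in> sobolev s \<Longrightarrow> g \<in> sobolev s \<Longrightarrow> f - g \<in> sobolev s"
  using sobolev_iff sob_le_diff by blast

lemma Gamma_dom: "f \<in> sobolev 2 \<Longrightarrow> \<Gamma> f \<in> dom"
  using Gamma_dom_iff sobolev_mono[of f 2 0] by simp

lemma Gamma_dom_set: "{f \<in> L2_T. \<Gamma> f \<in> dom} = sobolev 2"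
  using Gamma_dom_iff sobolev_mono[of _ 2 0] by auto

lemma dom_vals:
  assumes "u \<in> dom"
  shows "sob_le 0 (sob_val 0 u) u" "s \<le> 2 \<Longrightarrow> sob_le s (sob_val s (R u)) (R u)"
proof -
  show "sob_le 0 (sob_val 0 u) u"
    using dom_L2[OF assms] sobolev_iff sobolev_norm_eq(2) by blast
  show "sob_le s (sob_val s (R u)) (R u)" if "s \<le> 2"
    using assms sobolev_mono[OF _ that] sobolev_norm_eq(2) unfolding domain_H_def by blast
qed

lemma H_Gamma_upper:
  obtains c where "0 < c" "\<And>f. f \<in> sobolev 2 \<Longrightarrow> sob_le 0 (c * sob_val 2 f) (H K (\<Gamma> f))"
proof -
  obtain B where B: "0 \<le> B" "\<And>f n. f \<in> L2_T \<Longrightarrow> sob_le 0 n (\<Gamma> f) \<Longrightarrow> sob_le 2 (B * n) (f - R (\<Gamma> f))"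
    by (rule remainder_Gamma_bounds) (rule that; blast)
  obtain D where D: "0 \<le> D" "\<And>u n e K. u \<in> dom \<Longrightarrow> sob_le 0 n u \<Longrightarrow> sob_le 2 e (R u) \<Longrightarrow>
    sob_le 0 (D * (e + n) + \<bar>K\<bar> * n) (H K u)"
    by (rule H_upper) (rule that; blast)
  show thesis
  proof (rule that[of "D * (3 + 2 * B) + 2 * K + 1"])
    show "0 < D * (3 + 2 * B) + 2 * K + 1" using D(1) B(1) K by (intro add_nonneg_pos add_nonneg_nonneg) auto
    fix f assume f: "f \<in> sobolev 2"
    define F where "F = sob_val 2 f"
    have F0: "0 \<le> F" by (simp add: F_def sob_val_nonneg)
    have F: "sob_le 2 F f" unfolding F_def by (rule sobolev_norm_eq(2)[OF f])
    have fL: "f \<in> L2_T" using sobolev_mono[OF f] by simp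
    have n: "sob_le 0 (2 * F) (\<Gamma> f)" using sob_le_weaken[OF F] by (intro Gamma_bound) simp
    have "sob_le 2 (F + B * (2 * F)) (R (\<Gamma> f))" using sob_le_diff[OF F B(2)[OF fL n]] by simp
    from D(2)[OF Gamma_dom[OF f] n this, of K]
    have "sob_le 0 (D * (F + B * (2 * F) + 2 * F) + \<bar>K\<bar> * (2 * F)) (H K (\<Gamma> f))" .
    then show "sob_le 0 ((D * (3 + 2 * B) + 2 * K + 1) * sob_val 2 f) (H K (\<Gamma> f))"
      by (rule sob_le_mono) (use K F0 in \<open>simp add: F_def[symmetric] algebra_simps\<close>)
  qed
qed

text \<open>Cauchy-Schwarz turns the lower bound of the form into an L^2 bound by H u; this removes
  the L^2 norm of u from the right-hand side of \<open>H_lower\<close>.\<close>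

lemma coercive:
  assumes u: "u \<in> dom" and h: "sob_le 0 h (H K u)"
  shows "sob_val 0 u \<le> h"
proof -
  let ?n = "sob_val 0 u"
  have n: "0 \<le> ?n" by (rule sob_val_nonneg)
  have "?n\<^sup>2 \<le> Re (L2_inner u (- H K u))" using form_lower[OF u] zero_le_power2[of "sob_val 1 (R u)"] by linarith
  also have "\<dots> \<le> cmod (L2_inner u (- H K u))" by (rule complex_Re_le_cmod)
  also have "\<dots> \<le> ?n * h" by (rule L2_inner_bound0[OF dom_vals(1)[OF u] sob_le_uminus[OF h]])
  finally have "?n * ?n \<le> ?n * h" by (simp add: power2_eq_square)
  then show ?thesis using n sob_le_nonneg[OF h] by (cases "?n = 0") auto
qed

lemma H_Gamma_lower:
  obtains c where "0 < c" "\<And>f h. f \<in> sobolev 2 \<Longrightarrow> sob_le 0 h (H K (\<Gamma> f)) \<Longrightarrow> sob_le 2 (c * h) f"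
proof -
  obtain B where B: "0 \<le> B" "\<And>f n. f \<in> L2_T \<Longrightarrow> sob_le 0 n (\<Gamma> f) \<Longrightarrow> sob_le 2 (B * n) (f - R (\<Gamma> f))"
    by (rule remainder_Gamma_bounds) (rule that; blast)
  obtain D where D: "0 \<le> D" "\<And>u n h K. u \<in> dom \<Longrightarrow> sob_le 0 n u \<Longrightarrow> sob_le 0 h (H K u) \<Longrightarrow>
    sob_le 2 (D * (h + n + \<bar>K\<bar> * n)) (R u)"
    by (rule H_lower) (rule that; blast)
  show thesis
  proof (rule that[of "D * (2 + K) + B + 1"])
    show "0 < D * (2 + K) + B + 1" using D(1) B(1) K by (intro add_nonneg_pos add_nonneg_nonneg) auto
    fix f h assume f: "f \<in> sobolev 2" and h: "sob_le 0 h (H K (\<Gamma> f))"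
    note u = Gamma_dom[OF f]
    have n: "sob_le 0 h (\<Gamma> f)" by (rule sob_le_mono[OF dom_vals(1)[OF u] coercive[OF u h]])
    have fL: "f \<in> L2_T" using sobolev_mono[OF f] by simp
    have "sob_le 2 (B * h + D * (h + h + \<bar>K\<bar> * h)) f"
      using sob_le_add[OF B(2)[OF fL n] D(2)[OF u n h]] by simp
    then show "sob_le 2 ((D * (2 + K) + B + 1) * h) f"
      by (rule sob_le_mono) (use K sob_le_nonneg[OF h] in \<open>simp add: algebra_simps\<close>)
  qed
qed

text \<open>The squared form norm is comparable to the squared H^1 norm of R (\<Gamma> f) plus the
  squared L^2 norm of \<Gamma> f, and f - R (\<Gamma> f) is bounded in H^2 by the latter
  norm.\<close>

lemma form_Gamma:
  obtains c where "0 < c" "\<And>f. f \<in> sobolev 2 \<Longrightarrow> sob_val 1 f \<le> c * form f"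
    "\<And>f. f \<in> sobolev 2 \<Longrightarrow> form f \<le> c * sob_val 1 f"
proof -
  obtain B where B: "0 \<le> B" "\<And>f n. f \<in> L2_T \<Longrightarrow> sob_le 0 n (\<Gamma> f) \<Longrightarrow> sob_le 2 (B * n) (f - R (\<Gamma> f))"
    by (rule remainder_Gamma_bounds) (rule that; blast)
  \<comment> \<open>Chosen so that c dominates 2 + B and c^2 dominates 2 * (1 + 2 * B)^2 + 8 * K,
    which avoids square roots of the constants.\<close>
  define c where "c = 2 * (1 + 2 * B) + 8 * K + 1"
  have c: "0 < c" "2 + B \<le> c" using B(1) K by (simp_all add: c_def)
  have "sob_val 1 f \<le> c * form f \<and> form f \<le> c * sob_val 1 f" if f: "f \<in> sobolev 2" for f
  proof
    note u = Gamma_dom[OF f]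
    define n where "n = sob_val 0 (\<Gamma> f)"
    define e where "e = sob_val 1 (R (\<Gamma> f))"
    define q where "q = Re (L2_inner (\<Gamma> f) (- H K (\<Gamma> f)))"
    define F where "F = sob_val 1 f"
    have pos: "0 \<le> n" "0 \<le> e" "0 \<le> F" by (simp_all add: n_def e_def F_def sob_val_nonneg)
    have fL: "f \<in> L2_T" using sobolev_mono[OF f] by simp
    have n: "sob_le 0 n (\<Gamma> f)" unfolding n_def by (rule dom_vals(1)[OF u])
    have e: "sob_le 1 e (R (\<Gamma> f))" unfolding e_def by (rule dom_vals(2)[OF u]) simp
    have F: "sob_le 1 F f" unfolding F_def by (rule sobolev_norm_eq(2)[OF sobolev_mono[OF f]]) simp
    have d: "sob_le 1 (B * n) (f - R (\<Gamma> f))" using sob_le_weaken[OF B(2)[OF fL n]] by simp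
    have q1: "e\<^sup>2 / 2 + n\<^sup>2 \<le> q" using form_lower[OF u] by (simp only: n_def e_def q_def)
    have q2: "q \<le> 2 * e\<^sup>2 + 2 * K * n\<^sup>2" using form_upper[OF u] by (simp only: n_def e_def q_def)
    have q0: "0 \<le> q" "n\<^sup>2 \<le> q" "e\<^sup>2 / 4 \<le> q"
      using q1 zero_le_power2[of e] zero_le_power2[of n] by linarith+
    have form_q: "form f = sqrt q" by (simp only: form_def q_def)
    then have sq: "0 \<le> form f" "form f = sqrt q" using q0(1) by simp_all
    have "n\<^sup>2 \<le> q" "(e / 2)\<^sup>2 \<le> q" using q0 by (simp_all add: power_divide)
    then have "n \<le> sqrt q" "e / 2 \<le> sqrt q" by (simp_all only: real_le_rsqrt)
    then have ne: "n \<le> form f" "e \<le> 2 * form f" using sq(2) by simp_all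
    have "sob_le 1 (B * n + e) f" using sob_le_add[OF d e] by simp
    then have "sob_val 1 f \<le> B * n + e" by (rule sob_val_le)
    also have "\<dots> \<le> B * form f + 2 * form f" using ne B(1) by (intro add_mono mult_left_mono)
    also have "\<dots> \<le> c * form f" using mult_right_mono[OF c(2) sq(1)] by (simp add: algebra_simps)
    finally show "sob_val 1 f \<le> c * form f" .
    have "sob_le 0 (2 * F) (\<Gamma> f)" using sob_le_weaken[OF F] by (intro Gamma_bound) simp
    then have nF: "n \<le> 2 * F" unfolding n_def by (rule sob_val_le)
    have "sob_le 1 (F + B * n) (R (\<Gamma> f))" using sob_le_diff[OF F d] by simp
    then have "e \<le> F + B * n" unfolding e_def by (rule sob_val_le)
    also have "\<dots> \<le> F + B * (2 * F)" using nF B(1) by (intro add_left_mono mult_left_mono)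
    finally have eF: "e \<le> (1 + 2 * B) * F" by (simp add: algebra_simps)
    have "q \<le> 2 * ((1 + 2 * B) * F)\<^sup>2 + 2 * K * (2 * F)\<^sup>2"
      using q2 mult_left_mono[OF power_mono[OF eF pos(2), of 2], of 2]
        mult_left_mono[OF power_mono[OF nF pos(1), of 2], of "2 * K"] K by linarith
    also have "\<dots> = (2 * (1 + 2 * B)\<^sup>2 + 8 * K) * F\<^sup>2"
      unfolding power_mult_distrib by (simp add: distrib_right)
    also have "\<dots> \<le> c\<^sup>2 * F\<^sup>2"
    proof (rule mult_right_mono)
      let ?a = "2 * (1 + 2 * B)" and ?b = "8 * K"
      have "c\<^sup>2 = ?a\<^sup>2 + ?b\<^sup>2 + 1 + 2 * (?a * ?b) + 2 * ?a + 2 * ?b"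
        unfolding c_def by (simp add: power2_eq_square algebra_simps)
      moreover have "0 \<le> ?a * ?b" "0 \<le> ?a" using B(1) K by simp_all
      moreover have "?a\<^sup>2 = 4 * (1 + 2 * B)\<^sup>2" unfolding power_mult_distrib by simp
      ultimately show "2 * (1 + 2 * B)\<^sup>2 + 8 * K \<le> c\<^sup>2"
        using K zero_le_power2[of ?b] zero_le_power2[of "1 + 2 * B"] by linarith
    qed simp
    finally have "q \<le> (c * F)\<^sup>2" by (simp add: power_mult_distrib)
    then have "sqrt q \<le> c * F" using c(1) pos(3) by (intro real_le_lsqrt) auto
    then show "form f \<le> c * sob_val 1 f" using sq(2) by (simp add: F_def)
  qed
  with that c(1) show thesis by blast
qed

text \<open>The inverse of \<Gamma> maps a form-Cauchy sequence to arguments g n in H^2 that are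
  eventually bounded in H^1. They converge coefficientwise to f because f = \<Gamma> f -
  \<open>hT (\<Gamma> f)\<close>, and lower semicontinuity concludes.\<close>

lemma form_domain_Gamma:
  assumes f: "f \<in> L2_T" and mem: "\<Gamma> f \<in> form_domain P C \<Xi> \<gamma> K"
  shows "f \<in> sobolev 1"
proof -
  obtain c where c: "0 < c" "\<And>f. f \<in> sobolev 2 \<Longrightarrow> sob_val 1 f \<le> c * form f"
    by (rule form_Gamma) (rule that; blast)
  obtain s where s: "\<And>n. s n \<in> dom"
    and p: "\<And>e. 0 < e \<Longrightarrow> \<exists>n0. \<forall>n\<ge>n0. \<forall>n'\<ge>n0. form_norm P C \<Xi> K (s n - s n') < e"
    and l: "(\<lambda>n. L2_norm_T (s n - \<Gamma> f)) \<longlonglongrightarrow> 0"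
    using mem unfolding form_domain_def norm_closure_def by blast
  define g where "g n = s n - hT (s n)" for n
  have gL: "g n \<in> L2_T" and Gg: "\<Gamma> (g n) = s n" for n
    unfolding g_def using dom_Gamma[OF s[of n]] by simp_all
  have g2: "g n \<in> sobolev 2" for n using Gamma_dom_iff[OF gL[of n]] s[of n] Gg[of n] by simp
  obtain n0 where n0: "\<And>n n'. n0 \<le> n \<Longrightarrow> n0 \<le> n' \<Longrightarrow> form_norm P C \<Xi> K (s n - s n') < 1"
    using p[OF zero_less_one] by blast
  have bound: "sob_le 1 (c + sob_val 1 (g n0)) (g n)" if n: "n0 \<le> n" for n
  proof -
    have d2: "g n - g n0 \<in> sobolev 2" by (rule sobolev_diff[OF g2 g2])
    have "ennreal (form (g n - g n0)) < 1"
      using n0[OF n order_refl] by (simp only: form_norm_Gamma[symmetric] Gamma_diff[OF gL gL] Gg)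
    then have "form (g n - g n0) \<le> 1" by simp
    then have "sob_val 1 (g n - g n0) \<le> c * 1" using c(2)[OF d2] mult_left_mono[of "form (g n - g n0)" 1 c] c(1) by linarith
    then have "sob_le 1 c (g n - g n0)"
      using sob_le_mono[OF sobolev_norm_eq(2)[OF sobolev_mono[OF d2]], of 1 c] by simp
    moreover have "sob_le 1 (sob_val 1 (g n0)) (g n0)" by (rule sobolev_norm_eq(2)[OF sobolev_mono[OF g2]]) simp
    ultimately have "sob_le 1 (c + sob_val 1 (g n0)) (g n - g n0 + g n0)" by (rule sob_le_add)
    then show ?thesis by simp
  qed
  have lim: "(\<lambda>n. g n k) \<longlonglongrightarrow> f k" for k
  proof (rule tendstoI)
    fix e :: real assume e: "0 < e"
    then have "\<forall>\<^sub>F n in sequentially. L2_norm_T (s n - \<Gamma> f) < ennreal (e / 2)"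
      by (intro order_tendstoD(2)[OF l]) simp
    then show "\<forall>\<^sub>F n in sequentially. dist (g n k) (f k) < e"
    proof eventually_elim
      fix n assume l: "L2_norm_T (s n - \<Gamma> f) < ennreal (e / 2)"
      have "0 \<le> e / 2" using e by simp
      from iffD1[OF sobolev_norm_le_iff[OF this] less_imp_le[OF l]]
      have s1: "sob_le 0 (e / 2) (s n - \<Gamma> f)" .
      obtain a b where ab: "sob_le 0 a (s n)" "sob_le 0 b (\<Gamma> f)"
        using dom_L2[OF s[of n]] Gamma_fixed_point(1)[OF f] L2_T_iff by blast
      have "f = \<Gamma> f - hT (\<Gamma> f)"
        using arg_cong[OF Gamma_fixed_point(2)[OF f], of "\<lambda>v. v - hT (\<Gamma> f)"] by (simp only: add_diff_cancel_left')
      from arg_cong[OF this, of "\<lambda>v. g n - v"]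
      have "g n - f = (s n - \<Gamma> f) - (hT (s n) - hT (\<Gamma> f))" by (simp only: g_def) (simp only: algebra_simps)
      also have "\<dots> = (s n - \<Gamma> f) - hT (s n - \<Gamma> f)" by (simp only: hT_diff[OF ab])
      finally have "sob_le 0 (e / 2 + e / 2 / 2) (g n - f)"
        using sob_le_diff[OF s1 contraction[OF s1]] by (simp only:)
      from sob_le_0_point[OF this, of k] show "dist (g n k) (f k) < e" using e by (simp add: dist_norm)
    qed
  qed
  have "sob_le 1 (c + sob_val 1 (g n0)) f"
    by (rule sob_le_limit[OF sequentially_bot lim]) (use bound eventually_sequentially in blast)
  then show ?thesis using sobolev_iff by blast
qed

text \<open>Truncations of f are Cauchy in H^1, so their images are Cauchy for the form norm;
  boundedness of \<Gamma> on L^2 identifies the limit.\<close>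

lemma Gamma_form_domain:
  assumes f: "f \<in> sobolev 1"
  shows "\<Gamma> f \<in> form_domain P C \<Xi> \<gamma> K"
proof -
  obtain c where c: "0 < c" "\<And>f. f \<in> sobolev 2 \<Longrightarrow> form f \<le> c * sob_val 1 f"
    by (rule form_Gamma) (rule that; blast)
  define g where "g m = truncate m f" for m
  have g2: "g m \<in> sobolev 2" for m unfolding g_def by (rule truncate_sobolev[OF f])
  have fL: "f \<in> L2_T" and gL: "g m \<in> L2_T" for m using sobolev_mono[OF f] sobolev_mono[OF g2] by simp_all
  show ?thesis
    unfolding form_domain_def norm_closure_def
  proof (intro CollectI conjI exI[of _ "\<lambda>m. \<Gamma> (g m)"] allI impI)
    show "\<Gamma> f \<in> L2_T" by (rule Gamma_fixed_point(1)[OF fL])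
    show "\<Gamma> (g m) \<in> dom" for m by (rule Gamma_dom[OF g2])
    show "\<exists>n0. \<forall>n\<ge>n0. \<forall>n'\<ge>n0. form_norm P C \<Xi> K (\<Gamma> (g n) - \<Gamma> (g n')) < e" if e: "0 < e" for e
    proof -
      obtain r where r: "0 < r" "ennreal r \<le> e" using e by (rule ennreal_ge_real)
      have "0 < r / (4 * c)" using r(1) c(1) by simp
      from truncate_tendsto[OF f this] obtain n0 where
        n0: "\<And>n. n0 \<le> n \<Longrightarrow> sob_le 1 (r / (4 * c)) (f - g n)" unfolding g_def by blast
      have "form_norm P C \<Xi> K (\<Gamma> (g n) - \<Gamma> (g n')) < e" if n: "n0 \<le> n" "n0 \<le> n'" for n n'
      proof -
        have "(f - g n') - (f - g n) = g n - g n'" by simp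
        with sob_le_diff[OF n0[OF n(2)] n0[OF n(1)]]
        have "sob_le 1 (r / (4 * c) + r / (4 * c)) (g n - g n')" by (simp only:)
        then have "sob_val 1 (g n - g n') \<le> r / (4 * c) + r / (4 * c)" by (rule sob_val_le)
        then have "c * sob_val 1 (g n - g n') \<le> c * (r / (4 * c) + r / (4 * c))"
          by (rule mult_left_mono) (use c(1) in simp)
        also have "\<dots> = r / 2" using c(1) by simp
        finally have "form (g n - g n') < r" using c(2)[OF sobolev_diff[OF g2 g2], of n n'] r(1) by linarith
        then have "ennreal (form (g n - g n')) < ennreal r" using r(1) by (simp add: ennreal_lessI)
        then have "form_norm P C \<Xi> K (\<Gamma> (g n) - \<Gamma> (g n')) < ennreal r"
          by (simp only: form_norm_Gamma[symmetric] Gamma_diff[OF gL gL])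
        then show ?thesis using r(2) by (rule less_le_trans)
      qed
      then show ?thesis by blast
    qed
    show "(\<lambda>n. L2_norm_T (\<Gamma> (g n) - \<Gamma> f)) \<longlonglongrightarrow> 0"
    proof (rule order_tendstoI)
      fix e :: ennreal assume "0 < e"
      then obtain r where r: "0 < r" "ennreal r \<le> e" by (rule ennreal_ge_real)
      have "0 < r / 4" using r(1) by simp
      from truncate_tendsto[OF f this] obtain n0 where
        n0: "\<And>n. n0 \<le> n \<Longrightarrow> sob_le 1 (r / 4) (f - g n)" unfolding g_def by blast
      have "L2_norm_T (\<Gamma> (g n) - \<Gamma> f) < e" if n: "n0 \<le> n" for n
      proof -
        have "sob_le 0 (r / 4) (f - g n)" by (rule sob_le_weaken[OF n0[OF n]]) simp
        from sob_le_uminus[OF this] have "sob_le 0 (r / 4) (g n - f)" by simp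
        from Gamma_bound[OF this] have "sob_le 0 (2 * (r / 4)) (\<Gamma> (g n) - \<Gamma> f)" by (simp only: Gamma_diff[OF gL fL])
        then have "L2_norm_T (\<Gamma> (g n) - \<Gamma> f) \<le> ennreal (2 * (r / 4))" using sobolev_norm_le_iff r(1) by simp
        also have "\<dots> < ennreal r" using r(1) by (intro ennreal_lessI) auto
        finally show ?thesis using r(2) by (rule less_le_trans)
      qed
      then show "\<forall>\<^sub>F n in sequentially. L2_norm_T (\<Gamma> (g n) - \<Gamma> f) < e"
        unfolding eventually_sequentially by blast
    qed simp
  qed
qed

lemma ennreal_bound:
  assumes "0 < c" "0 \<le> y" "x \<le> c * y"
  shows "ennreal x \<le> ennreal c * ennreal y"
  using assms by (simp add: ennreal_mult[symmetric] ennreal_leI)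

lemma H_Gamma_equivalence:
  "\<exists>c>0. \<forall>f\<in>sobolev 2. sobolev_norm 2 f \<le> ennreal c * L2_norm_T (H K (\<Gamma> f)) \<and>
     L2_norm_T (H K (\<Gamma> f)) \<le> ennreal c * sobolev_norm 2 f"
proof -
  obtain c1 where c1: "0 < c1" "\<And>f. f \<in> sobolev 2 \<Longrightarrow> sob_le 0 (c1 * sob_val 2 f) (H K (\<Gamma> f))"
    by (rule H_Gamma_upper) (rule that; blast)
  obtain c2 where c2: "0 < c2" "\<And>f h. f \<in> sobolev 2 \<Longrightarrow> sob_le 0 h (H K (\<Gamma> f)) \<Longrightarrow> sob_le 2 (c2 * h) f"
    by (rule H_Gamma_lower) (rule that; blast)
  let ?c = "max c1 c2"
  have c: "0 < ?c" using c1(1) by simp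
  have "sobolev_norm 2 f \<le> ennreal ?c * L2_norm_T (H K (\<Gamma> f)) \<and>
     L2_norm_T (H K (\<Gamma> f)) \<le> ennreal ?c * sobolev_norm 2 f" if f: "f \<in> sobolev 2" for f
  proof -
    have H: "H K (\<Gamma> f) \<in> L2_T" using c1(2)[OF f] sobolev_iff by blast
    let ?h = "sob_val 0 (H K (\<Gamma> f))" and ?F = "sob_val 2 f"
    have "?F \<le> c2 * ?h" by (rule sob_val_le[OF c2(2)[OF f sobolev_norm_eq(2)[OF H]]])
    also have "\<dots> \<le> ?c * ?h" by (intro mult_right_mono sob_val_nonneg) simp
    finally have 1: "?F \<le> ?c * ?h" .
    have "?h \<le> c1 * ?F" by (rule sob_val_le[OF c1(2)[OF f]])
    also have "\<dots> \<le> ?c * ?F" by (intro mult_right_mono sob_val_nonneg) simp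
    finally have 2: "?h \<le> ?c * ?F" .
    show ?thesis
      unfolding sobolev_norm_eq(1)[OF f] sobolev_norm_eq(1)[OF H]
      by (intro conjI ennreal_bound c sob_val_nonneg 1 2)
  qed
  with c show ?thesis by blast
qed

lemma form_equivalence:
  obtains c where "0 < c"
    "\<And>f. f \<in> sobolev 2 \<Longrightarrow> sobolev_norm 1 f \<le> ennreal c * form_norm P C \<Xi> K (\<Gamma> f)"
    "\<And>f. f \<in> sobolev 2 \<Longrightarrow> form_norm P C \<Xi> K (\<Gamma> f) \<le> ennreal c * sobolev_norm 1 f"
proof -
  obtain c where c: "0 < c" "\<And>f. f \<in> sobolev 2 \<Longrightarrow> sob_val 1 f \<le> c * form f"
    "\<And>f. f \<in> sobolev 2 \<Longrightarrow> form f \<le> c * sob_val 1 f"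
    by (rule form_Gamma) (rule that; blast)
  show thesis
  proof (rule that[OF c(1)])
    fix f assume f: "f \<in> sobolev 2"
    have f1: "f \<in> sobolev 1" by (rule sobolev_mono[OF f]) simp
    \<comment> \<open>\<open>ennreal\<close> sends negative reals to 0, so the real inequality is
      transferred with the sign of \<open>form f\<close> checked first.\<close>
    have "0 \<le> form f"
    proof (rule ccontr)
      assume "\<not> ?thesis"
      then have "c * form f < 0" using c(1) by (simp add: mult_pos_neg)
      then show False using c(2)[OF f] sob_val_nonneg[of 1 f] by linarith
    qed
    then show "sobolev_norm 1 f \<le> ennreal c * form_norm P C \<Xi> K (\<Gamma> f)"
      unfolding sobolev_norm_eq(1)[OF f1] form_norm_Gamma by (intro ennreal_bound c f)
    show "form_norm P C \<Xi> K (\<Gamma> f) \<le> ennreal c * sobolev_norm 1 f"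
      unfolding sobolev_norm_eq(1)[OF f1] form_norm_Gamma by (intro ennreal_bound c f sob_val_nonneg)
  qed
qed

lemma characterizations:
  "(\<forall>f\<in>L2_T. \<Gamma> f \<in> dom \<longleftrightarrow> f \<in> sobolev 2) \<and>
   (\<exists>c>0. \<forall>f\<in>sobolev 2. sobolev_norm 2 f \<le> ennreal c * L2_norm_T (H K (\<Gamma> f)) \<and>
     L2_norm_T (H K (\<Gamma> f)) \<le> ennreal c * sobolev_norm 2 f) \<and>
   (\<forall>f\<in>L2_T. \<Gamma> f \<in> form_domain P C \<Xi> \<gamma> K \<longleftrightarrow> f \<in> sobolev 1) \<and>
   (\<exists>c>0. \<forall>f\<in>sobolev 2. sobolev_norm 1 f \<le> ennreal c * form_norm P C \<Xi> K (\<Gamma> f) \<and>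
     form_norm P C \<Xi> K (\<Gamma> f) \<le> ennreal c * sobolev_norm 1 f) \<and>
   norm_closure (\<lambda>f. form_norm P C \<Xi> K (\<Gamma> f)) (sobolev 2) = norm_closure (sobolev_norm 1) (sobolev 2)"
proof -
  obtain c where c: "0 < c"
    "\<And>f. f \<in> sobolev 2 \<Longrightarrow> sobolev_norm 1 f \<le> ennreal c * form_norm P C \<Xi> K (\<Gamma> f)"
    "\<And>f. f \<in> sobolev 2 \<Longrightarrow> form_norm P C \<Xi> K (\<Gamma> f) \<le> ennreal c * sobolev_norm 1 f"
    by (rule form_equivalence) (rule that; blast)
  show ?thesis
  proof (intro conjI)
    show "\<forall>f\<in>L2_T. \<Gamma> f \<in> dom \<longleftrightarrow> f \<in> sobolev 2" using Gamma_dom_iff by blast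
    show "\<forall>f\<in>L2_T. \<Gamma> f \<in> form_domain P C \<Xi> \<gamma> K \<longleftrightarrow> f \<in> sobolev 1"
      using form_domain_Gamma Gamma_form_domain by blast
    show "\<exists>c>0. \<forall>f\<in>sobolev 2. sobolev_norm 1 f \<le> ennreal c * form_norm P C \<Xi> K (\<Gamma> f) \<and>
      form_norm P C \<Xi> K (\<Gamma> f) \<le> ennreal c * sobolev_norm 1 f" using c by blast
    show "norm_closure (\<lambda>f. form_norm P C \<Xi> K (\<Gamma> f)) (sobolev 2) = norm_closure (sobolev_norm 1) (sobolev 2)"
      by (intro equalityI norm_closure_mono[OF c(1)] c(2,3) sobolev_diff)
  qed (rule H_Gamma_equivalence)
qed

end

theorem proposition2p27:
  fixes M :: "'w measure" and W :: "freq \<Rightarrow> 'w \<Rightarrow> complex" and w :: 'w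
    and P :: dyadic and m :: "plane \<Rightarrow> real"
    and C :: "torus_dist \<Rightarrow> torus_dist \<Rightarrow> torus_dist \<Rightarrow> torus_dist"
    and \<Xi> :: enhanced and \<alpha> \<gamma> :: real
  assumes "dyadic_partition P"
    and "commutator_operator P C"
    and "white_noise M W"
    and "mollifier m"
    and "w \<in> space M"
    and "fst \<Xi> = (\<lambda>k. W k w)"
    and "enhanced_noise P m \<Xi>"
    and "- 4 / 3 < \<alpha>" and "\<alpha> < - 1" and "2 / 3 < \<gamma>" and "\<gamma> \<le> \<alpha> + 2"
  shows "\<exists>K0>0. \<exists>N0. \<forall>K\<ge>K0. \<forall>N\<ge>N0.
    (let \<Gamma> = Gamma_map P \<Xi> N; D = domain_H P \<Xi> \<gamma>; H = H_op P C \<Xi> K;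
         nrm = form_norm P C \<Xi> K; D\<Gamma> = {f \<in> L2_T. \<Gamma> f \<in> D}
     in
      (\<forall>f\<in>L2_T. \<Gamma> f \<in> D \<longleftrightarrow> f \<in> sobolev 2) \<and>
      (\<exists>c>0. \<forall>f\<in>D\<Gamma>.
         sobolev_norm 2 f \<le> ennreal c * L2_norm_T (H (\<Gamma> f)) \<and>
         L2_norm_T (H (\<Gamma> f)) \<le> ennreal c * sobolev_norm 2 f) \<and>
      (\<forall>f\<in>L2_T. \<Gamma> f \<in> form_domain P C \<Xi> \<gamma> K \<longleftrightarrow> f \<in> sobolev 1) \<and>
      (\<exists>c>0. \<forall>f\<in>D\<Gamma>.
         sobolev_norm 1 f \<le> ennreal c * nrm (\<Gamma> f) \<and>
         nrm (\<Gamma> f) \<le> ennreal c * sobolev_norm 1 f) \<and>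
      norm_closure (\<lambda>f. nrm (\<Gamma> f)) D\<Gamma> = norm_closure (sobolev_norm 1) D\<Gamma>)"
proof -
  have \<gamma>1: "\<gamma> < 1" using assms(9,11) by linarith
  interpret noise P \<Xi> "(1 - \<gamma>) / 4" \<gamma>
    by (rule noise_of_enhanced[OF assms(1,3,4,5,6,7,10) \<gamma>1])
  interpret anderson P \<Xi> "(1 - \<gamma>) / 4" \<gamma> C by unfold_locales (rule assms(2))
  obtain K0 where K0: "0 < K0"
    "\<And>u K. u \<in> dom \<Longrightarrow> K0 \<le> K \<Longrightarrow> (sob_val 1 (R u))\<^sup>2 / 2 + (sob_val 0 u)\<^sup>2 \<le> Re (L2_inner u (- H K u))"
    "\<And>u K. u \<in> dom \<Longrightarrow> K0 \<le> K \<Longrightarrow> Re (L2_inner u (- H K u)) \<le> 2 * (sob_val 1 (R u))\<^sup>2 + 2 * K * (sob_val 0 u)\<^sup>2"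
    by (rule form_bounds) (rule that; blast)
  obtain N0 where N0: "\<And>N c u. N0 \<le> N \<Longrightarrow> sob_le 0 c u \<Longrightarrow> sob_le 0 (c / 2) (high_freq N (T u))"
    by (rule high_freq_contraction) (rule that; blast)
  show ?thesis
  \<comment> \<open>The two thresholds are chosen independently of each other, before K and N are
    given.\<close>
  proof (intro exI[of _ K0] exI[of _ N0] conjI allI impI K0(1))
    fix K N assume K: "K0 \<le> K" and N: "N0 \<le> N"
    interpret anderson_shifted P \<Xi> "(1 - \<gamma>) / 4" \<gamma> C N K
      by unfold_locales (rule N0[OF N], assumption, use K K0(1) in simp, rule K0(2)[OF _ K], assumption, rule K0(3)[OF _ K])
    show "let \<Gamma> = Gamma_map P \<Xi> N; D = domain_H P \<Xi> \<gamma>; H = H_op P C \<Xi> K;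
         nrm = form_norm P C \<Xi> K; D\<Gamma> = {f \<in> L2_T. \<Gamma> f \<in> D}
     in
      (\<forall>f\<in>L2_T. \<Gamma> f \<in> D \<longleftrightarrow> f \<in> sobolev 2) \<and>
      (\<exists>c>0. \<forall>f\<in>D\<Gamma>.
         sobolev_norm 2 f \<le> ennreal c * L2_norm_T (H (\<Gamma> f)) \<and>
         L2_norm_T (H (\<Gamma> f)) \<le> ennreal c * sobolev_norm 2 f) \<and>
      (\<forall>f\<in>L2_T. \<Gamma> f \<in> form_domain P C \<Xi> \<gamma> K \<longleftrightarrow> f \<in> sobolev 1) \<and>
      (\<exists>c>0. \<forall>f\<in>D\<Gamma>.
         sobolev_norm 1 f \<le> ennreal c * nrm (\<Gamma> f) \<and>
         nrm (\<Gamma> f) \<le> ennreal c * sobolev_norm 1 f) \<and>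
      norm_closure (\<lambda>f. nrm (\<Gamma> f)) D\<Gamma> = norm_closure (sobolev_norm 1) D\<Gamma>"
      unfolding Let_def Gamma_dom_set by (rule characterizations)
  qed
qed

end
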